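(* Let $k\ge 2$ be a prime and let $m_0,\dots,m_{n-1}$ be integers not divisible by $k$. For every $R>0$ there exists $\varepsilon>0$ such that for every $R'\in(0,\varepsilon)$ there is no contactomorphism $\psi\in \mathrm{Cont}_0^{\mathbb{Z}_k}(\mathbb{R}^{2n}\times S^1)$ with $\psi\big(\overline{\widehat{B(R)}}\big)\subset \widehat{B(R')}$. In other words, $\widehat{B(R)}$ cannot be squeezed into $\widehat{B(R')}$ for arbitrarily small $R'$ by a compactly supported $\mathbb{Z}_k$-equivariant contact isotopy of $\mathbb{R}^{2n}\times S^1$.
   Context: Identify $\mathbb{R}^{2n}=\mathbb{C}^n$ with coordinates $w_j=x_j+iy_j$, and let $S^1=\mathbb{R}/\mathbb{Z}$ with coordinate $z$. The manifold $\mathbb{R}^{2n}\times S^1$ carries the contact structure $\xi=\ker\big(dz-\tfrac12\sum_j(y_jdx_j-x_jdy_j)\big)$. The group $\mathbb{Z}_k$ acts on $\mathbb{R}^{2n}\times S^1$ via the generator $\tau_k(w_0,\dots,w_{n-1},z)=(e^{2\pi i m_0/k}w_0,\dots,e^{2\pi i m_{n-1}/k}w_{n-1},z)$. For $R>0$, $B(R)=\{w\in\mathbb{R}^{2n}:\pi\sum_j|w_j|^2<R\}$ and $\widehat{B(R)}=B(R)\times S^1$. $\mathrm{Cont}_0^{\mathbb{Z}_k}(\mathbb{R}^{2n}\times S^1)$ denotes the group of compactly supported contactomorphisms of $(\mathbb{R}^{2n}\times S^1,\xi)$ commuting with $\tau_k$ that are isotopic to the identity through compactly supported contactomorphisms commuting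 with $\tau_k$. *)

theory Defs
  imports "HOL-Analysis.Analysis"
begin

text \<open>Points of the universal cover R^{2n} x R of R^{2n} x S^1, with C^n = R^{2n}
  (w_j = x_j + i y_j) and the last coordinate z a lift of the S^1 = R/Z coordinate.\<close>
type_synonym 'n pt = "(complex ^ 'n) \<times> real"

fun Ck_on :: "nat \<Rightarrow> ('a::real_normed_vector \<Rightarrow> 'b::real_normed_vector) \<Rightarrow> 'a set \<Rightarrow> bool" where
  "Ck_on 0 f S = continuous_on S f"
| "Ck_on (Suc k) f S = (\<exists>f'. (\<forall>x\<in>S. (f has_derivative f' x) (at x)) \<and> (\<forall>v. Ck_on k (\<lambda>x. f' x v) S))"

definition smooth_on :: "('a::real_normed_vector \<Rightarrow> 'b::real_normed_vector) \<Rightarrow> 'a set \<Rightarrow> bool" where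
  "smooth_on f S \<longleftrightarrow> (\<forall>k. Ck_on k f S)"

definition diffeo :: "('a::real_normed_vector \<Rightarrow> 'a) \<Rightarrow> bool" where
  "diffeo f \<longleftrightarrow> smooth_on f UNIV \<and> (\<exists>g. (\<forall>p. g (f p) = p \<and> f (g p) = p) \<and> smooth_on g UNIV)"

definition alpha :: "'n::finite pt \<Rightarrow> 'n pt \<Rightarrow> real" where
  "alpha p v = snd v - (1/2) * (\<Sum>j\<in>UNIV. Im (fst p $ j) * Re (fst v $ j) - Re (fst p $ j) * Im (fst v $ j))"

definition preserves_xi :: "('n::finite pt \<Rightarrow> 'n pt) \<Rightarrow> bool" where
  "preserves_xi f \<longleftrightarrow> (\<forall>p. \<exists>f'. (f has_derivative f') (at p) \<and> (\<forall>v. alpha p v = 0 \<longrightarrow> alpha (f p) (f' v) = 0))"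

definition tau :: "nat \<Rightarrow> ('n::finite \<Rightarrow> int) \<Rightarrow> 'n pt \<Rightarrow> 'n pt" where
  "tau k m p = ((\<chi> j. cis (2 * pi * of_int (m j) / of_nat k) * (fst p $ j)), snd p)"

text \<open>A lifted map descends to R^{2n} x S^1 (commutes with the deck translation z -> z+1).\<close>
definition descends :: "('n::finite pt \<Rightarrow> 'n pt) \<Rightarrow> bool" where
  "descends f \<longleftrightarrow> (\<forall>w z. f (w, z + 1) = (fst (f (w, z)), snd (f (w, z)) + 1))"

text \<open>Identity outside a compact set of R^{2n} x S^1 (S^1 compact, so: outside a ball in w).\<close>
definition supported_in :: "real \<Rightarrow> ('n::finite pt \<Rightarrow> 'n pt) \<Rightarrow> bool" where
  "supported_in C f \<longleftrightarrow> (\<forall>w z. norm w \<ge> C \<longrightarrow> f (w, z) = (w, z))"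

definition equivariant_contacto :: "nat \<Rightarrow> ('n::finite \<Rightarrow> int) \<Rightarrow> ('n pt \<Rightarrow> 'n pt) \<Rightarrow> bool" where
  "equivariant_contacto k m f \<longleftrightarrow> diffeo f \<and> preserves_xi f \<and> descends f \<and> f \<circ> tau k m = tau k m \<circ> f"

definition Cont0Zk :: "nat \<Rightarrow> ('n::finite \<Rightarrow> int) \<Rightarrow> ('n pt \<Rightarrow> 'n pt) set" where
  "Cont0Zk k m = {f. \<exists>\<Phi> :: real \<Rightarrow> 'n pt \<Rightarrow> 'n pt. \<exists>C.
      smooth_on (\<lambda>(t, p). \<Phi> t p) UNIV \<and> \<Phi> 0 = id \<and> \<Phi> 1 = f \<and>
      (\<forall>t\<in>{0..1}. equivariant_contacto k m (\<Phi> t) \<and> supported_in C (\<Phi> t))}"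

definition Bball :: "real \<Rightarrow> (complex ^ 'n::finite) set" where
  "Bball R = {w. pi * (\<Sum>j\<in>UNIV. (cmod (w $ j))\<^sup>2) < R}"

definition Bhat :: "real \<Rightarrow> 'n::finite pt set" where
  "Bhat R = Bball R \<times> UNIV"

end

theory Submission
  imports Defs "HOL-Homology.Homology" "HOL-Number_Theory.Cong"
begin

text \<open>
  Suppose \<open>\<psi>\<close> squeezes the sphere \<open>\<pi>|w|\<^sup>2 = 1/N\<close> into \<open>\<pi>|w|\<^sup>2 < 1/N\<close>. Unwrapping the
  symplectization of \<open>\<complex>\<^sup>n \<times> S\<^sup>1\<close> by \<open>N\<close> full rotations \<open>cis (2\<pi>Nz)\<close> turns the contact isotopy into a
  homogeneous isotopy of \<open>{((w, \<sigma>), z). (w, \<sigma>) \<noteq> 0}\<close> preserving \<open>\<sigma> dz + (1/2) w \<times> dw\<close>, in which that sphere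
  becomes \<open>\<sigma> = 0\<close> and whose time-one map would send \<open>\<sigma> = 0\<close> into \<open>\<sigma> > 0\<close>.

  Cutting the isotopy into steps close to the identity, each step has a homogeneous generating function, and the
  points with \<open>\<sigma> = 0\<close> at both ends are the critical points of a function \<open>F\<close>, homogeneous of degree two,
  on a finite-dimensional space, invariant under \<open>\<int>\<^sub>k\<close> and periodic in the \<open>z\<close>-variables. Adding
  \<open>\<kappa> |\<nu>|\<^sup>2\<close> in redundant variables \<open>\<nu>\<close> does not change this, for any \<open>\<kappa>\<close>. If there were no critical points,
  the negative sublevels for \<open>\<kappa> = \<plusminus>\<kappa>\<^sub>0\<close> could be deformed equivariantly into each other, which yields an
  equivariant map from the unit sphere of \<open>\<real>\<^sup>M \<oplus> \<complex>\<^sup>d\<^sup>+\<^sup>1\<close> to that of \<open>\<real>\<^sup>M \<oplus> \<complex>\<^sup>d\<close>, homotopic to the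
  identity on the fixed sphere. For \<open>k\<close> prime and weights prime to \<open>k\<close> this contradicts a Borsuk--Ulam theorem,
  which is proved with singular chains.
\<close>

section \<open>A Borsuk--Ulam theorem for cyclic groups of prime order\<close>

text \<open>The contradiction is a count of dimensions. The M steps carry M vectors of C^n and M
  real variables y, and there are M + 1 redundant vectors. For very negative kappa the redundant
  vectors are negative directions, for very positive kappa they are positive ones and a negative
  value must be visible in the variables of the steps; the surplus n(M + 1) - nM is at least 1. The
  real variables y, paired with the increments of z, span the fixed part, which kappa does not
  affect. Three obstacles shape the details. The coordinates w and sigma have weights 1 and 2;
  writing sigma = y * |(w, y)| gives all linear variables weight 1. The increment of z under a step
  has weight 0 and need not extend continuously to the origin, so the gradient of F is only known to
  be continuous and Euler steps with renormalization replace its flow. Shifting a single z-variable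
  by an integer changes F although the geometric condition stays the same; hence critical points are
  detected by a function in which the mismatch of z enters through a sine, and orbits close up only
  modulo integer shifts of z.\<close>

lemma singular_cycle_iff:
  "singular_relcycle q X {} c \<longleftrightarrow> singular_chain q X c \<and> chain_boundary q c = 0"
  by (simp add: singular_cycle)

section \<open>Filling and dividing singular cycles\<close>

lemma cycle_bounds_if_trivial_homology:
  assumes triv: "trivial_group (homology_group (int q) X)" and c: "singular_relcycle q X {} c"
  obtains d where "singular_chain (Suc q) X d" "chain_boundary (Suc q) d = c"
proof -
  have "homologous_rel_set q X {} c \<in> carrier (homology_group (int q) X)"
    using c by (auto simp: carrier_relative_homology_group)
  then have "homologous_rel_set q X {} c = singular_relboundary_set q X {}"
    using triv unfolding trivial_group_def by auto
  then have "singular_relboundary q X {} c"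
    by (simp add: homologous_rel_set_eq_relboundary)
  then show thesis
    using that by (auto simp: singular_boundary)
qed

lemma nsphere_cycle_bounds:
  assumes "singular_relcycle q (nsphere n) {} c" "0 < q" "q \<noteq> n"
  obtains d where "singular_chain (Suc q) (nsphere n) d" "chain_boundary (Suc q) d = c"
proof (rule cycle_bounds_if_trivial_homology)
  show "trivial_group (homology_group (int q) (nsphere n))"
    using assms reduced_homology_group_nsphere(2)[of "int q" n]
    by (simp add: un_reduced_homology_group)
qed (use assms that in auto)

lemma contractible_cycle_bounds:
  assumes "contractible_space X" "singular_relcycle q X {} c" "0 < q"
  obtains d where "singular_chain (Suc q) X d" "chain_boundary (Suc q) d = c"
proof (rule cycle_bounds_if_trivial_homology)
  show "trivial_group (homology_group (int q) X)"
    using assms trivial_reduced_homology_group_contractible_space[of X "int q"]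
    by (simp add: un_reduced_homology_group)
qed (use assms that in auto)

text \<open>Divisibility of a class in singular homology, phrased on chains because the fillings and
  averages that it is applied to are chains.\<close>

definition divisible_cycle :: "int \<Rightarrow> nat \<Rightarrow> 'a topology \<Rightarrow> 'a chain \<Rightarrow> bool" where
  "divisible_cycle m q X c \<longleftrightarrow>
     (\<exists>y. singular_relcycle q X {} y \<and> homologous_rel q X {} c (frag_cmul m y))"

lemma divisible_cycle_homologous:
  assumes "homologous_rel q X {} c c'" "divisible_cycle m q X c'"
  shows "divisible_cycle m q X c"
  using assms unfolding divisible_cycle_def by (meson homologous_rel_trans)

lemma frag_cmul_diff_right: "frag_cmul c (a - b) = frag_cmul c a - frag_cmul c b"
  using frag_cmul_distrib2[of c "a - b" b] by (simp add: algebra_simps)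

text \<open>The suspension isomorphism on chains. Relative to the lower hemisphere \<open>cl\<close>
  vanishes, so \<open>cu\<close> becomes a multiple of \<open>y\<close>; the isomorphism with the
  upper hemisphere relative to the equator replaces \<open>y\<close> by some \<open>u\<close> there,
  and taking boundaries exhibits \<open>F\<close> as m times the boundary of \<open>u\<close>, up to
  a boundary.\<close>

lemma divisible_cycle_equator:
  assumes cu: "singular_chain (Suc n) (subtopology (nsphere (Suc n)) {x. x (Suc n) \<ge> 0}) cu"
    and cl: "singular_chain (Suc n) (subtopology (nsphere (Suc n)) {x. x (Suc n) \<le> 0}) cl"
    and F: "singular_chain n (nsphere n) F"
    and bu: "chain_boundary (Suc n) cu = F" and bl: "chain_boundary (Suc n) cl = F"
    and div: "divisible_cycle m (Suc n) (nsphere (Suc n)) (cu - cl)"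
  shows "divisible_cycle m n (nsphere n) F"
proof -
  let ?S = "nsphere (Suc n)"
  let ?U = "{x. x (Suc n) \<ge> (0::real)}" and ?L = "{x. x (Suc n) \<le> (0::real)}" and ?E = "{x. x (Suc n) = (0::real)}"
  let ?XU = "subtopology ?S ?U"
  let ?q = "Suc n"
  note of_nat_Suc [simp del]
  have eqE: "subtopology ?XU ?E = nsphere n"
  proof -
    have "?U \<inter> ?E = ?E" by auto
    then show ?thesis by (simp add: subtopology_subtopology subtopology_nsphere_equator)
  qed
  have iso: "hom_induced (int ?q) ?XU ?E ?S ?L id
     \<in> iso (relative_homology_group (int ?q) ?XU ?E) (relative_homology_group (int ?q) ?S ?L)" (is "?h \<in> iso ?G ?H")
    by (rule iso_relative_homology_group_upper_hemisphere)
  have cmid: "continuous_map ?XU ?S id" 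
    by (simp add: continuous_map_from_subtopology)
  have himg: "?h (homologous_rel_set ?q ?XU ?E c) = homologous_rel_set ?q ?S ?L c"
    if "singular_relcycle ?q ?XU ?E c" for c
  proof -
    have "chain_map ?q id c = c"
      using that chain_map_ident unfolding singular_relcycle by blast
    then show ?thesis
      using hom_induced_chain_map[OF cmid _ that, of ?L] by (auto simp: Pi_iff)
  qed
  obtain y where y: "singular_relcycle ?q ?S {} y" and yh: "homologous_rel ?q ?S {} (cu - cl) (frag_cmul m y)"
    using div unfolding divisible_cycle_def by blast
  have yL: "singular_relcycle ?q ?S ?L y"
    using y unfolding singular_cycle_iff by (simp add: singular_relcycle)
  have "homologous_rel_set ?q ?S ?L y \<in> carrier ?H"
    unfolding carrier_relative_homology_group using yL by blast
  moreover have im: "?h ` carrier ?G = carrier ?H"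
    using iso unfolding iso_def bij_betw_def by blast
  ultimately have "homologous_rel_set ?q ?S ?L y \<in> ?h ` carrier ?G"
    by (simp only: im)
  then obtain R where R: "R \<in> carrier ?G" "?h R = homologous_rel_set ?q ?S ?L y"
    by (rule imageE) (rule that, assumption, rule sym)
  then obtain u where u: "singular_relcycle ?q ?XU ?E u" and Ru: "R = homologous_rel_set ?q ?XU ?E u"
    by (auto simp: carrier_relative_homology_group)
  have "homologous_rel_set ?q ?S ?L u = homologous_rel_set ?q ?S ?L y"
    using R Ru himg[OF u] by simp
  then have uy: "homologous_rel ?q ?S ?L u y"
    by (simp add: homologous_rel_set_eq)
  have b1: "singular_relboundary ?q ?S ?L (u - y)" using uy by (simp add: homologous_rel_def)
  have b2: "singular_relboundary ?q ?S ?L ((cu - cl) - frag_cmul m y)"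
  proof -
    have "singular_relboundary ?q ?S {} ((cu - cl) - frag_cmul m y)"
      using yh by (simp add: homologous_rel_def)
    then obtain d where "singular_chain (Suc ?q) ?S d" "chain_boundary (Suc ?q) d = (cu - cl) - frag_cmul m y"
      by (auto simp: singular_boundary)
    then show ?thesis unfolding singular_relboundary
      by (metis add.right_neutral singular_chain_0)
  qed
  have b3: "singular_relboundary ?q ?S ?L cl"
    unfolding singular_relboundary using cl by (metis add.left_neutral chain_boundary_0 singular_chain_0)
  \<comment> \<open>Relative to the lower hemisphere, \<open>cl\<close> may be added for free and
    \<open>y\<close> may be traded for \<open>u\<close>.\<close>
  have "singular_relboundary ?q ?S ?L (((cu - cl) - frag_cmul m y) + cl - frag_cmul m (u - y))"
    by (intro singular_relboundary_add singular_relboundary_diff singular_relboundary_cmul b1 b2 b3)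
  moreover have "((cu - cl) - frag_cmul m y) + cl - frag_cmul m (u - y) = cu - frag_cmul m u"
    unfolding frag_cmul_diff_right by (simp del: minus_frag_cmul)
  ultimately have b4: "singular_relboundary ?q ?S ?L (cu - frag_cmul m u)" by (simp only:)
  let ?v = "cu - frag_cmul m u"
  have cuc: "singular_relcycle ?q ?XU ?E cu"
    unfolding singular_relcycle using cu bu F eqE by simp
  have vc: "singular_relcycle ?q ?XU ?E ?v"
    by (intro singular_relcycle_diff singular_relcycle_cmul cuc u)
  have "?h (homologous_rel_set ?q ?XU ?E ?v) = ?h (homologous_rel_set ?q ?XU ?E 0)"
  proof -
    have "homologous_rel ?q ?S ?L ?v 0" using b4 by (simp add: homologous_rel_def)
    then show ?thesis using himg[OF vc] himg[of 0] by (simp add: homologous_rel_set_eq)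
  qed
  then have "homologous_rel_set ?q ?XU ?E ?v = homologous_rel_set ?q ?XU ?E 0"
    using iso vc unfolding iso_def bij_betw_def inj_on_def
    by (auto simp: carrier_relative_homology_group)
  then have "homologous_rel ?q ?XU ?E ?v 0"
    by (metis homologous_rel_set_eq)
  then have "singular_relboundary ?q ?XU ?E ?v"
    by (simp add: homologous_rel_def)
  then obtain d e where d: "singular_chain (Suc ?q) ?XU d" and e: "singular_chain ?q (nsphere n) e"
    and de: "chain_boundary (Suc ?q) d + e = ?v"
    unfolding singular_relboundary eqE by blast
  \<comment> \<open>The part \<open>d\<close> has vanishing double boundary, which leaves a relation
    inside the equator.\<close>
  have "chain_boundary ?q ?v = chain_boundary ?q e"
    unfolding de[symmetric] chain_boundary_add using chain_boundary_boundary_alt[OF d] by simp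
  moreover have "chain_boundary ?q ?v = F - frag_cmul m (chain_boundary ?q u)"
    by (simp add: chain_boundary_diff chain_boundary_cmul bu)
  ultimately have Fe: "F - frag_cmul m (chain_boundary ?q u) = chain_boundary (Suc n) e" by simp
  have uch: "singular_chain n (nsphere n) (chain_boundary ?q u)"
    using u unfolding singular_relcycle eqE by simp
  have "chain_boundary n (chain_boundary (Suc n) u) = 0"
    using u chain_boundary_boundary_alt unfolding singular_relcycle by blast
  then have cyc: "singular_relcycle n (nsphere n) {} (chain_boundary ?q u)"
    unfolding singular_cycle_iff using uch by simp
  show ?thesis unfolding divisible_cycle_def homologous_rel_def
    unfolding singular_boundary using cyc e Fe[symmetric] by blast
qed

lemma divisible_cycle_minus:
  assumes "divisible_cycle m q X c"
  shows "divisible_cycle m q X (- c)"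
proof -
  obtain y where y: "singular_relcycle q X {} y" "homologous_rel q X {} c (frag_cmul m y)"
    using assms unfolding divisible_cycle_def by blast
  have "homologous_rel q X {} (0 - c) (0 - frag_cmul m y)"
    using y by (intro homologous_rel_diff) auto
  moreover have "frag_cmul m (frag_cmul (-1) y) = 0 - frag_cmul m y"
    unfolding frag_cmul_cmul by simp
  ultimately have "homologous_rel q X {} (- c) (frag_cmul m (frag_cmul (-1) y))"
    by simp
  then show ?thesis
    using y singular_relcycle_cmul unfolding divisible_cycle_def by blast
qed

section \<open>Contractible sectors of a sphere\<close>

lemma contractible_space_sphere_cone:
  fixes e :: "nat \<Rightarrow> real"
  assumes e: "e \<in> topspace (nsphere n)" "e \<in> K" "(\<lambda>i. - e i) \<notin> K"
    and cone: "\<And>x s t. x \<in> K \<Longrightarrow> 0 \<le> s \<Longrightarrow> 0 \<le> t \<Longrightarrow> (\<lambda>i. s * x i + t * e i) \<in> K"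
  shows "contractible_space (subtopology (nsphere n) K)"
proof -
  let ?g = "\<lambda>x i. x i / sqrt(\<Sum>j\<le>n. x j ^ 2)"
  let ?h = "\<lambda>(t,q) i. (1 - t) * q i + t * e i"
  let ?Y = "subtopology (Euclidean_space (Suc n)) {x. x \<in> K \<and> (\<exists>i\<le>n. x i \<noteq> 0)}"
  have esum: "(\<Sum>i\<le>n. (e i)\<^sup>2) = 1" and e0: "\<And>i. i > n \<Longrightarrow> e i = 0"
    using e by (auto simp: nsphere)
  \<comment> \<open>The segment from x to e could meet the origin only at t = 1/2, since both ends
    are unit vectors, and then x = -e.\<close>
  have nz: "\<exists>i\<le>n. (1 - t) * x i + t * e i \<noteq> 0"
    if x: "x \<in> K" "(\<Sum>i\<le>n. (x i)\<^sup>2) = 1" "\<forall>i>n. x i = 0" and t: "0 \<le> t" "t \<le> 1" for x t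
  proof (rule ccontr)
    assume "\<not> ?thesis"
    then have eq: "(1 - t) * x i = - t * e i" for i
    proof (cases "i \<le> n")
      case True
      then show ?thesis using \<open>\<not> (\<exists>i\<le>n. (1 - t) * x i + t * e i \<noteq> 0)\<close>
        by fastforce
    next
      case False
      then show ?thesis using e0 x(3) by simp
    qed
    have "(\<Sum>i\<le>n. ((1 - t) * x i)\<^sup>2) = (\<Sum>i\<le>n. (- t * e i)\<^sup>2)"
      using eq by simp
    then have "(1 - t)\<^sup>2 = t\<^sup>2"
      using x(2) esum by (simp add: power_mult_distrib flip: sum_distrib_left)
    then have "t = 1/2" using t by (simp add: power2_eq_iff)
    then have "x i = - e i" for i
      using eq[of i] unfolding \<open>t = 1/2\<close> by simp
    then have "x = (\<lambda>i. - e i)" by (rule ext)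
    then show False using x(1) e(3) by simp
  qed
  have "continuous_map (prod_topology (top_of_set {0..1}) (subtopology (nsphere n) K))
                       (subtopology (nsphere n) K) (?g \<circ> ?h)"
  proof (rule continuous_map_compose)
    show "continuous_map (prod_topology (top_of_set {0..1}) (subtopology (nsphere n) K)) ?Y ?h"
      using e0 nz cone
      apply (auto simp: nsphere continuous_map_componentwise_UNIV
               prod_topology_subtopology subtopology_subtopology case_prod_unfold
               continuous_map_in_subtopology Euclidean_space_def)
      apply (intro continuous_map_prod_snd continuous_intros continuous_map_from_subtopology)
        apply auto
      done
  next
    have 1: "\<And>x i. \<lbrakk> i \<le> n; x i \<noteq> 0\<rbrakk> \<Longrightarrow> (\<Sum>i\<le>n. (x i / sqrt (\<Sum>j\<le>n. (x j)\<^sup>2))\<^sup>2) = 1"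
      by (force simp: sum_nonneg sum_nonneg_eq_0_iff field_split_simps simp flip: sum_divide_distrib)
    have cm: "continuous_map ?Y (nsphere n) (\<lambda>x i. x i / sqrt (\<Sum>j\<le>n. (x j)\<^sup>2))"
      unfolding Euclidean_space_def nsphere subtopology_subtopology continuous_map_in_subtopology
    proof (intro continuous_intros conjI)
      show "continuous_map
               (subtopology (powertop_real UNIV) ({x. \<forall>i\<ge>Suc n. x i = 0} \<inter> {x. x \<in> K \<and> (\<exists>i\<le>n. x i \<noteq> 0)}))
               (powertop_real UNIV) (\<lambda>x i. x i / sqrt (\<Sum>j\<le>n. (x j)\<^sup>2))"
        unfolding continuous_map_componentwise
        by (intro continuous_intros conjI ballI) (auto simp: sum_nonneg_eq_0_iff)
    qed (auto simp: 1)
    have inK: "(\<lambda>i. x i / sqrt (\<Sum>j\<le>n. (x j)\<^sup>2)) \<in> K" if "x \<in> K" for x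
      using cone[OF that, of "1 / sqrt (\<Sum>j\<le>n. (x j)\<^sup>2)" 0] by (simp add: sum_nonneg)
    show "continuous_map ?Y (subtopology (nsphere n) K) (\<lambda>x i. x i / sqrt (\<Sum>j\<le>n. (x j)\<^sup>2))"
      using inK by (force simp: cm continuous_map_in_subtopology)
  qed
  moreover have "(?g \<circ> ?h) (0, x) = x"
    if "x \<in> topspace (subtopology (nsphere n) K)" for x
    using that by (simp add: nsphere)
  moreover
  have "(?g \<circ> ?h) (1, x) = e"
    if "x \<in> topspace (subtopology (nsphere n) K)" for x
    using esum by force
  ultimately
  show ?thesis
    apply (simp add: contractible_space_def homotopic_with)
    apply (rule_tac x=e in exI)
    apply (rule_tac x="?g \<circ> ?h" in exI, force)
    done
qed

text \<open>On the sphere this is the join of the subsphere \<open>nsphere q\<close> with a circular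
  arc: the case s = 0 puts the subsphere into every sector. Angles are real numbers, so that sectors
  can be ordered along a full turn.\<close>

definition sector :: "nat \<Rightarrow> real \<Rightarrow> real \<Rightarrow> (nat \<Rightarrow> real) set" where
  "sector q \<alpha> \<beta> = {x. \<exists>s\<ge>0. \<exists>\<phi>\<in>{\<alpha>..\<beta>}. x (Suc q) = s * cos \<phi> \<and> x (Suc (Suc q)) = s * sin \<phi>}"

lemma sector_mono: "\<alpha>' \<le> \<alpha> \<Longrightarrow> \<beta> \<le> \<beta>' \<Longrightarrow> sector q \<alpha> \<beta> \<subseteq> sector q \<alpha>' \<beta>'"
  unfolding sector_def by force

text \<open>Angles are real numbers here, so a cone argument has to return an angle inside the
  prescribed interval and not merely a direction. This is what closes a sector under adding
  multiples of its bisecting direction.\<close>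

lemma polar_sum_between:
  assumes "0 \<le> s" "0 \<le> t" "\<bar>\<phi> - \<mu>\<bar> \<le> pi / 2"
  obtains r \<psi> where "0 \<le> r" "min \<phi> \<mu> \<le> \<psi>" "\<psi> \<le> max \<phi> \<mu>"
    "s * cos \<phi> + t * cos \<mu> = r * cos \<psi>" "s * sin \<phi> + t * sin \<mu> = r * sin \<psi>"
proof -
  have main: "\<exists>r \<psi>. 0 \<le> r \<and> a \<le> \<psi> \<and> \<psi> \<le> b \<and> s * cos a + t * cos b = r * cos \<psi> \<and> s * sin a + t * sin b = r * sin \<psi>"
    if st: "0 \<le> s" "0 \<le> t" and ab: "a \<le> b" "b - a \<le> pi/2" for s t a b :: real
  proof -
    \<comment> \<open>Coordinates of the sum in the frame rotated by a.\<close>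
    define u v where "u = s + t * cos (b - a)" and "v = t * sin (b - a)"
    have c0: "cos (b - a) \<ge> 0" "sin (b - a) \<ge> 0"
      using ab by (auto intro!: cos_ge_zero sin_ge_zero)
    have uv: "u \<ge> 0" "v \<ge> 0" unfolding u_def v_def using st c0 by auto
    have rot: "s * cos a + t * cos b = u * cos a - v * sin a" "s * sin a + t * sin b = u * sin a + v * cos a"
    proof -
      have cb: "cos b = cos (b - a) * cos a - sin (b - a) * sin a" and sb: "sin b = sin (b - a) * cos a + cos (b - a) * sin a"
        using cos_add[of "b - a" a] sin_add[of "b - a" a] by simp_all
      show "s * cos a + t * cos b = u * cos a - v * sin a" "s * sin a + t * sin b = u * sin a + v * cos a"
        unfolding u_def v_def cb sb by (simp_all add: ring_distribs mult.assoc)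
    qed
    show ?thesis
    proof (cases "u = 0 \<and> v = 0")
      case True
      then show ?thesis using rot ab by (intro exI[of _ 0] exI[of _ a]) auto
    next
      case False
      define r where "r = sqrt (u\<^sup>2 + v\<^sup>2)"
      have rpos: "r > 0" unfolding r_def using False by (auto simp: sum_power2_gt_zero_iff)
      have r2: "r\<^sup>2 = u\<^sup>2 + v\<^sup>2" unfolding r_def by simp
      have "(u/r)\<^sup>2 + (v/r)\<^sup>2 = 1" 
        unfolding power_divide add_divide_distrib[symmetric] r2[symmetric] using rpos by simp
      then obtain \<omega> where \<omega>: "0 \<le> \<omega>" "\<omega> \<le> pi/2" "u/r = cos \<omega>" "v/r = sin \<omega>"
        using sincos_total_pi_half[of "u/r" "v/r"] uv rpos by auto
      have uv2: "u = r * cos \<omega>" "v = r * sin \<omega>" using \<omega> rpos by (auto simp: field_simps)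
      \<comment> \<open>Shows that the angle \<open>\<omega>\<close> found in the rotated frame does
        not exceed b - a.\<close>
      have "r * sin (b - a - \<omega>) = sin (b-a) * u - cos (b-a) * v"
        unfolding sin_diff[of "b-a"] uv2 by (simp add: algebra_simps)
      also have "\<dots> = s * sin (b - a)" unfolding u_def v_def by (simp add: algebra_simps)
      finally have "sin (b - a - \<omega>) \<ge> 0" using st c0 rpos
        by (metis mult_nonneg_nonneg zero_le_mult_iff not_le)
      then have "\<omega> \<le> b - a"
      proof (rule contrapos_pp)
        assume "\<not> \<omega> \<le> b - a"
        then have "sin (\<omega> - (b - a)) > 0"
          using \<omega> ab by (intro sin_gt_zero) auto
        then show "\<not> 0 \<le> sin (b - a - \<omega>)" using sin_minus[of "\<omega> - (b-a)"] by simp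
      qed
      moreover have "s * cos a + t * cos b = r * cos (a + \<omega>)" "s * sin a + t * sin b = r * sin (a + \<omega>)"
        unfolding rot uv2 cos_add sin_add by (simp_all add: algebra_simps)
      ultimately show ?thesis using \<omega> rpos by (intro exI[of _ r] exI[of _ "a + \<omega>"]) auto
    qed
  qed
  show thesis
  proof (cases "\<phi> \<le> \<mu>")
    case True
    then show thesis using main[of s t \<phi> \<mu>] assms that by (auto simp: abs_le_iff)
  next
    case False
    then show thesis using main[of t s \<mu> \<phi>] assms that by (auto simp: abs_le_iff add.commute)
  qed
qed

text \<open>The bisecting direction e is the apex. Width at most pi keeps every angle within pi/2 of
  the bisector, which excludes -e and makes the sector a cone for adding multiples of e.\<close>

lemma contractible_space_sector:
  assumes "\<alpha> \<le> \<beta>" "\<beta> - \<alpha> \<le> pi"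
  shows "contractible_space (subtopology (nsphere (Suc (Suc q))) (sector q \<alpha> \<beta>))"
proof -
  define \<mu> where "\<mu> = (\<alpha> + \<beta>) / 2"
  define e where "e = (\<lambda>i. if i = Suc q then cos \<mu> else if i = Suc (Suc q) then sin \<mu> else 0)"
  have esum: "(\<Sum>i\<le>q. (e i)\<^sup>2) = 0" unfolding e_def by (intro sum.neutral) auto
  have esp: "e \<in> topspace (nsphere (Suc (Suc q)))"
    using esum by (simp add: nsphere, simp add: e_def)
  show ?thesis
  proof (rule contractible_space_sphere_cone[OF esp])
    show "e \<in> sector q \<alpha> \<beta>"
      unfolding sector_def using assms by (auto simp: e_def \<mu>_def intro!: exI[of _ 1] bexI[of _ \<mu>])
    show "(\<lambda>i. - e i) \<notin> sector q \<alpha> \<beta>"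
    proof
      assume "(\<lambda>i. - e i) \<in> sector q \<alpha> \<beta>"
      then obtain s \<phi> where s: "s \<ge> 0" "\<alpha> \<le> \<phi>" "\<phi> \<le> \<beta>" "- cos \<mu> = s * cos \<phi>" "- sin \<mu> = s * sin \<phi>"
        unfolding sector_def by (auto simp: e_def)
      have "s * cos (\<phi> - \<mu>) = (s * cos \<phi>) * cos \<mu> + (s * sin \<phi>) * sin \<mu>"
        by (simp add: cos_diff algebra_simps)
      also have "\<dots> = - ((cos \<mu>)\<^sup>2 + (sin \<mu>)\<^sup>2)"
        unfolding s(4,5)[symmetric] by (simp only: power2_eq_square minus_add_distrib mult_minus_left)
      finally have "s * cos (\<phi> - \<mu>) = -1" using sin_cos_squared_add2[of \<mu>] by linarith
      moreover have "cos (\<phi> - \<mu>) \<ge> 0"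
        using s assms by (intro cos_ge_zero) (auto simp: \<mu>_def field_simps)
      ultimately show False using s(1) by (metis mult_nonneg_nonneg neg_0_le_iff_le not_one_le_zero)
    qed
    show "(\<lambda>i. s * x i + t * e i) \<in> sector q \<alpha> \<beta>" if x: "x \<in> sector q \<alpha> \<beta>" "0 \<le> s" "0 \<le> t" for x s t
    proof -
      obtain r \<phi> where r: "r \<ge> 0" "\<alpha> \<le> \<phi>" "\<phi> \<le> \<beta>" "x (Suc q) = r * cos \<phi>" "x (Suc (Suc q)) = r * sin \<phi>"
        using x unfolding sector_def by auto
      have "\<bar>\<phi> - \<mu>\<bar> \<le> pi/2" using r assms by (auto simp: \<mu>_def abs_le_iff field_simps)
      then obtain r' \<psi> where r': "0 \<le> r'" "min \<phi> \<mu> \<le> \<psi>" "\<psi> \<le> max \<phi> \<mu>"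
        "(s * r) * cos \<phi> + t * cos \<mu> = r' * cos \<psi>" "(s * r) * sin \<phi> + t * sin \<mu> = r' * sin \<psi>"
        using polar_sum_between[of "s * r" t \<phi> \<mu>] x r by (metis mult_nonneg_nonneg)
      have "\<alpha> \<le> \<psi>" "\<psi> \<le> \<beta>" using r' r assms by (auto simp: \<mu>_def min_def max_def split: if_splits)
      then show ?thesis unfolding sector_def
        using r r' by (auto simp: e_def mult.assoc intro!: exI[of _ r'] bexI[of _ \<psi>])
    qed
  qed
qed

section \<open>Rotations of coordinate pairs\<close>

definition pair_rot :: "nat \<Rightarrow> (nat \<Rightarrow> real) \<Rightarrow> (nat \<Rightarrow> real) \<Rightarrow> nat \<Rightarrow> real" where
  "pair_rot n \<theta> x i =
     (if i \<le> n then x i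
      else let j = (i - Suc n) div 2 in
        if even (i - Suc n) then cos (\<theta> j) * x i - sin (\<theta> j) * x (Suc i)
        else sin (\<theta> j) * x (i - 1) + cos (\<theta> j) * x i)"

lemma pair_rot_low [simp]: "i \<le> n \<Longrightarrow> pair_rot n \<theta> x i = x i"
  by (simp add: pair_rot_def)

lemma pair_rot_even: "pair_rot n \<theta> x (Suc (n + 2 * j)) =
    cos (\<theta> j) * x (Suc (n + 2 * j)) - sin (\<theta> j) * x (Suc (Suc (n + 2 * j)))"
  by (simp add: pair_rot_def)

lemma pair_rot_odd: "pair_rot n \<theta> x (Suc (Suc (n + 2 * j))) =
    sin (\<theta> j) * x (Suc (n + 2 * j)) + cos (\<theta> j) * x (Suc (Suc (n + 2 * j)))"
  by (simp add: pair_rot_def Suc_diff_le)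

lemma pair_index_cases:
  obtains "i \<le> n" | j where "i = Suc (n + 2 * j)" | j where "i = Suc (Suc (n + 2 * j))"
proof (cases "i \<le> n")
  case False
  then obtain k where k: "i = Suc (n + k)" by (metis less_iff_Suc_add not_le)
  show thesis
  proof (cases "even k")
    case True
    then show thesis using that k by (auto elim!: evenE)
  next
    case False
    then obtain j where "k = 2 * j + 1" by (elim oddE)
    then show thesis using that k by auto
  qed
qed (use that in auto)

lemma pair_rot_add: "pair_rot n \<theta> (pair_rot n \<phi> x) = pair_rot n (\<lambda>j. \<theta> j + \<phi> j) x"
proof
  fix i
  show "pair_rot n \<theta> (pair_rot n \<phi> x) i = pair_rot n (\<lambda>j. \<theta> j + \<phi> j) x i"
  proof (rule pair_index_cases[of i n])
    fix j assume "i = Suc (n + 2 * j)"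
    then show ?thesis
      by (simp only: pair_rot_even pair_rot_odd sin_add cos_add) (simp add: ring_distribs)
  next
    fix j assume "i = Suc (Suc (n + 2 * j))"
    then show ?thesis
      by (simp only: pair_rot_even pair_rot_odd sin_add cos_add) (simp add: ring_distribs)
  qed simp
qed

lemma pair_rot_cong:
  assumes "\<And>j. sin (\<theta> j) = sin (\<phi> j)" "\<And>j. cos (\<theta> j) = cos (\<phi> j)"
  shows "pair_rot n \<theta> = pair_rot n \<phi>"
  by (intro ext) (simp add: pair_rot_def assms Let_def)

lemma pair_rot_zero: "pair_rot n (\<lambda>j. 0) x = x"
  by (rule ext, rule_tac i=xa and n=n in pair_index_cases) (simp_all add: pair_rot_even pair_rot_odd)

lemma pair_rot_sum_squares:
  "(\<Sum>i\<le>n + 2 * d. (pair_rot n \<theta> x i)\<^sup>2) = (\<Sum>i\<le>n + 2 * d. (x i)\<^sup>2)"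
proof (induction d)
  case (Suc d)
  have e: "(c * a - s * b)\<^sup>2 + (s * a + c * b)\<^sup>2 = (s\<^sup>2 + c\<^sup>2) * (a\<^sup>2 + b\<^sup>2)" for a b c s :: real
    by (simp add: power2_eq_square algebra_simps)
  show ?case
    using Suc e[of "cos (\<theta> d)" "x (Suc (n + 2 * d))" "sin (\<theta> d)" "x (Suc (Suc (n + 2 * d)))"]
    by (simp add: pair_rot_even pair_rot_odd)
qed simp

lemma continuous_map_pair_rot_homotopy:
  "continuous_map (prod_topology (top_of_set {0..1}) (nsphere (n + 2 * d))) (nsphere (n + 2 * d))
     (\<lambda>(s, x). pair_rot n (\<lambda>j. s * \<theta> j) x)"
proof -
  have z: "pair_rot n \<phi> x i = 0" if "\<forall>i>n + 2 * d. x i = 0" "i > n + 2 * d" for x i \<phi>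
  proof (rule pair_index_cases[of i n])
    fix j assume j: "i = Suc (Suc (n + 2 * j))"
    then have "Suc (n + 2 * j) > n + 2 * d" using that(2) by presburger
    then show ?thesis using that j by (simp add: pair_rot_odd)
  qed (use that in \<open>auto simp: pair_rot_even\<close>)
  have c: "continuous_map (prod_topology (top_of_set {0..1}) (nsphere (n + 2 * d))) euclideanreal
     (\<lambda>y. pair_rot n (\<lambda>j. fst y * \<theta> j) (snd y) i)" for i
  proof -
    have s: "continuous_map (prod_topology (top_of_set {0..1}) (nsphere (n + 2 * d))) euclideanreal (\<lambda>y. snd y k)" for k
      using continuous_map_compose[OF continuous_map_snd continuous_map_nsphere_projection] by (auto simp: o_def)
    have f: "continuous_map (prod_topology (top_of_set {0..1::real}) (nsphere (n + 2 * d))) euclideanreal (\<lambda>y. g (fst y))"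
      if "continuous_on {0..1} g" for g
      using continuous_map_compose[OF continuous_map_fst, of "top_of_set {0..1::real}" euclideanreal g "nsphere (n + 2 * d)"] that
      by (auto simp: o_def)
    have f1: "continuous_map (prod_topology (top_of_set {0..1::real}) (nsphere (n + 2 * d))) euclideanreal (\<lambda>y. cos (fst y * r))"
      and f2: "continuous_map (prod_topology (top_of_set {0..1::real}) (nsphere (n + 2 * d))) euclideanreal (\<lambda>y. sin (fst y * r))" for r
      by (rule f, intro continuous_intros)+
    show ?thesis
      by (rule pair_index_cases[of i n])
         (auto simp: pair_rot_even pair_rot_odd intro!: continuous_map_diff continuous_map_add continuous_map_real_mult s f1 f2)
  qed
  show ?thesis
    unfolding nsphere[of "n + 2 * d"]
    unfolding continuous_map_in_subtopology
    using c[unfolded nsphere] z pair_rot_sum_squares[of n _ _ d]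
    by (auto simp: continuous_map_componentwise_UNIV case_prod_unfold)
qed

lemma homotopic_pair_rot_id:
  "homotopic_with (\<lambda>h. True) (nsphere (n + 2 * d)) (nsphere (n + 2 * d)) id (pair_rot n \<theta>)"
  unfolding homotopic_with_def
  apply (rule exI[of _ "\<lambda>(s, x). pair_rot n (\<lambda>j. s * \<theta> j) x"])
  using continuous_map_pair_rot_homotopy[of n d \<theta>] by (auto simp: pair_rot_zero)

lemma continuous_map_pair_rot:
  "continuous_map (nsphere (n + 2 * d)) (nsphere (n + 2 * d)) (pair_rot n \<theta>)"
  using homotopic_pair_rot_id homotopic_with_imp_continuous_maps by blast

text \<open>Shrinking the angles to 0 is a homotopy to the identity. Consequently a sum over the
  cyclic group acts on homology as multiplication by the group order.\<close>

lemma pair_rot_homologous: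
  assumes "singular_relcycle q (nsphere (n + 2 * d)) {} c"
  shows "homologous_rel q (nsphere (n + 2 * d)) {} (chain_map q (pair_rot n \<theta>) c) c"
proof -
  have "homotopic_with (\<lambda>h. h \<in> {} \<rightarrow> {}) (nsphere (n + 2 * d)) (nsphere (n + 2 * d)) (pair_rot n \<theta>) id"
    using homotopic_pair_rot_id[of n d \<theta>] by (simp add: homotopic_with_sym)
  from homotopic_imp_homologous_rel_chain_maps[OF this assms]
  show ?thesis using assms chain_map_ident unfolding singular_relcycle by metis
qed

lemma singular_chain_subtopology_mono:
  assumes "singular_chain q (subtopology X S) c" "S \<subseteq> T"
  shows "singular_chain q (subtopology X T) c"
  using assms unfolding singular_chain_def singular_simplex_subtopology by (auto simp: singular_simplex_subtopology subset_iff)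

lemma singular_chain_map_subtopology:
  assumes "singular_chain q (subtopology X S) c" "continuous_map X Y g" "g \<in> S \<rightarrow> T"
  shows "singular_chain q (subtopology Y T) (chain_map q g c)"
proof (rule singular_chain_chain_map[OF assms(1)])
  show "continuous_map (subtopology X S) (subtopology Y T) g"
    using assms(2,3) by (auto simp: continuous_map_in_subtopology continuous_map_from_subtopology)
qed

text \<open>The cyclic group generated by a rotation of the coordinate pairs acts on the sphere; over
  a cycle \<open>F\<close> of a subsphere, adding one more coordinate pair, the half-disc chain \<open>a\<close> and
  the chain \<open>c\<close> of a sector fit together to the double suspension of \<open>F\<close>.\<close>
lemma sector_chains:
  fixes R :: "nat \<Rightarrow> (nat \<Rightarrow> real) \<Rightarrow> nat \<Rightarrow> real" and p q :: nat
  assumes S_def: "S = nsphere (Suc (Suc q))" and q: "0 < q" and p: "2 \<le> p"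
    and Rcont: "\<And>i. continuous_map S S (R i)"
    and Rsec: "\<And>i \<alpha> \<beta> x. x \<in> sector q \<alpha> \<beta> \<Longrightarrow> R i x \<in> sector q (\<alpha> + 2 * pi * i / p) (\<beta> + 2 * pi * i / p)"
    and Radd: "\<And>i j x. R i (R j x) = R (i + j) x" and Rp: "\<And>x. R p x = x" and R0: "\<And>x. R 0 x = x"
    and F: "singular_relcycle q (nsphere q) {} F" and RF: "\<And>i. chain_map q (R i) F = F"
  shows "\<exists>a c. singular_chain (Suc q) S a \<and> chain_boundary (Suc q) a = F \<and>
    singular_chain (Suc (Suc q)) S c \<and>
    chain_boundary (Suc (Suc q)) c = chain_map (Suc q) (R 1) a - a \<and>
    (\<forall>m. divisible_cycle m (Suc (Suc q)) S (\<Sum>i<p. chain_map (Suc (Suc q)) (R i) c) \<longrightarrow>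
       divisible_cycle m q (nsphere q) F)"
proof -
  let ?sec = "\<lambda>\<alpha> \<beta>. subtopology S (sector q \<alpha> \<beta>)"
  let ?q1 = "Suc q" and ?q2 = "Suc (Suc q)"
  have p0: "real p > 0" using p by simp
  have contr: "contractible_space (?sec \<alpha> \<beta>)" if "\<alpha> \<le> \<beta>" "\<beta> - \<alpha> \<le> pi" for \<alpha> \<beta>
    unfolding S_def by (rule contractible_space_sector[OF that])
  have Fch: "singular_chain q (nsphere q) F" and Fb: "chain_boundary q F = 0"
    using F unfolding singular_cycle_iff by auto
  have eqr: "subtopology S ({x. x (Suc (Suc q)) = 0} \<inter> {x. x (Suc q) = 0}) = nsphere q"
    unfolding S_def subtopology_subtopology[symmetric] subtopology_nsphere_equator ..
  have Fsec: "singular_chain q (?sec \<alpha> \<beta>) F" if "\<alpha> \<le> \<beta>" for \<alpha> \<beta>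
  proof (rule singular_chain_subtopology_mono)
    show "singular_chain q (subtopology S ({x. x (Suc (Suc q)) = 0} \<inter> {x. x (Suc q) = 0})) F"
      using Fch eqr by simp
    show "{x. x (Suc (Suc q)) = 0} \<inter> {x. x (Suc q) = 0} \<subseteq> sector q \<alpha> \<beta>"
      unfolding sector_def using that by (auto intro!: exI[of _ 0] bexI[of _ \<alpha>])
  qed
  \<comment> \<open>A sector of width 0 is a half-disc page bounded by the subsphere, and each page
    carries a filling of \<open>F\<close>.\<close>
  have fill1: "\<exists>a. singular_chain ?q1 (?sec \<alpha> \<alpha>) a \<and> chain_boundary ?q1 a = F" for \<alpha>
    by (rule contractible_cycle_bounds[of "?sec \<alpha> \<alpha>" q F])
       (use contr[of \<alpha> \<alpha>] Fsec[of \<alpha> \<alpha>] Fb q in \<open>auto simp: singular_cycle_iff\<close>)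
  have fill2: "\<exists>c. singular_chain ?q2 (?sec \<alpha> \<beta>) c \<and> chain_boundary ?q2 c = v - u"
    if "\<alpha> \<le> \<beta>" "\<beta> - \<alpha> \<le> pi" "singular_chain ?q1 (?sec \<alpha> \<alpha>) u" "chain_boundary ?q1 u = F"
      "singular_chain ?q1 (?sec \<beta> \<beta>) v" "chain_boundary ?q1 v = F" for \<alpha> \<beta> u v
  proof -
    have "singular_chain ?q1 (?sec \<alpha> \<beta>) u"
      by (rule singular_chain_subtopology_mono[OF that(3)], rule sector_mono) (use that in auto)
    moreover have "singular_chain ?q1 (?sec \<alpha> \<beta>) v"
      by (rule singular_chain_subtopology_mono[OF that(5)], rule sector_mono) (use that in auto)
    ultimately have "singular_relcycle ?q1 (?sec \<alpha> \<beta>) {} (v - u)"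
      using that by (auto simp: singular_cycle_iff singular_chain_diff chain_boundary_diff)
    then show ?thesis
      by (rule contractible_cycle_bounds[OF contr[OF that(1,2)]]) auto
  qed
  have fill3: "\<exists>c. singular_chain (Suc ?q2) (?sec \<alpha> \<beta>) c \<and> chain_boundary (Suc ?q2) c = v"
    if "\<alpha> \<le> \<beta>" "\<beta> - \<alpha> \<le> pi" "singular_chain ?q2 (?sec \<alpha> \<beta>) v" "chain_boundary ?q2 v = 0" for \<alpha> \<beta> v
    by (rule contractible_cycle_bounds[OF contr[OF that(1,2)], of ?q2 v]) (use that in \<open>auto simp: singular_cycle_iff\<close>)
  define \<theta> where "\<theta> = (\<lambda>i::nat. 2 * pi * i / p)"
  have \<theta>S: "\<theta> (Suc i) = \<theta> i + \<theta> 1" for i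
    unfolding \<theta>_def by (simp add: add_divide_distrib algebra_simps)
  have \<theta>mono: "\<theta> i \<le> \<theta> j" if "i \<le> j" for i j unfolding \<theta>_def using that p0 by (intro divide_right_mono mult_left_mono) auto
  have \<theta>1: "0 \<le> \<theta> 1" "\<theta> 1 \<le> pi" unfolding \<theta>_def using p by (auto simp: field_simps)
  have \<theta>0: "\<theta> 0 = 0" and \<theta>p: "\<theta> p = 2 * pi" unfolding \<theta>_def using p0 by auto
  have Rch: "singular_chain k (?sec (\<alpha> + \<theta> i) (\<beta> + \<theta> i)) (chain_map k (R i) u)"
    if "singular_chain k (?sec \<alpha> \<beta>) u" for k i \<alpha> \<beta> u
    by (rule singular_chain_map_subtopology[OF that Rcont]) (auto simp: \<theta>_def Rsec)
  have Rcomp: "chain_map k (R i) (chain_map k (R j) u) = chain_map k (R (i + j)) u" for k i j u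
  proof -
    have "R i \<circ> R j = R (i + j)" by (auto simp: fun_eq_iff Radd)
    then show ?thesis using chain_map_compose[of k "R i" "R j"] by (metis comp_apply)
  qed
  obtain a where a: "singular_chain ?q1 (?sec 0 0) a" "chain_boundary ?q1 a = F" using fill1 by blast
  \<comment> \<open>An auxiliary filling at angle pi, where the sphere will be cut into hemispheres;
    pi need not be a multiple of 2 pi / p.\<close>
  obtain b where b: "singular_chain ?q1 (?sec pi pi) b" "chain_boundary ?q1 b = F" using fill1 by blast
  have aS: "singular_chain ?q1 S a" and bS: "singular_chain ?q1 S b"
    using a b by (meson singular_chain_subtopology)+
  let ?a = "\<lambda>i. chain_map ?q1 (R i) a"
  have Ra: "singular_chain ?q1 (?sec (\<theta> i) (\<theta> i)) (?a i)" "chain_boundary ?q1 (?a i) = F" for i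
    using Rch[OF a(1), of i] chain_boundary_chain_map[OF aS, of "R i"] a(2) RF by auto
  have a0: "?a 0 = a" and ap: "?a p = a"
    using chain_map_id_gen[OF aS, of "R 0"] chain_map_id_gen[OF aS, of "R p"] R0 Rp by auto
  obtain c where c: "singular_chain ?q2 (?sec 0 (\<theta> 1)) c" "chain_boundary ?q2 c = ?a 1 - a"
    using fill2[of 0 "\<theta> 1" a "?a 1"] a Ra[of 1] \<theta>1 by auto
  have cS: "singular_chain ?q2 S c" using c by (meson singular_chain_subtopology)
  let ?c = "\<lambda>i. chain_map ?q2 (R i) c"
  have Rc: "singular_chain ?q2 (?sec (\<theta> i) (\<theta> (Suc i))) (?c i)" "chain_boundary ?q2 (?c i) = ?a (Suc i) - ?a i" for i
    using Rch[OF c(1), of i] chain_boundary_chain_map[OF cS, of "R i"] c(2) \<theta>S[of i]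
    by (auto simp: chain_map_diff Rcomp add.commute)
  have "divisible_cycle m q (nsphere q) F" if div: "divisible_cycle m ?q2 S (\<Sum>i<p. ?c i)" for m
  proof -
    \<comment> \<open>Index of a sector that contains the angle pi.\<close>
    define h where "h = p div 2"
    have h: "h < p" "\<theta> h \<le> pi" "pi \<le> \<theta> (Suc h)"
    proof -
      have "2 * h \<le> p" "p \<le> 2 * Suc h" unfolding h_def using p by presburger+
      then have "2 * real h \<le> real p" "real p \<le> 2 * real (Suc h)" by linarith+
      then have "pi * (2 * real h) \<le> pi * p" "pi * p \<le> pi * (2 * real (Suc h))"
        by (intro mult_left_mono; simp)+
      then show "\<theta> h \<le> pi" "pi \<le> \<theta> (Suc h)"
        unfolding \<theta>_def using p0 by (simp_all add: field_simps)
      show "h < p" unfolding h_def using p by auto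
    qed
    have h2: "\<theta> (Suc h) - \<theta> h \<le> pi" using \<theta>S[of h] \<theta>1 by simp
    obtain c1 where c1: "singular_chain ?q2 (?sec (\<theta> h) pi) c1" "chain_boundary ?q2 c1 = b - ?a h"
      using fill2[of "\<theta> h" pi "?a h" b] Ra[of h] b h h2 by auto
    obtain c2 where c2: "singular_chain ?q2 (?sec pi (\<theta> (Suc h))) c2" "chain_boundary ?q2 c2 = ?a (Suc h) - b"
      using fill2[of pi "\<theta> (Suc h)" b "?a (Suc h)"] Ra[of "Suc h"] b h h2 by auto
    \<comment> \<open>This sector is contractible, so cutting its chain at angle pi changes it only
      by a boundary.\<close>
    have "singular_chain ?q2 (?sec (\<theta> h) (\<theta> (Suc h))) (?c h - (c1 + c2))"
    proof (intro singular_chain_diff singular_chain_add)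
      show "singular_chain ?q2 (?sec (\<theta> h) (\<theta> (Suc h))) c1"
        by (rule singular_chain_subtopology_mono[OF c1(1)], rule sector_mono) (use h in auto)
      show "singular_chain ?q2 (?sec (\<theta> h) (\<theta> (Suc h))) c2"
        by (rule singular_chain_subtopology_mono[OF c2(1)], rule sector_mono) (use h in auto)
    qed (rule Rc)
    moreover have "chain_boundary ?q2 (?c h - (c1 + c2)) = 0"
      by (simp add: chain_boundary_diff chain_boundary_add Rc c1 c2)
    ultimately obtain x where x: "singular_chain (Suc ?q2) (?sec (\<theta> h) (\<theta> (Suc h))) x"
       "chain_boundary (Suc ?q2) x = ?c h - (c1 + c2)"
      using fill3[OF _ h2] \<theta>mono[of h "Suc h"] by auto
    \<comment> \<open>Both halves are oriented to have boundary \<open>b - a\<close>, so that the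
      full sum over the group is homologous to \<open>cu - cl\<close>.\<close>
    define cu where "cu = (\<Sum>i<h. ?c i) + c1"
    define cl where "cl = - (c2 + (\<Sum>i\<in>{Suc h..<p}. ?c i))"
    let ?up = "subtopology S {x. x (Suc (Suc q)) \<ge> 0}" and ?lo = "subtopology S {x. x (Suc (Suc q)) \<le> 0}"
    have up: "sector q \<alpha> \<beta> \<subseteq> {x. x (Suc (Suc q)) \<ge> 0}" if "0 \<le> \<alpha>" "\<beta> \<le> pi" for \<alpha> \<beta>
      unfolding sector_def using that by (auto intro!: mult_nonneg_nonneg sin_ge_zero)
    have lo: "sector q \<alpha> \<beta> \<subseteq> {x. x (Suc (Suc q)) \<le> 0}" if "pi \<le> \<alpha>" "\<beta> \<le> 2 * pi" for \<alpha> \<beta>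
    proof -
      have "sin \<phi> \<le> 0" if "pi \<le> \<phi>" "\<phi> \<le> 2 * pi" for \<phi>
        using sin_ge_zero[of "\<phi> - pi"] that by (simp add: sin_diff)
      then show ?thesis unfolding sector_def using that by (auto intro!: mult_nonneg_nonpos)
    qed
    have "sum ?c {..<p} = sum ?c {..<h} + ?c h + sum ?c {Suc h..<p}"
    proof -
      have U: "{..<p} = ({..<h} \<union> {h}) \<union> {Suc h..<p}" using h by auto
      have "sum ?c {..<p} = sum ?c ({..<h} \<union> {h}) + sum ?c {Suc h..<p}"
        unfolding U by (rule sum.union_disjoint) auto
      also have "sum ?c ({..<h} \<union> {h}) = sum ?c {..<h} + ?c h"
        by (subst sum.union_disjoint) auto
      finally show ?thesis .
    qed
    then have eq: "(\<Sum>i<p. ?c i) - (cu - cl) = chain_boundary (Suc ?q2) x"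
      unfolding cu_def cl_def x(2) by (simp add: algebra_simps)
    have xS: "singular_chain (Suc ?q2) S x" using x by (meson singular_chain_subtopology)
    have "homologous_rel ?q2 S {} (\<Sum>i<p. ?c i) (cu - cl)"
      unfolding homologous_rel_def singular_boundary eq using xS by blast
    then have div2: "divisible_cycle m ?q2 S (cu - cl)"
      using div divisible_cycle_homologous homologous_rel_sym by blast
    have tel: "(\<Sum>i<h. ?a (Suc i) - ?a i) = ?a h - a"
      using sum_lessThan_telescope[of ?a h] a0 by simp
    have tel2: "(\<Sum>i\<in>{Suc h..<p}. ?a (Suc i) - ?a i) = a - ?a (Suc h)"
      using sum_Suc_diff'[of "Suc h" p ?a] h ap by simp
    have bu: "chain_boundary ?q2 cu = b - a"
      unfolding cu_def by (simp add: chain_boundary_add chain_boundary_sum Rc c1 tel o_def)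
    have bl: "chain_boundary ?q2 cl = b - a"
      unfolding cl_def chain_boundary_minus chain_boundary_add by (simp add: chain_boundary_sum Rc c2 tel2 o_def)
    have "singular_chain ?q2 ?up cu"
      unfolding cu_def
    proof (intro singular_chain_add singular_chain_sum)
      show "singular_chain ?q2 ?up (?c i)" if "i \<in> {..<h}" for i
        by (rule singular_chain_subtopology_mono[OF Rc(1) up])
           (use that \<theta>mono[of 0 i] \<theta>mono[of "Suc i" h] h \<theta>0 in auto)
      show "singular_chain ?q2 ?up c1"
        by (rule singular_chain_subtopology_mono[OF c1(1) up]) (use \<theta>mono[of 0 h] \<theta>0 in auto)
    qed
    moreover have "singular_chain ?q2 ?lo cl"
      unfolding cl_def
    proof (intro singular_chain_minus[THEN iffD2] singular_chain_add singular_chain_sum)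
      show "singular_chain ?q2 ?lo (?c i)" if "i \<in> {Suc h..<p}" for i
        by (rule singular_chain_subtopology_mono[OF Rc(1) lo])
           (use that \<theta>mono[of "Suc h" i] \<theta>mono[of "Suc i" p] h \<theta>p in auto)
      show "singular_chain ?q2 ?lo c2"
        by (rule singular_chain_subtopology_mono[OF c2(1) lo]) (use \<theta>mono[of "Suc h" p] h \<theta>p in auto)
    qed
    moreover have sec0: "sector q 0 0 \<subseteq> {x. x (Suc (Suc q)) = 0} \<inter> {x. x (Suc q) \<ge> 0}"
      and secpi: "sector q pi pi \<subseteq> {x. x (Suc (Suc q)) = 0} \<inter> {x. x (Suc q) \<le> 0}"
      unfolding sector_def by auto
    have eq1: "subtopology S ({x. x (Suc (Suc q)) = 0} \<inter> T) = subtopology (nsphere (Suc q)) T" for T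
      unfolding S_def subtopology_subtopology[symmetric] subtopology_nsphere_equator ..
    have a1: "singular_chain ?q1 (subtopology (nsphere ?q1) {x. x (Suc q) \<ge> 0}) a"
      using singular_chain_subtopology_mono[OF a(1) sec0] eq1 by simp
    have b1: "singular_chain ?q1 (subtopology (nsphere ?q1) {x. x (Suc q) \<le> 0}) b"
      using singular_chain_subtopology_mono[OF b(1) secpi] eq1 by simp
    have "singular_chain ?q1 (nsphere ?q1) (b - a)"
      using a1 b1 by (intro singular_chain_diff) (meson singular_chain_subtopology)+
    \<comment> \<open>Desuspension is applied twice: first to the equator, where
      \<open>b - a\<close> is up to sign the difference of two fillings of \<open>F\<close>, and
      then to the subsphere.\<close>
    ultimately have "divisible_cycle m ?q1 (nsphere ?q1) (b - a)"
      using divisible_cycle_equator[of ?q1 cu cl "b - a" m] bu bl div2 unfolding S_def by blast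
    then have "divisible_cycle m ?q1 (nsphere ?q1) (a - b)"
      using divisible_cycle_minus by fastforce
    then show ?thesis
      using divisible_cycle_equator[OF a1 b1 Fch a(2) b(2)] by blast
  qed
  then show ?thesis
    using aS a(2) cS c(2) by blast
qed

section \<open>Nested spheres, generators and the cyclic group\<close>

lemma nsphere_eq_subtopology:
  assumes "a \<le> b"
  shows "nsphere a = subtopology (nsphere b) {x. \<forall>i>a. x i = 0}"
proof -
  have "(\<Sum>i\<le>b. (x i)\<^sup>2) = (\<Sum>i\<le>a. (x i)\<^sup>2)" if "\<forall>i>a. x i = 0" for x :: "nat \<Rightarrow> real"
    by (rule sum.mono_neutral_right) (use that assms in auto)
  then have "{x. (\<Sum>i\<le>a. (x i)\<^sup>2) = 1 \<and> (\<forall>i>a. x i = 0)} =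
     {x. (\<Sum>i\<le>b. (x i)\<^sup>2) = 1 \<and> (\<forall>i>b. x i = 0)} \<inter> {x. \<forall>i>a. x i = (0::real)}"
    using assms by auto
  then show ?thesis by (simp add: nsphere subtopology_subtopology)
qed

lemma singular_chain_nsphere_mono:
  assumes "singular_chain q (nsphere a) c" "a \<le> b"
  shows "singular_chain q (nsphere b) c"
  using assms nsphere_eq_subtopology[OF assms(2)] by (metis singular_chain_subtopology)

text \<open>Elements of the homology group are sets of chains, and the set of sums on the right is
  the group operation.\<close>

lemma homologous_rel_set_add:
  "homologous_rel_set q X {} (c + c') =
     (\<Union>r\<in>homologous_rel_set q X {} c. \<Union>s\<in>homologous_rel_set q X {} c'. {r + s})"
proof -
  have "homologous_rel q X {} c (x - c')" if "homologous_rel q X {} (c + c') x" for x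
    using homologous_rel_diff[OF that homologous_rel_refl[of q X "{}" c']] by simp
  then show ?thesis
    by (auto intro: homologous_rel_add) (metis diff_add_cancel homologous_rel_refl)
qed

text \<open>Top homology is infinite cyclic; a class sent to 1 cannot also be sent to a multiple of
  m.\<close>

lemma ex_nondivisible_cycle:
  assumes "0 < n" "1 < m"
  obtains F where "singular_relcycle n (nsphere n) {} F" "\<not> divisible_cycle (int m) n (nsphere n) F"
proof -
  let ?G = "homology_group (int n) (nsphere n)"
  have "?G \<cong> integer_group"
    using reduced_homology_group_nsphere(1)[of n] assms by (simp add: un_reduced_homology_group)
  then obtain \<phi> where \<phi>: "\<phi> \<in> iso ?G integer_group" unfolding is_iso_def by blast
  define \<psi> where "\<psi> c = \<phi> (homologous_rel_set n (nsphere n) {} c)" for c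
  have car: "homologous_rel_set n (nsphere n) {} c \<in> carrier ?G" if "singular_relcycle n (nsphere n) {} c" for c
    using that by (auto simp: carrier_relative_homology_group)
  have add: "\<psi> (c + c') = \<psi> c + \<psi> c'"
    if "singular_relcycle n (nsphere n) {} c" "singular_relcycle n (nsphere n) {} c'" for c c'
  proof -
    have "homologous_rel_set n (nsphere n) {} (c + c') =
       homologous_rel_set n (nsphere n) {} c \<otimes>\<^bsub>?G\<^esub> homologous_rel_set n (nsphere n) {} c'"
      unfolding mult_relative_homology_group homologous_rel_set_add ..
    then show ?thesis
      using \<phi> car[OF that(1)] car[OF that(2)] unfolding \<psi>_def iso_def hom_def by (auto simp: integer_group_def)
  qed
  have mul: "\<psi> (frag_cmul (int j) y) = int j * \<psi> y" if y: "singular_relcycle n (nsphere n) {} y" for y j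
  proof (induction j)
    case 0
    have "\<psi> (0 + 0) = \<psi> 0 + \<psi> 0" by (rule add) auto
    then show ?case by simp
  next
    case (Suc j)
    have "frag_cmul (int (Suc j)) y = frag_cmul (int j) y + y"
      using frag_cmul_distrib[of "int j" 1 y] by (simp add: add.commute)
    then show ?case using Suc add[OF singular_relcycle_cmul[OF y] y, of "int j"] by (simp add: algebra_simps)
  qed
  have "1 \<in> carrier integer_group" by (simp add: integer_group_def)
  moreover have "\<phi> ` carrier ?G = carrier integer_group"
    using \<phi> unfolding iso_def bij_betw_def by blast
  ultimately have "\<exists>r\<in>carrier ?G. 1 = \<phi> r"
    unfolding image_iff[symmetric] by (simp only:)
  then obtain r where r: "r \<in> carrier ?G" "\<phi> r = 1" by (elim bexE) (rule that, assumption, rule sym)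
  then obtain F where F: "singular_relcycle n (nsphere n) {} F" "r = homologous_rel_set n (nsphere n) {} F"
    by (auto simp: carrier_relative_homology_group)
  have "\<not> divisible_cycle (int m) n (nsphere n) F"
  proof
    assume "divisible_cycle (int m) n (nsphere n) F"
    then obtain y where y: "singular_relcycle n (nsphere n) {} y" "homologous_rel n (nsphere n) {} F (frag_cmul (int m) y)"
      unfolding divisible_cycle_def by blast
    have "homologous_rel_set n (nsphere n) {} F = homologous_rel_set n (nsphere n) {} (frag_cmul (int m) y)"
      using y(2) by (simp only: homologous_rel_set_eq)
    then have "1 = int m * \<psi> y" using r F mul[OF y(1)] unfolding \<psi>_def by metis
    then show False using assms(2) zmult_eq_1_iff[of "int m" "\<psi> y"] by auto
  qed
  then show thesis using that F(1) by blast
qed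

lemma sum_periodic_shift:
  fixes g :: "nat \<Rightarrow> 'a::comm_monoid_add"
  assumes "\<And>i. g (i mod p) = g i" "0 < p"
  shows "(\<Sum>i<p. g (m + i)) = (\<Sum>i<p. g i)"
proof -
  have inj: "inj_on (\<lambda>i. (m + i) mod p) {..<p}"
  proof (rule inj_onI)
    fix x y assume xy: "x \<in> {..<p}" "y \<in> {..<p}" "(m + x) mod p = (m + y) mod p"
    then have "[x = y] (mod p)" using cong_add_lcancel_nat[of m x y p] by (simp add: cong_def)
    then show "x = y" using xy by (simp add: cong_def)
  qed
  then have "bij_betw (\<lambda>i. (m + i) mod p) {..<p} {..<p}"
    using assms(2) by (intro bij_betw_imageI endo_inj_surj) auto
  then have "(\<Sum>i<p. g ((m + i) mod p)) = (\<Sum>i<p. g i)" by (rule sum.reindex_bij_betw)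
  then show ?thesis by (simp add: assms(1))
qed

text \<open>Multiplication by a unit permutes the residues. This lets the norm be formed with the
  power of the generator that suits one coordinate pair.\<close>

lemma sum_periodic_mult:
  fixes g :: "nat \<Rightarrow> 'a::comm_monoid_add"
  assumes "\<And>i. g (i mod p) = g i" "0 < p" "coprime l p"
  shows "(\<Sum>i<p. g (l * i)) = (\<Sum>i<p. g i)"
proof -
  have inj: "inj_on (\<lambda>i. (l * i) mod p) {..<p}"
  proof (rule inj_onI)
    fix x y assume xy: "x \<in> {..<p}" "y \<in> {..<p}" "(l * x) mod p = (l * y) mod p"
    then have "[x = y] (mod p)" using cong_mult_lcancel_nat[OF assms(3)] by (simp add: cong_def)
    then show "x = y" using xy by (simp add: cong_def)
  qed
  then have "bij_betw (\<lambda>i. (l * i) mod p) {..<p} {..<p}"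
    using assms(2) by (intro bij_betw_imageI endo_inj_surj) auto
  then have "(\<Sum>i<p. g ((l * i) mod p)) = (\<Sum>i<p. g i)" by (rule sum.reindex_bij_betw)
  then show ?thesis by (simp add: assms(1))
qed

text \<open>The m-th power of a generator of the cyclic group of order p, acting with weight
  \<open>k j\<close> on the j-th pair.\<close>

definition cyc_rot :: "nat \<Rightarrow> nat \<Rightarrow> (nat \<Rightarrow> int) \<Rightarrow> nat \<Rightarrow> (nat \<Rightarrow> real) \<Rightarrow> nat \<Rightarrow> real" where
  "cyc_rot p n k m = pair_rot n (\<lambda>j. 2 * pi * (real m * of_int (k j)) / real p)"

lemma cyc_rot_add: "cyc_rot p n k i (cyc_rot p n k j x) = cyc_rot p n k (i + j) x"
  unfolding cyc_rot_def pair_rot_add by (simp add: algebra_simps add_divide_distrib)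

lemma cyc_rot_0: "cyc_rot p n k 0 x = x"
  unfolding cyc_rot_def by (simp add: pair_rot_zero)

lemma cyc_rot_p: "0 < p \<Longrightarrow> cyc_rot p n k p x = x"
proof -
  assume "0 < p"
  then have e: "2 * pi * (real p * of_int (k j)) / real p = 2 * pi * of_int (k j)" for j by simp
  have "pair_rot n (\<lambda>j. 2 * pi * (real p * of_int (k j)) / real p) = pair_rot n (\<lambda>j. 0)"
    by (rule pair_rot_cong) (simp_all only: e sin_int_2pin cos_int_2pin sin_zero cos_zero)
  then show ?thesis unfolding cyc_rot_def using pair_rot_zero by metis
qed

lemma cyc_rot_mod: "0 < p \<Longrightarrow> cyc_rot p n k (m mod p) x = cyc_rot p n k m x"
proof -
  assume p: "0 < p"
  have m: "cyc_rot p n k (p * t) y = y" for t y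
  proof (induction t)
    case (Suc t)
    then show ?case using cyc_rot_add[of p n k p "p * t" y] cyc_rot_p[OF p] by simp
  qed (simp add: cyc_rot_0)
  have "cyc_rot p n k m x = cyc_rot p n k (m mod p) (cyc_rot p n k (p * (m div p)) x)"
    unfolding cyc_rot_add by simp
  then show ?thesis using m by simp
qed

lemma continuous_map_cyc_rot:
  "continuous_map (nsphere (n + 2 * d)) (nsphere (n + 2 * d)) (cyc_rot p n k m)"
  unfolding cyc_rot_def by (rule continuous_map_pair_rot)

lemma cyc_rot_fixes: 
  assumes "x \<in> topspace (nsphere n)" shows "cyc_rot p n k m x = x"
proof
  fix i
  have "\<forall>i>n. x i = 0" using assms by (auto simp: nsphere)
  then show "cyc_rot p n k m x i = x i"
    unfolding cyc_rot_def by (rule_tac pair_index_cases[of i n]) (auto simp: pair_rot_even pair_rot_odd)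
qed

text \<open>As l inverts the weight of the d-th pair modulo p, the l-th power of the generator turns
  this pair by 2 pi / p up to full turns, and so moves a sector of that width to the adjacent
  one.\<close>

lemma cyc_rot_sector:
  assumes p: "0 < p" and lk: "[int l * k d = 1] (mod int p)" and x: "x \<in> sector (n + 2 * d) \<alpha> \<beta>"
  shows "cyc_rot p n k (l * i) x \<in> sector (n + 2 * d) (\<alpha> + 2 * pi * i / p) (\<beta> + 2 * pi * i / p)"
proof -
  obtain s \<phi> where s: "s \<ge> 0" "\<alpha> \<le> \<phi>" "\<phi> \<le> \<beta>" "x (Suc (n + 2 * d)) = s * cos \<phi>" "x (Suc (Suc (n + 2 * d))) = s * sin \<phi>"
    using x unfolding sector_def by auto
  obtain t where t: "int l * k d = 1 + int p * t"
    using lk by (metis cong_iff_lin cong_sym)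
  define \<omega> where "\<omega> = 2 * pi * (real (l * i) * of_int (k d)) / real p"
  have "real_of_int (int l * k d) = 1 + real p * of_int t" unfolding t by simp
  then have "\<omega> = 2 * pi * (real i * (1 + real p * of_int t)) / real p"
    unfolding \<omega>_def by (simp add: algebra_simps)
  also have "\<dots> = 2 * pi * i / p + 2 * pi * of_int (int i * t)"
    using p by (simp add: field_simps)
  finally have \<omega>: "\<omega> = 2 * pi * i / p + 2 * pi * of_int (int i * t)" .
  have per: "cos (\<psi> + 2 * pi * of_int j) = cos \<psi>" "sin (\<psi> + 2 * pi * of_int j) = sin \<psi>" for \<psi> and j :: int
    using sin_cos_eq_iff[of "\<psi> + 2 * pi * of_int j" \<psi>] by auto
  have cs: "cos (\<phi> + \<omega>) = cos (\<phi> + 2 * pi * i / p)" "sin (\<phi> + \<omega>) = sin (\<phi> + 2 * pi * i / p)"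
    unfolding \<omega> using per[of "\<phi> + 2 * pi * i / p" "int i * t"] by (simp_all only: add.assoc)
  have "cyc_rot p n k (l * i) x (Suc (n + 2 * d)) = s * cos (\<phi> + \<omega>)"
       "cyc_rot p n k (l * i) x (Suc (Suc (n + 2 * d))) = s * sin (\<phi> + \<omega>)"
    unfolding cyc_rot_def pair_rot_even pair_rot_odd s(4,5) \<omega>_def[symmetric] cos_add sin_add
    by (simp_all only: ring_distribs mult_ac)
  then have "cyc_rot p n k (l * i) x (Suc (n + 2 * d)) = s * cos (\<phi> + 2 * pi * i / p) \<and>
       cyc_rot p n k (l * i) x (Suc (Suc (n + 2 * d))) = s * sin (\<phi> + 2 * pi * i / p)"
    unfolding cs by blast
  moreover have "\<phi> + 2 * pi * i / p \<in> {\<alpha> + 2 * pi * i / p..\<beta> + 2 * pi * i / p}"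
    using s(2,3) by simp
  ultimately show ?thesis unfolding sector_def using s(1) by blast
qed

text \<open>From a generator of the fixed sphere, invariant cycles \<open>Fs d\<close> of growing
  spheres are built as norms of sector chains, none of them divisible by p. Comparing f with the
  identity on these cycles, degree by degree, leaves in the top degree of the target only a norm,
  that is, p times a class. But \<open>Fs D\<close> bounds in the source of f, so its image is
  null-homologous and \<open>Fs D\<close> itself would be divisible by p.\<close>

theorem cyclic_borsuk_ulam:
  assumes p: "prime p" and n: "0 < n" and k: "\<And>j. \<not> int p dvd k j"
    and f: "continuous_map (nsphere (n + 2 * Suc D)) (nsphere (n + 2 * D)) f"
    and eqv: "\<And>x. x \<in> topspace (nsphere (n + 2 * Suc D)) \<Longrightarrow> f (cyc_rot p n k 1 x) = cyc_rot p n k 1 (f x)"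
    and hom: "homotopic_with (\<lambda>_. True) (nsphere n) (nsphere n) f id"
  shows False
proof -
  let ?T = "cyc_rot p n k"
  let ?S = "\<lambda>d. nsphere (n + 2 * d)"
  have p0: "0 < p" and p2: "2 \<le> p" using p by (auto simp: prime_gt_0_nat prime_ge_2_nat)
  have Tcont: "continuous_map (?S d) (?S d) (?T m)" for d m by (rule continuous_map_cyc_rot)
  have comp: "chain_map q (?T i) (chain_map q (?T j) c) = chain_map q (?T (i + j)) c" for q i j c
  proof -
    have "?T i \<circ> ?T j = ?T (i + j)" by (auto simp: fun_eq_iff cyc_rot_add)
    then show ?thesis using chain_map_compose[of q "?T i" "?T j"] by (metis comp_apply)
  qed
  have per: "chain_map q (?T (i mod p)) c = chain_map q (?T i) c" for q i c
  proof -
    have "?T (i mod p) = ?T i" using cyc_rot_mod[OF p0] by (intro ext) metis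
    then show ?thesis by simp
  qed
  \<comment> \<open>The norm of a chain: it is invariant and annihilates every difference between a
    translate and the chain itself.\<close>
  define Nm where "Nm q c = (\<Sum>i<p. chain_map q (?T i) c)" for q c
  have Nm_inv: "chain_map q (?T m) (Nm q c) = Nm q c" for q m c
    unfolding Nm_def using sum_periodic_shift[of "\<lambda>i. chain_map q (?T i) c" p m] per p0
    by (simp add: chain_map_sum o_def comp)
  have Nm_T: "Nm q (chain_map q (?T l) c) = Nm q c" for q l c
    unfolding Nm_def using sum_periodic_shift[of "\<lambda>i. chain_map q (?T i) c" p l] per p0
    by (simp add: comp add.commute)
  have Nm_diff: "Nm q (a - b) = Nm q a - Nm q b" for q a b
    unfolding Nm_def by (simp add: chain_map_diff sum_subtractf)
  have Nm_bd: "chain_boundary (Suc q) (Nm (Suc q) c) = Nm q (chain_boundary (Suc q) c)"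
    if "singular_chain (Suc q) X c" for q X c
    unfolding Nm_def by (simp add: chain_boundary_sum o_def chain_boundary_chain_map[OF that])
  have Nm_chain: "singular_chain q (?S d) (Nm q c)" if "singular_chain q (?S d) c" for q d c
    unfolding Nm_def by (intro singular_chain_sum singular_chain_chain_map[OF that] Tcont)
  have Nm_cycle: "chain_boundary (Suc q) (Nm (Suc q) c) = 0"
    if "singular_chain (Suc q) X c" "chain_boundary (Suc q) c = chain_map q (?T l) a - a" for q X c l a
    using Nm_bd[OF that(1)] that(2) by (simp add: Nm_diff Nm_T)
  have S2: "n + 2 * Suc d = Suc (Suc (n + 2 * d))" for d by simp
  \<comment> \<open>\<open>P\<close> collects what is carried along: an invariant cycle whose class
    is not divisible by p. \<open>Q\<close> links consecutive cycles: the next one is the norm of a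
    chain spanned between a filling \<open>a\<close> and its rotated copy.\<close>
  define P where "P d F \<longleftrightarrow> singular_relcycle (n + 2 * d) (?S d) {} F \<and>
      (\<forall>m. chain_map (n + 2 * d) (?T m) F = F) \<and> \<not> divisible_cycle (int p) (n + 2 * d) (?S d) F" for d F
  define Q where "Q d F F' \<longleftrightarrow> (\<exists>a c l. singular_chain (Suc (n + 2 * d)) (?S (Suc d)) a \<and>
      chain_boundary (Suc (n + 2 * d)) a = F \<and> singular_chain (Suc (Suc (n + 2 * d))) (?S (Suc d)) c \<and>
      chain_boundary (Suc (Suc (n + 2 * d))) c = chain_map (Suc (n + 2 * d)) (?T l) a - a \<and>
      F' = Nm (Suc (Suc (n + 2 * d))) c)" for d F F'
  have P0: "\<exists>F. P 0 F"
  proof -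
    obtain F where F: "singular_relcycle n (nsphere n) {} F" "\<not> divisible_cycle (int p) n (nsphere n) F"
      using ex_nondivisible_cycle[OF n, of p] p2 by (metis Suc_1 Suc_le_lessD One_nat_def)
    have "chain_map n (?T m) F = F" for m
      by (rule chain_map_id_gen[of n "nsphere n"]) (use F cyc_rot_fixes in \<open>auto simp: singular_cycle_iff\<close>)
    then show ?thesis unfolding P_def using F by auto
  qed
  have PS: "\<exists>F'. P (Suc d) F' \<and> Q d F F'" if PF: "P d F" for d F
  proof -
    \<comment> \<open>The inverse of the weight of the new pair selects the power of the generator
      that turns this pair by 2 pi / p.\<close>
    have "coprime (k d) (int p)"
      using k[of d] p by (metis coprime_commute prime_imp_coprime prime_nat_int_transfer)
    then obtain x where x: "[k d * x = 1] (mod int p)" using cong_solve_coprime_int by blast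
    define l where "l = nat (x mod int p)"
    have lx: "int l = x mod int p" unfolding l_def using p0 by simp
    have lk: "[int l * k d = 1] (mod int p)"
      using x unfolding lx cong_def by (metis mod_mult_right_eq mult.commute)
    have "coprime (int l) (int p)"
      using lk by (metis coprime_iff_invertible_int mult.commute)
    then have cop: "coprime l p" by simp
    have F: "singular_relcycle (n + 2 * d) (?S d) {} F" "\<And>m. chain_map (n + 2 * d) (?T m) F = F"
      "\<not> divisible_cycle (int p) (n + 2 * d) (?S d) F" using PF unfolding P_def by auto
    have "\<exists>a c. singular_chain (Suc (n + 2 * d)) (?S (Suc d)) a \<and> chain_boundary (Suc (n + 2 * d)) a = F \<and>
      singular_chain (Suc (Suc (n + 2 * d))) (?S (Suc d)) c \<and>
      chain_boundary (Suc (Suc (n + 2 * d))) c = chain_map (Suc (n + 2 * d)) (?T (l * 1)) a - a \<and>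
      (\<forall>m. divisible_cycle m (Suc (Suc (n + 2 * d))) (?S (Suc d)) (\<Sum>i<p. chain_map (Suc (Suc (n + 2 * d))) (?T (l * i)) c) \<longrightarrow>
       divisible_cycle m (n + 2 * d) (?S d) F)"
    proof (rule sector_chains)
      show "?T (l * i) x \<in> sector (n + 2 * d) (\<alpha> + 2 * pi * i / p) (\<beta> + 2 * pi * i / p)"
        if "x \<in> sector (n + 2 * d) \<alpha> \<beta>" for i \<alpha> \<beta> x
        using cyc_rot_sector[of p l k d x n \<alpha> \<beta> i] p0 lk that by blast
      show "?T (l * p) x = x" for x
        using cyc_rot_mod[OF p0, of n k "l * p" x] by (simp add: cyc_rot_0)
      show "?T (l * i) (?T (l * j) x) = ?T (l * (i + j)) x" for i j x
        by (simp only: cyc_rot_add distrib_left)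
      show "?T (l * 0) x = x" for x by (simp add: cyc_rot_0)
      show "nsphere (n + 2 * Suc d) = nsphere (Suc (Suc (n + 2 * d)))" by simp
      show "0 < n + 2 * d" using n by simp
      show "continuous_map (?S (Suc d)) (?S (Suc d)) (?T (l * i))" for i by (rule Tcont)
      show "chain_map (n + 2 * d) (?T (l * i)) F = F" for i by (rule F(2))
    qed (rule p2 F(1))+
    then obtain a c where ac: "singular_chain (Suc (n + 2 * d)) (?S (Suc d)) a" "chain_boundary (Suc (n + 2 * d)) a = F"
      "singular_chain (Suc (Suc (n + 2 * d))) (?S (Suc d)) c"
      "chain_boundary (Suc (Suc (n + 2 * d))) c = chain_map (Suc (n + 2 * d)) (?T (l * 1)) a - a"
      "\<And>m. divisible_cycle m (Suc (Suc (n + 2 * d))) (?S (Suc d)) (\<Sum>i<p. chain_map (Suc (Suc (n + 2 * d))) (?T (l * i)) c) \<Longrightarrow>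
       divisible_cycle m (n + 2 * d) (?S d) F"
      by blast
    have "(\<Sum>i<p. chain_map q (?T (l * i)) c) = Nm q c" for q
      unfolding Nm_def by (rule sum_periodic_mult[OF _ p0 cop, of "\<lambda>i. chain_map q (?T i) c"]) (rule per)
    then have nd: "\<not> divisible_cycle (int p) (Suc (Suc (n + 2 * d))) (?S (Suc d)) (Nm (Suc (Suc (n + 2 * d))) c)"
      using ac(5) F(3) by metis
    have "P (Suc d) (Nm (Suc (Suc (n + 2 * d))) c)"
      unfolding P_def singular_cycle_iff S2 using nd Nm_inv Nm_chain[OF ac(3)] Nm_cycle[OF ac(3,4)] by simp
    moreover have "Q d F (Nm (Suc (Suc (n + 2 * d))) c)" unfolding Q_def using ac by blast
    ultimately show ?thesis by blast
  qed
  obtain Fs where Fs: "\<And>d. P d (Fs d)" "\<And>d. Q d (Fs d) (Fs (Suc d))"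
    using dependent_nat_choice[of P Q] P0 PS by metis
  have feq0: "f (?T m x) = ?T m (f x)" if "x \<in> topspace (?S (Suc D))" for m x
  proof (induction m)
    case (Suc m)
    have "?T m x \<in> topspace (?S (Suc D))" using Tcont[of "Suc D" m] that unfolding continuous_map_def by blast
    then have "f (?T 1 (?T m x)) = ?T 1 (f (?T m x))" by (rule eqv)
    then show ?case using Suc by (simp add: cyc_rot_add)
  qed (simp add: cyc_rot_0)
  have feq: "chain_map q f (chain_map q (?T m) c) = chain_map q (?T m) (chain_map q f c)"
    if "singular_chain q (?S (Suc D)) c" for q m c
  proof -
    have "chain_map q (f \<circ> ?T m) c = chain_map q (?T m \<circ> f) c"
      by (rule chain_map_eq[OF that]) (simp add: feq0)
    then show ?thesis by (simp add: chain_map_compose)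
  qed
  let ?Y = "?S D"
  \<comment> \<open>All comparison chains live in the target sphere. An obstruction \<open>y\<close>
    can appear only for d = D, since the homology of the target vanishes in lower positive
    degrees.\<close>
  have main: "\<exists>X y. singular_chain (Suc (n + 2 * d)) ?Y X \<and> (\<forall>m. chain_map (Suc (n + 2 * d)) (?T m) X = X) \<and>
      singular_relcycle (n + 2 * d) ?Y {} y \<and>
      chain_map (n + 2 * d) f (Fs d) - Fs d = chain_boundary (Suc (n + 2 * d)) X + Nm (n + 2 * d) y \<and>
      (d < D \<longrightarrow> y = 0)" if "d \<le> D" for d
    using that
  proof (induction d)
    case 0
    have F: "singular_relcycle n (nsphere n) {} (Fs 0)" using Fs(1)[of 0] unfolding P_def by simp
    have "homotopic_with (\<lambda>h. h \<in> {} \<rightarrow> {}) (nsphere n) (nsphere n) f id" using hom by simp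
    from homotopic_imp_homologous_rel_chain_maps[OF this F]
    have "homologous_rel n (nsphere n) {} (chain_map n f (Fs 0)) (Fs 0)"
      using F chain_map_ident unfolding singular_cycle_iff by metis
    then obtain X where X: "singular_chain (Suc n) (nsphere n) X" "chain_boundary (Suc n) X = chain_map n f (Fs 0) - Fs 0"
      unfolding homologous_rel_def singular_boundary by blast
    have "chain_map (Suc n) (?T m) X = X" for m
      by (rule chain_map_id_gen[OF X(1)]) (use cyc_rot_fixes in auto)
    moreover have "Nm n 0 = 0" unfolding Nm_def by simp
    ultimately show ?case
      using X singular_chain_nsphere_mono[OF X(1), of "n + 2 * D"] by (intro exI[of _ X] exI[of _ 0]) auto
  next
    case (Suc d)
    then obtain X where X: "singular_chain (Suc (n + 2 * d)) ?Y X" "\<And>m. chain_map (Suc (n + 2 * d)) (?T m) X = X"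
      "chain_map (n + 2 * d) f (Fs d) - Fs d = chain_boundary (Suc (n + 2 * d)) X"
      by (auto simp: Nm_def)
    obtain a c l where ac: "singular_chain (Suc (n + 2 * d)) (?S (Suc d)) a" "chain_boundary (Suc (n + 2 * d)) a = Fs d"
      "singular_chain (Suc (Suc (n + 2 * d))) (?S (Suc d)) c"
      "chain_boundary (Suc (Suc (n + 2 * d))) c = chain_map (Suc (n + 2 * d)) (?T l) a - a"
      "Fs (Suc d) = Nm (Suc (Suc (n + 2 * d))) c"
      using Fs(2)[of d] unfolding Q_def by blast
    let ?q = "n + 2 * d"
    have le: "n + 2 * Suc d \<le> n + 2 * D" "n + 2 * Suc d \<le> n + 2 * Suc D" using Suc.prems by auto
    have aY: "singular_chain (Suc ?q) ?Y a" and cY: "singular_chain (Suc (Suc ?q)) ?Y c"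
      and aX: "singular_chain (Suc ?q) (?S (Suc D)) a" and cX: "singular_chain (Suc (Suc ?q)) (?S (Suc D)) c"
      using singular_chain_nsphere_mono[OF ac(1)] singular_chain_nsphere_mono[OF ac(3)] le by blast+
    \<comment> \<open>\<open>X\<close> corrects the difference of the two fillings to a cycle; its
      degree has the wrong parity to be the top degree of the target, so it bounds.\<close>
    let ?u = "chain_map (Suc ?q) f a - a - X"
    have fa: "singular_chain (Suc ?q) ?Y (chain_map (Suc ?q) f a)" and fc: "singular_chain (Suc (Suc ?q)) ?Y (chain_map (Suc (Suc ?q)) f c)"
      using singular_chain_chain_map[OF _ f] aX cX by blast+
    have "chain_boundary (Suc ?q) (chain_map (Suc ?q) f a) = chain_map ?q f (Fs d)"
      using chain_boundary_chain_map[OF aX, of f] ac(2) by simp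
    then have "singular_relcycle (Suc ?q) ?Y {} ?u"
      unfolding singular_cycle_iff using fa aY X(1,3) ac(2)
      by (auto simp: singular_chain_diff chain_boundary_diff)
    then obtain x where x: "singular_chain (Suc (Suc ?q)) ?Y x" "chain_boundary (Suc (Suc ?q)) x = ?u"
      by (rule nsphere_cycle_bounds) presburger+
    \<comment> \<open>The same correction one degree higher. Invariance of \<open>X\<close> makes
      this a cycle, and the term with \<open>x\<close> is invisible to the norm.\<close>
    let ?v = "chain_map (Suc (Suc ?q)) f c - c - (chain_map (Suc (Suc ?q)) (?T l) x - x)"
    have bTx: "chain_boundary (Suc (Suc ?q)) (chain_map (Suc (Suc ?q)) (?T l) x) = chain_map (Suc ?q) (?T l) ?u"
      using chain_boundary_chain_map[OF x(1), of "?T l"] x(2) by simp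
    have bfc: "chain_boundary (Suc (Suc ?q)) (chain_map (Suc (Suc ?q)) f c)
        = chain_map (Suc ?q) (?T l) (chain_map (Suc ?q) f a) - chain_map (Suc ?q) f a"
      using chain_boundary_chain_map[OF cX, of f] ac(4) feq[OF aX] by (simp add: chain_map_diff)
    have Tx: "singular_chain (Suc (Suc ?q)) ?Y (chain_map (Suc (Suc ?q)) (?T l) x)"
      by (rule singular_chain_chain_map[OF x(1) Tcont])
    have vcyc: "singular_relcycle (Suc (Suc ?q)) ?Y {} ?v"
      unfolding singular_cycle_iff
      using fc cY Tx x(1)
      by (auto simp: singular_chain_diff chain_boundary_diff bTx bfc x(2) ac(4) chain_map_diff X(2))
    have NmT0: "Nm (Suc (Suc ?q)) (chain_map (Suc (Suc ?q)) (?T l) x - x) = 0"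
      by (simp add: Nm_diff Nm_T)
    have "chain_map (Suc (Suc ?q)) f (Nm (Suc (Suc ?q)) c) = Nm (Suc (Suc ?q)) (chain_map (Suc (Suc ?q)) f c)"
      unfolding Nm_def using feq[OF cX] by (simp add: chain_map_sum o_def)
    then have dF: "chain_map (Suc (Suc ?q)) f (Fs (Suc d)) - Fs (Suc d) = Nm (Suc (Suc ?q)) ?v"
      unfolding ac(5) using NmT0 by (simp add: Nm_diff)
    show ?case
    proof (cases "Suc d < D")
      case True
      then have "Suc (Suc ?q) \<noteq> n + 2 * D" by auto
      then obtain x' where x': "singular_chain (Suc (Suc (Suc ?q))) ?Y x'" "chain_boundary (Suc (Suc (Suc ?q))) x' = ?v"
        using nsphere_cycle_bounds[OF vcyc] by blast
      have "Nm (n + 2 * Suc d) 0 = 0" unfolding Nm_def by simp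
      then show ?thesis
        using Nm_bd[OF x'(1)] x'(2) dF Nm_inv Nm_chain[OF x'(1)]
        by (intro exI[of _ "Nm (Suc (Suc (Suc ?q))) x'"] exI[of _ 0]) (simp add: S2)
    next
      case False
      then show ?thesis using dF vcyc
        by (intro exI[of _ 0] exI[of _ ?v]) (simp add: S2)
    qed
  qed
  obtain X y where X: "singular_chain (Suc (n + 2 * D)) ?Y X" and y: "singular_relcycle (n + 2 * D) ?Y {} y"
    and Xy: "chain_map (n + 2 * D) f (Fs D) - Fs D = chain_boundary (Suc (n + 2 * D)) X + Nm (n + 2 * D) y"
    using main[of D] by blast
  obtain a where a: "singular_chain (Suc (n + 2 * D)) (?S (Suc D)) a" "chain_boundary (Suc (n + 2 * D)) a = Fs D"
    using Fs(2)[of D] unfolding Q_def by blast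
  let ?q = "n + 2 * D"
  have fa: "singular_chain (Suc ?q) ?Y (chain_map (Suc ?q) f a)"
    by (rule singular_chain_chain_map[OF a(1) f])
  have bfa: "chain_boundary (Suc ?q) (chain_map (Suc ?q) f a) = chain_map ?q f (Fs D)"
    using chain_boundary_chain_map[OF a(1), of f] a(2) by simp
  \<comment> \<open>Rotations act trivially on homology, so the norm of \<open>y\<close> is
    homologous to p copies of \<open>y\<close>.\<close>
  have "homologous_rel ?q ?Y {} (Nm ?q y) (\<Sum>i<p. y)"
    unfolding Nm_def
    by (rule homologous_rel_sum) (auto simp: cyc_rot_def intro!: pair_rot_homologous y)
  moreover have "(\<Sum>i<j. y) = frag_cmul (int j) y" for j :: nat
    by (induction j) (auto simp: frag_cmul_distrib)
  ultimately have Ny: "homologous_rel ?q ?Y {} (Nm ?q y) (frag_cmul (int p) y)" by simp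
  have h1: "homologous_rel ?q ?Y {} (Fs D) (0 - Nm ?q y)"
  proof -
    have "Fs D - (0 - Nm ?q y) = chain_boundary (Suc ?q) (chain_map (Suc ?q) f a - X)"
      using Xy bfa by (simp add: chain_boundary_diff algebra_simps)
    then show ?thesis unfolding homologous_rel_def singular_boundary
      using singular_chain_diff[OF fa X] by metis
  qed
  have h2: "homologous_rel ?q ?Y {} (0 - Nm ?q y) (0 - frag_cmul (int p) y)"
    using Ny by (intro homologous_rel_diff) auto
  have "0 - frag_cmul (int p) y = frag_cmul (int p) (frag_cmul (-1) y)"
    unfolding frag_cmul_cmul by simp
  then have "homologous_rel ?q ?Y {} (Fs D) (frag_cmul (int p) (frag_cmul (-1) y))"
    using homologous_rel_trans[OF h2 h1] by simp
  then have "divisible_cycle (int p) ?q ?Y (Fs D)"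
    unfolding divisible_cycle_def using singular_relcycle_cmul[OF y, of "-1"] by blast
  then show False using Fs(1)[of D] unfolding P_def by blast
qed

section \<open>Deformation of sublevels\<close>

text \<open>Only the linear components are measured and scaled; the second components are lifts of
  circle variables and stay out of the normalization.\<close>

definition esq :: "nat \<Rightarrow> (nat \<Rightarrow> 'e::euclidean_space \<times> real) \<Rightarrow> real" where
  "esq L x = (\<Sum>i<L. (norm (fst (x i)))\<^sup>2)"

definition escale :: "real \<Rightarrow> (nat \<Rightarrow> 'e::euclidean_space \<times> real) \<Rightarrow> nat \<Rightarrow> 'e \<times> real" where
  "escale c x = (\<lambda>i. (c *\<^sub>R fst (x i), snd (x i)))"

lemma escale_1: "escale 1 x = x"
  by (simp add: escale_def)

lemma esq_escale: "esq L (escale c x) = c\<^sup>2 * esq L x"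
  unfolding esq_def escale_def by (simp add: power_mult_distrib sum_distrib_left)

definition enormalize :: "nat \<Rightarrow> (nat \<Rightarrow> 'e::euclidean_space \<times> real) \<Rightarrow> nat \<Rightarrow> 'e \<times> real" where
  "enormalize L x = escale (1 / sqrt (esq L x)) x"

lemma esq_enormalize: "esq L x > 0 \<Longrightarrow> esq L (enormalize L x) = 1"
  unfolding enormalize_def esq_escale by (simp add: power_divide)

lemma enormalize_id: "esq L x = 1 \<Longrightarrow> enormalize L x = x"
  unfolding enormalize_def escale_def by simp

lemma continuous_on_esq:
  assumes "\<And>i. continuous_on S (\<lambda>p. f p i)"
  shows "continuous_on S (\<lambda>p. esq L (f p))"
  unfolding esq_def by (intro continuous_intros assms)

lemma continuous_on_enormalize:
  assumes "\<And>i. continuous_on S (\<lambda>p. f p i)" "\<And>p. p \<in> S \<Longrightarrow> esq L (f p) > 0"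
  shows "continuous_on S (\<lambda>p. enormalize L (f p) i)"
  unfolding enormalize_def escale_def
  by (intro continuous_intros continuous_on_esq assms) (use assms(2) in force)

lemma compact_unit_config:
  "compact {x :: nat \<Rightarrow> 'e::euclidean_space \<times> real. esq L x = 1 \<and> (\<forall>i\<ge>L. x i = 0) \<and> (\<forall>i. \<bar>snd (x i)\<bar> \<le> D)}"
    (is "compact ?K")
proof -
  have "compactin (product_topology (\<lambda>i. euclidean) UNIV) (PiE UNIV (\<lambda>i::nat. cball (0::'e) 1 \<times> {-D..D}))"
    by (subst compactin_PiE) (auto intro: compact_Times)
  then have c: "compact (PiE UNIV (\<lambda>i::nat. cball (0::'e) 1 \<times> {-D..D}))"
    by (simp add: euclidean_product_topology)
  have co: "continuous_on UNIV (\<lambda>x::nat \<Rightarrow> 'e \<times> real. x i)" for i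
    by (rule continuous_on_product_coordinates)
  have cl: "closed ?K"
    unfolding Collect_conj_eq
  proof (intro closed_Int)
    show "closed {x :: nat \<Rightarrow> 'e \<times> real. esq L x = 1}"
      by (intro closed_Collect_eq continuous_on_esq co continuous_intros)
    show "closed {x :: nat \<Rightarrow> 'e \<times> real. \<forall>i\<ge>L. x i = 0}"
      by (intro closed_Collect_all closed_Collect_imp open_Collect_const closed_Collect_eq co continuous_intros)
    show "closed {x :: nat \<Rightarrow> 'e \<times> real. \<forall>i. \<bar>snd (x i)\<bar> \<le> D}"
      by (intro closed_Collect_all closed_Collect_le continuous_intros co)
  qed
  have "x \<in> PiE UNIV (\<lambda>i::nat. cball (0::'e) 1 \<times> {-D..D})" if "x \<in> ?K" for x
  proof -
    have "(norm (fst (x i)))\<^sup>2 \<le> 1" for i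
    proof (cases "i < L")
      case True
      have "(norm (fst (x i)))\<^sup>2 \<le> esq L x" unfolding esq_def
        using member_le_sum[of i "{..<L}" "\<lambda>i. (norm (fst (x i)))\<^sup>2"] True by simp
      then show ?thesis using that by simp
    next
      case False
      then show ?thesis using that by simp
    qed
    then have "norm (fst (x i)) \<le> 1" for i by (simp add: power_le_one_iff)
    then show ?thesis using that by (auto simp: PiE_def Pi_def mem_Times_iff abs_le_iff minus_le_iff)
  qed
  then have "?K = (PiE UNIV (\<lambda>i::nat. cball (0::'e) 1 \<times> {-D..D})) \<inter> ?K" by blast
  then show ?thesis using compact_Int_closed[OF c cl] by simp
qed

text \<open>Explicit Euler steps along the negative gradient, renormalized each time, replace a flow
  because the gradient is merely continuous. The parameter of the functional advances with the step
  number.\<close>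

primrec euler_iter :: "nat \<Rightarrow> (real \<Rightarrow> (nat \<Rightarrow> 'e::euclidean_space \<times> real) \<Rightarrow> nat \<Rightarrow> 'e \<times> real)
    \<Rightarrow> (nat \<Rightarrow> real) \<Rightarrow> real \<Rightarrow> nat \<Rightarrow> (nat \<Rightarrow> 'e \<times> real) \<Rightarrow> nat \<Rightarrow> 'e \<times> real" where
  "euler_iter L g \<kappa> h 0 x = x"
| "euler_iter L g \<kappa> h (Suc j) x =
     (let y = euler_iter L g \<kappa> h j x in enormalize L (\<lambda>i. y i - h *\<^sub>R g (\<kappa> j) y i))"

text \<open>A step of size h lowers F by at least h * delta / 2, while raising kappa by h * delta /
  8 adds at most h * delta / 2, because q \<le> esq \<le> 4 after the step; homogeneity lets the
  renormalization keep the sign. The parameter s scales the step size and thus gives a homotopy that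
  starts at the inclusion. Away from s = 1 negativity is only recorded on sets P that the steps
  preserve and on which kappa has no effect; P will be the set of fixed configurations.\<close>

theorem sublevel_deformation:
  fixes F :: "real \<Rightarrow> (nat \<Rightarrow> 'e::euclidean_space \<times> real) \<Rightarrow> real"
    and g :: "real \<Rightarrow> (nat \<Rightarrow> 'e \<times> real) \<Rightarrow> nat \<Rightarrow> 'e \<times> real"
  assumes der: "\<And>\<kappa> x v s. ((\<lambda>s. F \<kappa> (\<lambda>i. x i + s *\<^sub>R v i)) has_real_derivative
        (\<Sum>i<L. g \<kappa> (\<lambda>i. x i + s *\<^sub>R v i) i \<bullet> v i)) (at s)"
    and contg: "\<And>i. continuous_on UNIV (\<lambda>p. g (fst p) (snd p) i)"
    and g0: "\<And>\<kappa> x i. i \<ge> L \<Longrightarrow> g \<kappa> x i = 0"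
    and hom: "\<And>\<kappa> c x. 0 \<le> c \<Longrightarrow> F \<kappa> (escale c x) = c\<^sup>2 * F \<kappa> x"
    and aff: "\<And>\<kappa> \<kappa>' x. F \<kappa>' x = F \<kappa> x + (\<kappa>' - \<kappa>) * q x"
    and q: "\<And>x. q x \<le> esq L x"
    and pos: "0 < \<delta>" "0 < \<kappa>0"
    and \<delta>: "\<And>\<kappa> x. \<bar>\<kappa>\<bar> \<le> \<kappa>0 \<Longrightarrow> esq L x = 1 \<Longrightarrow> \<delta> \<le> (\<Sum>i<L. (norm (g \<kappa> x i))\<^sup>2)"
    and Cz: "\<And>\<kappa> x i. \<bar>\<kappa>\<bar> \<le> \<kappa>0 \<Longrightarrow> esq L x = 1 \<Longrightarrow> \<bar>snd (g \<kappa> x i)\<bar> \<le> C"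
    and K: "\<And>x. x \<in> K \<Longrightarrow> esq L x = 1 \<and> (\<forall>i\<ge>L. x i = 0) \<and> (\<forall>i. \<bar>snd (x i)\<bar> \<le> D) \<and> F (- \<kappa>0) x < 0"
  obtains \<Theta> :: "real \<Rightarrow> (nat \<Rightarrow> 'e \<times> real) \<Rightarrow> nat \<Rightarrow> 'e \<times> real" where "continuous_on ({0..1} \<times> K) (\<lambda>p. \<Theta> (fst p) (snd p))"
    "\<And>x. x \<in> K \<Longrightarrow> \<Theta> 0 x = x"
    "\<And>s x. x \<in> K \<Longrightarrow> s \<in> {0..1} \<Longrightarrow> esq L (\<Theta> s x) = 1"
    "\<And>x. x \<in> K \<Longrightarrow> F \<kappa>0 (\<Theta> 1 x) < 0"
    "\<And>T s x. (\<And>c x. T (escale c x) = escale c (T x)) \<Longrightarrow> (\<And>x. esq L (T x) = esq L x) \<Longrightarrow>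
        (\<And>\<kappa> x h. T (\<lambda>i. x i - h *\<^sub>R g \<kappa> x i) = (\<lambda>i. T x i - h *\<^sub>R g \<kappa> (T x) i)) \<Longrightarrow> \<Theta> s (T x) = T (\<Theta> s x)"
    "\<And>P s x. (\<And>\<kappa> x h c. P x \<Longrightarrow> P (escale c (\<lambda>i. x i - h *\<^sub>R g \<kappa> x i))) \<Longrightarrow>
        (\<And>\<kappa> x. P x \<Longrightarrow> F \<kappa> x = F \<kappa>0 x) \<Longrightarrow> x \<in> K \<Longrightarrow> P x \<Longrightarrow> s \<in> {0..1} \<Longrightarrow>
        P (\<Theta> s x) \<and> F \<kappa>0 (\<Theta> s x) < 0"
proof -
  \<comment> \<open>The total time of all steps is 16 * \<open>\<kappa>0\<close> /
    \<open>\<delta>\<close>; multiplied by the speed bound C it limits the drift of the circle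
    variables, so all iterates stay in the compact set \<open>KD\<close>.\<close>
  define D' where "D' = D + 16 * \<kappa>0 * \<bar>C\<bar> / \<delta>"
  define KD where "KD = {x :: nat \<Rightarrow> 'e \<times> real. esq L x = 1 \<and> (\<forall>i\<ge>L. x i = 0) \<and> (\<forall>i. \<bar>snd (x i)\<bar> \<le> D')}"
  define CK where "CK = {-\<kappa>0..\<kappa>0} \<times> KD"
  have cCK: "compact CK" unfolding CK_def KD_def by (intro compact_Times compact_unit_config) auto
  have co: "continuous_on S (\<lambda>x::nat \<Rightarrow> 'e \<times> real. x i)" for i S
    by (rule continuous_on_product_coordinates[THEN continuous_on_subset]) auto
  have gcont: "continuous_on S (\<lambda>p. g (u p) (f p) i)"
    if "continuous_on S u" "\<And>i. continuous_on S (\<lambda>p. f p i)" for S :: "'z::topological_space set" and u f i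
  proof -
    have "continuous_on S (\<lambda>p. (u p, f p))"
      by (intro continuous_intros that continuous_on_coordinatewise_then_product)
    then show ?thesis
      using continuous_on_compose2[OF contg, of S "\<lambda>p. (u p, f p)" i] by simp
  qed
  \<comment> \<open>The rate of decrease of F along the straight line of an Euler step; at time 0 it
    is the squared norm of the gradient.\<close>
  define \<Psi> where "\<Psi> p = (\<Sum>i<L. g (fst (snd p)) (\<lambda>i. snd (snd p) i - fst p *\<^sub>R g (fst (snd p)) (snd (snd p)) i) i
       \<bullet> g (fst (snd p)) (snd (snd p)) i)" for p :: "real \<times> real \<times> (nat \<Rightarrow> 'e \<times> real)"
  have cx: "continuous_on S (\<lambda>p :: real \<times> real \<times> (nat \<Rightarrow> 'e \<times> real). snd (snd p) i)" for S i
    by (rule continuous_on_product_then_coordinatewise) (intro continuous_on_snd continuous_on_id)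
  have c\<Psi>: "continuous_on ({0..1} \<times> CK) \<Psi>"
    unfolding \<Psi>_def by (intro continuous_intros gcont cx)
  define E where "E p = esq L (\<lambda>i. fst p *\<^sub>R g (fst (snd p)) (snd (snd p)) i)" for p :: "real \<times> real \<times> (nat \<Rightarrow> 'e \<times> real)"
  have cE: "continuous_on ({0..1} \<times> CK) E"
    unfolding E_def by (intro continuous_on_esq continuous_intros gcont cx)
  have comp: "compact ({0..1::real} \<times> CK)" by (intro compact_Times cCK) auto
  have small: "\<exists>h>0. \<forall>s c. 0 \<le> s \<longrightarrow> s \<le> h \<longrightarrow> s \<le> 1 \<longrightarrow> c \<in> CK \<longrightarrow> \<bar>f (s, c) - f (0, c)\<bar> < e"
    if cf: "continuous_on ({0..1::real} \<times> CK) f" and e: "e > 0" for f :: "_ \<Rightarrow> real" and e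
  proof -
    have "uniformly_continuous_on ({0..1::real} \<times> CK) f"
      by (rule compact_uniformly_continuous[OF cf comp])
    then obtain d where d: "d > 0" "\<forall>p\<in>{0..1::real} \<times> CK. \<forall>p'\<in>{0..1::real} \<times> CK. dist p' p < d \<longrightarrow> dist (f p') (f p) < e"
      using e unfolding uniformly_continuous_on_def by blast
    have "\<bar>f (s, c) - f (0, c)\<bar> < e" if "0 \<le> s" "s \<le> d/2" "s \<le> 1" "c \<in> CK" for s c
    proof -
      have "dist (s, c) (0::real, c) < d" using that d(1) by (simp add: dist_Pair_Pair dist_real_def)
      then show ?thesis using d(2)[rule_format, of "(0,c)" "(s,c)"] that by (simp add: dist_real_def)
    qed
    then show ?thesis using d(1) by (intro exI[of _ "d/2"]) auto
  qed
  obtain h1 where h1: "h1 > 0" "\<And>s c. 0 \<le> s \<Longrightarrow> s \<le> h1 \<Longrightarrow> s \<le> 1 \<Longrightarrow> c \<in> CK \<Longrightarrow> \<bar>\<Psi> (s, c) - \<Psi> (0, c)\<bar> < \<delta>/2"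
    using small[OF c\<Psi>, of "\<delta>/2"] pos by auto
  obtain h2 where h2: "h2 > 0" "\<And>s c. 0 \<le> s \<Longrightarrow> s \<le> h2 \<Longrightarrow> s \<le> 1 \<Longrightarrow> c \<in> CK \<Longrightarrow> \<bar>E (s, c) - E (0, c)\<bar> < 1/4"
    using small[OF cE, of "1/4"] by auto
  define h0 where "h0 = min 1 (min h1 h2)"
  have h0: "h0 > 0" unfolding h0_def using h1 h2 by auto
  \<comment> \<open>J is large enough for h \<le> h0, where h is fixed by the demand that increments
    h * \<open>\<delta>\<close> / 8 lead from -\<open>\<kappa>0\<close> to \<open>\<kappa>0\<close>
    in J steps.\<close>
  define J where "J = nat \<lceil>16 * \<kappa>0 / (\<delta> * h0)\<rceil> + 1"
  have J: "J > 0" "real J \<ge> 16 * \<kappa>0 / (\<delta> * h0)" unfolding J_def by linarith+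
  define h where "h = 16 * \<kappa>0 / (\<delta> * J)"
  have h: "0 < h" "h \<le> h0"
    unfolding h_def using J pos h0 by (auto simp: field_simps)
  have hJ: "h * J = 16 * \<kappa>0 / \<delta>" unfolding h_def using J by simp
  define \<kappa> where "\<kappa> j = - \<kappa>0 + real j * (2 * \<kappa>0 / J)" for j
  have \<kappa>: "\<bar>\<kappa> j\<bar> \<le> \<kappa>0" if "j \<le> J" for j
  proof -
    have "real j * (2 * \<kappa>0 / J) \<le> real J * (2 * \<kappa>0 / J)" using that pos by (intro mult_right_mono) auto
    then show ?thesis unfolding \<kappa>_def using J pos by (auto simp: abs_le_iff)
  qed
  have \<kappa>0: "\<kappa> 0 = - \<kappa>0" and \<kappa>J: "\<kappa> J = \<kappa>0" unfolding \<kappa>_def using J by auto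
  have \<kappa>S: "\<kappa> (Suc j) = \<kappa> j + h * \<delta> / 8" for j
    unfolding \<kappa>_def h_def using J pos by (simp add: field_simps)
  have step: "F k (\<lambda>i. x i - s *\<^sub>R g k x i) \<le> F k x - s * \<delta> / 2 \<and>
       esq L (\<lambda>i. x i - s *\<^sub>R g k x i) > 0 \<and> esq L (\<lambda>i. x i - s *\<^sub>R g k x i) \<le> 4"
    if x: "x \<in> KD" and k: "\<bar>k\<bar> \<le> \<kappa>0" and s: "0 \<le> s" "s \<le> h0" for x k s
  proof (intro conjI)
    have CKx: "(k, x) \<in> CK" unfolding CK_def using x k by (auto simp: abs_le_iff)
    have s1: "s \<le> 1" "s \<le> h1" "s \<le> h2" using s unfolding h0_def by auto
    have \<Psi>0: "\<Psi> (0, k, x) \<ge> \<delta>"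
      unfolding \<Psi>_def using \<delta>[OF k, of x] x by (simp add: KD_def power2_norm_eq_inner)
    define \<phi> where "\<phi> u = F k (\<lambda>i. x i + u *\<^sub>R (- g k x i))" for u
    have d\<phi>: "(\<phi> has_real_derivative - \<Psi> (u, k, x)) (at u)" for u
      unfolding \<phi>_def \<Psi>_def using der[of k x "\<lambda>i. - g k x i" u] by (simp add: sum_negf)
    have "\<phi> s \<le> \<phi> 0 - s * \<delta> / 2"
    proof (cases "s = 0")
      case False
      then obtain u where u: "0 < u" "u < s" "\<phi> s - \<phi> 0 = (s - 0) * (- \<Psi> (u, k, x))"
        using MVT2[of 0 s \<phi> "\<lambda>u. - \<Psi> (u, k, x)"] d\<phi> s by auto
      have "\<bar>\<Psi> (u, k, x) - \<Psi> (0, k, x)\<bar> < \<delta>/2" using h1(2)[of u "(k,x)"] u s1 CKx by simp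
      then have "\<Psi> (u, k, x) \<ge> \<delta>/2" using \<Psi>0 by linarith
      then have "s * \<delta> / 2 \<le> s * \<Psi> (u, k, x)"
        using mult_left_mono[of "\<delta>/2" "\<Psi> (u, k, x)" s] s by simp
      moreover have "\<phi> s - \<phi> 0 = - (s * \<Psi> (u, k, x))" using u(3) by simp
      ultimately show ?thesis by linarith
    qed simp
    then show "F k (\<lambda>i. x i - s *\<^sub>R g k x i) \<le> F k x - s * \<delta> / 2"
      unfolding \<phi>_def by simp
    have e4: "E (s, k, x) < 1/4"
      using h2(2)[of s "(k,x)"] s s1 CKx by (simp add: E_def esq_def)
    have tri: "\<bar>sqrt (esq L (\<lambda>i. a i - b i)) - sqrt (esq L a)\<bar> \<le> sqrt (esq L b)" for a b :: "nat \<Rightarrow> 'e \<times> real"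
    proof -
      have "sqrt (esq L (\<lambda>i. a i + b i)) \<le> sqrt (esq L a) + sqrt (esq L b)" for a b :: "nat \<Rightarrow> 'e \<times> real"
      proof -
        have "sqrt (esq L (\<lambda>i. a i + b i)) \<le> L2_set (\<lambda>i. norm (fst (a i)) + norm (fst (b i))) {..<L}"
          unfolding L2_set_def esq_def by (intro real_sqrt_le_mono sum_mono power_mono) (auto simp: norm_triangle_ineq)
        also have "\<dots> \<le> L2_set (\<lambda>i. norm (fst (a i))) {..<L} + L2_set (\<lambda>i. norm (fst (b i))) {..<L}"
          by (rule L2_set_triangle_ineq)
        finally show ?thesis unfolding L2_set_def esq_def .
      qed
      note t = this
      have m: "esq L (\<lambda>i. - b i) = esq L b" for b :: "nat \<Rightarrow> 'e \<times> real" unfolding esq_def by simp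
      have "sqrt (esq L (\<lambda>i. a i - b i)) \<le> sqrt (esq L a) + sqrt (esq L b)"
        using t[of a "\<lambda>i. - b i"] m[of b] by simp
      moreover have "sqrt (esq L a) \<le> sqrt (esq L (\<lambda>i. a i - b i)) + sqrt (esq L b)"
        using t[of "\<lambda>i. a i - b i" b] by simp
      ultimately show ?thesis by linarith
    qed
    \<comment> \<open>The linear part of the displacement has norm at most 1/2, so the result can be
      normalized and its \<open>esq\<close> is at most 4.\<close>
    have "sqrt (E (s, k, x)) \<le> 1/2"
      using e4 by (intro real_le_lsqrt) (auto simp: power2_eq_square)
    then have b: "\<bar>sqrt (esq L (\<lambda>i. x i - s *\<^sub>R g k x i)) - 1\<bar> \<le> 1/2"
      using tri[of x "\<lambda>i. s *\<^sub>R g k x i"] x by (simp add: E_def KD_def)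
    then have "sqrt (esq L (\<lambda>i. x i - s *\<^sub>R g k x i)) > 0" by linarith
    then show "esq L (\<lambda>i. x i - s *\<^sub>R g k x i) > 0" by simp
    have "sqrt (esq L (\<lambda>i. x i - s *\<^sub>R g k x i)) \<le> 2" using b by linarith
    then show "esq L (\<lambda>i. x i - s *\<^sub>R g k x i) \<le> 4"
      by (metis real_sqrt_four real_sqrt_le_iff)
  qed
  define \<Theta> where "\<Theta> j s x = euler_iter L g \<kappa> (s * h) j x" for j s x
  have inv: "esq L (\<Theta> j s x) = 1 \<and> (\<forall>i\<ge>L. \<Theta> j s x i = 0) \<and> (\<forall>i. \<bar>snd (\<Theta> j s x i)\<bar> \<le> D + real j * h * \<bar>C\<bar>)"
    if "x \<in> K" "s \<in> {0..1}" "j \<le> J" for j s x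
    using that(3)
  proof (induction j)
    case 0
    then show ?case using K[OF that(1)] by (simp add: \<Theta>_def)
  next
    case (Suc j)
    let ?y = "\<Theta> j s x"
    have y: "esq L ?y = 1" "\<forall>i\<ge>L. ?y i = 0" "\<And>i. \<bar>snd (?y i)\<bar> \<le> D + real j * h * \<bar>C\<bar>"
      using Suc by auto
    have "real j * h * \<bar>C\<bar> \<le> real J * h * \<bar>C\<bar>" using Suc.prems h by (intro mult_right_mono) auto
    also have "\<dots> = 16 * \<kappa>0 * \<bar>C\<bar> / \<delta>" using hJ by (simp add: field_simps)
    finally have jb: "real j * h * \<bar>C\<bar> \<le> 16 * \<kappa>0 * \<bar>C\<bar> / \<delta>" .
    have yKD: "?y \<in> KD" unfolding KD_def D'_def
      using y(1,2) order_trans[OF y(3) add_left_mono[OF jb, of D]] by blast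
    have sh3: "s * h \<le> h" using that(2) h mult_left_le_one_le[of h s] by simp
    have sh1: "0 \<le> s * h" using that(2) h by simp
    note sh = sh1 order_trans[OF sh3 h(2)] sh3
    have kj: "\<bar>\<kappa> j\<bar> \<le> \<kappa>0" using Suc.prems by (intro \<kappa>) auto
    let ?m = "\<lambda>i. ?y i - (s * h) *\<^sub>R g (\<kappa> j) ?y i"
    have eq: "\<Theta> (Suc j) s x = enormalize L ?m" unfolding \<Theta>_def by (simp add: Let_def)
    have e1: "esq L (\<Theta> (Suc j) s x) = 1" unfolding eq using step[OF yKD kj sh(1,2)] by (intro esq_enormalize) auto
    moreover have "\<Theta> (Suc j) s x i = 0" if "i \<ge> L" for i
      unfolding eq enormalize_def escale_def using that y(2) g0 by (simp add: zero_prod_def)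
    moreover have "\<bar>snd (\<Theta> (Suc j) s x i)\<bar> \<le> D + real (Suc j) * h * \<bar>C\<bar>" for i
    proof -
      have "\<bar>snd (g (\<kappa> j) ?y i)\<bar> \<le> \<bar>C\<bar>" using Cz[OF kj y(1), of i] by linarith
      then have "(s * h) * \<bar>snd (g (\<kappa> j) ?y i)\<bar> \<le> h * \<bar>C\<bar>"
        using sh h by (intro mult_mono) auto
      then have "\<bar>(s * h) * snd (g (\<kappa> j) ?y i)\<bar> \<le> h * \<bar>C\<bar>"
        using abs_of_nonneg[OF sh(1)] by (simp only: abs_mult[of "s * h"])
      moreover have "snd (\<Theta> (Suc j) s x i) = snd (?y i) - (s * h) * snd (g (\<kappa> j) ?y i)"
        unfolding eq enormalize_def escale_def by simp
      ultimately show ?thesis using y(3)[of i] by (simp add: algebra_simps)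
    qed
    ultimately show ?case by blast
  qed
  have inKD: "\<Theta> j s x \<in> KD" if "x \<in> K" "s \<in> {0..1}" "j \<le> J" for j s x
  proof -
    have "real j * h * \<bar>C\<bar> \<le> real J * h * \<bar>C\<bar>" using that h by (intro mult_right_mono) auto
    also have "\<dots> = 16 * \<kappa>0 * \<bar>C\<bar> / \<delta>" using hJ by (simp add: field_simps)
    finally have jb: "real j * h * \<bar>C\<bar> \<le> 16 * \<kappa>0 * \<bar>C\<bar> / \<delta>" .
    have y: "esq L (\<Theta> j s x) = 1" "\<forall>i\<ge>L. \<Theta> j s x i = 0" "\<And>i. \<bar>snd (\<Theta> j s x i)\<bar> \<le> D + real j * h * \<bar>C\<bar>"
      using inv[OF that] by auto
    show ?thesis unfolding KD_def D'_def
      using y(1,2) order_trans[OF y(3) add_left_mono[OF jb, of D]] by blast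
  qed
  have \<Theta>S: "\<Theta> (Suc j) s x = enormalize L (\<lambda>i. \<Theta> j s x i - (s * h) *\<^sub>R g (\<kappa> j) (\<Theta> j s x) i)" for j s x
    unfolding \<Theta>_def by (simp add: Let_def)
  have sh: "0 \<le> s * h" "s * h \<le> h0" if "s \<in> {0..1}" for s
  proof -
    have "s * h \<le> h" using that h mult_left_le_one_le[of h s] by simp
    from order_trans[OF this h(2)] show "s * h \<le> h0" .
    show "0 \<le> s * h" using that h by simp
  qed
  have cont: "continuous_on ({0..1} \<times> K) (\<lambda>p. \<Theta> j (fst p) (snd p) i)" if "j \<le> J" for i j
    using that
  proof (induction j arbitrary: i)
    case 0
    show ?case unfolding \<Theta>_def
      by (simp, rule continuous_on_product_then_coordinatewise) (intro continuous_on_snd continuous_on_id)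
  next
    case (Suc j)
    then have IH: "\<And>i. continuous_on ({0..1} \<times> K) (\<lambda>p. \<Theta> j (fst p) (snd p) i)" and jJ: "j \<le> J" by auto
    show ?case unfolding \<Theta>S
    proof (intro continuous_on_enormalize continuous_intros IH gcont)
      fix p assume p: "p \<in> {0..1::real} \<times> K"
      then show "0 < esq L (\<lambda>i. \<Theta> j (fst p) (snd p) i - (fst p * h) *\<^sub>R g (\<kappa> j) (\<Theta> j (fst p) (snd p)) i)"
        using step[OF inKD[of "snd p" "fst p" j] \<kappa>[OF jJ] sh[of "fst p"]] jJ by auto
    qed
  qed
  have Fneg: "F (\<kappa> j) (\<Theta> j 1 x) < 0" if "x \<in> K" "j \<le> J" for j x
    using that(2)
  proof (induction j)
    case 0
    then show ?case using K[OF that(1)] \<kappa>0 by (simp add: \<Theta>_def)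
  next
    case (Suc j)
    let ?y = "\<Theta> j 1 x" let ?m = "\<lambda>i. ?y i - (1 * h) *\<^sub>R g (\<kappa> j) ?y i"
    have st: "F (\<kappa> j) ?m \<le> F (\<kappa> j) ?y - (1 * h) * \<delta> / 2" "esq L ?m > 0" "esq L ?m \<le> 4"
      using step[OF inKD[OF that(1), of 1 j] \<kappa>[of j] sh[of 1]] Suc.prems by auto
    have "F (\<kappa> (Suc j)) ?m = F (\<kappa> j) ?m + (h * \<delta> / 8) * q ?m"
      using aff[of "\<kappa> (Suc j)" ?m "\<kappa> j"] \<kappa>S[of j] by simp
    also have "\<dots> \<le> F (\<kappa> j) ?m + (h * \<delta> / 8) * 4"
      using q[of ?m] st(3) h pos by (intro add_left_mono mult_left_mono) auto
    also have "\<dots> \<le> F (\<kappa> j) ?y" using st(1) by (simp add: mult.commute)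
    finally have "F (\<kappa> (Suc j)) ?m < 0" using Suc by simp
    then show ?case unfolding \<Theta>S enormalize_def using st(2)
      by (subst hom) (auto intro!: mult_pos_neg)
  qed
  show thesis
  proof (rule that[of "\<Theta> J"])
    show "continuous_on ({0..1} \<times> K) (\<lambda>p. \<Theta> J (fst p) (snd p))"
      by (rule continuous_on_coordinatewise_then_product) (rule cont, simp)
    show "esq L (\<Theta> J s x) = 1" if "x \<in> K" "s \<in> {0..1}" for s x using inv[OF that, of J] by simp
    show "F \<kappa>0 (\<Theta> J 1 x) < 0" if "x \<in> K" for x using Fneg[OF that, of J] \<kappa>J by simp
    show "\<Theta> J 0 x = x" if x: "x \<in> K" for x
    proof -
      have "\<Theta> j 0 x = x" if "j \<le> J" for j
        using that
      proof (induction j)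
        case (Suc j)
        then show ?case unfolding \<Theta>S using K[OF x] by (simp add: enormalize_id)
      qed (simp add: \<Theta>_def)
      then show ?thesis by simp
    qed
    show "\<Theta> J s (T x) = T (\<Theta> J s x)"
      if T: "\<And>c x. T (escale c x) = escale c (T x)" "\<And>x. esq L (T x) = esq L x"
        "\<And>\<kappa> x h. T (\<lambda>i. x i - h *\<^sub>R g \<kappa> x i) = (\<lambda>i. T x i - h *\<^sub>R g \<kappa> (T x) i)" for T s x
    proof -
      have "\<Theta> j s (T x) = T (\<Theta> j s x)" for j
      proof (induction j)
        case (Suc j)
        have "enormalize L (T y) = T (enormalize L y)" for y by (simp add: enormalize_def T(1,2))
        then show ?case unfolding \<Theta>S Suc T(3)[symmetric] by simp
      qed (simp add: \<Theta>_def)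
      then show ?thesis .
    qed
    show "P (\<Theta> J s x) \<and> F \<kappa>0 (\<Theta> J s x) < 0"
      if P: "\<And>\<kappa> x h c. P x \<Longrightarrow> P (escale c (\<lambda>i. x i - h *\<^sub>R g \<kappa> x i))"
         "\<And>\<kappa> x. P x \<Longrightarrow> F \<kappa> x = F \<kappa>0 x" and x: "x \<in> K" "P x" "s \<in> {0..1}" for P s x
    proof -
      have "P (\<Theta> j s x) \<and> F \<kappa>0 (\<Theta> j s x) < 0" if "j \<le> J" for j
        using that
      proof (induction j)
        case 0
        then show ?case using x K[OF x(1)] P(2)[OF x(2), of "- \<kappa>0"] by (simp add: \<Theta>_def)
      next
        case (Suc j)
        let ?y = "\<Theta> j s x" let ?m = "\<lambda>i. ?y i - (s * h) *\<^sub>R g (\<kappa> j) ?y i"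
        have IH: "P ?y" "F \<kappa>0 ?y < 0" using Suc by auto
        have st: "F (\<kappa> j) ?m \<le> F (\<kappa> j) ?y - (s * h) * \<delta> / 2" "esq L ?m > 0"
          using step[OF inKD[OF x(1) x(3), of j] \<kappa>[of j] sh[OF x(3)]] Suc.prems by auto
        have Pm: "P ?m" using P(1)[OF IH(1), of 1 "s * h" "\<kappa> j"] unfolding escale_1 .
        have "0 \<le> (s * h) * \<delta> / 2" using sh[OF x(3)] pos by simp
        then have "F \<kappa>0 ?m < 0" using st(1) IH(2) P(2)[OF IH(1), of "\<kappa> j"] P(2)[OF Pm, of "\<kappa> j"] by linarith
        then have "F \<kappa>0 (escale (1 / sqrt (esq L ?m)) ?m) < 0"
          using st(2) by (subst hom) (auto intro!: mult_pos_neg)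
        then show ?case unfolding \<Theta>S enormalize_def using P(1)[OF IH(1)] by blast
      qed
      then show ?thesis by simp
    qed
  qed
qed

section \<open>The discrete action functional\<close>

definition cxp :: "complex ^ 'n::finite \<Rightarrow> complex ^ 'n \<Rightarrow> real" where
  "cxp u v = (\<Sum>j\<in>UNIV. Re (u $ j) * Im (v $ j) - Im (u $ j) * Re (v $ j))"

definition Jv :: "complex ^ 'n::finite \<Rightarrow> complex ^ 'n" where
  "Jv u = (\<chi> j. \<i> * u $ j)"

lemma inner_Jv: "inner (Jv u) v = cxp u v"
  unfolding Jv_def cxp_def inner_vec_def by (simp add: inner_complex_def algebra_simps)

lemma Jv_linear: "linear Jv"
  by (rule linearI) (auto simp: Jv_def vec_eq_iff scaleR_conv_of_real algebra_simps)

lemma norm_Jv [simp]: "norm (Jv u) = norm u"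
  unfolding Jv_def norm_vec_def by (simp add: norm_mult)

lemma Jv_0 [simp]: "Jv 0 = 0"
  by (simp add: Jv_def vec_eq_iff)

lemma continuous_on_Jv [continuous_intros]: "continuous_on S f \<Longrightarrow> continuous_on S (\<lambda>x. Jv (f x))"
  using Jv_linear linear_conv_bounded_linear[of Jv] bounded_linear.continuous_on by blast

lemma cxp_bilinear: "bounded_bilinear cxp"
proof -
  have "bounded_bilinear (\<lambda>u v. inner (Jv u) v)"
    by (rule bounded_bilinear.comp1[OF bounded_bilinear_inner])
       (use Jv_linear linear_conv_bounded_linear in blast)
  then show ?thesis by (simp add: inner_Jv)
qed

interpretation cxp: bounded_bilinear cxp by (rule cxp_bilinear)

lemma cxp_antisym: "cxp u v = - cxp v u"
  unfolding cxp_def by (simp add: sum_negf[symmetric] algebra_simps)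

lemma abs_cxp_le: "\<bar>cxp u v\<bar> \<le> norm u * norm v"
  using Cauchy_Schwarz_ineq2[of "Jv u" v] by (simp add: inner_Jv)

text \<open>The substitution for sigma. For fixed w it is increasing in y, and it is homogeneous of
  degree two in e = (w, y), so a pair (w, sigma) of weights 1 and 2 becomes a vector of weight 1 to
  which Euclidean normalization applies.\<close>

definition sg :: "'w::euclidean_space \<times> real \<Rightarrow> real" where
  "sg e = snd e * norm e"

text \<open>The gradient of \<open>sg\<close>. It is correct at the origin as well, where the
  quotient 0 / 0 is 0.\<close>

definition gsg :: "'w::euclidean_space \<times> real \<Rightarrow> 'w \<times> real" where
  "gsg e = (snd e / norm e) *\<^sub>R e + (0, norm e)"

lemma abs_snd_le_norm: "\<bar>snd e\<bar> \<le> norm (e :: 'w::euclidean_space \<times> real)"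
  using norm_snd_le[of "snd e" "fst e"] by simp

lemma sg_has_derivative: "(sg has_derivative (\<lambda>v. gsg e \<bullet> v)) (at e)"
proof (cases "e = 0")
  case True
  have "(sg has_derivative (\<lambda>v. 0)) (at (0 :: 'a \<times> real))"
    unfolding has_derivative_at
  proof (intro conjI)
    have q: "norm (norm (sg (0 + h) - sg 0 - 0) / norm h) \<le> norm h" for h :: "'a \<times> real"
    proof -
      have "\<bar>snd h * norm h\<bar> \<le> norm h * norm h"
        unfolding abs_mult using abs_snd_le_norm[of h] by (intro mult_mono) auto
      then have "norm (sg (0 + h) - sg 0 - 0) / norm h \<le> norm h"
        by (cases "h = 0") (auto simp: sg_def divide_le_eq)
      moreover have "norm (r / norm h) = r / norm h" if "0 \<le> r" for r :: real using that by simp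
      ultimately show ?thesis using norm_ge_zero by metis
    qed
    have "\<forall>\<^sub>F h in at (0::'a \<times> real). norm (norm (sg (0 + h) - sg 0 - 0) / norm h) \<le> norm h"
      by (intro always_eventually allI) (rule q)
    then show "(\<lambda>h::'a \<times> real. norm (sg (0 + h) - sg 0 - 0) / norm h) \<midarrow>0\<rightarrow> 0"
      by (rule Lim_null_comparison) (rule tendsto_norm_zero[OF tendsto_ident_at])
  qed simp
  then show ?thesis using True by (simp add: gsg_def zero_prod_def[symmetric])
next
  case False
  have n: "(norm has_derivative (\<lambda>v. v \<bullet> sgn e)) (at e)"
    using GDERIV_norm[OF False] by (simp add: gderiv_def)
  have "((\<lambda>e. snd e * norm e) has_derivative (\<lambda>v. snd e * (v \<bullet> sgn e) + snd v * norm e)) (at e)"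
    by (intro has_derivative_mult n has_derivative_snd has_derivative_ident)
  moreover have "(\<lambda>v. snd e * (v \<bullet> sgn e) + snd v * norm e) = (\<lambda>v. gsg e \<bullet> v)"
    by (auto simp: gsg_def inner_add_left inner_prod_def sgn_div_norm field_simps inner_commute[of "fst e"])
  ultimately show ?thesis unfolding sg_def[abs_def] by simp
qed

lemma norm_gsg_le: "norm (gsg e) \<le> 2 * norm e"
proof -
  have "norm (gsg e) \<le> norm ((snd e / norm e) *\<^sub>R e) + norm ((0::'a), norm e)"
    unfolding gsg_def by (rule norm_triangle_ineq)
  also have "\<dots> \<le> norm e + norm e"
    using abs_snd_le_norm[of e] by (intro add_mono) (auto simp: norm_Pair)
  finally show ?thesis by simp
qed

text \<open>Keeps the gradient away from 0 off the origin, so that the size of a coefficient can be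
  read off from its product with \<open>gsg e\<close>.\<close>

lemma gsg_snd_ge: "norm e \<le> snd (gsg e)"
  by (simp add: gsg_def)

text \<open>Lets the last component of a multiple of \<open>gsg e\<close> control the remaining
  ones.\<close>

lemma gsg_fst_le: "norm (fst (gsg e)) \<le> \<bar>snd (gsg e)\<bar>"
proof -
  have "norm (fst (gsg e)) = \<bar>snd e\<bar> * norm (fst e) / norm e"
    by (simp add: gsg_def)
  also have "\<dots> \<le> \<bar>snd e\<bar>"
    using norm_fst_le[of "fst e" "snd e"] by (cases "e = 0") (auto simp: divide_le_eq mult_left_mono)
  also have "\<dots> \<le> norm e" by (rule abs_snd_le_norm)
  also have "\<dots> \<le> snd (gsg e)" by (rule gsg_snd_ge)
  finally show ?thesis by simp
qed

lemma gsg_eq_0_iff: "gsg e = 0 \<longleftrightarrow> e = 0"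
proof
  assume "gsg e = 0"
  then show "e = 0" using gsg_snd_ge[of e] by simp
qed (simp add: gsg_def zero_prod_def[symmetric])

lemma continuous_on_gsg: "continuous_on UNIV gsg"
  unfolding continuous_on_eq_continuous_at[OF open_UNIV]
proof
  fix e :: "'a \<times> real"
  show "isCont gsg e"
  proof (cases "e = 0")
    case True
    have "(gsg \<longlongrightarrow> 0) (at (0 :: 'a \<times> real))"
    proof (rule Lim_null_comparison)
      show "\<forall>\<^sub>F x in at (0 :: 'a \<times> real). norm (gsg x) \<le> 2 * norm x" using norm_gsg_le by (intro always_eventually) auto
      show "((\<lambda>x. 2 * norm x) \<longlongrightarrow> 0) (at (0 :: 'a \<times> real))" by (intro tendsto_eq_intros) auto
    qed
    then show ?thesis using True gsg_eq_0_iff[of e] by (simp add: isCont_def)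
  next
    case False
    then show ?thesis unfolding gsg_def[abs_def] by (intro continuous_intros) auto
  qed
qed

lemma continuous_on_sg: "continuous_on S sg"
  unfolding sg_def[abs_def] by (intro continuous_intros)

text \<open>Meant for coefficients of weight 0: bounded, but possibly without a limit where k
  vanishes.\<close>

lemma vanishing_mult_continuous:
  fixes h :: "'a::metric_space \<Rightarrow> real" and k :: "'a \<Rightarrow> 'b::real_normed_vector"
  assumes k: "continuous_on UNIV k" and h: "continuous_on {p. k p \<noteq> 0} h" and b: "\<And>p. \<bar>h p\<bar> \<le> C"
  shows "continuous_on UNIV (\<lambda>p. h p *\<^sub>R k p)"
  unfolding continuous_on_eq_continuous_at[OF open_UNIV]
proof
  fix p
  have kp: "isCont k p" using k by (simp add: continuous_on_eq_continuous_at)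
  show "isCont (\<lambda>p. h p *\<^sub>R k p) p"
  proof (cases "k p = 0")
    case True
    have "((\<lambda>q. h q *\<^sub>R k q) \<longlongrightarrow> 0) (at p)"
    proof (rule Lim_null_comparison)
      show "\<forall>\<^sub>F q in at p. norm (h q *\<^sub>R k q) \<le> \<bar>C\<bar> * norm (k q)"
        by (intro always_eventually allI) (use b in \<open>auto intro!: mult_right_mono order_trans[OF b]\<close>)
      have "(k \<longlongrightarrow> 0) (at p)" using kp True by (simp add: isCont_def)
      then show "((\<lambda>q. \<bar>C\<bar> * norm (k q)) \<longlongrightarrow> 0) (at p)"
        by (intro tendsto_eq_intros) auto
    qed
    then show ?thesis using True by (simp add: isCont_def)
  next
    case False
    have "open {p. k p \<noteq> 0}" using k by (intro open_Collect_neq) auto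
    then have "isCont h p" using h False by (simp add: continuous_on_eq_continuous_at)
    then show ?thesis using kp by (intro continuous_intros)
  qed
qed

lemma line_has_real_derivative:
  fixes f :: "'a::real_normed_vector \<Rightarrow> real"
  assumes "(f has_derivative f') (at (x + s *\<^sub>R v))"
  shows "((\<lambda>s. f (x + s *\<^sub>R v)) has_real_derivative f' v) (at s)"
proof -
  have "((\<lambda>s. x + s *\<^sub>R v) has_derivative (\<lambda>u. u *\<^sub>R v)) (at s)"
    by (auto intro!: derivative_eq_intros)
  from has_derivative_compose[OF this assms]
  have "((\<lambda>s. f (x + s *\<^sub>R v)) has_derivative (\<lambda>u. f' (u *\<^sub>R v))) (at s)" .
  moreover have "(\<lambda>u. f' (u *\<^sub>R v)) = (*) (f' v)"
    using has_derivative_linear[OF assms] by (auto simp: linear_scale fun_eq_iff mult.commute)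
  ultimately show ?thesis by (simp add: has_field_derivative_def)
qed

section \<open>Polygons described by their midpoints\<close>

definition kmat :: "nat \<Rightarrow> nat \<Rightarrow> real" where
  "kmat i j = (if i < j then 2 * (-1) ^ (j - i - 1) else if j < i then - 2 * (-1) ^ (i - j - 1) else 0)"

lemma kmat_antisym: "kmat i j = - kmat j i"
  by (auto simp: kmat_def)

lemma abs_kmat_le: "\<bar>kmat i j\<bar> \<le> 2"
  by (auto simp: kmat_def abs_mult power_abs)

text \<open>The origin of the alternating entries. With \<open>dlt L m i\<close> as the i-th edge
  and \<open>m i\<close> as its midpoint, this relation says that edge i ends where edge i + 1
  begins.\<close>

lemma kmat_chain: "kmat i j + kmat (Suc i) j = (if j = Suc i then 2 else if j = i then -2 else 0)"
proof -
  consider "j = i" | "j = Suc i" | "j > Suc i" | "j < i" by linarith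
  then show ?thesis
  proof cases
    case 3
    then obtain t where "j = Suc (Suc i) + t" by (metis Suc_leI le_iff_add)
    then show ?thesis by (auto simp: kmat_def)
  next
    case 4
    then obtain t where "i = Suc j + t" by (metis Suc_leI le_iff_add)
    then show ?thesis by (auto simp: kmat_def)
  qed (auto simp: kmat_def)
qed

definition dlt :: "nat \<Rightarrow> (nat \<Rightarrow> 'w::real_vector) \<Rightarrow> nat \<Rightarrow> 'w" where
  "dlt L m i = (\<Sum>j<L. kmat i j *\<^sub>R m j)"

lemma dlt_line: "dlt L (\<lambda>i. m i + s *\<^sub>R v i) i = dlt L m i + s *\<^sub>R dlt L v i"
  unfolding dlt_def by (simp add: scaleR_add_right sum.distrib scaleR_sum_right mult.commute)

lemma dlt_scale: "dlt L (\<lambda>i. c *\<^sub>R m i) i = c *\<^sub>R dlt L m i"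
  unfolding dlt_def by (simp add: scaleR_sum_right mult.commute)

lemma dlt_chain:
  assumes "Suc i < L"
  shows "m i + (1/2) *\<^sub>R dlt L m i = m (Suc i) - (1/2) *\<^sub>R dlt L m (Suc i)"
proof -
  have "dlt L m i + dlt L m (Suc i) = (\<Sum>j<L. (kmat i j + kmat (Suc i) j) *\<^sub>R m j)"
    unfolding dlt_def by (simp add: scaleR_add_left sum.distrib)
  also have "\<dots> = (\<Sum>j<L. (if j = Suc i then 2 *\<^sub>R m j else 0) - (if j = i then 2 *\<^sub>R m j else 0))"
    by (intro sum.cong) (auto simp: kmat_chain)
  also have "\<dots> = 2 *\<^sub>R m (Suc i) - 2 *\<^sub>R m i"
    using assms by (simp add: sum_subtractf sum.delta)
  finally have "(1/2) *\<^sub>R (dlt L m i + dlt L m (Suc i)) = m (Suc i) - m i"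
    by (simp add: scaleR_diff_right)
  then show ?thesis by (simp add: scaleR_add_right algebra_simps)
qed

text \<open>The symplectic term of the discrete action in terms of midpoints: its derivative pairs
  every edge with the variation of its midpoint.\<close>

definition Bq :: "nat \<Rightarrow> (nat \<Rightarrow> complex ^ 'n::finite) \<Rightarrow> real" where
  "Bq L m = (\<Sum>i<L. cxp (dlt L m i) (m i)) / 2"

text \<open>The antisymmetries of \<open>kmat\<close> and of \<open>cxp\<close> combine to a
  symmetric bilinear form, which is why the factor 1/2 in \<open>Bq\<close> disappears in the
  derivative.\<close>

lemma cxp_dlt_sym: "(\<Sum>i<L. cxp (dlt L v i) (m i)) = (\<Sum>i<L. cxp (dlt L m i) (v i))"
proof -
  have "(\<Sum>i<L. cxp (dlt L v i) (m i)) = (\<Sum>i<L. \<Sum>j<L. kmat i j * cxp (v j) (m i))"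
    unfolding dlt_def by (simp add: cxp.sum_left cxp.scaleR_left)
  also have "\<dots> = (\<Sum>j<L. \<Sum>i<L. kmat i j * cxp (v j) (m i))" by (rule sum.swap)
  also have "\<dots> = (\<Sum>j<L. \<Sum>i<L. kmat j i * cxp (m i) (v j))"
  proof (intro sum.cong refl)
    fix i j
    show "kmat i j * cxp (v j) (m i) = kmat j i * cxp (m i) (v j)"
      using cxp_antisym[of "v j" "m i"] kmat_antisym[of i j] by simp
  qed
  also have "\<dots> = (\<Sum>i<L. cxp (dlt L m i) (v i))"
    unfolding dlt_def by (simp add: cxp.sum_left cxp.scaleR_left)
  finally show ?thesis .
qed

lemma Bq_line_derivative:
  "((\<lambda>s. Bq L (\<lambda>i. m i + s *\<^sub>R v i)) has_real_derivative
     (\<Sum>i<L. cxp (dlt L (\<lambda>i. m i + s *\<^sub>R v i) i) (v i))) (at s)"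
proof -
  let ?a = "(\<Sum>i<L. cxp (dlt L m i) (m i))" and ?b = "(\<Sum>i<L. cxp (dlt L m i) (v i))"
    and ?c = "(\<Sum>i<L. cxp (dlt L v i) (v i))"
  have eq: "Bq L (\<lambda>i. m i + s *\<^sub>R v i) = (?a + s * (?b + ?b) + s * s * ?c) / 2" for s
  proof -
    have "Bq L (\<lambda>i. m i + s *\<^sub>R v i) = (?a + s * ?b + s * (\<Sum>i<L. cxp (dlt L v i) (m i)) + s * s * ?c) / 2"
      unfolding Bq_def dlt_line
      by (simp add: cxp.add_left cxp.add_right cxp.scaleR_left cxp.scaleR_right sum.distrib sum_distrib_left algebra_simps)
    then show ?thesis unfolding cxp_dlt_sym[of L v m] by (simp add: algebra_simps)
  qed
  have "((\<lambda>s. (?a + s * (?b + ?b) + s * s * ?c) / 2) has_real_derivative (?b + s * ?c)) (at s)"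
    by (auto intro!: derivative_eq_intros simp: field_simps)
  moreover have "?b + s * ?c = (\<Sum>i<L. cxp (dlt L (\<lambda>i. m i + s *\<^sub>R v i) i) (v i))"
    unfolding dlt_line by (simp add: cxp.add_left cxp.scaleR_left sum.distrib sum_distrib_left)
  ultimately show ?thesis unfolding eq by simp
qed

text \<open>Determines the size of kappa: once the midpoints of the steps are 0, a coefficient of
  |nu|^2 beyond L dominates this term.\<close>

lemma abs_Bq_le: "\<bar>Bq L m\<bar> \<le> real L * (\<Sum>i<L. (norm (m i))\<^sup>2)"
proof -
  let ?s = "\<Sum>i<L. norm (m i)"
  have d: "norm (dlt L m i) \<le> 2 * ?s" for i
  proof -
    have "norm (dlt L m i) \<le> (\<Sum>j<L. norm (kmat i j *\<^sub>R m j))" unfolding dlt_def by (rule norm_sum)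
    also have "\<dots> \<le> (\<Sum>j<L. 2 * norm (m j))"
      using abs_kmat_le by (intro sum_mono) (auto intro!: mult_right_mono)
    finally show ?thesis by (simp add: sum_distrib_left)
  qed
  have "\<bar>\<Sum>i<L. cxp (dlt L m i) (m i)\<bar> \<le> (\<Sum>i<L. \<bar>cxp (dlt L m i) (m i)\<bar>)" by (rule sum_abs)
  also have "\<dots> \<le> (\<Sum>i<L. (2 * ?s) * norm (m i))"
    using d by (intro sum_mono order_trans[OF abs_cxp_le] mult_right_mono) auto
  also have "\<dots> = 2 * ?s * ?s" by (simp add: sum_distrib_left)
  finally have "\<bar>Bq L m\<bar> \<le> ?s\<^sup>2" unfolding Bq_def by (simp add: power2_eq_square)
  also have "?s\<^sup>2 \<le> real L * (\<Sum>i<L. (norm (m i))\<^sup>2)"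
    using Cauchy_Schwarz_ineq_sum[of "\<lambda>_. 1" "\<lambda>i. norm (m i)" "{..<L}"] by simp
  finally show ?thesis .
qed

section \<open>The cyclic action on the linear variables\<close>

definition tw :: "nat \<Rightarrow> ('n::finite \<Rightarrow> int) \<Rightarrow> complex ^ 'n \<Rightarrow> complex ^ 'n" where
  "tw k mm w = (\<chi> j. cis (2 * pi * of_int (mm j) / of_nat k) * w $ j)"

lemma tw_linear: "linear (tw k mm)"
  by (rule linearI) (auto simp: tw_def vec_eq_iff scaleR_conv_of_real algebra_simps)

lemma tw_simps [simp]: "tw k mm 0 = 0" "tw k mm (u + v) = tw k mm u + tw k mm v"
  "tw k mm (u - v) = tw k mm u - tw k mm v" "tw k mm (c *\<^sub>R u) = c *\<^sub>R tw k mm u"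
  by (auto simp: tw_def vec_eq_iff scaleR_conv_of_real algebra_simps)

lemma norm_tw [simp]: "norm (tw k mm u) = norm u"
  unfolding tw_def norm_vec_def by (simp add: norm_mult)

lemma tw_Jv: "Jv (tw k mm u) = tw k mm (Jv u)"
  by (auto simp: tw_def Jv_def vec_eq_iff)

lemma tw_sum: "tw k mm (\<Sum>i\<in>A. f i) = (\<Sum>i\<in>A. tw k mm (f i))"
  using tw_linear linear_sum by blast

lemma tw_inner: "inner (tw k mm u) (tw k mm v) = inner u v"
  using norm_tw[of k mm "u + v"] norm_tw[of k mm u] norm_tw[of k mm v]
  by (simp add: norm_eq_sqrt_inner inner_add_left inner_add_right inner_commute)

lemma tw_cxp: "cxp (tw k mm u) (tw k mm v) = cxp u v"
  by (simp add: inner_Jv[symmetric] tw_Jv tw_inner)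

text \<open>A nonzero coordinate is fixed only if its root of unity is 1, which the weights
  exclude.\<close>

lemma tw_fixed:
  assumes k: "prime k" and mm: "\<And>j. \<not> int k dvd mm j" and fx: "tw k mm u = u"
  shows "u = 0"
proof -
  have k0: "k > 0" using k prime_gt_0_nat by blast
  have "u $ j = 0" for j
  proof (rule ccontr)
    assume "u $ j \<noteq> 0"
    moreover have "cis (2 * pi * of_int (mm j) / of_nat k) * u $ j = u $ j"
      using fx by (simp add: tw_def vec_eq_iff)
    ultimately have "cis (2 * pi * of_int (mm j) / of_nat k) = 1" by simp
    then have "cos (2 * pi * of_int (mm j) / of_nat k) = 1" by (simp add: complex_eq_iff)
    then obtain n where n: "2 * pi * of_int (mm j) / of_nat k = of_int n * 2 * pi"
      using cos_one_2pi_int by blast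
    then have "of_int (mm j) = (of_int n :: real) * of_nat k" using k0 by (simp add: field_simps)
    then have "mm j = n * int k" by (metis of_int_eq_iff of_int_mult of_int_of_nat_eq)
    then show False using mm[of j] by simp
  qed
  then show ?thesis by (simp add: vec_eq_iff)
qed

text \<open>One entry per step of the isotopy: \<open>S i\<close> is its generating function, and
  \<open>a\<close>, \<open>b\<close>, \<open>d\<close> are the increments of z, of sigma with
  reversed sign, and of w. The increment of z has weight 0, hence for \<open>a\<close> only
  continuity off the origin and a bound are demanded.\<close>

locale discrete_action =
  fixes k :: nat and mm :: "'n::finite \<Rightarrow> int" and M :: nat
    and S a b :: "nat \<Rightarrow> (complex ^ 'n) \<times> real \<Rightarrow> real \<Rightarrow> real"
    and d :: "nat \<Rightarrow> (complex ^ 'n) \<times> real \<Rightarrow> real \<Rightarrow> complex ^ 'n" and Ca :: real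
  assumes k_prime: "prime k" and mm: "\<And>j. \<not> int k dvd mm j" and M2: "2 \<le> M"
    and S_der: "\<And>i e z. ((\<lambda>p. S i (fst p) (snd p)) has_derivative
       (\<lambda>v. a i e z * (gsg e \<bullet> fst v) + b i e z * snd v - cxp (d i e z) (fst (fst v)))) (at (e, z))"
    and a_cont: "\<And>i. continuous_on {p. fst p \<noteq> 0} (\<lambda>p. a i (fst p) (snd p))"
    and a_bd: "\<And>i e z. \<bar>a i e z\<bar> \<le> Ca"
    and b_cont: "\<And>i. continuous_on UNIV (\<lambda>p. b i (fst p) (snd p))"
    and d_cont: "\<And>i. continuous_on UNIV (\<lambda>p. d i (fst p) (snd p))"
    and S_hom: "\<And>i c e z. 0 \<le> c \<Longrightarrow> S i (c *\<^sub>R e) z = c\<^sup>2 * S i e z"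
    and S_per: "\<And>i e z n. S i e (z + of_int n) = S i e z"
    and a_per: "\<And>i e z n. a i e (z + of_int n) = a i e z"
    and b_per: "\<And>i e z n. b i e (z + of_int n) = b i e z"
    and d_per: "\<And>i e z n. d i e (z + of_int n) = d i e z"
    and a_tw: "\<And>i w y z. a i (tw k mm w, y) z = a i (w, y) z"
    and b_tw: "\<And>i w y z. b i (tw k mm w, y) z = b i (w, y) z"
    and d_tw: "\<And>i w y z. d i (tw k mm w, y) z = tw k mm (d i (w, y) z)"
begin

text \<open>The indices below M belong to the steps, those from M to 2 * M to the redundant
  variables, which are one more in number.\<close>

definition "L = 2 * M + 1"

text \<open>Discrete action: the polygon term, the generating functions, and sigma paired with the
  increments of z. A redundant index adds kappa * |nu|^2 and the square of its y, which is 0 at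
  critical points. The variable z with index M occurs in the last pairing only and enforces sigma =
  0 at the end.\<close>

definition FF :: "real \<Rightarrow> (nat \<Rightarrow> ((complex ^ 'n) \<times> real) \<times> real) \<Rightarrow> real" where
  "FF \<kappa> x = Bq L (\<lambda>i. fst (fst (x i))) + \<kappa> * (\<Sum>j\<in>{M..<L}. (norm (fst (fst (x j))))\<^sup>2)
     + (\<Sum>i<M. S i (fst (x i)) (snd (x i)) - sg (fst (x i)) * (snd (x (Suc i)) - snd (x i)))
     + (\<Sum>j\<in>{M..<L}. (snd (fst (x j)))\<^sup>2)"

definition AA :: "(nat \<Rightarrow> ((complex ^ 'n) \<times> real) \<times> real) \<Rightarrow> nat \<Rightarrow> real" where
  "AA x i = a i (fst (x i)) (snd (x i)) - (snd (x (Suc i)) - snd (x i))"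

text \<open>The derivatives in the z-variables. Their vanishing matches sigma between consecutive
  steps and makes it 0 at the start (i = 0) and at the end (i = M).\<close>

definition Gz :: "(nat \<Rightarrow> ((complex ^ 'n) \<times> real) \<times> real) \<Rightarrow> nat \<Rightarrow> real" where
  "Gz x i = (if i < M then b i (fst (x i)) (snd (x i)) + sg (fst (x i)) else 0)
     - (if 0 < i \<and> i \<le> M then sg (fst (x (i - 1))) else 0)"

definition Ge :: "real \<Rightarrow> (nat \<Rightarrow> ((complex ^ 'n) \<times> real) \<times> real) \<Rightarrow> nat \<Rightarrow> (complex ^ 'n) \<times> real" where
  "Ge \<kappa> x i = (if i < M
     then (Jv (dlt L (\<lambda>i. fst (fst (x i))) i - d i (fst (x i)) (snd (x i))), 0) + AA x i *\<^sub>R gsg (fst (x i))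
     else (Jv (dlt L (\<lambda>i. fst (fst (x i))) i) + (2 * \<kappa>) *\<^sub>R fst (fst (x i)), 2 * snd (fst (x i))))"

definition GG :: "real \<Rightarrow> (nat \<Rightarrow> ((complex ^ 'n) \<times> real) \<times> real) \<Rightarrow> nat \<Rightarrow> ((complex ^ 'n) \<times> real) \<times> real" where
  "GG \<kappa> x i = (if i < L then (Ge \<kappa> x i, Gz x i) else 0)"

lemma M_less_L: "M < L" unfolding L_def by simp

lemma sum_split_M: "(\<Sum>i<L. f i) = (\<Sum>i<M. f i) + (\<Sum>j\<in>{M..<L}. f j)" for f :: "nat \<Rightarrow> real"
  using sum.atLeastLessThan_concat[of 0 M L f] M_less_L by (simp add: lessThan_atLeast0)

text \<open>Regroups the gradient by the summands of \<open>FF\<close>, so that its derivative can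
  be computed summand by summand.\<close>

lemma GG_inner_sum:
  "(\<Sum>i<L. GG \<kappa> y i \<bullet> v i) =
     (\<Sum>i<L. cxp (dlt L (\<lambda>i. fst (fst (y i))) i) (fst (fst (v i))))
     + \<kappa> * (\<Sum>j\<in>{M..<L}. 2 * (fst (fst (y j)) \<bullet> fst (fst (v j))))
     + (\<Sum>i<M. (a i (fst (y i)) (snd (y i)) * (gsg (fst (y i)) \<bullet> fst (v i)) + b i (fst (y i)) (snd (y i)) * snd (v i)
           - cxp (d i (fst (y i)) (snd (y i))) (fst (fst (v i))))
        - ((gsg (fst (y i)) \<bullet> fst (v i)) * (snd (y (Suc i)) - snd (y i)) + (snd (v (Suc i)) - snd (v i)) * sg (fst (y i))))
     + (\<Sum>j\<in>{M..<L}. 2 * snd (fst (y j)) * snd (fst (v j)))"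
proof -
  let ?D = "\<lambda>i. dlt L (\<lambda>i. fst (fst (y i))) i"
  have e1: "Ge \<kappa> y i \<bullet> fst (v i) = cxp (?D i) (fst (fst (v i))) - cxp (d i (fst (y i)) (snd (y i))) (fst (fst (v i)))
      + a i (fst (y i)) (snd (y i)) * (gsg (fst (y i)) \<bullet> fst (v i)) - (gsg (fst (y i)) \<bullet> fst (v i)) * (snd (y (Suc i)) - snd (y i))"
    if "i < M" for i
  proof -
    have "Ge \<kappa> y i \<bullet> fst (v i) = (Jv (?D i - d i (fst (y i)) (snd (y i))), 0) \<bullet> fst (v i) + AA y i * (gsg (fst (y i)) \<bullet> fst (v i))"
      using that by (simp add: Ge_def inner_add_left)
    also have "(Jv (?D i - d i (fst (y i)) (snd (y i))), 0) \<bullet> fst (v i) =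
       cxp (?D i) (fst (fst (v i))) - cxp (d i (fst (y i)) (snd (y i))) (fst (fst (v i)))"
      by (simp add: inner_prod_def inner_Jv cxp.diff_left)
    finally show ?thesis by (simp add: AA_def algebra_simps)
  qed
  have e2: "Ge \<kappa> y j \<bullet> fst (v j) = cxp (?D j) (fst (fst (v j))) + \<kappa> * (2 * (fst (fst (y j)) \<bullet> fst (fst (v j))))
      + 2 * snd (fst (y j)) * snd (fst (v j))" if "j \<in> {M..<L}" for j
    using that by (simp add: Ge_def inner_prod_def inner_add_left inner_Jv)
  have z: "(\<Sum>i<L. Gz y i * snd (v i)) = (\<Sum>i<M. (b i (fst (y i)) (snd (y i)) + sg (fst (y i))) * snd (v i)) - (\<Sum>i<M. sg (fst (y i)) * snd (v (Suc i)))"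
  proof -
    have "(\<Sum>i<L. Gz y i * snd (v i)) =
       (\<Sum>i<L. if i < M then (b i (fst (y i)) (snd (y i)) + sg (fst (y i))) * snd (v i) else 0)
       - (\<Sum>i<L. if 0 < i \<and> i \<le> M then sg (fst (y (i - 1))) * snd (v i) else 0)"
      unfolding sum_subtractf[symmetric] by (intro sum.cong) (auto simp: Gz_def algebra_simps)
    also have "(\<Sum>i<L. if i < M then (b i (fst (y i)) (snd (y i)) + sg (fst (y i))) * snd (v i) else 0)
        = (\<Sum>i<M. (b i (fst (y i)) (snd (y i)) + sg (fst (y i))) * snd (v i))"
      by (rule sum.mono_neutral_cong_right) (use M_less_L in auto)
    also have "(\<Sum>i<L. if 0 < i \<and> i \<le> M then sg (fst (y (i - 1))) * snd (v i) else 0)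
        = (\<Sum>i\<in>Suc ` {..<M}. sg (fst (y (i - 1))) * snd (v i))"
      by (rule sum.mono_neutral_cong_right) (use M_less_L in \<open>auto simp: image_iff Suc_le_eq gr0_conv_Suc\<close>)
    also have "\<dots> = (\<Sum>i<M. sg (fst (y i)) * snd (v (Suc i)))"
      by (subst sum.reindex) auto
    finally show ?thesis .
  qed
  have "(\<Sum>i<L. GG \<kappa> y i \<bullet> v i) = (\<Sum>i<L. Ge \<kappa> y i \<bullet> fst (v i)) + (\<Sum>i<L. Gz y i * snd (v i))"
    unfolding sum.distrib[symmetric] by (intro sum.cong) (auto simp: GG_def inner_prod_def)
  then have tot: "(\<Sum>i<L. GG \<kappa> y i \<bullet> v i) = (\<Sum>i<M. Ge \<kappa> y i \<bullet> fst (v i)) + (\<Sum>j\<in>{M..<L}. Ge \<kappa> y j \<bullet> fst (v j))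
      + (\<Sum>i<L. Gz y i * snd (v i))"
    by (simp only: sum_split_M[of "\<lambda>i. Ge \<kappa> y i \<bullet> fst (v i)"])
  have s1: "(\<Sum>i<M. Ge \<kappa> y i \<bullet> fst (v i)) = (\<Sum>i<M. cxp (?D i) (fst (fst (v i)))) - (\<Sum>i<M. cxp (d i (fst (y i)) (snd (y i))) (fst (fst (v i))))
      + (\<Sum>i<M. a i (fst (y i)) (snd (y i)) * (gsg (fst (y i)) \<bullet> fst (v i))) - (\<Sum>i<M. (gsg (fst (y i)) \<bullet> fst (v i)) * (snd (y (Suc i)) - snd (y i)))"
    unfolding sum_subtractf[symmetric] sum.distrib[symmetric] by (intro sum.cong refl e1) simp
  have s2: "(\<Sum>j\<in>{M..<L}. Ge \<kappa> y j \<bullet> fst (v j)) = (\<Sum>j\<in>{M..<L}. cxp (?D j) (fst (fst (v j))))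
      + \<kappa> * (\<Sum>j\<in>{M..<L}. 2 * (fst (fst (y j)) \<bullet> fst (fst (v j)))) + (\<Sum>j\<in>{M..<L}. 2 * snd (fst (y j)) * snd (fst (v j)))"
    unfolding sum_distrib_left sum.distrib[symmetric] by (intro sum.cong refl e2)
  have s3: "(\<Sum>i<M. (a i (fst (y i)) (snd (y i)) * (gsg (fst (y i)) \<bullet> fst (v i)) + b i (fst (y i)) (snd (y i)) * snd (v i)
           - cxp (d i (fst (y i)) (snd (y i))) (fst (fst (v i))))
        - ((gsg (fst (y i)) \<bullet> fst (v i)) * (snd (y (Suc i)) - snd (y i)) + (snd (v (Suc i)) - snd (v i)) * sg (fst (y i))))
     = (\<Sum>i<M. a i (fst (y i)) (snd (y i)) * (gsg (fst (y i)) \<bullet> fst (v i))) - (\<Sum>i<M. cxp (d i (fst (y i)) (snd (y i))) (fst (fst (v i))))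
      - (\<Sum>i<M. (gsg (fst (y i)) \<bullet> fst (v i)) * (snd (y (Suc i)) - snd (y i)))
      + ((\<Sum>i<M. (b i (fst (y i)) (snd (y i)) + sg (fst (y i))) * snd (v i)) - (\<Sum>i<M. sg (fst (y i)) * snd (v (Suc i))))"
    unfolding sum_subtractf[symmetric] sum.distrib[symmetric] by (intro sum.cong refl) (simp add: ring_distribs)
  show ?thesis
    unfolding tot s1 s2 s3 z sum_split_M[of "\<lambda>i. cxp (?D i) (fst (fst (v i)))"] by linarith
qed

lemma FF_der:
  "((\<lambda>s. FF \<kappa> (\<lambda>i. x i + s *\<^sub>R v i)) has_real_derivative
        (\<Sum>i<L. GG \<kappa> (\<lambda>i. x i + s *\<^sub>R v i) i \<bullet> v i)) (at s)"
proof -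
  let ?y = "\<lambda>s i. x i + s *\<^sub>R v i"
  have t1: "((\<lambda>s. Bq L (\<lambda>i. fst (fst (?y s i)))) has_real_derivative
      (\<Sum>i<L. cxp (dlt L (\<lambda>i. fst (fst (?y s i))) i) (fst (fst (v i))))) (at s)"
    using Bq_line_derivative[of L "\<lambda>i. fst (fst (x i))" "\<lambda>i. fst (fst (v i))" s] by simp
  have t2: "((\<lambda>s. (norm (fst (fst (?y s j))))\<^sup>2) has_real_derivative 2 * (fst (fst (?y s j)) \<bullet> fst (fst (v j)))) (at s)" for j
  proof -
    have "((\<lambda>p. fst (fst p) \<bullet> fst (fst p)) has_derivative (\<lambda>u. fst (fst (?y s j)) \<bullet> fst (fst u) + fst (fst u) \<bullet> fst (fst (?y s j)))) (at (?y s j))"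
      by (intro has_derivative_inner has_derivative_fst has_derivative_ident)
    from line_has_real_derivative[OF this] show ?thesis
      by (simp add: power2_norm_eq_inner inner_commute)
  qed
  have t3: "((\<lambda>s. S i (fst (?y s i)) (snd (?y s i))) has_real_derivative
      (a i (fst (?y s i)) (snd (?y s i)) * (gsg (fst (?y s i)) \<bullet> fst (v i)) + b i (fst (?y s i)) (snd (?y s i)) * snd (v i)
           - cxp (d i (fst (?y s i)) (snd (?y s i))) (fst (fst (v i))))) (at s)" for i
    using line_has_real_derivative[OF S_der[of i "fst (?y s i)" "snd (?y s i)", unfolded prod.collapse]] by simp
  have t4: "((\<lambda>s. sg (fst (?y s i))) has_real_derivative (gsg (fst (?y s i)) \<bullet> fst (v i))) (at s)" for i
  proof -
    have "((\<lambda>p. sg (fst p)) has_derivative (\<lambda>u. gsg (fst (?y s i)) \<bullet> fst u)) (at (?y s i))"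
      by (rule has_derivative_compose[OF has_derivative_fst[OF has_derivative_ident] sg_has_derivative])
    from line_has_real_derivative[OF this] show ?thesis .
  qed
  have t5: "((\<lambda>s. snd (?y s (Suc i)) - snd (?y s i)) has_real_derivative (snd (v (Suc i)) - snd (v i))) (at s)" for i
    by (auto intro!: derivative_eq_intros)
  have t6: "((\<lambda>s. (snd (fst (?y s j)))\<^sup>2) has_real_derivative 2 * snd (fst (?y s j)) * snd (fst (v j))) (at s)" for j
    by (auto intro!: derivative_eq_intros)
  show ?thesis unfolding FF_def GG_inner_sum
    by (intro DERIV_add DERIV_sum DERIV_diff DERIV_mult DERIV_cmult t1 t2 t3 t4 t5 t6)
qed

section \<open>Continuity, homogeneity and a periodic test for critical points\<close>

lemma config_coord: "continuous_on UNIV (\<lambda>p :: real \<times> (nat \<Rightarrow> ((complex ^ 'n) \<times> real) \<times> real). snd p i)"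
  by (rule continuous_on_product_then_coordinatewise) (intro continuous_on_snd continuous_on_id)

lemma agsg_cont: "continuous_on UNIV (\<lambda>p. a i (fst p) (snd p) *\<^sub>R gsg (fst p))"
proof (rule vanishing_mult_continuous)
  show "continuous_on UNIV (\<lambda>p :: ((complex ^ 'n) \<times> real) \<times> real. gsg (fst p))"
    by (rule continuous_on_compose2[OF continuous_on_gsg]) (auto intro!: continuous_intros)
qed (use a_cont[of i] a_bd in \<open>auto simp: gsg_eq_0_iff\<close>)

lemma dlt_cont:
  "continuous_on UNIV (\<lambda>p :: real \<times> (nat \<Rightarrow> ((complex ^ 'n) \<times> real) \<times> real). dlt L (\<lambda>i. fst (fst (snd p i))) i)"
  unfolding dlt_def by (intro continuous_intros config_coord)

lemma Gz_cont: "continuous_on UNIV (\<lambda>p :: real \<times> (nat \<Rightarrow> ((complex ^ 'n) \<times> real) \<times> real). Gz (snd p) i)" for i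
proof -
  have b: "continuous_on UNIV (\<lambda>p :: real \<times> (nat \<Rightarrow> ((complex ^ 'n) \<times> real) \<times> real). b i (fst (snd p i)) (snd (snd p i)))" for i
    using continuous_on_compose2[OF b_cont[of i] config_coord[of i]] by simp
  have s: "continuous_on UNIV (\<lambda>p :: real \<times> (nat \<Rightarrow> ((complex ^ 'n) \<times> real) \<times> real). sg (fst (snd p i)))" for i
    by (rule continuous_on_compose2[OF continuous_on_sg[of UNIV] continuous_on_fst[OF config_coord]]) auto
  show ?thesis unfolding Gz_def
    by (cases "i < M"; cases "0 < i \<and> i \<le> M") (auto intro!: continuous_intros b s)
qed

lemma Ge_cont: "continuous_on UNIV (\<lambda>p. Ge (fst p) (snd p) i)" for i
proof (cases "i < M")
  case True
  have dd: "continuous_on UNIV (\<lambda>p :: real \<times> (nat \<Rightarrow> ((complex ^ 'n) \<times> real) \<times> real). d i (fst (snd p i)) (snd (snd p i)))"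
    using continuous_on_compose2[OF d_cont[of i] config_coord[of i]] by simp
  have ag: "continuous_on UNIV (\<lambda>p :: real \<times> (nat \<Rightarrow> ((complex ^ 'n) \<times> real) \<times> real). a i (fst (snd p i)) (snd (snd p i)) *\<^sub>R gsg (fst (snd p i)))"
    using continuous_on_compose2[OF agsg_cont[of i] config_coord[of i]] by simp
  have g: "continuous_on UNIV (\<lambda>p :: real \<times> (nat \<Rightarrow> ((complex ^ 'n) \<times> real) \<times> real). gsg (fst (snd p i)))"
    by (rule continuous_on_compose2[OF continuous_on_gsg continuous_on_fst[OF config_coord]]) auto
  show ?thesis using True
    unfolding Ge_def AA_def scaleR_diff_left
    by (auto intro!: continuous_intros dd ag g dlt_cont config_coord)
next
  case False
  then show ?thesis unfolding Ge_def
    by (auto intro!: continuous_intros dlt_cont config_coord)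
qed

lemma GG_cont: "continuous_on UNIV (\<lambda>p. GG (fst p) (snd p) i)"
  unfolding GG_def by (cases "i < L") (auto intro!: continuous_intros Ge_cont Gz_cont)

lemma FF_hom:
  assumes "0 \<le> c" shows "FF \<kappa> (escale c x) = c\<^sup>2 * FF \<kappa> x"
proof -
  have B: "Bq L (\<lambda>i. c *\<^sub>R fst (fst (x i))) = c\<^sup>2 * Bq L (\<lambda>i. fst (fst (x i)))"
    unfolding Bq_def dlt_scale by (simp add: cxp.scaleR_left cxp.scaleR_right sum_distrib_left power2_eq_square algebra_simps)
  have s: "sg (c *\<^sub>R e) = c\<^sup>2 * sg e" for e :: "(complex ^ 'n) \<times> real"
    using assms by (simp add: sg_def power2_eq_square)
  show ?thesis unfolding FF_def escale_def
    using assms by (simp add: B s S_hom sum_distrib_left power_mult_distrib algebra_simps)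
qed

lemma FF_aff: "FF \<kappa>' x = FF \<kappa> x + (\<kappa>' - \<kappa>) * (\<Sum>j\<in>{M..<L}. (norm (fst (fst (x j))))\<^sup>2)"
  unfolding FF_def by (simp add: algebra_simps)

lemma sum_nu_le: "(\<Sum>j\<in>{M..<L}. (norm (fst (fst (x j))))\<^sup>2) \<le> esq L x"
proof -
  have "(\<Sum>j\<in>{M..<L}. (norm (fst (fst (x j))))\<^sup>2) \<le> (\<Sum>j\<in>{M..<L}. (norm (fst (x j)))\<^sup>2)"
    by (intro sum_mono power_mono) (metis norm_fst_le prod.collapse, simp)
  also have "\<dots> \<le> esq L x" unfolding esq_def by (intro sum_mono2) auto
  finally show ?thesis .
qed

text \<open>A substitute for the squared gradient. An integer shift of a single z-variable changes
  \<open>AA\<close> by an integer; the squared sine does not notice it, so a minimum over a compact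
  set bounds the gradient everywhere. Its zeros are critical points up to integer mismatches of z,
  and these do no harm because all maps commute with integer shifts.\<close>

definition gs :: "real \<Rightarrow> (nat \<Rightarrow> ((complex ^ 'n) \<times> real) \<times> real) \<Rightarrow> real" where
  "gs \<kappa> x = (\<Sum>i<M. (norm (dlt L (\<lambda>i. fst (fst (x i))) i - d i (fst (x i)) (snd (x i))))\<^sup>2
       + (sin (pi * AA x i) * norm (fst (x i)))\<^sup>2)
     + (\<Sum>i\<le>M. (Gz x i)\<^sup>2) + (\<Sum>j\<in>{M..<L}. (norm (Ge \<kappa> x j))\<^sup>2)"

text \<open>18 = 2 + 16: removing the multiple of \<open>gsg\<close> from the w-component costs a
  factor 2, and |sin (pi * A)| \<le> 4 * |A| costs 16.\<close>

lemma gs_le: "gs \<kappa> x \<le> 18 * (\<Sum>i<L. (norm (GG \<kappa> x i))\<^sup>2)"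
proof -
  have nG: "(norm (GG \<kappa> x i))\<^sup>2 = (norm (Ge \<kappa> x i))\<^sup>2 + (Gz x i)\<^sup>2" if "i < L" for i
    using that by (simp add: GG_def norm_Pair)
  have t1: "(norm (dlt L (\<lambda>i. fst (fst (x i))) i - d i (fst (x i)) (snd (x i))))\<^sup>2
       + (sin (pi * AA x i) * norm (fst (x i)))\<^sup>2 \<le> 18 * (norm (Ge \<kappa> x i))\<^sup>2" if "i < M" for i
  proof -
    let ?u = "dlt L (\<lambda>i. fst (fst (x i))) i - d i (fst (x i)) (snd (x i))" and ?e = "fst (x i)"
    have f: "fst (Ge \<kappa> x i) = Jv ?u + AA x i *\<^sub>R fst (gsg ?e)" and s: "snd (Ge \<kappa> x i) = AA x i * snd (gsg ?e)"
      using that by (simp_all add: Ge_def)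
    have n2: "(norm (Ge \<kappa> x i))\<^sup>2 = (norm (fst (Ge \<kappa> x i)))\<^sup>2 + (snd (Ge \<kappa> x i))\<^sup>2"
      by (simp add: norm_prod_def)
    have "norm ?u = norm (fst (Ge \<kappa> x i) - AA x i *\<^sub>R fst (gsg ?e))" unfolding f by simp
    also have "\<dots> \<le> norm (fst (Ge \<kappa> x i)) + \<bar>AA x i\<bar> * norm (fst (gsg ?e))"
      using norm_triangle_ineq4[of "fst (Ge \<kappa> x i)" "AA x i *\<^sub>R fst (gsg ?e)"] by simp
    also have "\<dots> \<le> norm (fst (Ge \<kappa> x i)) + \<bar>AA x i\<bar> * \<bar>snd (gsg ?e)\<bar>"
      by (intro add_left_mono mult_left_mono gsg_fst_le) auto
    also have "\<dots> = norm (fst (Ge \<kappa> x i)) + \<bar>snd (Ge \<kappa> x i)\<bar>" unfolding s by (simp add: abs_mult)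
    finally have "(norm ?u)\<^sup>2 \<le> (norm (fst (Ge \<kappa> x i)) + \<bar>snd (Ge \<kappa> x i)\<bar>)\<^sup>2" by (intro power_mono) auto
    also have "\<dots> \<le> 2 * (norm (Ge \<kappa> x i))\<^sup>2"
      unfolding n2 using sum_squares_bound[of "norm (fst (Ge \<kappa> x i))" "\<bar>snd (Ge \<kappa> x i)\<bar>"] by (simp add: power2_sum)
    finally have u: "(norm ?u)\<^sup>2 \<le> 2 * (norm (Ge \<kappa> x i))\<^sup>2" .
    have "\<bar>sin (pi * AA x i)\<bar> \<le> pi * \<bar>AA x i\<bar>" using abs_sin_x_le_abs_x[of "pi * AA x i"] by (simp add: abs_mult)
    also have "pi * \<bar>AA x i\<bar> \<le> 4 * \<bar>AA x i\<bar>" using pi_less_4 by (intro mult_right_mono) auto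
    finally have "\<bar>sin (pi * AA x i)\<bar> * norm ?e \<le> (4 * \<bar>AA x i\<bar>) * norm ?e" by (intro mult_right_mono) auto
    then have "\<bar>sin (pi * AA x i) * norm ?e\<bar> \<le> (4 * \<bar>AA x i\<bar>) * norm ?e" by (simp add: abs_mult)
    also have "\<dots> \<le> 4 * \<bar>snd (Ge \<kappa> x i)\<bar>"
    proof -
      have "norm ?e \<le> \<bar>snd (gsg ?e)\<bar>" using gsg_snd_ge[of ?e] by simp
      then have "(4 * \<bar>AA x i\<bar>) * norm ?e \<le> (4 * \<bar>AA x i\<bar>) * \<bar>snd (gsg ?e)\<bar>" by (intro mult_left_mono) auto
      then show ?thesis unfolding s abs_mult by simp
    qed
    finally have "(sin (pi * AA x i) * norm ?e)\<^sup>2 \<le> (4 * \<bar>snd (Ge \<kappa> x i)\<bar>)\<^sup>2"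
      by (metis abs_ge_zero power2_abs power_mono)
    also have "\<dots> \<le> 16 * (norm (Ge \<kappa> x i))\<^sup>2" unfolding n2 by (simp add: power_mult_distrib)
    finally show ?thesis using u by simp
  qed
  have "gs \<kappa> x \<le> (\<Sum>i<M. 18 * (norm (Ge \<kappa> x i))\<^sup>2) + (\<Sum>i<L. 18 * (Gz x i)\<^sup>2) + (\<Sum>j\<in>{M..<L}. 18 * (norm (Ge \<kappa> x j))\<^sup>2)"
    unfolding gs_def
  proof (intro add_mono)
    show "(\<Sum>i\<le>M. (Gz x i)\<^sup>2) \<le> (\<Sum>i<L. 18 * (Gz x i)\<^sup>2)"
    proof -
      have "(\<Sum>i\<le>M. (Gz x i)\<^sup>2) \<le> (\<Sum>i\<le>M. 18 * (Gz x i)\<^sup>2)" by (intro sum_mono) simp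
      also have "\<dots> \<le> (\<Sum>i<L. 18 * (Gz x i)\<^sup>2)" by (intro sum_mono2) (use M_less_L in auto)
      finally show ?thesis .
    qed
  qed (auto intro!: sum_mono t1)
  also have "\<dots> = 18 * (\<Sum>i<L. (norm (GG \<kappa> x i))\<^sup>2)"
    using sum_split_M[of "\<lambda>i. (norm (Ge \<kappa> x i))\<^sup>2"] nG
    by (simp add: sum_distrib_left[symmetric] sum.distrib)
  finally show ?thesis .
qed

lemma gs_cont: "continuous_on UNIV (\<lambda>p. gs (fst p) (snd p))"
proof -
  have dd: "continuous_on UNIV (\<lambda>p :: real \<times> (nat \<Rightarrow> ((complex ^ 'n) \<times> real) \<times> real). d i (fst (snd p i)) (snd (snd p i)))" for i
    using continuous_on_compose2[OF d_cont[of i] config_coord[of i]] by simp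
  have sa: "continuous_on UNIV (\<lambda>p :: real \<times> (nat \<Rightarrow> ((complex ^ 'n) \<times> real) \<times> real). h (pi * a i (fst (snd p i)) (snd (snd p i))) * norm (fst (snd p i)))"
    if h: "continuous_on UNIV h" "\<And>r. \<bar>h r\<bar> \<le> 1" for i and h :: "real \<Rightarrow> real"
  proof -
    have "continuous_on UNIV (\<lambda>q. h (pi * a i (fst q) (snd q)) *\<^sub>R norm (fst q))"
    proof (rule vanishing_mult_continuous)
      show "continuous_on {p::((complex ^ 'n) \<times> real) \<times> real. norm (fst p) \<noteq> 0} (\<lambda>q. h (pi * a i (fst q) (snd q)))"
        by (rule continuous_on_compose2[OF h(1)]) (use a_cont[of i] in \<open>auto intro!: continuous_intros\<close>)
    qed (auto intro!: continuous_intros h)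
    from continuous_on_compose2[OF this config_coord[of i]] show ?thesis by simp
  qed
  have sinc: "continuous_on UNIV (\<lambda>p :: real \<times> (nat \<Rightarrow> ((complex ^ 'n) \<times> real) \<times> real). sin (pi * AA (snd p) i) * norm (fst (snd p i)))" for i
  proof -
    \<comment> \<open>The addition theorem separates the bounded coefficient \<open>a\<close>, which
      is tamed by the norm of e, from the continuous difference of the z-variables.\<close>
    have eq: "sin (pi * AA x i) * norm (fst (x i)) =
       (sin (pi * a i (fst (x i)) (snd (x i))) * norm (fst (x i))) * cos (pi * (snd (x (Suc i)) - snd (x i)))
       - (cos (pi * a i (fst (x i)) (snd (x i))) * norm (fst (x i))) * sin (pi * (snd (x (Suc i)) - snd (x i)))" for x
      unfolding AA_def right_diff_distrib sin_diff by (simp add: algebra_simps)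
    have c1: "continuous_on UNIV (\<lambda>p :: real \<times> (nat \<Rightarrow> ((complex ^ 'n) \<times> real) \<times> real). cos (pi * (snd (snd p (Suc i)) - snd (snd p i))))"
      and c2: "continuous_on UNIV (\<lambda>p :: real \<times> (nat \<Rightarrow> ((complex ^ 'n) \<times> real) \<times> real). sin (pi * (snd (snd p (Suc i)) - snd (snd p i))))"
      by (intro continuous_intros config_coord)+
    show ?thesis unfolding eq
      by (intro continuous_on_diff continuous_on_mult c1 c2 sa[of sin] sa[of cos]) (auto intro!: continuous_intros)
  qed
  show ?thesis unfolding gs_def
    by (intro continuous_on_add continuous_on_sum continuous_on_power sinc continuous_on_norm
        continuous_on_diff dd dlt_cont Gz_cont Ge_cont)
qed

end

lemma periodic_bounded:
  fixes f :: "'e::euclidean_space \<Rightarrow> real \<Rightarrow> real"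
  assumes c: "continuous_on UNIV (\<lambda>p. f (fst p) (snd p))" and per: "\<And>e z n. f e (z + of_int n) = f e z"
  obtains C where "0 \<le> C" "\<And>e z. norm e \<le> 1 \<Longrightarrow> \<bar>f e z\<bar> \<le> C"
proof -
  have "compact (cball (0::'e) 1 \<times> {0..1::real})" by (intro compact_Times) auto
  then have "compact ((\<lambda>p. f (fst p) (snd p)) ` (cball (0::'e) 1 \<times> {0..1::real}))"
    by (intro compact_continuous_image continuous_on_subset[OF c]) auto
  then have "bounded ((\<lambda>p. f (fst p) (snd p)) ` (cball (0::'e) 1 \<times> {0..1::real}))"
    by (rule compact_imp_bounded)
  then obtain C where "\<forall>r\<in>(\<lambda>p. f (fst p) (snd p)) ` (cball (0::'e) 1 \<times> {0..1::real}). norm r \<le> C"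
    unfolding bounded_iff by blast
  then have C: "\<bar>f (fst p) (snd p)\<bar> \<le> C" if "p \<in> cball (0::'e) 1 \<times> {0..1::real}" for p
    using that by auto
  have "\<bar>f e z\<bar> \<le> C" if "norm e \<le> 1" for e z
  proof -
    have "f e z = f e (frac z)" using per[of e "frac z" "\<lfloor>z\<rfloor>"] by (simp add: frac_def)
    moreover have "(e, frac z) \<in> cball (0::'e) 1 \<times> {0..1::real}"
      using that frac_lt_1[of z] by (auto simp: less_imp_le)
    ultimately show ?thesis using C by fastforce
  qed
  moreover from this[of 0 0] have "0 \<le> C" by simp
  ultimately show thesis using that by blast
qed

text \<open>Compare |y| with K / D: beyond this value the cubic term wins, below it the quadratic
  term is at most K * (K / D)^2.\<close>

lemma cubic_bound:
  fixes y K D :: real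
  assumes "0 \<le> K" "0 < D"
  shows "K * y\<^sup>2 - D * \<bar>y\<bar> ^ 3 \<le> K ^ 3 / D\<^sup>2"
proof (cases "K / D \<le> \<bar>y\<bar>")
  case True
  then have "K \<le> D * \<bar>y\<bar>" using assms by (simp add: field_simps)
  then have "K * y\<^sup>2 \<le> (D * \<bar>y\<bar>) * y\<^sup>2" by (intro mult_right_mono) auto
  also have "\<dots> = D * \<bar>y\<bar> ^ 3" by (simp add: power3_eq_cube power2_eq_square)
  finally show ?thesis using assms by (smt (verit) divide_nonneg_nonneg zero_le_power)
next
  case False
  then have "\<bar>y\<bar>\<^sup>2 \<le> (K / D)\<^sup>2" by (intro power_mono) auto
  then have "K * y\<^sup>2 \<le> K * (K / D)\<^sup>2" using assms by (intro mult_left_mono) auto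
  also have "\<dots> = K ^ 3 / D\<^sup>2" by (simp add: power3_eq_cube power2_eq_square)
  moreover have "0 \<le> D * \<bar>y\<bar> ^ 3" using assms by simp
  ultimately show ?thesis by linarith
qed

lemma sin_pi_shift_squared: "(sin (pi * (A + of_int n)))\<^sup>2 = (sin (pi * A))\<^sup>2"
proof -
  have "sin (pi * of_int n) = 0" "(cos (pi * of_int n))\<^sup>2 = 1"
    using sin_npi_int[of n] cos_npi_int[of n] by auto
  then show ?thesis by (simp add: distrib_left sin_add power_mult_distrib)
qed

context discrete_action
begin

lemma gs_nonneg: "0 \<le> gs \<kappa> x"
  unfolding gs_def by (intro add_nonneg_nonneg sum_nonneg) auto

text \<open>Representative with all z-variables in [0, 1). Since \<open>gs\<close> and
  \<open>esq\<close> are unchanged, compactness has to handle these configurations only.\<close>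

definition red :: "(nat \<Rightarrow> ((complex ^ 'n) \<times> real) \<times> real) \<Rightarrow> nat \<Rightarrow> ((complex ^ 'n) \<times> real) \<times> real" where
  "red x i = (if i < L then (fst (x i), frac (snd (x i))) else 0)"

lemma dlt_cong: "(\<And>i. i < L \<Longrightarrow> m i = m' i) \<Longrightarrow> dlt L m i = dlt L m' i"
  unfolding dlt_def by (intro sum.cong) auto

lemma gs_red: "gs \<kappa> (red x) = gs \<kappa> x"
proof -
  have fr: "snd (x i) = frac (snd (x i)) + of_int \<lfloor>snd (x i)\<rfloor>" for i by (simp add: frac_def)
  have d1: "dlt L (\<lambda>i. fst (fst (red x i))) i = dlt L (\<lambda>i. fst (fst (x i))) i" for i
    by (rule dlt_cong) (simp add: red_def)
  have f1: "fst (red x i) = fst (x i)" and z1: "snd (red x i) = frac (snd (x i))" if "i < L" for i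
    using that by (auto simp: red_def)
  have b1: "b i e (frac (snd (x i))) = b i e (snd (x i))" and a1: "a i e (frac (snd (x i))) = a i e (snd (x i))"
    and dd1: "d i e (frac (snd (x i))) = d i e (snd (x i))" for i e
    using b_per[of i e "frac (snd (x i))" "\<lfloor>snd (x i)\<rfloor>"] a_per[of i e "frac (snd (x i))" "\<lfloor>snd (x i)\<rfloor>"]
      d_per[of i e "frac (snd (x i))" "\<lfloor>snd (x i)\<rfloor>"] fr[of i] by auto
  have A: "(sin (pi * AA (red x) i))\<^sup>2 = (sin (pi * AA x i))\<^sup>2" if "i < M" for i
  proof -
    have i: "i < L" "Suc i < L" using that M_less_L by auto
    have "AA (red x) i = AA x i + of_int (\<lfloor>snd (x (Suc i))\<rfloor> - \<lfloor>snd (x i)\<rfloor>)"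
      unfolding AA_def f1[OF i(1)] z1[OF i(1)] z1[OF i(2)] a1 by (simp add: frac_def)
    then show ?thesis by (simp only: sin_pi_shift_squared)
  qed
  have Gz1: "Gz (red x) i = Gz x i" if "i \<le> M" for i
    using that M_less_L f1[of i] f1[of "i - 1"] z1[of i] b1[of i "fst (x i)"] by (auto simp: Gz_def)
  have Ge1: "Ge \<kappa> (red x) j = Ge \<kappa> x j" if "j \<in> {M..<L}" for j
    using that f1[of j] by (simp add: Ge_def d1)
  have t: "i < M \<Longrightarrow> i < L" for i using M_less_L by simp
  show ?thesis unfolding gs_def
    by (intro arg_cong2[where f = "(+)"] sum.cong refl)
       (auto simp: d1 f1[OF t] z1[OF t] dd1 A power_mult_distrib Gz1 Ge1)
qed

lemma esq_red: "esq L (red x) = esq L x"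
  unfolding esq_def by (intro sum.cong) (auto simp: red_def)

lemma gradient_lower_bound:
  assumes no: "\<And>\<kappa> x. esq L x = 1 \<Longrightarrow> gs \<kappa> x \<noteq> 0"
  obtains \<delta> where "\<delta> > 0" "\<And>\<kappa> x. \<bar>\<kappa>\<bar> \<le> \<kappa>0 \<Longrightarrow> esq L x = 1 \<Longrightarrow> \<delta> \<le> (\<Sum>i<L. (norm (GG \<kappa> x i))\<^sup>2)"
proof -
  let ?U = "{x :: nat \<Rightarrow> ((complex ^ 'n) \<times> real) \<times> real. esq L x = 1 \<and> (\<forall>i\<ge>L. x i = 0) \<and> (\<forall>i. \<bar>snd (x i)\<bar> \<le> 1)}"
  let ?C = "{-\<kappa>0..\<kappa>0} \<times> ?U"
  have comp: "compact ?C" by (intro compact_Times compact_unit_config) auto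
  have "\<exists>\<delta>>0. \<forall>p\<in>?C. \<delta> \<le> gs (fst p) (snd p)"
  proof (cases "?C = {}")
    case False
    then obtain p where p: "p \<in> ?C" "\<forall>q\<in>?C. gs (fst p) (snd p) \<le> gs (fst q) (snd q)"
      using continuous_attains_inf[OF comp False continuous_on_subset[OF gs_cont]] by auto
    have "gs (fst p) (snd p) \<noteq> 0" using no[of "snd p" "fst p"] p(1) by auto
    then have "gs (fst p) (snd p) > 0" using gs_nonneg[of "fst p" "snd p"] by linarith
    then show ?thesis using p(2) by blast
  next
    case True
    then show ?thesis by (intro exI[of _ 1]) (simp only: ball_empty, simp)
  qed
  then obtain \<delta> where \<delta>: "\<delta> > 0" "\<And>p. p \<in> ?C \<Longrightarrow> \<delta> \<le> gs (fst p) (snd p)" by blast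
  have "\<delta> / 18 \<le> (\<Sum>i<L. (norm (GG \<kappa> x i))\<^sup>2)" if "\<bar>\<kappa>\<bar> \<le> \<kappa>0" "esq L x = 1" for \<kappa> x
  proof -
    have "\<bar>frac z\<bar> \<le> 1" for z :: real using frac_lt_1[of z] frac_ge_0[of z] by linarith
    then have "\<forall>i. \<bar>snd (red x i)\<bar> \<le> 1" by (simp add: red_def)
    moreover have "\<forall>i\<ge>L. red x i = 0" by (simp add: red_def)
    ultimately have "(\<kappa>, red x) \<in> ?C" using that esq_red[of x] by (simp add: abs_le_iff minus_le_iff)
    then have "\<delta> \<le> gs \<kappa> (red x)" using \<delta>(2) by fastforce
    then have "\<delta> \<le> gs \<kappa> x" by (simp only: gs_red)
    then show ?thesis using gs_le[of \<kappa> x] by simp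
  qed
  then show thesis using that[of "\<delta> / 18"] \<delta>(1) by simp
qed

lemma S_cont: "continuous_on UNIV (\<lambda>p. S i (fst p) (snd p))"
proof -
  have "isCont (\<lambda>p. S i (fst p) (snd p)) (e, z)" for e z
    using has_derivative_continuous[OF S_der] by simp
  then show ?thesis by (auto simp: continuous_on_eq_continuous_at)
qed

lemma S_quadratic_bound:
  obtains C where "0 \<le> C" "\<And>i e z. i < M \<Longrightarrow> \<bar>S i e z\<bar> \<le> C * (norm e)\<^sup>2"
proof -
  have "\<exists>C\<ge>0. \<forall>e z. norm e \<le> 1 \<longrightarrow> \<bar>S i e z\<bar> \<le> C" for i
    by (rule periodic_bounded[OF S_cont[of i] S_per]) auto
  then obtain C where C: "\<And>i. 0 \<le> C i" "\<And>i e z. norm e \<le> 1 \<Longrightarrow> \<bar>S i e z\<bar> \<le> C i" by metis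
  have "\<bar>S i e z\<bar> \<le> sum C {..<M} * (norm e)\<^sup>2" if "i < M" for i e z
  proof (cases "e = 0")
    case True
    then show ?thesis using S_hom[of 0 i e z] by simp
  next
    case False
    have "S i e z = (norm e)\<^sup>2 * S i (e /\<^sub>R norm e) z" using S_hom[of "norm e" i "e /\<^sub>R norm e" z] False by simp
    moreover have "\<bar>S i (e /\<^sub>R norm e) z\<bar> \<le> C i" by (rule C(2)) (use False in simp)
    moreover have "C i \<le> sum C {..<M}" using that C(1) by (intro member_le_sum) auto
    ultimately have "\<bar>S i e z\<bar> = (norm e)\<^sup>2 * \<bar>S i (e /\<^sub>R norm e) z\<bar>" "\<bar>S i (e /\<^sub>R norm e) z\<bar> \<le> sum C {..<M}"
      by (simp_all add: abs_mult)
    then show ?thesis using mult_left_mono[of "\<bar>S i (e /\<^sub>R norm e) z\<bar>" "sum C {..<M}" "(norm e)\<^sup>2"]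
      by (simp add: mult.commute)
  qed
  then show thesis using that[of "sum C {..<M}"] C(1) by (simp add: sum_nonneg)
qed

text \<open>Supplies the speed bound that limits the drift of the z-variables during the
  deformation.\<close>

lemma Gz_bound:
  obtains C where "\<And>\<kappa> x i. esq L x = 1 \<Longrightarrow> \<bar>snd (GG \<kappa> x i)\<bar> \<le> C"
proof -
  have "\<exists>C\<ge>0. \<forall>e z. norm e \<le> 1 \<longrightarrow> \<bar>b i e z\<bar> \<le> C" for i
    by (rule periodic_bounded[OF b_cont[of i] b_per]) auto
  then obtain C where C: "\<And>i. 0 \<le> C i" "\<And>i e z. norm e \<le> 1 \<Longrightarrow> \<bar>b i e z\<bar> \<le> C i" by metis
  have "\<bar>snd (GG \<kappa> x i)\<bar> \<le> sum C {..<M} + 2" if x: "esq L x = 1" for \<kappa> x i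
  proof -
    have n1: "norm (fst (x i)) \<le> 1" if "i < L" for i
    proof -
      have "(norm (fst (x i)))\<^sup>2 \<le> esq L x" unfolding esq_def
        using member_le_sum[of i "{..<L}" "\<lambda>i. (norm (fst (x i)))\<^sup>2"] that by simp
      then show ?thesis using x by (simp add: power_le_one_iff)
    qed
    have s1: "\<bar>sg e\<bar> \<le> 1" if "norm e \<le> 1" for e :: "(complex ^ 'n) \<times> real"
      unfolding sg_def abs_mult using that abs_snd_le_norm[of e] by (simp add: mult_le_one)
    have c0: "0 \<le> sum C {..<M}" using C(1) by (simp add: sum_nonneg)
    have b1: "\<bar>b i (fst (x i)) (snd (x i))\<bar> \<le> sum C {..<M}" if "i < M" for i
    proof -
      have "C i \<le> sum C {..<M}" using that C(1) by (intro member_le_sum) auto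
      then show ?thesis using C(2)[OF n1[of i], of i "snd (x i)"] that M_less_L by linarith
    qed
    have g1: "\<bar>if i < M then b i (fst (x i)) (snd (x i)) + sg (fst (x i)) else 0\<bar> \<le> sum C {..<M} + 1"
      using b1[of i] s1[OF n1[of i]] c0 M_less_L by auto
    have g2: "\<bar>if 0 < i \<and> i \<le> M then sg (fst (x (i - 1))) else 0\<bar> \<le> 1"
      using s1[OF n1[of "i - 1"]] M_less_L by auto
    have "\<bar>Gz x i\<bar> \<le> sum C {..<M} + 2" unfolding Gz_def using g1 g2 by linarith
    then show ?thesis using c0 by (simp add: GG_def)
  qed
  then show thesis using that by blast
qed

text \<open>For w = 0 the norm of e is |y|, so an increment D * y of z turns the pairing with sigma
  into D * |y|^3, while the polygon term sees only the redundant vectors.\<close>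

lemma FF_mu_zero:
  assumes m0: "\<And>i. i < M \<Longrightarrow> fst (fst (x i)) = 0"
    and dz: "\<And>i. i < M \<Longrightarrow> snd (x (Suc i)) - snd (x i) = D * snd (fst (x i))"
  shows "FF \<kappa> x = Bq L (\<lambda>i. fst (fst (x i))) + \<kappa> * (\<Sum>j\<in>{M..<L}. (norm (fst (fst (x j))))\<^sup>2)
     + (\<Sum>i<M. S i (fst (x i)) (snd (x i)) - D * \<bar>snd (fst (x i))\<bar> ^ 3) + (\<Sum>j\<in>{M..<L}. (snd (fst (x j)))\<^sup>2)"
    and "\<bar>Bq L (\<lambda>i. fst (fst (x i)))\<bar> \<le> real L * (\<Sum>j\<in>{M..<L}. (norm (fst (fst (x j))))\<^sup>2)"
    and "esq L x = (\<Sum>i<M. (snd (fst (x i)))\<^sup>2) + (\<Sum>j\<in>{M..<L}. (norm (fst (fst (x j))))\<^sup>2) + (\<Sum>j\<in>{M..<L}. (snd (fst (x j)))\<^sup>2)"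
    and "\<And>i. i < M \<Longrightarrow> (norm (fst (x i)))\<^sup>2 = (snd (fst (x i)))\<^sup>2"
proof -
  have nn: "(norm e)\<^sup>2 = (norm (fst e))\<^sup>2 + (snd e)\<^sup>2" for e :: "(complex ^ 'n) \<times> real"
    by (simp add: norm_prod_def)
  show n1: "(norm (fst (x i)))\<^sup>2 = (snd (fst (x i)))\<^sup>2" if "i < M" for i using m0[OF that] by (simp add: nn)
  then have n2: "norm (fst (x i)) = \<bar>snd (fst (x i))\<bar>" if "i < M" for i
    using that by (metis abs_norm_cancel real_sqrt_abs)
  show "FF \<kappa> x = Bq L (\<lambda>i. fst (fst (x i))) + \<kappa> * (\<Sum>j\<in>{M..<L}. (norm (fst (fst (x j))))\<^sup>2)
     + (\<Sum>i<M. S i (fst (x i)) (snd (x i)) - D * \<bar>snd (fst (x i))\<bar> ^ 3) + (\<Sum>j\<in>{M..<L}. (snd (fst (x j)))\<^sup>2)"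
  proof -
    have "sg (fst (x i)) * (snd (x (Suc i)) - snd (x i)) = D * \<bar>snd (fst (x i))\<bar> ^ 3" if "i < M" for i
    proof -
      have "sg (fst (x i)) * (snd (x (Suc i)) - snd (x i)) = D * (snd (fst (x i)) * snd (fst (x i))) * \<bar>snd (fst (x i))\<bar>"
        unfolding dz[OF that] sg_def n2[OF that] by simp
      also have "snd (fst (x i)) * snd (fst (x i)) = \<bar>snd (fst (x i))\<bar> * \<bar>snd (fst (x i))\<bar>" by simp
      finally show ?thesis by (simp only: power3_eq_cube mult.assoc)
    qed
    then show ?thesis unfolding FF_def by simp
  qed
  have "(\<Sum>i<L. (norm (fst (fst (x i))))\<^sup>2) = (\<Sum>j\<in>{M..<L}. (norm (fst (fst (x j))))\<^sup>2)"
    unfolding sum_split_M using m0 by simp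
  then show "\<bar>Bq L (\<lambda>i. fst (fst (x i)))\<bar> \<le> real L * (\<Sum>j\<in>{M..<L}. (norm (fst (fst (x j))))\<^sup>2)"
    using abs_Bq_le[of L "\<lambda>i. fst (fst (x i))"] by simp
  show "esq L x = (\<Sum>i<M. (snd (fst (x i)))\<^sup>2) + (\<Sum>j\<in>{M..<L}. (norm (fst (fst (x j))))\<^sup>2) + (\<Sum>j\<in>{M..<L}. (snd (fst (x j)))\<^sup>2)"
    unfolding esq_def sum_split_M using n1 by (simp add: nn sum.distrib)
qed

text \<open>Both constants come from here. A kappa of size L + 1 absorbs the polygon term and leaves
  one copy of |nu|^2; a large D lets the cubic term beat the generating functions up to an error
  below 1 minus the sum of the y^2 of the steps. The normalization \<open>esq L x = 1\<close> then
  decides the sign: z-increments D * y give negative values, z-increments -D * y positive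
  ones.\<close>

lemma FF_sign:
  assumes C: "0 \<le> C" "\<And>i e z. i < M \<Longrightarrow> \<bar>S i e z\<bar> \<le> C * (norm e)\<^sup>2"
    and D: "0 < D" "real M * (C + 1) ^ 3 < D\<^sup>2" and e1: "esq L x = 1"
    and m0: "\<And>i. i < M \<Longrightarrow> fst (fst (x i)) = 0"
  shows FF_neg: "(\<And>j. j \<in> {M..<L} \<Longrightarrow> snd (fst (x j)) = 0) \<Longrightarrow>
       (\<And>i. i < M \<Longrightarrow> snd (x (Suc i)) - snd (x i) = D * snd (fst (x i))) \<Longrightarrow> FF (- (real L + 1)) x < 0"
    and FF_pos: "(\<And>i. i < M \<Longrightarrow> snd (x (Suc i)) - snd (x i) = - D * snd (fst (x i))) \<Longrightarrow> FF (real L + 1) x > 0"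
proof -
  let ?V = "\<Sum>j\<in>{M..<L}. (norm (fst (fst (x j))))\<^sup>2" and ?Y = "\<Sum>i<M. (snd (fst (x i)))\<^sup>2" and ?E = "\<Sum>j\<in>{M..<L}. (snd (fst (x j)))\<^sup>2"
  have small: "real M * ((C + 1) ^ 3 / D\<^sup>2) < 1" using D by (simp add: field_simps)
  have cb: "(\<Sum>i<M. C * (snd (fst (x i)))\<^sup>2 - D * \<bar>snd (fst (x i))\<bar> ^ 3) < 1 - ?Y"
  proof -
    have "(\<Sum>i<M. C * (snd (fst (x i)))\<^sup>2 - D * \<bar>snd (fst (x i))\<bar> ^ 3) + ?Y = (\<Sum>i<M. (C + 1) * (snd (fst (x i)))\<^sup>2 - D * \<bar>snd (fst (x i))\<bar> ^ 3)"
      unfolding sum.distrib[symmetric] by (intro sum.cong) (auto simp: algebra_simps)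
    also have "\<dots> \<le> (\<Sum>i<M. (C + 1) ^ 3 / D\<^sup>2)" using C D by (intro sum_mono cubic_bound) auto
    also have "\<dots> < 1" using small by simp
    finally show ?thesis by simp
  qed
  show "FF (- (real L + 1)) x < 0" if y0: "\<And>j. j \<in> {M..<L} \<Longrightarrow> snd (fst (x j)) = 0"
    and dz: "\<And>i. i < M \<Longrightarrow> snd (x (Suc i)) - snd (x i) = D * snd (fst (x i))"
  proof -
    have F1: "FF \<kappa> x = Bq L (\<lambda>i. fst (fst (x i))) + \<kappa> * ?V
        + (\<Sum>i<M. S i (fst (x i)) (snd (x i)) - D * \<bar>snd (fst (x i))\<bar> ^ 3) + ?E" for \<kappa>
      by (rule FF_mu_zero(1)[where D = D]) (use m0 dz in auto)
    have F2: "\<bar>Bq L (\<lambda>i. fst (fst (x i)))\<bar> \<le> real L * ?V" by (rule FF_mu_zero(2)[where D = D]) (use m0 dz in auto)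
    have F3: "esq L x = ?Y + ?V + ?E" by (rule FF_mu_zero(3)[where D = D]) (use m0 dz in auto)
    have F4: "(norm (fst (x i)))\<^sup>2 = (snd (fst (x i)))\<^sup>2" if "i < M" for i
      by (rule FF_mu_zero(4)[where D = D]) (use m0 dz that in auto)
    have E: "?E = 0" using y0 by simp
    have "(\<Sum>i<M. S i (fst (x i)) (snd (x i)) - D * \<bar>snd (fst (x i))\<bar> ^ 3) \<le> (\<Sum>i<M. C * (snd (fst (x i)))\<^sup>2 - D * \<bar>snd (fst (x i))\<bar> ^ 3)"
    proof (intro sum_mono diff_right_mono)
      fix i assume "i \<in> {..<M}"
      then show "S i (fst (x i)) (snd (x i)) \<le> C * (snd (fst (x i)))\<^sup>2"
        using C(2)[of i "fst (x i)" "snd (x i)"] F4[of i] by auto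
    qed
    then have "FF (- (real L + 1)) x < real L * ?V - (real L + 1) * ?V + (1 - ?Y)"
      using F2 cb unfolding F1 E by linarith
    also have "\<dots> = 1 - ?Y - ?V" by (simp add: algebra_simps)
    also have "\<dots> = 0" using F3 e1 E by simp
    finally show ?thesis .
  qed
  show "FF (real L + 1) x > 0" if dz: "\<And>i. i < M \<Longrightarrow> snd (x (Suc i)) - snd (x i) = - D * snd (fst (x i))"
  proof -
    have F1: "FF \<kappa> x = Bq L (\<lambda>i. fst (fst (x i))) + \<kappa> * ?V
        + (\<Sum>i<M. S i (fst (x i)) (snd (x i)) - (- D) * \<bar>snd (fst (x i))\<bar> ^ 3) + ?E" for \<kappa>
      by (rule FF_mu_zero(1)[where D = "- D"]) (use m0 dz in auto)
    have F2: "\<bar>Bq L (\<lambda>i. fst (fst (x i)))\<bar> \<le> real L * ?V" by (rule FF_mu_zero(2)[where D = "- D"]) (use m0 dz in auto)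
    have F3: "esq L x = ?Y + ?V + ?E" by (rule FF_mu_zero(3)[where D = "- D"]) (use m0 dz in auto)
    have F4: "(norm (fst (x i)))\<^sup>2 = (snd (fst (x i)))\<^sup>2" if "i < M" for i
      by (rule FF_mu_zero(4)[where D = "- D"]) (use m0 dz that in auto)
    have "(\<Sum>i<M. S i (fst (x i)) (snd (x i)) - (- D) * \<bar>snd (fst (x i))\<bar> ^ 3) \<ge> (\<Sum>i<M. - (C * (snd (fst (x i)))\<^sup>2 - D * \<bar>snd (fst (x i))\<bar> ^ 3))"
    proof (intro sum_mono)
      fix i assume "i \<in> {..<M}"
      then show "- (C * (snd (fst (x i)))\<^sup>2 - D * \<bar>snd (fst (x i))\<bar> ^ 3) \<le> S i (fst (x i)) (snd (x i)) - (- D) * \<bar>snd (fst (x i))\<bar> ^ 3"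
        using C(2)[of i "fst (x i)" "snd (x i)"] F4[of i] by auto
    qed
    then have "FF (real L + 1) x > - (real L * ?V) + (real L + 1) * ?V - (1 - ?Y) + ?E"
      using F2 cb unfolding sum_negf F1 by linarith
    moreover have "- (real L * ?V) + (real L + 1) * ?V - (1 - ?Y) + ?E = ?Y + ?V + ?E - 1" by (simp add: algebra_simps)
    ultimately show ?thesis using F3 e1 by simp
  qed
qed

definition Tp :: "((complex ^ 'n) \<times> real) \<times> real \<Rightarrow> ((complex ^ 'n) \<times> real) \<times> real" where
  "Tp p = ((tw k mm (fst (fst p)), snd (fst p)), snd p)"

lemma norm_tw_pair: "norm (tw k mm w, y::real) = norm (w, y)"
  by (simp add: norm_Pair)

lemma GG_Tp: "GG \<kappa> (\<lambda>i. Tp (x i)) i = Tp (GG \<kappa> x i)"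
proof -
  have s: "sg (tw k mm w, y) = sg (w, y)" for w y by (simp add: sg_def norm_tw_pair)
  have g: "gsg (tw k mm w, y) = (tw k mm (fst (gsg (w, y))), snd (gsg (w, y)))" for w y
    by (simp add: gsg_def norm_tw_pair)
  have dl: "dlt L (\<lambda>i. tw k mm (m i)) i = tw k mm (dlt L m i)" for m i
    unfolding dlt_def by (simp add: tw_sum)
  have z: "Gz (\<lambda>i. Tp (x i)) i = Gz x i"
    unfolding Gz_def Tp_def by (auto simp: s b_tw)
  have A: "AA (\<lambda>i. Tp (x i)) i = AA x i" unfolding AA_def Tp_def by (simp add: a_tw)
  have e: "Ge \<kappa> (\<lambda>i. Tp (x i)) i = (tw k mm (fst (Ge \<kappa> x i)), snd (Ge \<kappa> x i))"
    unfolding Ge_def A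
    by (auto simp: Tp_def dl d_tw g tw_Jv[symmetric])
  show ?thesis unfolding GG_def by (simp add: z e) (simp add: Tp_def zero_prod_def)
qed

lemma esq_Tp: "esq L (\<lambda>i. Tp (x i)) = esq L x"
  unfolding esq_def Tp_def by (intro sum.cong) (auto simp: norm_Pair norm_prod_def)

text \<open>A configuration with all w equal to 0 is fixed by the action, hence by equivariance so
  is its gradient, and fixed vectors have w = 0.\<close>

lemma GG_fixed:
  assumes "\<And>i. fst (fst (x i)) = 0" shows "fst (fst (GG \<kappa> x i)) = 0"
proof -
  have "(\<lambda>i. Tp (x i)) = x" using assms by (auto simp: Tp_def prod_eq_iff)
  then have "Tp (GG \<kappa> x i) = GG \<kappa> x i" using GG_Tp[of \<kappa> x i] by simp
  then have "tw k mm (fst (fst (GG \<kappa> x i))) = fst (fst (GG \<kappa> x i))" by (metis Tp_def fst_conv)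
  then show ?thesis by (rule tw_fixed[OF k_prime mm])
qed

end

section \<open>The equivariant map between spheres\<close>

lemma nsphere_top_of_set:
  "nsphere n = top_of_set {x. (\<Sum>i\<le>n. (x i)\<^sup>2) = 1 \<and> (\<forall>i>n. x i = 0)}"
  by (simp add: nsphere euclidean_product_topology)

lemma sum_pairs:
  fixes g :: "nat \<Rightarrow> real"
  shows "(\<Sum>r<M + 2 * T. g r) = (\<Sum>r<M. g r) + (\<Sum>t<T. g (M + 2 * t) + g (Suc (M + 2 * t)))"
  by (induction T) (auto simp: algebra_simps)

lemma cyc_rot_sum_squares:
  "(\<Sum>r\<le>n + 2 * D. (cyc_rot p n k m v r)\<^sup>2) = (\<Sum>r\<le>n + 2 * D. (v r)\<^sup>2)"
  unfolding cyc_rot_def by (rule pair_rot_sum_squares)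

lemma cyc_rot_divide: "cyc_rot p n k m (\<lambda>r. v r / s) = (\<lambda>r. cyc_rot p n k m v r / s)"
proof
  fix r
  show "cyc_rot p n k m (\<lambda>r. v r / s) r = cyc_rot p n k m v r / s"
    unfolding cyc_rot_def
    by (rule pair_index_cases[of r n]) (auto simp: pair_rot_even pair_rot_odd diff_divide_distrib add_divide_distrib)
qed

context discrete_action
begin

text \<open>Without a zero of \<open>gs\<close> the deformation is available. \<open>cfg\<close>
  places a sphere with Dd + 1 complex coordinates in the negative sublevel for
  -\<open>\<kappa>0\<close>, \<open>outv\<close> has no zero on the unit configurations in the
  negative sublevel for \<open>\<kappa>0\<close> and takes values with Dd complex coordinates, and
  the normalized composite contradicts the Borsuk--Ulam theorem.\<close>

theorem exists_critical:
  obtains \<kappa> x where "esq L x = 1" "gs \<kappa> x = 0"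
proof (rule ccontr)
  assume neg: "\<not> thesis"
  have no: "gs \<kappa> x \<noteq> 0" if "esq L x = 1" for \<kappa> x using neg that \<open>\<And>\<kappa> x. esq L x = 1 \<Longrightarrow> gs \<kappa> x = 0 \<Longrightarrow> thesis\<close> by blast
  define \<kappa>0 where "\<kappa>0 = real L + 1"
  have \<kappa>0: "0 < \<kappa>0" unfolding \<kappa>0_def by simp
  obtain \<delta> where \<delta>: "\<delta> > 0" "\<And>\<kappa> x. \<bar>\<kappa>\<bar> \<le> \<kappa>0 \<Longrightarrow> esq L x = 1 \<Longrightarrow> \<delta> \<le> (\<Sum>i<L. (norm (GG \<kappa> x i))\<^sup>2)"
    using gradient_lower_bound[OF no] by metis
  obtain Cz where Cz: "\<And>\<kappa> x i. esq L x = 1 \<Longrightarrow> \<bar>snd (GG \<kappa> x i)\<bar> \<le> Cz" using Gz_bound by blast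
  obtain C where C: "0 \<le> C" "\<And>i e z. i < M \<Longrightarrow> \<bar>S i e z\<bar> \<le> C * (norm e)\<^sup>2" using S_quadratic_bound by blast
  define D where "D = real M * (C + 1) ^ 3 + 1"
  have D1: "1 \<le> D" unfolding D_def using C by simp
  have D: "0 < D" "real M * (C + 1) ^ 3 < D\<^sup>2"
  proof -
    have "real M * (C + 1) ^ 3 < D" unfolding D_def by simp
    also have "D \<le> D\<^sup>2" using D1 by (simp add: power2_eq_square mult_le_cancel_left1)
    finally show "real M * (C + 1) ^ 3 < D\<^sup>2" .
  qed (use D1 in simp)
  define N0 where "N0 = CARD('n)"
  have N0: "0 < N0" unfolding N0_def by simp
  obtain ix :: "'n \<Rightarrow> nat" where ix: "bij_betw ix UNIV {..<N0}"
    using ex_bij_betw_finite_nat[of "UNIV :: 'n set"] by (auto simp: N0_def lessThan_atLeast0)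
  have ixl: "ix l < N0" for l using ix unfolding bij_betw_def by auto
  define ixi where "ixi = inv_into UNIV ix"
  have ixi: "ixi (ix l) = l" for l unfolding ixi_def using ix by (simp add: bij_betw_def)
  \<comment> \<open>The vectors of the steps have Dd complex coordinates in total; the redundant
    ones have (M + 1) * N0 \<ge> Dd + 1, of which the first Dd + 1 are used.\<close>
  define Dd where "Dd = M * N0"
  define n where "n = M - 1"
  have n: "Suc n = M" "0 < n" unfolding n_def using M2 by auto
  have nlt: "{..n + 2 * t} = {..<M + 2 * t}" for t using n(1) by (auto simp: less_Suc_eq_le[symmetric])
  \<comment> \<open>Complex coordinates are numbered t = j * N0 + ix l, so the weight depends on t
    modulo N0.\<close>
  define kk where "kk t = mm (ixi (t mod N0))" for t
  have kk: "\<not> int k dvd kk j" for j unfolding kk_def by (rule mm)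
  let ?R = "cyc_rot k n kk 1"
  define ang where "ang l = 2 * pi * of_int (mm l) / of_nat k" for l
  \<comment> \<open>The real coordinates become the y of the steps, z is the running sum that has
    increments D * y, and the complex coordinates fill the redundant vectors.\<close>
  define cfg :: "(nat \<Rightarrow> real) \<Rightarrow> nat \<Rightarrow> ((complex ^ 'n) \<times> real) \<times> real" where
    "cfg c i = (((\<chi> l. if M \<le> i \<and> i < L \<and> (i - M) * N0 + ix l \<le> Dd
         then Complex (c (M + 2 * ((i - M) * N0 + ix l))) (c (Suc (M + 2 * ((i - M) * N0 + ix l)))) else 0),
        if i < M then c i else 0), if i \<le> M then D * (\<Sum>j<i. c j) else 0)" for c i
  \<comment> \<open>Its common zeros are the configurations with w = 0 at all steps and z-increments
    -D * y, where \<open>FF_pos\<close> excludes a negative value.\<close>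
  define outv :: "(nat \<Rightarrow> ((complex ^ 'n) \<times> real) \<times> real) \<Rightarrow> nat \<Rightarrow> real" where
    "outv x r = (if r < M then D * snd (fst (x r)) + (snd (x (Suc r)) - snd (x r))
       else if r < M + 2 * Dd then
         (let t = (r - M) div 2; w = fst (fst (x (t div N0))) $ ixi (t mod N0) in if even (r - M) then Re w else Im w)
       else 0)" for x r
  define nrm where "nrm x = sqrt (\<Sum>r\<le>n + 2 * Dd. (outv x r)\<^sup>2)" for x
  define fin where "fin x = (\<lambda>r. outv x r / nrm x)" for x
  let ?X = "{c. (\<Sum>r\<le>n + 2 * Suc Dd. (c r)\<^sup>2) = 1 \<and> (\<forall>r>n + 2 * Suc Dd. c r = (0::real))}"
  let ?Xn = "{c. (\<Sum>r\<le>n. (c r)\<^sup>2) = 1 \<and> (\<forall>r>n. c r = (0::real))}"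
  let ?Y = "{c. (\<Sum>r\<le>n + 2 * Dd. (c r)\<^sup>2) = 1 \<and> (\<forall>r>n + 2 * Dd. c r = (0::real))}"
  have outv_even: "outv x (M + 2 * t) = Re (fst (fst (x (t div N0))) $ ixi (t mod N0))"
    and outv_odd: "outv x (Suc (M + 2 * t)) = Im (fst (fst (x (t div N0))) $ ixi (t mod N0))" if "t < Dd" for x t
  proof -
    have "M + 2 * t < M + 2 * Dd" "Suc (M + 2 * t) < M + 2 * Dd" using that by auto
    moreover have "Suc (M + 2 * t) - M = Suc (2 * t)" by simp
    moreover have "Suc (2 * t) div 2 = t" by simp
    ultimately show "outv x (M + 2 * t) = Re (fst (fst (x (t div N0))) $ ixi (t mod N0))"
      "outv x (Suc (M + 2 * t)) = Im (fst (fst (x (t div N0))) $ ixi (t mod N0))"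
      unfolding outv_def by (simp_all add: Let_def)
  qed
  have outv_hi: "outv x r = 0" if "r \<ge> M + 2 * Dd" for x r using that by (auto simp: outv_def)
  have esq_cfg: "esq L (cfg c) = (\<Sum>r\<le>n + 2 * Suc Dd. (c r)\<^sup>2)" for c
  proof -
    \<comment> \<open>The redundant coordinates are summed in blocks of length N0; the cutoff
      matches the zeros that \<open>cfg\<close> puts beyond index Dd.\<close>
    define g where "g t = (if t \<le> Dd then (c (M + 2 * t))\<^sup>2 + (c (Suc (M + 2 * t)))\<^sup>2 else 0)" for t
    have lo: "(norm (fst (cfg c i)))\<^sup>2 = (c i)\<^sup>2" if "i < M" for i
    proof -
      have "fst (fst (cfg c i)) = 0" using that by (simp add: cfg_def vec_eq_iff)
      then show ?thesis using that by (simp add: norm_prod_def) (simp add: cfg_def)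
    qed
    have hi: "(norm (fst (cfg c (M + j))))\<^sup>2 = (\<Sum>s<N0. g (j * N0 + s))" if "j < M + 1" for j
    proof -
      have jL: "M + j < L" using that unfolding L_def by simp
      have "snd (fst (cfg c (M + j))) = 0" by (simp add: cfg_def)
      then have "(norm (fst (cfg c (M + j))))\<^sup>2 = (norm (fst (fst (cfg c (M + j)))))\<^sup>2" by (simp add: norm_prod_def)
      also have "\<dots> = (\<Sum>l\<in>UNIV. (norm (fst (fst (cfg c (M + j))) $ l))\<^sup>2)"
        unfolding norm_vec_def L2_set_def by (simp add: sum_nonneg)
      also have "\<dots> = (\<Sum>l\<in>UNIV. g (j * N0 + ix l))"
        by (intro sum.cong refl) (use jL in \<open>simp add: cfg_def g_def cmod_power2\<close>)
      also have "\<dots> = (\<Sum>s<N0. g (j * N0 + s))"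
        by (rule sum.reindex_bij_betw[OF ix])
      finally show ?thesis .
    qed
    have "esq L (cfg c) = (\<Sum>i<M. (c i)\<^sup>2) + (\<Sum>j<M + 1. (norm (fst (cfg c (M + j))))\<^sup>2)"
    proof -
      have "(\<Sum>i\<in>{M..<L}. (norm (fst (cfg c i)))\<^sup>2) = (\<Sum>j<M + 1. (norm (fst (cfg c (M + j))))\<^sup>2)"
        using sum.shift_bounds_nat_ivl[of "\<lambda>i. (norm (fst (cfg c i)))\<^sup>2" 0 M "M + 1"]
        unfolding L_def by (simp add: lessThan_atLeast0 add.commute mult_2)
      then show ?thesis unfolding esq_def sum_split_M using lo by simp
    qed
    also have "(\<Sum>j<M + 1. (norm (fst (cfg c (M + j))))\<^sup>2) = (\<Sum>j<M + 1. \<Sum>s<N0. g (j * N0 + s))"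
      using hi by (intro sum.cong) auto
    also have "\<dots> = (\<Sum>j<M + 1. sum g {j * N0..<j * N0 + N0})"
    proof (rule sum.cong[OF refl])
      fix j
      show "(\<Sum>s<N0. g (j * N0 + s)) = sum g {j * N0..<j * N0 + N0}"
        using sum.shift_bounds_nat_ivl[of g 0 "j * N0" N0] by (simp add: lessThan_atLeast0 add.commute)
    qed
    also have "\<dots> = sum g {..<(M + 1) * N0}" by (rule sum.nat_group)
    also have "\<dots> = sum g {..<Suc Dd}"
      by (rule sum.mono_neutral_right) (use N0 in \<open>auto simp: Dd_def g_def\<close>)
    also have "\<dots> = (\<Sum>t<Suc Dd. (c (M + 2 * t))\<^sup>2 + (c (Suc (M + 2 * t)))\<^sup>2)"
      by (intro sum.cong) (auto simp: g_def)
    finally show ?thesis unfolding nlt sum_pairs .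
  qed
  have cfg_m0: "fst (fst (cfg c i)) = 0" if "i < M" for c i using that by (simp add: cfg_def vec_eq_iff)
  have cfg_dz: "snd (cfg c (Suc i)) - snd (cfg c i) = D * snd (fst (cfg c i))" if "i < M" for c i
    using that by (simp add: cfg_def algebra_simps)
  define D0 where "D0 = D * real M"
  define K where "K = cfg ` ?X"
  have cr: "\<bar>c r\<bar> \<le> 1" if "c \<in> ?X" for c r
  proof (cases "r \<le> n + 2 * Suc Dd")
    case True
    then have "(c r)\<^sup>2 \<le> (\<Sum>r\<le>n + 2 * Suc Dd. (c r)\<^sup>2)" by (intro member_le_sum) auto
    then show ?thesis using that by (simp add: abs_square_le_1)
  qed (use that in auto)
  have K: "esq L x = 1 \<and> (\<forall>i\<ge>L. x i = 0) \<and> (\<forall>i. \<bar>snd (x i)\<bar> \<le> D0) \<and> FF (- \<kappa>0) x < 0" if "x \<in> K" for x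
  proof -
    from that obtain c where c: "c \<in> ?X" "x = cfg c" unfolding K_def by blast
    have e1: "esq L x = 1" using c esq_cfg by simp
    have z: "\<bar>snd (x i)\<bar> \<le> D0" for i
    proof (cases "i \<le> M")
      case True
      have "\<bar>\<Sum>j<i. c j\<bar> \<le> (\<Sum>j<i. \<bar>c j\<bar>)" by (rule sum_abs)
      also have "\<dots> \<le> (\<Sum>j<i. 1)" by (intro sum_mono cr c)
      also have "\<dots> \<le> real M" using True by simp
      finally have "\<bar>D * (\<Sum>j<i. c j)\<bar> \<le> D * real M" unfolding abs_mult using D by (intro mult_mono) auto
      then show ?thesis using True unfolding c(2) D0_def by (simp add: cfg_def)
    next
      case False
      then show ?thesis unfolding c(2) D0_def using D by (simp add: cfg_def)
    qed
    have i0: "x i = 0" if "i \<ge> L" for i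
      using that M_less_L unfolding c(2) cfg_def by (auto simp: zero_prod_def vec_eq_iff)
    have "FF (- \<kappa>0) x < 0" unfolding \<kappa>0_def
      by (rule FF_neg[OF C D e1]) (use cfg_m0 cfg_dz in \<open>auto simp: c(2)\<close>, simp add: cfg_def)
    then show ?thesis using e1 i0 z by blast
  qed
  have g0: "\<And>\<kappa> x i. L \<le> i \<Longrightarrow> GG \<kappa> x i = 0" by (simp add: GG_def)
  obtain \<Theta> :: "real \<Rightarrow> (nat \<Rightarrow> ((complex ^ 'n) \<times> real) \<times> real) \<Rightarrow> nat \<Rightarrow> ((complex ^ 'n) \<times> real) \<times> real"
    where \<Theta>: "continuous_on ({0..1} \<times> K) (\<lambda>p. \<Theta> (fst p) (snd p))"
    "\<And>x. x \<in> K \<Longrightarrow> \<Theta> 0 x = x"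
    "\<And>s x. x \<in> K \<Longrightarrow> s \<in> {0..1} \<Longrightarrow> esq L (\<Theta> s x) = 1"
    "\<And>x. x \<in> K \<Longrightarrow> FF \<kappa>0 (\<Theta> 1 x) < 0"
    "\<And>T s x. (\<And>c x. T (escale c x) = escale c (T x)) \<Longrightarrow> (\<And>x. esq L (T x) = esq L x) \<Longrightarrow>
        (\<And>\<kappa> x h. T (\<lambda>i. x i - h *\<^sub>R GG \<kappa> x i) = (\<lambda>i. T x i - h *\<^sub>R GG \<kappa> (T x) i)) \<Longrightarrow> \<Theta> s (T x) = T (\<Theta> s x)"
    "\<And>P s x. (\<And>\<kappa> x h c. P x \<Longrightarrow> P (escale c (\<lambda>i. x i - h *\<^sub>R GG \<kappa> x i))) \<Longrightarrow>
        (\<And>\<kappa> x. P x \<Longrightarrow> FF \<kappa> x = FF \<kappa>0 x) \<Longrightarrow> x \<in> K \<Longrightarrow> P x \<Longrightarrow> s \<in> {0..1} \<Longrightarrow>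
        P (\<Theta> s x) \<and> FF \<kappa>0 (\<Theta> s x) < 0"
  proof (rule sublevel_deformation[where F = FF and g = GG and L = L and \<delta> = \<delta> and C = Cz and D = D0 and K = K
        and q = "\<lambda>x. \<Sum>j\<in>{M..<L}. (norm (fst (fst (x j))))\<^sup>2", OF FF_der GG_cont g0 FF_hom FF_aff sum_nu_le \<delta>(1) \<kappa>0 \<delta>(2) Cz K], goal_cases)
    case (7 \<Theta>)
    show ?case by (rule 7(1)) (fact 7)+
  qed assumption+
  have \<Theta>T: "\<Theta> s (\<lambda>i. Tp (x i)) = (\<lambda>i. Tp (\<Theta> s x i))" for s x
  proof (rule \<Theta>(5)[where T = "\<lambda>x i. Tp (x i)"])
    show "(\<lambda>i. Tp (escale c x i)) = escale c (\<lambda>i. Tp (x i))" for c x by (auto simp: Tp_def escale_def)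
    show "esq L (\<lambda>i. Tp (x i)) = esq L x" for x by (rule esq_Tp)
    show "(\<lambda>i. Tp (x i - h *\<^sub>R GG \<kappa> x i)) = (\<lambda>i. Tp (x i) - h *\<^sub>R GG \<kappa> (\<lambda>i. Tp (x i)) i)" for \<kappa> x h
      unfolding GG_Tp by (auto simp: Tp_def)
  qed
  have nz: "nrm x > 0" if "FF \<kappa>0 x < 0" "esq L x = 1" for x
  proof (rule ccontr)
    assume "\<not> nrm x > 0"
    then have "(\<Sum>r\<le>n + 2 * Dd. (outv x r)\<^sup>2) \<le> 0" unfolding nrm_def real_sqrt_gt_0_iff by (rule leI)
    then have "(\<Sum>r\<le>n + 2 * Dd. (outv x r)\<^sup>2) = 0" by (rule antisym) (rule sum_nonneg, rule zero_le_power2)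
    then have "\<forall>r\<in>{..n + 2 * Dd}. (outv x r)\<^sup>2 = 0"
      by (subst (asm) sum_nonneg_eq_0_iff) (rule finite_atMost, rule zero_le_power2, assumption)
    then have o0: "outv x r = 0" if "r < M + 2 * Dd" for r
      using that unfolding nlt by (simp add: power_eq_0_iff)
    have "fst (fst (x j)) $ l = 0" if "j < M" for j l
    proof -
      let ?t = "j * N0 + ix l"
      have "?t < Dd"
      proof -
        have "?t < j * N0 + N0" using ixl[of l] by simp
        also have "\<dots> = Suc j * N0" by simp
        also have "\<dots> \<le> M * N0" using that by (intro mult_right_mono) auto
        finally show ?thesis unfolding Dd_def .
      qed
      moreover have "?t div N0 = j" "?t mod N0 = ix l" using ixl[of l] by auto
      ultimately show ?thesis using outv_even[of ?t x] outv_odd[of ?t x] o0[of "M + 2 * ?t"] o0[of "Suc (M + 2 * ?t)"] ixi[of l]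
        by (simp add: complex_eq_iff)
    qed
    then have m0: "fst (fst (x j)) = 0" if "j < M" for j using that by (simp add: vec_eq_iff)
    have dz: "snd (x (Suc i)) - snd (x i) = - D * snd (fst (x i))" if "i < M" for i
      using o0[of i] that by (simp add: outv_def)
    have "FF \<kappa>0 x > 0" unfolding \<kappa>0_def by (rule FF_pos[OF C D that(2)]) (use m0 dz in auto)
    then show False using that by simp
  qed
  have fin_sum: "(\<Sum>r\<le>n + 2 * Dd. (fin x r)\<^sup>2) = 1" if "nrm x > 0" for x
  proof -
    have "(\<Sum>r\<le>n + 2 * Dd. (outv x r)\<^sup>2) = (nrm x)\<^sup>2" unfolding nrm_def by (simp add: sum_nonneg)
    then show ?thesis using that unfolding fin_def by (simp add: power_divide flip: sum_divide_distrib)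
  qed
  have fin_hi: "fin x r = 0" if "r > n + 2 * Dd" for x r
    unfolding fin_def using outv_hi[of r x] that n(1) by simp
  have cont_cfg: "continuous_on A (\<lambda>c. cfg c)" for A
  proof (rule continuous_on_coordinatewise_then_product)
    fix i
    have cc: "continuous_on A (\<lambda>c::nat \<Rightarrow> real. c r)" for r
      by (rule continuous_on_product_coordinates[THEN continuous_on_subset]) auto
    have cC: "continuous_on A (\<lambda>c::nat \<Rightarrow> real. Complex (c r) (c r'))" for r r'
      unfolding Complex_eq by (intro continuous_intros cc)
    have "continuous_on A (\<lambda>c::nat \<Rightarrow> real. if P then Complex (c r) (c r') else 0)" for P r r'
      by (cases P) (auto intro: cC)
    moreover have "continuous_on A (\<lambda>c::nat \<Rightarrow> real. if i < M then c i else 0)" by (cases "i < M") (auto intro: cc)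
    moreover have "continuous_on A (\<lambda>c::nat \<Rightarrow> real. if i \<le> M then D * (\<Sum>j<i. c j) else 0)"
      by (cases "i \<le> M") (auto intro!: continuous_intros cc)
    ultimately show "continuous_on A (\<lambda>c. cfg c i)" unfolding cfg_def
      by (intro continuous_on_Pair continuous_on_vec_lambda)
  qed
  have cont_outv: "continuous_on A (\<lambda>p. outv (h p) r)" if "continuous_on A h" for A :: "'z::topological_space set" and h r
  proof -
    have hc: "continuous_on A (\<lambda>p. h p i)" for i by (rule continuous_on_product_then_coordinatewise[OF that])
    show ?thesis unfolding outv_def Let_def
      by (cases "r < M"; cases "r < M + 2 * Dd"; cases "even (r - M)") (auto intro!: continuous_intros hc)
  qed
  have cont_fin: "continuous_on A (\<lambda>p. fin (h p))" if "continuous_on A h" "\<And>p. p \<in> A \<Longrightarrow> nrm (h p) > 0"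
    for A :: "'z::topological_space set" and h
  proof (rule continuous_on_coordinatewise_then_product)
    fix r
    show "continuous_on A (\<lambda>p. fin (h p) r)" unfolding fin_def
    proof (rule continuous_on_divide[OF cont_outv[OF that(1)]])
      show "continuous_on A (\<lambda>p. nrm (h p))" unfolding nrm_def by (intro continuous_intros cont_outv that(1))
      show "\<forall>p\<in>A. nrm (h p) \<noteq> 0" using that(2) by force
    qed
  qed
  define f where "f c = fin (\<Theta> 1 (cfg c))" for c
  have cK: "cfg c \<in> K" if "c \<in> ?X" for c using that unfolding K_def by blast
  have npos: "nrm (\<Theta> 1 (cfg c)) > 0" if "c \<in> ?X" for c
    by (rule nz[OF \<Theta>(4)[OF cK[OF that]] \<Theta>(3)[OF cK[OF that]]]) simp
  have f1: "continuous_on ?X f"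
    unfolding f_def
  proof (rule cont_fin)
    have "continuous_on ?X (\<lambda>c. (1::real, cfg c))" by (intro continuous_intros cont_cfg)
    moreover have "(\<lambda>c. (1::real, cfg c)) ` ?X \<subseteq> {0..1} \<times> K"
      by (intro image_subsetI SigmaI cK) (simp, assumption)
    ultimately show "continuous_on ?X (\<lambda>c. \<Theta> 1 (cfg c))"
      using continuous_on_compose2[OF \<Theta>(1), of ?X "\<lambda>c. (1, cfg c)", unfolded fst_conv snd_conv] by blast
  qed (rule npos)
  have f2: "f c \<in> ?Y" if "c \<in> ?X" for c
    using fin_sum[OF npos[OF that]] fin_hi unfolding f_def by blast
  have fcm: "continuous_map (nsphere (n + 2 * Suc Dd)) (nsphere (n + 2 * Dd)) f"
    unfolding nsphere_top_of_set using f1 f2 by (auto simp: continuous_map_in_subtopology image_subset_iff_funcset)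
  have ang_kk: "2 * pi * (real 1 * of_int (kk t)) / real k = ang (ixi (t mod N0))" for t
    unfolding ang_def kk_def by simp
  have rotC: "Complex (?R c (M + 2 * t)) (?R c (Suc (M + 2 * t))) = cis (ang (ixi (t mod N0))) * Complex (c (M + 2 * t)) (c (Suc (M + 2 * t)))" for c t
  proof -
    have "?R c (Suc (n + 2 * t)) = cos (ang (ixi (t mod N0))) * c (Suc (n + 2 * t)) - sin (ang (ixi (t mod N0))) * c (Suc (Suc (n + 2 * t)))"
      "?R c (Suc (Suc (n + 2 * t))) = sin (ang (ixi (t mod N0))) * c (Suc (n + 2 * t)) + cos (ang (ixi (t mod N0))) * c (Suc (Suc (n + 2 * t)))"
      unfolding cyc_rot_def pair_rot_even pair_rot_odd ang_kk by auto
    moreover have "Suc (n + 2 * t) = M + 2 * t" using n(1) by simp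
    ultimately show ?thesis by (simp add: complex_eq_iff)
  qed
  note One_nat_def [simp del]
  have Rlow: "?R c r = c r" if "r < M" for c r
    using that n(1) unfolding cyc_rot_def by (intro pair_rot_low) auto
  have cfgT: "cfg (?R c) = (\<lambda>i. Tp (cfg c i))" for c
  proof
    fix i
    have "fst (fst (cfg (?R c) i)) $ l = cis (ang l) * fst (fst (cfg c i)) $ l" for l
    proof -
      have "((i - M) * N0 + ix l) mod N0 = ix l" using ixl[of l] by simp
      then show ?thesis using rotC[of c "(i - M) * N0 + ix l"] ixi[of l] by (simp add: cfg_def)
    qed
    then have "fst (fst (cfg (?R c) i)) = tw k mm (fst (fst (cfg c i)))" by (simp add: tw_def vec_eq_iff ang_def)
    moreover have "snd (fst (cfg (?R c) i)) = snd (fst (cfg c i))" by (simp add: cfg_def Rlow)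
    moreover have "snd (cfg (?R c) i) = snd (cfg c i)"
    proof (cases "i \<le> M")
      case True
      then have "(\<Sum>j<i. ?R c j) = (\<Sum>j<i. c j)" by (intro sum.cong) (auto simp: Rlow)
      then show ?thesis by (simp add: cfg_def)
    qed (simp add: cfg_def)
    ultimately show "cfg (?R c) i = Tp (cfg c i)" unfolding Tp_def by (simp add: prod_eq_iff)
  qed
  have outT: "outv (\<lambda>i. Tp (x i)) = ?R (outv x)" for x
  proof
    fix r
    show "outv (\<lambda>i. Tp (x i)) r = ?R (outv x) r"
    proof (rule pair_index_cases[of r n])
      assume "r \<le> n"
      then have "r < M" using n(1) by simp
      then show ?thesis by (simp add: Rlow) (simp add: outv_def Tp_def)
    next
      fix t assume r: "r = Suc (n + 2 * t)"
      then have rM: "r = M + 2 * t" using n(1) by simp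
      show ?thesis
      proof (cases "t < Dd")
        case True
        have "?R (outv x) (M + 2 * t) = Re (cis (ang (ixi (t mod N0))) * fst (fst (x (t div N0))) $ ixi (t mod N0))"
          using arg_cong[OF rotC[of "outv x" t], of Re] outv_even[OF True, of x] outv_odd[OF True, of x] by simp
        then show ?thesis unfolding rM outv_even[OF True] by (simp add: Tp_def tw_def ang_def)
      next
        case False
        then show ?thesis using arg_cong[OF rotC[of "outv x" t], of Re] by (simp add: rM outv_hi)
      qed
    next
      fix t assume r: "r = Suc (Suc (n + 2 * t))"
      then have rM: "r = Suc (M + 2 * t)" using n(1) by simp
      show ?thesis
      proof (cases "t < Dd")
        case True
        have "?R (outv x) (Suc (M + 2 * t)) = Im (cis (ang (ixi (t mod N0))) * fst (fst (x (t div N0))) $ ixi (t mod N0))"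
          using arg_cong[OF rotC[of "outv x" t], of Im] outv_even[OF True, of x] outv_odd[OF True, of x] by simp
        then show ?thesis unfolding rM outv_odd[OF True] by (simp add: Tp_def tw_def ang_def)
      next
        case False
        then show ?thesis using arg_cong[OF rotC[of "outv x" t], of Im] by (simp add: rM outv_hi)
      qed
    qed
  qed
  have finT: "fin (\<lambda>i. Tp (x i)) = ?R (fin x)" for x
  proof -
    have "nrm (\<lambda>i. Tp (x i)) = nrm x" unfolding nrm_def outT cyc_rot_sum_squares ..
    then show ?thesis unfolding fin_def cyc_rot_divide outT by simp
  qed
  have feqv: "f (?R c) = ?R (f c)" for c
    unfolding f_def cfgT \<Theta>T finT ..
  have Xn: "c \<in> ?X" if "c \<in> ?Xn" for c
  proof -
    have "(\<Sum>r\<le>n + 2 * Suc Dd. (c r)\<^sup>2) = (\<Sum>r\<le>n. (c r)\<^sup>2)"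
      by (rule sum.mono_neutral_right) (use that in auto)
    then show ?thesis using that by auto
  qed
  \<comment> \<open>The fixed configurations. On them negativity holds at every time of the
    deformation, which yields the homotopy on the fixed sphere.\<close>
  define P where "P x \<longleftrightarrow> (\<forall>i. fst (fst (x i)) = 0)" for x :: "nat \<Rightarrow> ((complex ^ 'n) \<times> real) \<times> real"
  have Pc: "P (cfg c)" if "c \<in> ?Xn" for c
  proof -
    have "c r = 0" if "r \<ge> M" for r using \<open>c \<in> ?Xn\<close> n(1) that by auto
    then show ?thesis unfolding P_def cfg_def by (auto simp: vec_eq_iff complex_eq_iff)
  qed
  have P\<Theta>: "P (\<Theta> s (cfg c)) \<and> FF \<kappa>0 (\<Theta> s (cfg c)) < 0" if "c \<in> ?Xn" "s \<in> {0..1}" for s c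
  proof (rule \<Theta>(6)[where P = P, OF _ _ cK[OF Xn[OF that(1)]] Pc[OF that(1)] that(2)])
    show "P (escale r (\<lambda>i. x i - h *\<^sub>R GG \<kappa> x i))" if "P x" for \<kappa> x h r
      using that GG_fixed[of x \<kappa>] unfolding P_def by (auto simp: escale_def)
    show "FF \<kappa> x = FF \<kappa>0 x" if "P x" for \<kappa> x
      using FF_aff[of \<kappa> x \<kappa>0] that unfolding P_def by simp
  qed
  have npos2: "nrm (\<Theta> s (cfg c)) > 0" if "c \<in> ?Xn" "s \<in> {0..1}" for s c
    using nz[of "\<Theta> s (cfg c)"] P\<Theta>[OF that] \<Theta>(3)[OF cK[OF Xn[OF that(1)]] that(2)] by blast
  define H where "H p = fin (\<Theta> (fst p) (cfg (snd p)))" for p :: "real \<times> (nat \<Rightarrow> real)"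
  have H1: "continuous_on ({0..1} \<times> ?Xn) H"
    unfolding H_def
  proof (rule cont_fin)
    have "continuous_on ({0..1} \<times> ?Xn) (\<lambda>p :: real \<times> (nat \<Rightarrow> real). cfg (snd p))"
      by (rule continuous_on_compose2[OF cont_cfg[of UNIV] continuous_on_snd[OF continuous_on_id]]) auto
    then have "continuous_on ({0..1} \<times> ?Xn) (\<lambda>p :: real \<times> (nat \<Rightarrow> real). (fst p, cfg (snd p)))"
      by (rule continuous_on_Pair[OF continuous_on_fst[OF continuous_on_id]])
    moreover have "(\<lambda>p. (fst p, cfg (snd p))) ` ({0..1::real} \<times> ?Xn) \<subseteq> {0..1} \<times> K"
    proof (rule image_subsetI)
      fix p assume "p \<in> {0..1::real} \<times> ?Xn"
      then have "fst p \<in> {0..1}" "snd p \<in> ?Xn" by (auto simp: mem_Times_iff)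
      then show "(fst p, cfg (snd p)) \<in> {0..1} \<times> K" by (intro SigmaI cK[OF Xn])
    qed
    ultimately show "continuous_on ({0..1} \<times> ?Xn) (\<lambda>p :: real \<times> (nat \<Rightarrow> real). \<Theta> (fst p) (cfg (snd p)))"
      using continuous_on_compose2[OF \<Theta>(1), of "{0..1} \<times> ?Xn" "\<lambda>p. (fst p, cfg (snd p))", unfolded fst_conv snd_conv] by blast
  qed (use npos2 in auto)
  have H2: "H (s, c) \<in> ?Xn" if "c \<in> ?Xn" "s \<in> {0..1}" for s c
  proof -
    have o0: "outv (\<Theta> s (cfg c)) r = 0" if "r > n" for r
    proof -
      have "\<not> r < M" using that n(1) by simp
      then show ?thesis using P\<Theta>[OF \<open>c \<in> ?Xn\<close> \<open>s \<in> {0..1}\<close>] by (simp add: outv_def P_def Let_def)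
    qed
    then have h0: "fin (\<Theta> s (cfg c)) r = 0" if "r > n" for r using that by (simp add: fin_def)
    have "(\<Sum>r\<le>n + 2 * Dd. (fin (\<Theta> s (cfg c)) r)\<^sup>2) = (\<Sum>r\<le>n. (fin (\<Theta> s (cfg c)) r)\<^sup>2)"
      by (rule sum.mono_neutral_right) (use h0 in auto)
    then show ?thesis using fin_sum[OF npos2[OF that]] h0 by (simp add: H_def)
  qed
  \<comment> \<open>On the fixed sphere \<open>outv (cfg c)\<close> equals 2 * D * c, one half from
    y and one from the z-increment, so normalization returns c.\<close>
  have H0: "H (0, c) = c" if "c \<in> ?Xn" for c
  proof -
    have t0: "\<Theta> 0 (cfg c) = cfg c" by (rule \<Theta>(2)[OF cK[OF Xn[OF that]]])
    have lo: "outv (cfg c) r = 2 * D * c r" if "r < M" for r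
      using that cfg_dz[OF that, of c] by (simp add: outv_def) (simp add: cfg_def)
    have hi: "outv (cfg c) r = 0" if "r \<ge> M" for r
      using that Pc[OF \<open>c \<in> ?Xn\<close>] by (simp add: outv_def P_def Let_def)
    have c0: "c r = 0" if "r \<ge> M" for r using \<open>c \<in> ?Xn\<close> n(1) that by auto
    have o: "outv (cfg c) r = 2 * D * c r" for r using lo[of r] hi[of r] c0[of r] by (cases "r < M") auto
    have "(\<Sum>r\<le>n + 2 * Dd. (c r)\<^sup>2) = (\<Sum>r\<le>n. (c r)\<^sup>2)"
      by (rule sum.mono_neutral_right) (use that in auto)
    then have "(\<Sum>r\<le>n + 2 * Dd. (c r)\<^sup>2) = 1" using that by simp
    then have "nrm (cfg c) = 2 * D" unfolding nrm_def o using D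
      by (simp add: power_mult_distrib real_sqrt_mult flip: sum_distrib_left)
    then show ?thesis unfolding H_def using D by (simp add: t0 fin_def o fun_eq_iff)
  qed
  have "homotopic_with (\<lambda>_. True) (nsphere n) (nsphere n) id f"
  proof (rule iffD2[OF homotopic_with], simp, rule exI[of _ "H"], intro conjI ballI)
    show "continuous_map (prod_topology (top_of_set {0..1}) (nsphere n)) (nsphere n) H"
      unfolding nsphere_top_of_set prod_topology_subtopology_eu
      using H1 H2 by (auto simp: continuous_map_in_subtopology image_subset_iff_funcset)
  qed (use H0 in \<open>auto simp: nsphere_top_of_set H_def f_def\<close>)
  then have hom: "homotopic_with (\<lambda>_. True) (nsphere n) (nsphere n) f id" by (simp add: homotopic_with_sym)
  show False
    by (rule cyclic_borsuk_ulam[OF k_prime n(2) kk fcm feqv hom])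
qed

end

section \<open>From critical points to orbits\<close>

context discrete_action
begin

lemma gs_zeroD:
  assumes "gs \<kappa> x = 0"
  shows "\<And>i. i < M \<Longrightarrow> dlt L (\<lambda>i. fst (fst (x i))) i = d i (fst (x i)) (snd (x i))"
    and "\<And>i. i < M \<Longrightarrow> fst (x i) \<noteq> 0 \<Longrightarrow> \<exists>n::int. AA x i = of_int n"
    and "\<And>i. i \<le> M \<Longrightarrow> Gz x i = 0"
    and "\<And>j. M \<le> j \<Longrightarrow> j < L \<Longrightarrow> Ge \<kappa> x j = 0"
proof -
  let ?A = "\<lambda>i. (norm (dlt L (\<lambda>i. fst (fst (x i))) i - d i (fst (x i)) (snd (x i))))\<^sup>2
       + (sin (pi * AA x i) * norm (fst (x i)))\<^sup>2"
  have nn: "0 \<le> (\<Sum>i<M. ?A i)" "0 \<le> (\<Sum>i\<le>M. (Gz x i)\<^sup>2)" "0 \<le> (\<Sum>j\<in>{M..<L}. (norm (Ge \<kappa> x j))\<^sup>2)"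
    by (intro sum_nonneg add_nonneg_nonneg zero_le_power2)+
  have z: "(\<Sum>i<M. ?A i) = 0" "(\<Sum>i\<le>M. (Gz x i)\<^sup>2) = 0" "(\<Sum>j\<in>{M..<L}. (norm (Ge \<kappa> x j))\<^sup>2) = 0"
    using assms nn unfolding gs_def by linarith+
  have a: "?A i = 0" if "i < M" for i
    using z(1) that by (subst (asm) sum_nonneg_eq_0_iff) auto
  have a1: "norm (dlt L (\<lambda>i. fst (fst (x i))) i - d i (fst (x i)) (snd (x i))) = 0"
    and a2: "sin (pi * AA x i) * norm (fst (x i)) = 0" if "i < M" for i
    using a[OF that] by (simp_all add: sum_power2_eq_zero_iff del: mult_eq_0_iff)
  show "dlt L (\<lambda>i. fst (fst (x i))) i = d i (fst (x i)) (snd (x i))" if "i < M" for i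
    using a1[OF that] by simp
  show "\<exists>n::int. AA x i = of_int n" if "i < M" "fst (x i) \<noteq> 0" for i
  proof -
    have "sin (pi * AA x i) = 0" using a2[OF that(1)] that(2) by simp
    then obtain n :: int where "pi * AA x i = of_int n * pi" by (auto simp: sin_zero_iff_int2)
    then show ?thesis by (intro exI[of _ n]) simp
  qed
  show "Gz x i = 0" if "i \<le> M" for i
    using z(2) that by (subst (asm) sum_nonneg_eq_0_iff) auto
  show "Ge \<kappa> x j = 0" if "M \<le> j" "j < L" for j
    using z(3) that by (subst (asm) sum_nonneg_eq_0_iff) auto
qed

text \<open>An edge that starts at 0 is twice its midpoint m. Pairing the critical equation with J m
  removes the kappa term, because m is orthogonal to J m, and leaves 2 * |m|^2 = 0 whatever kappa
  is.\<close>

lemma nu_chain: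
  assumes G: "Ge \<kappa> x j = 0" and j: "M \<le> j" and m: "fst (fst (x j)) - (1/2) *\<^sub>R dlt L (\<lambda>i. fst (fst (x i))) j = 0"
  shows "fst (x j) = 0" "dlt L (\<lambda>i. fst (fst (x i))) j = 0"
proof -
  let ?m = "fst (fst (x j))" and ?D = "dlt L (\<lambda>i. fst (fst (x i))) j"
  have g: "Jv ?D + (2 * \<kappa>) *\<^sub>R ?m = 0" "snd (fst (x j)) = 0"
    using G j by (auto simp: Ge_def zero_prod_def)
  have mD: "?D = 2 *\<^sub>R ?m" using m by (simp add: algebra_simps)
  have "0 = (Jv ?D + (2 * \<kappa>) *\<^sub>R ?m) \<bullet> Jv ?m" using g by simp
  also have "\<dots> = 2 * (norm ?m)\<^sup>2"
  proof -
    have "?m \<bullet> Jv ?m = 0" using cxp_antisym[of ?m ?m] inner_Jv[of ?m ?m] by (simp add: inner_commute[of ?m])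
    moreover have "Jv ?D = 2 *\<^sub>R Jv ?m" unfolding mD by (rule linear_cmul[OF Jv_linear])
    moreover have "Jv ?m \<bullet> Jv ?m = (norm ?m)\<^sup>2" by (simp flip: power2_norm_eq_inner)
    ultimately show ?thesis by (simp add: inner_add_left)
  qed
  finally have "?m = 0" by simp
  then show "fst (x j) = 0" "?D = 0" using g mD by (auto simp: prod_eq_iff)
qed

text \<open>A zero of \<open>gs\<close> says that the steps fit together; the point is to exclude e
  i = 0. Such a zero would spread to all steps, because an endpoint of a step vanishes only together
  with e, and then along the redundant edges by \<open>nu_chain\<close>, against
  \<open>esq L x = 1\<close>.\<close>

theorem critical_orbit:
  assumes nz: "\<And>i e z. i < M \<Longrightarrow> e \<noteq> 0 \<Longrightarrow>
      (fst e - (1/2) *\<^sub>R d i e z, sg e + b i e z) \<noteq> 0 \<and> (fst e + (1/2) *\<^sub>R d i e z, sg e) \<noteq> 0"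
    and d0: "\<And>i z. i < M \<Longrightarrow> d i 0 z = 0" and b0: "\<And>i z. i < M \<Longrightarrow> b i 0 z = 0"
  shows "\<exists>e z. (\<forall>i<M. e i \<noteq> 0) \<and> sg (e 0) + b 0 (e 0) (z 0) = 0 \<and> sg (e (M - 1)) = 0 \<and>
     (\<forall>i. Suc i < M \<longrightarrow> fst (e i) + (1/2) *\<^sub>R d i (e i) (z i) = fst (e (Suc i)) - (1/2) *\<^sub>R d (Suc i) (e (Suc i)) (z (Suc i))
        \<and> sg (e i) = sg (e (Suc i)) + b (Suc i) (e (Suc i)) (z (Suc i))
        \<and> (\<exists>n::int. z (Suc i) = z i + a i (e i) (z i) + of_int n))"
proof -
  obtain \<kappa> x where x: "esq L x = 1" "gs \<kappa> x = 0" using exists_critical by blast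
  note eqs = gs_zeroD[OF x(2)]
  define e where "e i = fst (x i)" for i
  define z where "z i = snd (x i)" for i
  let ?D = "\<lambda>i. dlt L (\<lambda>i. fst (fst (x i))) i"
  have D: "?D i = d i (e i) (z i)" if "i < M" for i using eqs(1)[OF that] by (simp add: e_def z_def)
  have ch: "fst (e i) + (1/2) *\<^sub>R ?D i = fst (e (Suc i)) - (1/2) *\<^sub>R ?D (Suc i)" if "Suc i < L" for i
    using dlt_chain[OF that, of "\<lambda>i. fst (fst (x i))"] by (simp add: e_def)
  have chM: "fst (e i) + (1/2) *\<^sub>R d i (e i) (z i) = fst (e (Suc i)) - (1/2) *\<^sub>R d (Suc i) (e (Suc i)) (z (Suc i))" if "Suc i < M" for i
    using ch[of i] D[of i] D[of "Suc i"] that M_less_L by simp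
  have sc: "sg (e i) = sg (e (Suc i)) + b (Suc i) (e (Suc i)) (z (Suc i))" if "Suc i < M" for i
    using eqs(3)[of "Suc i"] that by (simp add: Gz_def e_def z_def)
  have s0: "sg (e 0) + b 0 (e 0) (z 0) = 0" using eqs(3)[of 0] M2 by (simp add: Gz_def e_def z_def)
  have sM: "sg (e (M - 1)) = 0" using eqs(3)[of M] M2 by (simp add: Gz_def e_def)
  have step: "e i = 0 \<longleftrightarrow> e (Suc i) = 0" if "Suc i < M" for i
  proof
    assume "e i = 0"
    then have "(fst (e (Suc i)) - (1/2) *\<^sub>R d (Suc i) (e (Suc i)) (z (Suc i)), sg (e (Suc i)) + b (Suc i) (e (Suc i)) (z (Suc i))) = 0"
      using chM[OF that] sc[OF that] d0[of i] that by (simp add: sg_def zero_prod_def)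
    then show "e (Suc i) = 0" using nz[OF that, of "e (Suc i)" "z (Suc i)"] by blast
  next
    assume "e (Suc i) = 0"
    then have "(fst (e i) + (1/2) *\<^sub>R d i (e i) (z i), sg (e i)) = 0"
      using chM[OF that] sc[OF that] d0[of "Suc i"] b0[of "Suc i"] that by (simp add: sg_def zero_prod_def)
    then show "e i = 0" using nz[of i "e i" "z i"] that by auto
  qed
  have all: "e i = 0 \<longleftrightarrow> e 0 = 0" if "i < M" for i
    using that by (induction i) (use step in auto)
  have "e 0 \<noteq> 0"
  proof
    assume "e 0 = 0"
    then have lo: "e i = 0" if "i < M" for i using all that by blast
    \<comment> \<open>The last step ends at the vertex 0, and the redundant edges inherit this one
      after the other.\<close>
    have up: "(fst (e j) + (1/2) *\<^sub>R ?D j = 0 \<and> e j = 0)" if "M - 1 \<le> j" "j < L" for j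
      using that
    proof (induction j rule: dec_induct)
      case base
      then show ?case using lo[of "M - 1"] D[of "M - 1"] d0[of "M - 1"] M2 by simp
    next
      case (step j)
      have "fst (e j) + (1/2) *\<^sub>R ?D j = 0" using step Suc_lessD by blast
      then have *: "fst (fst (x (Suc j))) - (1/2) *\<^sub>R ?D (Suc j) = 0" using ch[OF step(4)] unfolding e_def by (simp only:)
      have "M \<le> Suc j" using step by simp
      from nu_chain[OF eqs(4)[OF this] this *] show ?case using step by (simp add: e_def)
    qed
    have "e i = 0" if "i < L" for i using lo[of i] up[of i] that by (cases "i < M") auto
    then have "esq L x = 0" unfolding esq_def by (auto simp: e_def)
    then show False using x by simp
  qed
  then have ne: "e i \<noteq> 0" if "i < M" for i using all that by blast
  have zc: "\<exists>n::int. z (Suc i) = z i + a i (e i) (z i) + of_int n" if "Suc i < M" for i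
  proof -
    have "i < M" using that by simp
    then obtain n :: int where "AA x i = of_int n" using eqs(2)[of i] ne[of i] by (auto simp: e_def)
    then show ?thesis by (intro exI[of _ "- n"]) (simp add: AA_def e_def z_def)
  qed
  show ?thesis
    using ne s0 sM chM sc zc by (intro exI[of _ e] exI[of _ z]) blast
qed

end

section \<open>The homogeneous lift\<close>

lemma linear_family_continuous:
  fixes f' :: "'x::topological_space \<Rightarrow> 'a::euclidean_space \<Rightarrow> 'b::real_normed_vector"
  assumes l: "\<And>x. x \<in> S \<Longrightarrow> linear (f' x)" and c: "\<And>v. continuous_on S (\<lambda>x. f' x v)"
    and g: "continuous_on T g" "g ` T \<subseteq> S" and u: "continuous_on T u"
  shows "continuous_on T (\<lambda>x. f' (g x) (u x))"
proof -
  have e: "(\<Sum>b\<in>Basis. (u x \<bullet> b) *\<^sub>R f' (g x) b) = f' (g x) (u x)" if "x \<in> T" for x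
  proof -
    have lin: "linear (f' (g x))" using l g(2) that by blast
    have "f' (g x) (\<Sum>b\<in>Basis. (u x \<bullet> b) *\<^sub>R b) = (\<Sum>b\<in>Basis. f' (g x) ((u x \<bullet> b) *\<^sub>R b))"
      by (rule linear_sum[OF lin])
    then show ?thesis by (simp add: euclidean_representation linear_cmul[OF lin])
  qed
  have "continuous_on T (\<lambda>x. \<Sum>b\<in>Basis. (u x \<bullet> b) *\<^sub>R f' (g x) b)"
    by (intro continuous_intros u continuous_on_compose2[OF c g])
  then show ?thesis using e by (simp cong: continuous_on_cong)
qed

lemma C1_continuous_on: assumes "Ck_on (Suc 0) f S" shows "continuous_on S f"
proof -
  obtain f' where "\<And>x. x \<in> S \<Longrightarrow> (f has_derivative f' x) (at x)" using assms by auto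
  then show ?thesis by (intro continuous_at_imp_continuous_on ballI has_derivative_continuous)
qed

lemma C1_compose:
  fixes f :: "'a::real_normed_vector \<Rightarrow> 'b::euclidean_space" and g :: "'b \<Rightarrow> 'c::real_normed_vector"
  assumes g: "Ck_on (Suc 0) g T" and f: "Ck_on (Suc 0) f S" and sub: "f ` S \<subseteq> T"
  shows "Ck_on (Suc 0) (\<lambda>x. g (f x)) S"
proof -
  obtain f' where f': "\<And>x. x \<in> S \<Longrightarrow> (f has_derivative f' x) (at x)" "\<And>v. continuous_on S (\<lambda>x. f' x v)"
    using f by auto
  obtain g' where g': "\<And>x. x \<in> T \<Longrightarrow> (g has_derivative g' x) (at x)" "\<And>v. continuous_on T (\<lambda>x. g' x v)"
    using g by auto
  have "((\<lambda>x. g (f x)) has_derivative (\<lambda>v. g' (f x) (f' x v))) (at x)" if "x \<in> S" for x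
    using has_derivative_compose[OF f'(1)[OF that] g'(1)] sub that by auto
  moreover have "continuous_on S (\<lambda>x. g' (f x) (f' x v))" for v
    by (rule linear_family_continuous[OF _ g'(2) C1_continuous_on[OF f] sub f'(2)])
      (use g'(1) has_derivative_linear in blast)
  ultimately show ?thesis by (auto intro!: exI[of _ "\<lambda>x v. g' (f x) (f' x v)"])
qed

lemma C1_Pair:
  assumes "Ck_on (Suc 0) f S" "Ck_on (Suc 0) g S"
  shows "Ck_on (Suc 0) (\<lambda>x. (f x, g x)) S"
proof -
  obtain f' where f': "\<And>x. x \<in> S \<Longrightarrow> (f has_derivative f' x) (at x)" "\<And>v. continuous_on S (\<lambda>x. f' x v)"
    using assms(1) by auto
  obtain g' where g': "\<And>x. x \<in> S \<Longrightarrow> (g has_derivative g' x) (at x)" "\<And>v. continuous_on S (\<lambda>x. g' x v)"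
    using assms(2) by auto
  show ?thesis using f' g'
    by (auto intro!: exI[of _ "\<lambda>x v. (f' x v, g' x v)"] has_derivative_Pair continuous_on_Pair)
qed

lemma C1_bilinear:
  assumes B: "bounded_bilinear B" and fg: "Ck_on (Suc 0) f S" "Ck_on (Suc 0) g S"
  shows "Ck_on (Suc 0) (\<lambda>x. B (f x) (g x)) S"
proof -
  obtain f' where f': "\<And>x. x \<in> S \<Longrightarrow> (f has_derivative f' x) (at x)" "\<And>v. continuous_on S (\<lambda>x. f' x v)"
    using fg(1) by auto
  obtain g' where g': "\<And>x. x \<in> S \<Longrightarrow> (g has_derivative g' x) (at x)" "\<And>v. continuous_on S (\<lambda>x. g' x v)"
    using fg(2) by auto
  have "((\<lambda>x. B (f x) (g x)) has_derivative (\<lambda>v. B (f x) (g' x v) + B (f' x v) (g x))) (at x)" if "x \<in> S" for x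
    by (rule bounded_bilinear.FDERIV[OF B f'(1)[OF that] g'(1)[OF that]])
  moreover have "continuous_on S (\<lambda>x. B (f x) (g' x v) + B (f' x v) (g x))" for v
    by (intro continuous_on_add bounded_bilinear.continuous_on[OF B] C1_continuous_on[OF fg(1)] C1_continuous_on[OF fg(2)] f'(2) g'(2))
  ultimately show ?thesis by (auto intro!: exI[of _ "\<lambda>x v. B (f x) (g' x v) + B (f' x v) (g x)"])
qed

lemma C1_bounded_linear:
  assumes L: "bounded_linear L" and f: "Ck_on (Suc 0) f S"
  shows "Ck_on (Suc 0) (\<lambda>x. L (f x)) S"
proof -
  obtain f' where f': "\<And>x. x \<in> S \<Longrightarrow> (f has_derivative f' x) (at x)" "\<And>v. continuous_on S (\<lambda>x. f' x v)"
    using f by auto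
  show ?thesis using f'
    by (auto intro!: exI[of _ "\<lambda>x v. L (f' x v)"] bounded_linear.has_derivative[OF L] bounded_linear.continuous_on[OF L])
qed

lemma C1_const: "Ck_on (Suc 0) (\<lambda>x. c) S"
  by (auto intro!: exI[of _ "\<lambda>x v. 0"])

lemma C1_id: "Ck_on (Suc 0) (\<lambda>x. x) S"
  by (auto intro!: exI[of _ "\<lambda>x v. v"])

lemma C1_add:
  assumes "Ck_on (Suc 0) f S" "Ck_on (Suc 0) g S"
  shows "Ck_on (Suc 0) (\<lambda>x. f x + g x) S"
proof -
  obtain f' where f': "\<And>x. x \<in> S \<Longrightarrow> (f has_derivative f' x) (at x)" "\<And>v. continuous_on S (\<lambda>x. f' x v)"
    using assms(1) by auto
  obtain g' where g': "\<And>x. x \<in> S \<Longrightarrow> (g has_derivative g' x) (at x)" "\<And>v. continuous_on S (\<lambda>x. g' x v)"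
    using assms(2) by auto
  show ?thesis using f' g'
    by (auto intro!: exI[of _ "\<lambda>x v. f' x v + g' x v"] has_derivative_add continuous_on_add)
qed

lemma C1_diff:
  assumes "Ck_on (Suc 0) f S" "Ck_on (Suc 0) g S"
  shows "Ck_on (Suc 0) (\<lambda>x. f x - g x) S"
  using C1_add[OF assms(1) C1_bounded_linear[OF bounded_linear_minus[OF bounded_linear_ident] assms(2)]] by simp

lemmas C1_fst = C1_bounded_linear[OF bounded_linear_fst]
lemmas C1_snd = C1_bounded_linear[OF bounded_linear_snd]
lemmas C1_mult = C1_bilinear[OF bounded_bilinear_mult]
lemmas C1_scaleR = C1_bilinear[OF bounded_bilinear_scaleR]
lemmas C1_inner = C1_bilinear[OF bounded_bilinear_inner]

lemma C1_sqrt: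
  assumes "Ck_on (Suc 0) f S" "\<And>x. x \<in> S \<Longrightarrow> 0 < f x"
  shows "Ck_on (Suc 0) (\<lambda>x. sqrt (f x)) S"
proof (rule C1_compose[OF _ assms(1)])
  show "Ck_on (Suc 0) sqrt {0<..}"
    by (auto intro!: exI[of _ "\<lambda>x v. v * (inverse (sqrt x) / 2)"] continuous_intros
        has_derivative_eq_rhs[OF DERIV_real_sqrt[unfolded has_field_derivative_def]])
qed (use assms(2) in auto)

lemma C1_inverse:
  fixes f :: "'a::real_normed_vector \<Rightarrow> real"
  assumes "Ck_on (Suc 0) f S" "\<And>x. x \<in> S \<Longrightarrow> f x \<noteq> 0"
  shows "Ck_on (Suc 0) (\<lambda>x. inverse (f x)) S"
proof (rule C1_compose[OF _ assms(1)])
  show "Ck_on (Suc 0) (inverse :: real \<Rightarrow> real) {x. x \<noteq> 0}"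
    by (auto intro!: exI[of _ "\<lambda>x v. - (inverse x * v * inverse x)"] continuous_intros has_derivative_inverse')
qed (use assms(2) in auto)

lemma C1_cis:
  assumes "Ck_on (Suc 0) f S"
  shows "Ck_on (Suc 0) (\<lambda>x. cis (f x)) S"
proof (rule C1_compose[OF _ assms])
  show "Ck_on (Suc 0) cis UNIV"
    by (auto intro!: exI[of _ "\<lambda>x v. v *\<^sub>R (\<i> * cis x)"] continuous_intros has_derivative_cis[OF has_derivative_ident])
qed auto

section \<open>Complex scalars and the chart of the symplectization\<close>

definition cml :: "complex \<Rightarrow> complex ^ 'n::finite \<Rightarrow> complex ^ 'n" where
  "cml c w = (\<chi> j. c * w $ j)"

lemma norm_cml: "norm (cml c w) = cmod c * norm w"
  unfolding cml_def norm_vec_def L2_set_def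
  by (simp add: norm_mult power_mult_distrib real_sqrt_mult flip: sum_distrib_left)

lemma cml_bilinear: "bounded_bilinear (cml :: complex \<Rightarrow> complex ^ 'n::finite \<Rightarrow> complex ^ 'n)"
proof
  show "\<exists>K. \<forall>a b. norm (cml a (b :: complex ^ 'n)) \<le> norm a * norm b * K"
    by (intro exI[of _ 1]) (simp add: norm_cml)
qed (auto simp: cml_def vec_eq_iff distrib_left distrib_right)

interpretation cml: bounded_bilinear "cml :: complex \<Rightarrow> complex ^ 'n::finite \<Rightarrow> complex ^ 'n" by (rule cml_bilinear)

lemma cml_cml: "cml a (cml b w) = cml (a * b) w"
  by (simp add: cml_def vec_eq_iff)

lemma cml_1 [simp]: "cml 1 w = w"
  by (simp add: cml_def vec_eq_iff)

lemma cxp_cml: "cxp (cml c u) (cml c v) = (cmod c)\<^sup>2 * cxp u v"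
  unfolding cxp_def cml_def cmod_power2 sum_distrib_left
  by (intro sum.cong refl) (simp add: power2_eq_square algebra_simps)

lemma cxp_Jv: "cxp w (Jv v) = w \<bullet> v"
  unfolding cxp_def Jv_def inner_vec_def by (simp add: inner_complex_def)

lemma tw_cml: "tw k mm (cml c w) = cml c (tw k mm w)"
  by (simp add: tw_def cml_def vec_eq_iff)

text \<open>The chart \<open>LL\<close> identifies the symplectization \<open>r\<^sup>2 \<alpha>\<close> with the region \<open>hro > 0\<close>, with inverse
  \<open>p \<mapsto> (A1 p, sqrt (hro p))\<close>.\<close>

definition hro :: "real \<Rightarrow> ((complex ^ 'n::finite) \<times> real) \<times> real \<Rightarrow> real" where
  "hro N p = snd (fst p) + N * pi * (fst (fst p) \<bullet> fst (fst p))"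

definition LL :: "real \<Rightarrow> ('n::finite pt) \<times> real \<Rightarrow> ((complex ^ 'n) \<times> real) \<times> real" where
  "LL N x = ((snd x *\<^sub>R cml (cis (2 * pi * N * snd (fst x))) (fst (fst x)),
       snd x * snd x * (1 - N * pi * (fst (fst x) \<bullet> fst (fst x)))), snd (fst x))"

definition A1 :: "real \<Rightarrow> ((complex ^ 'n::finite) \<times> real) \<times> real \<Rightarrow> 'n pt" where
  "A1 N p = (inverse (sqrt (hro N p)) *\<^sub>R cml (cis (2 * pi * N * (- snd p))) (fst (fst p)), snd p)"

text \<open>A contactomorphism with conformal factor c acts on the symplectization by dividing r by
  sqrt c, which preserves r^2 alpha. Outside the chart region the identity is taken; compact support
  makes the two definitions fit together.\<close>

definition lift :: "real \<Rightarrow> ('n::finite pt \<Rightarrow> 'n pt) \<Rightarrow> ('n pt \<Rightarrow> real)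
    \<Rightarrow> ((complex ^ 'n) \<times> real) \<times> real \<Rightarrow> ((complex ^ 'n) \<times> real) \<times> real" where
  "lift N g c p = (if hro N p > 0 then LL N (g (A1 N p), sqrt (hro N p) * inverse (sqrt (c (A1 N p)))) else p)"

lemma inner_cml: "cml (cis a) u \<bullet> cml (cis a) u = u \<bullet> u"
  by (simp add: norm_cml flip: power2_norm_eq_inner)

lemma hro_LL: "hro N (LL N x) = (snd x)\<^sup>2"
  by (simp add: hro_def LL_def inner_cml power2_eq_square algebra_simps)

lemma A1_LL: "0 < snd x \<Longrightarrow> A1 N (LL N x) = fst x"
  unfolding A1_def hro_LL by (simp add: LL_def cml.scaleR_right cml_cml cis_mult prod_eq_iff)

lemma LL_A1: "0 < hro N p \<Longrightarrow> LL N (A1 N p, sqrt (hro N p)) = p"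
proof -
  assume h: "0 < hro N p"
  have "sqrt (hro N p) * sqrt (hro N p) = hro N p" using h by simp
  moreover have "inverse (sqrt (hro N p)) * inverse (sqrt (hro N p)) = inverse (hro N p)"
    using h by (simp add: inverse_mult_distrib[symmetric] del: inverse_mult_distrib)
  moreover have "hro N p * (1 - N * pi * (inverse (hro N p) * (fst (fst p) \<bullet> fst (fst p)))) = snd (fst p)"
  proof -
    have "hro N p * (1 - N * pi * (inverse (hro N p) * (fst (fst p) \<bullet> fst (fst p)))) =
        hro N p - N * pi * (fst (fst p) \<bullet> fst (fst p)) * (hro N p * inverse (hro N p))"
      by (simp only: algebra_simps mult_1_right)
    also have "\<dots> = snd (fst p)" using h by simp (simp add: hro_def)
    finally show ?thesis .
  qed
  moreover have "fst (A1 N p) \<bullet> fst (A1 N p) = inverse (hro N p) * (fst (fst p) \<bullet> fst (fst p))"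
    using h by (simp add: A1_def inner_cml mult.assoc[symmetric] flip: real_sqrt_inverse inverse_mult_distrib)
  ultimately show ?thesis using h
    by (simp add: LL_def prod_eq_iff) (simp add: A1_def cml.scaleR_right cml_cml cis_mult)
qed

lemma norm_A1: "0 < hro N p \<Longrightarrow> (norm (fst (A1 N p)))\<^sup>2 * hro N p = (norm (fst (fst p)))\<^sup>2"
  by (simp add: A1_def norm_cml power_mult_distrib power_inverse)

lemma C1_hro: "Ck_on (Suc 0) f S \<Longrightarrow> Ck_on (Suc 0) (\<lambda>x. hro N (f x)) S"
  unfolding hro_def by (intro C1_add C1_mult C1_const C1_inner C1_fst C1_snd)

lemma C1_LL: "Ck_on (Suc 0) f S \<Longrightarrow> Ck_on (Suc 0) (\<lambda>x. LL N (f x)) S"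
  unfolding LL_def
  by (intro C1_Pair C1_scaleR C1_mult C1_diff C1_bilinear[OF cml_bilinear] C1_cis C1_const C1_inner C1_fst C1_snd)

lemma C1_A1: "Ck_on (Suc 0) f S \<Longrightarrow> (\<And>x. x \<in> S \<Longrightarrow> 0 < hro N (f x)) \<Longrightarrow> Ck_on (Suc 0) (\<lambda>x. A1 N (f x)) S"
  unfolding A1_def
  by (intro C1_Pair C1_scaleR C1_mult C1_inverse C1_sqrt C1_hro C1_bilinear[OF cml_bilinear] C1_cis C1_const
      C1_bounded_linear[OF bounded_linear_minus[OF bounded_linear_ident]] C1_fst C1_snd) force+

lemma open_hro: "open {p. 0 < hro N p}"
  unfolding hro_def by (intro open_Collect_less continuous_intros)

text \<open>In the chart region these are the points over |w| > C. For C > 0 the set also contains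
  every point with \<open>hro\<close> \<le> 0 whose first component is nonzero, so together with the
  chart region it covers all of the domain.\<close>

definition Vset :: "real \<Rightarrow> real \<Rightarrow> (((complex ^ 'n::finite) \<times> real) \<times> real) set" where
  "Vset C N = {p. C\<^sup>2 * hro N p < (norm (fst (fst p)))\<^sup>2}"

lemma open_Vset: "open (Vset C N)"
  unfolding Vset_def hro_def by (intro open_Collect_less continuous_intros)

lemma Vset_cover:
  assumes "fst p \<noteq> 0" and C: "0 < C"
  shows "0 < hro N p \<or> p \<in> Vset C N"
proof (rule disjCI)
  assume "p \<notin> Vset C N"
  then have le: "(norm (fst (fst p)))\<^sup>2 \<le> C\<^sup>2 * hro N p" by (simp add: Vset_def)
  show "0 < hro N p"
  proof (cases "fst (fst p) = 0")
    case True
    then have s: "hro N p = snd (fst p)" by (simp add: hro_def)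
    have "snd (fst p) \<noteq> 0" using True assms(1) by (simp add: prod_eq_iff)
    moreover have "0 \<le> snd (fst p)" using le True C s by (simp add: zero_le_mult_iff)
    ultimately show ?thesis using s by simp
  next
    case False
    then have "0 < C\<^sup>2 * hro N p" using le by (simp add: less_le_trans[rotated])
    then show ?thesis using C by (simp add: zero_less_mult_iff)
  qed
qed

text \<open>Over |w| > C the map is the identity with factor 1, so the lift merely undoes the
  chart.\<close>

lemma lift_Vset:
  assumes C: "0 < C" and supp: "\<And>w z. C < norm w \<Longrightarrow> g (w, z) = (w, z) \<and> c (w, z) = 1"
    and "p \<in> Vset C N"
  shows "lift N g c p = p"
proof (cases "0 < hro N p")
  case True
  have "C\<^sup>2 * hro N p < (norm (fst (A1 N p)))\<^sup>2 * hro N p" using assms(3) norm_A1[OF True] by (simp add: Vset_def)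
  then have "C\<^sup>2 < (norm (fst (A1 N p)))\<^sup>2" using True by simp
  then have "C < norm (fst (A1 N p))" using power2_less_imp_less by (metis norm_ge_zero)
  then have "g (A1 N p) = A1 N p" "c (A1 N p) = 1" using supp by (metis prod.collapse)+
  then show ?thesis using True LL_A1[OF True] by (simp add: lift_def)
qed (simp add: lift_def)

text \<open>Two open sets cover the domain: the chart region, where the lift is a composition of C1
  maps, and \<open>Vset\<close>, where it is the identity. Derivatives agree on the overlap by
  uniqueness and are glued jointly in time and space.\<close>

lemma lift_C1:
  fixes g :: "real \<Rightarrow> 'n::finite pt \<Rightarrow> 'n pt"
  assumes g: "Ck_on (Suc 0) (\<lambda>q. g (fst q) (snd q)) UNIV" and c: "Ck_on (Suc 0) (\<lambda>q. c (fst q) (snd q)) UNIV"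
    and pos: "\<And>t p. t \<in> T \<Longrightarrow> 0 < c t p" and C: "0 < C"
    and supp: "\<And>t w z. t \<in> T \<Longrightarrow> C < norm w \<Longrightarrow> g t (w, z) = (w, z) \<and> c t (w, z) = 1"
  shows "\<exists>f'. (\<forall>t\<in>T. \<forall>p. fst p \<noteq> 0 \<longrightarrow> (lift N (g t) (c t) has_derivative f' t p) (at p)) \<and>
     (\<forall>v. continuous_on (T \<times> {p. fst p \<noteq> 0}) (\<lambda>q. f' (fst q) (snd q) v))"
    and "continuous_on (T \<times> {p. fst p \<noteq> 0}) (\<lambda>q. lift N (g (fst q)) (c (fst q)) (snd q))"
proof -
  define H where "H q = LL N (g (fst q) (A1 N (snd q)), sqrt (hro N (snd q)) * inverse (sqrt (c (fst q) (A1 N (snd q)))))"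
    for q :: "real \<times> ((complex ^ 'n) \<times> real) \<times> real"
  \<comment> \<open>Positivity of c is part of this set because c is assumed positive only for times
    in T, while the square root has to be differentiable at all points of the set.\<close>
  define Om where "Om = {q :: real \<times> ((complex ^ 'n) \<times> real) \<times> real. 0 < hro N (snd q) \<and> 0 < c (fst q) (A1 N (snd q))}"
  have A: "Ck_on (Suc 0) (\<lambda>q. (fst q, A1 N (snd q))) Om"
    by (intro C1_Pair C1_A1 C1_fst C1_snd C1_id) (auto simp: Om_def)
  have gO: "Ck_on (Suc 0) (\<lambda>q. g (fst q) (A1 N (snd q))) Om" using C1_compose[OF g A] by simp
  have cO: "Ck_on (Suc 0) (\<lambda>q. c (fst q) (A1 N (snd q))) Om" using C1_compose[OF c A] by simp
  have HO: "Ck_on (Suc 0) H Om" unfolding H_def[abs_def]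
    by (intro C1_LL C1_Pair gO C1_mult C1_sqrt C1_inverse C1_hro C1_snd C1_id cO) (force simp: Om_def)+
  obtain H' where H': "\<And>q. q \<in> Om \<Longrightarrow> (H has_derivative H' q) (at q)" "\<And>v. continuous_on Om (\<lambda>q. H' q v)"
    using HO by auto
  define f' where "f' t p v = (if 0 < hro N p then H' (t, p) (0, v) else v)" for t p v
  define V :: "(((complex ^ 'n) \<times> real) \<times> real) set" where "V = Vset C N"
  have oV: "open V" unfolding V_def by (rule open_Vset)
  have cover: "0 < hro N p \<or> p \<in> V" if "fst p \<noteq> 0" for p unfolding V_def by (rule Vset_cover[OF that C])
  have idV: "lift N (g t) (c t) p = p" if "t \<in> T" "p \<in> V" for t p
    by (rule lift_Vset[OF C supp[OF that(1)] that(2)[unfolded V_def]])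
  have inOm: "(t, p) \<in> Om" if "t \<in> T" "0 < hro N p" for t p using that pos by (simp add: Om_def)
  have derU: "(lift N (g t) (c t) has_derivative (\<lambda>v. H' (t, p) (0, v))) (at p)" if "t \<in> T" "0 < hro N p" for t p
  proof -
    have "((\<lambda>p. (t, p)) has_derivative (\<lambda>v. (0, v))) (at p)" by (auto intro!: derivative_eq_intros)
    from has_derivative_compose[OF this H'(1)[OF inOm[OF that]]]
    have "((\<lambda>p. H (t, p)) has_derivative (\<lambda>v. H' (t, p) (0, v))) (at p)" .
    then show ?thesis
      by (rule has_derivative_transform_within_open[OF _ open_hro[of N]]) (use that in \<open>auto simp: H_def lift_def\<close>)
  qed
  have derV: "(lift N (g t) (c t) has_derivative (\<lambda>v. v)) (at p)" if "t \<in> T" "p \<in> V" for t p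
    by (rule has_derivative_transform_within_open[OF has_derivative_ident oV]) (use that idV in auto)
  have der: "(lift N (g t) (c t) has_derivative f' t p) (at p)" if "t \<in> T" "fst p \<noteq> 0" for t p
  proof (cases "0 < hro N p")
    case True
    then have "f' t p = (\<lambda>v. H' (t, p) (0, v))" by (simp add: f'_def fun_eq_iff)
    then show ?thesis using derU[OF that(1) True] by simp
  next
    case False
    then have "f' t p = (\<lambda>v. v)" by (simp add: f'_def fun_eq_iff)
    then show ?thesis using derV[OF that(1), of p] cover[OF that(2)] False by simp
  qed
  have f'V: "f' t p v = v" if "t \<in> T" "p \<in> V" for t p v
    using fun_cong[OF has_derivative_unique[OF derU[OF that(1), of p] derV[OF that]], of v] by (auto simp: f'_def)
  define D where "D = {p :: ((complex ^ 'n) \<times> real) \<times> real. fst p \<noteq> 0}"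
  let ?S1 = "(T \<times> D) \<inter> {q. 0 < hro N (snd q)}" and ?S2 = "(T \<times> D) \<inter> {q. snd q \<in> V}"
  have un: "?S1 \<union> ?S2 = T \<times> D"
  proof -
    have "0 < hro N (snd q) \<or> snd q \<in> V" if "q \<in> T \<times> D" for q
      using cover[of "snd q"] that by (simp add: D_def mem_Times_iff)
    then show ?thesis by blast
  qed
  have o1: "open {q :: real \<times> ((complex ^ 'n) \<times> real) \<times> real. 0 < hro N (snd q)}"
    using open_vimage_snd[OF open_hro[of N]] by (simp add: vimage_def)
  have o2: "open {q :: real \<times> ((complex ^ 'n) \<times> real) \<times> real. snd q \<in> V}"
    using open_vimage_snd[OF oV] by (simp add: vimage_def)
  have op: "openin (top_of_set (?S1 \<union> ?S2)) ?S1" "openin (top_of_set (?S1 \<union> ?S2)) ?S2"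
    unfolding un by (rule openin_open_Int[OF o1], rule openin_open_Int[OF o2])
  have S1: "?S1 \<subseteq> Om" using inOm by auto
  have "continuous_on (?S1 \<union> ?S2) (\<lambda>q. f' (fst q) (snd q) v)" for v
  proof (rule continuous_on_Un_local_open[OF op])
    have "continuous_on ?S1 (\<lambda>q. H' q (0, v))" by (rule continuous_on_subset[OF H'(2) S1])
    then show "continuous_on ?S1 (\<lambda>q. f' (fst q) (snd q) v)" by (rule continuous_on_eq) (auto simp: f'_def)
    show "continuous_on ?S2 (\<lambda>q. f' (fst q) (snd q) v)"
      by (rule continuous_on_eq[OF continuous_on_const[of _ v]]) (auto simp: f'V)
  qed
  then have cf: "continuous_on (T \<times> D) (\<lambda>q. f' (fst q) (snd q) v)" for v unfolding un .
  have "continuous_on (?S1 \<union> ?S2) (\<lambda>q. lift N (g (fst q)) (c (fst q)) (snd q))"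
  proof (rule continuous_on_Un_local_open[OF op])
    have "continuous_on ?S1 H" by (rule continuous_on_subset[OF C1_continuous_on[OF HO] S1])
    then show "continuous_on ?S1 (\<lambda>q. lift N (g (fst q)) (c (fst q)) (snd q))"
      by (rule continuous_on_eq) (auto simp: H_def lift_def)
    show "continuous_on ?S2 (\<lambda>q. lift N (g (fst q)) (c (fst q)) (snd q))"
      by (rule continuous_on_eq[OF continuous_on_snd[OF continuous_on_id]]) (auto simp: idV)
  qed
  then show "continuous_on (T \<times> {p. fst p \<noteq> 0}) (\<lambda>q. lift N (g (fst q)) (c (fst q)) (snd q))"
    unfolding un unfolding D_def .
  show "\<exists>f'. (\<forall>t\<in>T. \<forall>p. fst p \<noteq> 0 \<longrightarrow> (lift N (g t) (c t) has_derivative f' t p) (at p)) \<and>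
     (\<forall>v. continuous_on (T \<times> {p. fst p \<noteq> 0}) (\<lambda>q. f' (fst q) (snd q) v))"
    using der cf unfolding D_def by (intro exI[of _ f'] conjI allI ballI impI) auto
qed

section \<open>Generating functions\<close>

text \<open>The dilation of weights 1 and 2; in the chart it multiplies r by c.\<close>

definition hs :: "real \<Rightarrow> ((complex ^ 'n::finite) \<times> real) \<times> real \<Rightarrow> ((complex ^ 'n) \<times> real) \<times> real" where
  "hs c p = ((c *\<^sub>R fst (fst p), c\<^sup>2 * snd (fst p)), snd p)"

text \<open>A gauge of weight 2 for \<open>hs\<close>, by which points are normalized.\<close>

definition nu :: "((complex ^ 'n::finite) \<times> real) \<times> real \<Rightarrow> real" where
  "nu p = (norm (fst (fst p)))\<^sup>2 + \<bar>snd (fst p)\<bar>"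

definition lam :: "((complex ^ 'n::finite) \<times> real) \<times> real \<Rightarrow> ((complex ^ 'n) \<times> real) \<times> real \<Rightarrow> real" where
  "lam p v = snd (fst p) * snd v + (1/2) * cxp (fst (fst p)) (fst (fst v))"

definition twX :: "nat \<Rightarrow> ('n::finite \<Rightarrow> int) \<Rightarrow> ((complex ^ 'n) \<times> real) \<times> real \<Rightarrow> ((complex ^ 'n) \<times> real) \<times> real" where
  "twX k mm p = ((tw k mm (fst (fst p)), snd (fst p)), snd p)"

definition shift :: "real \<Rightarrow> ((complex ^ 'n::finite) \<times> real) \<times> real \<Rightarrow> ((complex ^ 'n) \<times> real) \<times> real" where
  "shift n p = (fst p, snd p + n)"

lemma hs_hs [simp]: "hs a (hs b p) = hs (a * b) p"
  by (simp add: hs_def power_mult_distrib)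

lemma hs_1 [simp]: "hs 1 p = p" by (simp add: hs_def)

lemma nu_hs [simp]: "nu (hs c p) = c\<^sup>2 * nu p"
  by (simp add: nu_def hs_def power_mult_distrib abs_mult distrib_left)

lemma nu_pos_iff: "0 < nu p \<longleftrightarrow> fst p \<noteq> 0"
proof -
  have "0 \<le> nu p" by (simp add: nu_def)
  moreover have "nu p = 0 \<longleftrightarrow> fst p = 0" by (simp add: nu_def add_nonneg_eq_0_iff prod_eq_iff)
  ultimately show ?thesis by linarith
qed

lemma nu_shift [simp]: "nu (shift n p) = nu p" by (simp add: nu_def shift_def)

lemma nu_twX [simp]: "nu (twX k mm p) = nu p" by (simp add: nu_def twX_def)

lemma fst_hs: "c \<noteq> 0 \<Longrightarrow> fst (hs c p) \<noteq> 0 \<longleftrightarrow> fst p \<noteq> 0"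
  using nu_pos_iff[of "hs c p"] nu_pos_iff[of p] by (simp add: zero_less_mult_iff)

lemma fst_twX: "fst (twX k mm p) \<noteq> 0 \<longleftrightarrow> fst p \<noteq> 0"
  using nu_pos_iff[of "twX k mm p"] nu_pos_iff[of p] by simp

lemma fst_shift [simp]: "fst (shift n p) = fst p" by (simp add: shift_def)

lemma bounded_linear_hs: "bounded_linear (hs c)"
  unfolding linear_conv_bounded_linear[symmetric]
  by (rule linearI) (auto simp: hs_def algebra_simps)

lemma normalized: "fst p \<noteq> 0 \<Longrightarrow> nu (hs (inverse (sqrt (nu p))) p) = 1"
  using nu_pos_iff[of p] by (simp add: power_inverse)

lemma norm_parts: "norm (fst (fst p)) \<le> norm p" "\<bar>snd (fst p)\<bar> \<le> norm p" "\<bar>snd p\<bar> \<le> norm p"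
  for p :: "('a::real_normed_vector \<times> real) \<times> real"
proof -
  have "norm (fst p) \<le> norm p" by (simp add: norm_fst_le[of "fst p" "snd p", unfolded prod.collapse])
  moreover have "norm (fst (fst p)) \<le> norm (fst p)" using norm_fst_le[of "fst (fst p)" "snd (fst p)"] by simp
  moreover have "norm (snd (fst p)) \<le> norm (fst p)" using norm_snd_le[of "snd (fst p)" "fst (fst p)"] by simp
  moreover have "norm (snd p) \<le> norm p" using norm_snd_le[of "snd p" "fst p"] by simp
  ultimately show "norm (fst (fst p)) \<le> norm p" "\<bar>snd (fst p)\<bar> \<le> norm p" "\<bar>snd p\<bar> \<le> norm p" by auto
qed

text \<open>The source of the bounds 1/8 and 8: the annulus between them contains the ball of radius
  1/4 about every point with \<open>nu q = 1\<close>.\<close>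

lemma nu_near:
  assumes "nu q = 1" "norm (p - q) \<le> 1/4"
  shows "1/8 \<le> nu p" "nu p \<le> 8"
proof -
  define x y x' y' where "x = norm (fst (fst q))" and "y = \<bar>snd (fst q)\<bar>" and "x' = norm (fst (fst p))" and "y' = \<bar>snd (fst p)\<bar>"
  have xy: "x\<^sup>2 + y = 1" "0 \<le> x" "0 \<le> y" "0 \<le> x'" "0 \<le> y'" using assms(1) by (auto simp: nu_def x_def y_def x'_def y'_def)
  have "norm (fst (fst p) - fst (fst q)) \<le> 1/4" using norm_parts(1)[of "p - q"] assms(2) by simp
  then have x': "x' \<le> x + 1/4" "x - 1/4 \<le> x'" unfolding x'_def x_def using norm_triangle_ineq3[of "fst (fst p)" "fst (fst q)"] by linarith+
  have "\<bar>snd (fst p) - snd (fst q)\<bar> \<le> 1/4" using norm_parts(2)[of "p - q"] assms(2) by simp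
  then have y': "y' \<le> y + 1/4" "y - 1/4 \<le> y'" unfolding y'_def y_def by linarith+
  have nup: "nu p = x'\<^sup>2 + y'" by (simp add: nu_def x'_def y'_def)
  have "x \<le> 1"
  proof (rule ccontr)
    assume "\<not> x \<le> 1"
    then have "1 < x\<^sup>2" by (simp add: one_less_power)
    then show False using xy by simp
  qed
  then have "x'\<^sup>2 \<le> (5/4)\<^sup>2" using x' xy by (intro power_mono) auto
  moreover have "y \<le> 1" using xy(1) zero_le_power2[of x] by linarith
  ultimately show "nu p \<le> 8" unfolding nup using y' by (simp add: power2_eq_square)
  show "1/8 \<le> nu p"
  proof (cases "3/8 \<le> y")
    case True
    then show ?thesis unfolding nup using y'(2) zero_le_power2[of x'] by linarith
  next
    case False
    then have "5/8 < x\<^sup>2" using xy by simp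
    have "3/4 < x"
    proof (rule ccontr)
      assume "\<not> 3/4 < x"
      then have "x\<^sup>2 \<le> (3/4)\<^sup>2" using xy by (intro power_mono) auto
      then show False using \<open>5/8 < x\<^sup>2\<close> by (simp add: power2_eq_square)
    qed
    then have "(1/2)\<^sup>2 \<le> x'\<^sup>2" using x' by (intro power_mono) auto
    then show ?thesis unfolding nup using xy by (simp add: power2_eq_square)
  qed
qed

text \<open>Homogeneity and periodicity reduce the estimate to the unit sphere times [0, 1], which
  is compact.\<close>

lemma homogeneous_bounded:
  fixes f :: "'e::euclidean_space \<Rightarrow> real \<Rightarrow> 'b::real_normed_vector"
  assumes cont: "continuous_on {p. fst p \<noteq> 0} (\<lambda>p. f (fst p) (snd p))"
    and hom: "\<And>c e z. 0 < c \<Longrightarrow> e \<noteq> 0 \<Longrightarrow> f (c *\<^sub>R e) z = c ^ j *\<^sub>R f e z"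
    and per: "\<And>e z n. f e (z + of_int n) = f e z"
  shows "\<exists>C\<ge>0. \<forall>e z. e \<noteq> 0 \<longrightarrow> norm (f e z) \<le> C * norm e ^ j"
proof -
  have "compact (sphere (0::'e) 1 \<times> {0..1::real})" by (intro compact_Times) auto
  then have "compact ((\<lambda>p. f (fst p) (snd p)) ` (sphere 0 1 \<times> {0..1}))"
    by (intro compact_continuous_image continuous_on_subset[OF cont]) auto
  then have "bounded ((\<lambda>p. f (fst p) (snd p)) ` (sphere 0 1 \<times> {0..1}))" by (rule compact_imp_bounded)
  then obtain C where C: "\<And>x. x \<in> (\<lambda>p. f (fst p) (snd p)) ` (sphere 0 1 \<times> {0..1}) \<Longrightarrow> norm x \<le> C"
    unfolding bounded_iff by blast
  have "norm (f e z) \<le> \<bar>C\<bar> * norm e ^ j" if "e \<noteq> 0" for e z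
  proof -
    have "f e z = f (norm e *\<^sub>R sgn e) (frac z + of_int \<lfloor>z\<rfloor>)" by (simp add: sgn_div_norm frac_def that)
    also have "\<dots> = norm e ^ j *\<^sub>R f (sgn e) (frac z)"
      unfolding per by (rule hom) (use that in \<open>auto simp: sgn_zero_iff\<close>)
    finally have "norm (f e z) = norm e ^ j * norm (f (sgn e) (frac z))" by simp
    moreover have "norm (f (sgn e) (frac z)) \<le> C"
    proof (rule C, rule image_eqI[of _ _ "(sgn e, frac z)"])
      show "(sgn e, frac z) \<in> sphere 0 1 \<times> {0..1}" using that frac_lt_1[of z] by (simp add: norm_sgn less_imp_le)
    qed simp
    then have "norm e ^ j * norm (f (sgn e) (frac z)) \<le> norm e ^ j * \<bar>C\<bar>" by (intro mult_left_mono) auto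
    ultimately show ?thesis by (simp add: mult.commute)
  qed
  then show ?thesis by (intro exI[of _ "\<bar>C\<bar>"]) simp
qed

lemma homogeneous_continuous:
  fixes f :: "'e::euclidean_space \<Rightarrow> real \<Rightarrow> 'b::real_normed_vector"
  assumes cont: "continuous_on {p. fst p \<noteq> 0} (\<lambda>p. f (fst p) (snd p))"
    and hom: "\<And>c e z. 0 < c \<Longrightarrow> e \<noteq> 0 \<Longrightarrow> f (c *\<^sub>R e) z = c ^ Suc j *\<^sub>R f e z"
    and per: "\<And>e z n. f e (z + of_int n) = f e z" and f0: "\<And>z. f 0 z = 0"
  shows "continuous_on UNIV (\<lambda>p. f (fst p) (snd p))"
  unfolding continuous_on_eq_continuous_at[OF open_UNIV]
proof
  fix p :: "'e \<times> real"
  show "isCont (\<lambda>p. f (fst p) (snd p)) p"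
  proof (cases "fst p = 0")
    case False
    have "open {p :: 'e \<times> real. fst p \<noteq> 0}" by (intro open_Collect_neq continuous_intros)
    from bspec[OF cont[unfolded continuous_on_eq_continuous_at[OF this]], of p] show ?thesis using False by simp
  next
    case True
    obtain C where C: "0 \<le> C" "\<And>e z. e \<noteq> 0 \<Longrightarrow> norm (f e z) \<le> C * norm e ^ Suc j"
      using homogeneous_bounded[OF cont hom per] by blast
    have b: "norm (f (fst x) (snd x)) \<le> C * norm (fst x) ^ Suc j" for x
      using C(2)[of "fst x"] f0 by (cases "fst x = 0") auto
    have "((\<lambda>x. C * norm (fst x) ^ Suc j) \<longlongrightarrow> C * norm (fst p) ^ Suc j) (at p)"
      by (intro tendsto_intros)
    then have "((\<lambda>x. C * norm (fst x) ^ Suc j) \<longlongrightarrow> 0) (at p)" using True by simp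
    then have "((\<lambda>x. f (fst x) (snd x)) \<longlongrightarrow> 0) (at p)"
      by (rule Lim_null_comparison[rotated]) (intro always_eventually allI b)
    then show ?thesis using True f0 by (simp add: isCont_def)
  qed
qed

text \<open>Handles the origin, where the generating function is defined by cases.\<close>

lemma quadratic_has_derivative_0:
  fixes f :: "'a::real_normed_vector \<Rightarrow> real"
  assumes b: "\<And>h. \<bar>f (x + h)\<bar> \<le> C * (norm h)\<^sup>2" and C: "0 \<le> C"
  shows "(f has_derivative (\<lambda>v. 0)) (at x)"
  unfolding has_derivative_at
proof (intro conjI)
  have f0: "f x = 0" using b[of 0] by simp
  have "norm (norm (f (x + h) - f x - 0) / norm h) \<le> C * norm h" for h
    using b[of h] f0 C by (cases "h = 0") (auto simp: divide_le_eq power2_eq_square mult.assoc)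
  then have "\<forall>\<^sub>F h in at 0. norm (norm (f (x + h) - f x - 0) / norm h) \<le> C * norm h"
    by (intro always_eventually allI)
  moreover have "((\<lambda>h::'a. C * norm h) \<longlongrightarrow> 0) (at 0)"
    by (rule tendsto_mult_right_zero[OF tendsto_norm_zero[OF tendsto_ident_at]])
  ultimately show "(\<lambda>h. norm (f (x + h) - f x - 0) / norm h) \<midarrow>0\<rightarrow> 0"
    by (rule Lim_null_comparison)
qed simp

text \<open>\<open>p + Pj (\<phi> p - p)\<close> averages w, takes the new sigma and keeps the old
  z: these are the mixed coordinates of the generating function.\<close>

definition Pj :: "((complex ^ 'n::finite) \<times> real) \<times> real \<Rightarrow> ((complex ^ 'n) \<times> real) \<times> real" where
  "Pj u = (((1/2) *\<^sub>R fst (fst u), snd (fst u)), 0)"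

lemma Pj_linear: "bounded_linear Pj"
  unfolding linear_conv_bounded_linear[symmetric] by (rule linearI) (auto simp: Pj_def algebra_simps)

lemma norm_Pj_le: "norm (Pj u) \<le> norm u"
proof -
  have "(norm (Pj u))\<^sup>2 \<le> (norm u)\<^sup>2"
    by (simp add: Pj_def norm_prod_def power_mult_distrib power_divide)
  then show ?thesis by (simp add: power2_le_iff_abs_le)
qed

text \<open>Closeness is asked on an annulus only, homogeneity carries it further. Displacement at
  most 1/4 keeps the fixed point iteration in a ball of radius 1/4, and the bound 1/2 on derivatives
  makes it a contraction.\<close>

locale near_identity =
  fixes k :: nat and mm :: "'n::finite \<Rightarrow> int"
    and \<phi> :: "((complex ^ 'n) \<times> real) \<times> real \<Rightarrow> ((complex ^ 'n) \<times> real) \<times> real"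
    and \<phi>' :: "((complex ^ 'n) \<times> real) \<times> real \<Rightarrow> ((complex ^ 'n) \<times> real) \<times> real \<Rightarrow> ((complex ^ 'n) \<times> real) \<times> real"
  assumes \<phi>_D: "\<And>p. fst p \<noteq> 0 \<Longrightarrow> fst (\<phi> p) \<noteq> 0"
    and \<phi>_der: "\<And>p. fst p \<noteq> 0 \<Longrightarrow> (\<phi> has_derivative \<phi>' p) (at p)"
    and \<phi>_lam: "\<And>p v. fst p \<noteq> 0 \<Longrightarrow> lam (\<phi> p) (\<phi>' p v) = lam p v"
    and \<phi>_hom: "\<And>c p. 0 < c \<Longrightarrow> fst p \<noteq> 0 \<Longrightarrow> \<phi> (hs c p) = hs c (\<phi> p)"
    and \<phi>_per: "\<And>n p. fst p \<noteq> 0 \<Longrightarrow> \<phi> (shift (of_int n) p) = shift (of_int n) (\<phi> p)"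
    and \<phi>_tw: "\<And>p. fst p \<noteq> 0 \<Longrightarrow> \<phi> (twX k mm p) = twX k mm (\<phi> p)"
    and near: "\<And>p. 1/8 \<le> nu p \<Longrightarrow> nu p \<le> 8 \<Longrightarrow> norm (\<phi> p - p) \<le> 1/4"
    and near': "\<And>p v. 1/8 \<le> nu p \<Longrightarrow> nu p \<le> 8 \<Longrightarrow> norm (\<phi>' p v - v) \<le> 1/2 * norm v"
begin

definition Gm where "Gm p = p + Pj (\<phi> p - p)"

lemma Gm_eq: "Gm p = (((1/2) *\<^sub>R (fst (fst p) + fst (fst (\<phi> p))), snd (fst (\<phi> p))), snd p)"
  by (simp add: Gm_def Pj_def prod_eq_iff algebra_simps flip: scaleR_add_left)

lemma Gm_hom: "0 < c \<Longrightarrow> fst p \<noteq> 0 \<Longrightarrow> Gm (hs c p) = hs c (Gm p)"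
  by (simp add: Gm_eq \<phi>_hom) (simp add: hs_def algebra_simps)

lemma Gm_per: "fst p \<noteq> 0 \<Longrightarrow> Gm (shift (of_int n) p) = shift (of_int n) (Gm p)"
  by (simp add: Gm_eq \<phi>_per) (simp add: shift_def)

lemma Gm_tw: "fst p \<noteq> 0 \<Longrightarrow> Gm (twX k mm p) = twX k mm (Gm p)"
  by (simp add: Gm_eq \<phi>_tw) (simp add: twX_def)

lemma Gm_near: "1/8 \<le> nu p \<Longrightarrow> nu p \<le> 8 \<Longrightarrow> norm (Gm p - p) \<le> 1/4"
  using near[of p] norm_Pj_le[of "\<phi> p - p"] by (simp add: Gm_def)

lemma Gm_der: "fst p \<noteq> 0 \<Longrightarrow> (Gm has_derivative (\<lambda>v. v + Pj (\<phi>' p v - v))) (at p)"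
  unfolding Gm_def[abs_def]
  by (intro has_derivative_add has_derivative_ident bounded_linear.has_derivative[OF Pj_linear] has_derivative_diff \<phi>_der)

lemma Gm_nu: 
  assumes "fst p \<noteq> 0"
  shows "1/8 * nu p \<le> nu (Gm p)" "nu (Gm p) \<le> 8 * nu p"
proof -
  let ?c = "inverse (sqrt (nu p))"
  have np: "0 < nu p" using assms nu_pos_iff by blast
  have n1: "nu (hs ?c p) = 1" by (rule normalized[OF assms])
  have "norm (Gm (hs ?c p) - hs ?c p) \<le> 1/4" by (rule Gm_near) (unfold n1, simp_all)
  from nu_near[OF n1 this] have "1/8 \<le> nu (Gm (hs ?c p))" "nu (Gm (hs ?c p)) \<le> 8" by auto
  moreover have "nu (Gm (hs ?c p)) = nu (Gm p) / nu p"
    using np assms by (simp add: Gm_hom power_inverse divide_inverse mult.commute)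
  ultimately have "1/8 \<le> nu (Gm p) / nu p" "nu (Gm p) / nu p \<le> 8" by simp_all
  then show "1/8 * nu p \<le> nu (Gm p)" "nu (Gm p) \<le> 8 * nu p" using np by (simp_all add: field_simps)
qed

lemma Gm_D: "fst p \<noteq> 0 \<Longrightarrow> fst (Gm p) \<noteq> 0"
  using Gm_nu(1)[of p] nu_pos_iff[of p] nu_pos_iff[of "Gm p"] by auto

lemma contraction:
  assumes "nu q = 1" "p1 \<in> cball q (1/4)" "p2 \<in> cball q (1/4)"
  shows "norm (Pj (\<phi> p1 - p1) - Pj (\<phi> p2 - p2)) \<le> 1/2 * norm (p1 - p2)"
proof (rule differentiable_bound[OF convex_cball _ _ assms(2,3), where f' = "\<lambda>p v. Pj (\<phi>' p v - v)"])
  fix p assume "p \<in> cball q (1/4)"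
  then have "norm (p - q) \<le> 1/4" by (simp add: dist_norm norm_minus_commute)
  note n = nu_near[OF assms(1) this]
  then have "fst p \<noteq> 0" using nu_pos_iff[of p] by linarith
  then show "((\<lambda>p. Pj (\<phi> p - p)) has_derivative (\<lambda>v. Pj (\<phi>' p v - v))) (at p within cball q (1/4))"
    by (intro has_derivative_at_withinI[OF bounded_linear.has_derivative[OF Pj_linear]] has_derivative_diff \<phi>_der has_derivative_ident)
  show "onorm (\<lambda>v. Pj (\<phi>' p v - v)) \<le> 1/2"
  proof (rule onorm_le)
    show "norm (Pj (\<phi>' p v - v)) \<le> 1/2 * norm v" for v
      using near'[OF n, of v] norm_Pj_le[of "\<phi>' p v - v"] by linarith
  qed
qed

text \<open>Rescaled so that the common image q has \<open>nu q = 1\<close>, both preimages lie in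
  the ball about q on which the displacement contracts.\<close>

lemma Gm_inj:
  assumes "fst p1 \<noteq> 0" "fst p2 \<noteq> 0" "Gm p1 = Gm p2"
  shows "p1 = p2"
proof -
  define q where "q = Gm p1"
  have q0: "fst q \<noteq> 0" unfolding q_def by (rule Gm_D[OF assms(1)])
  define c where "c = inverse (sqrt (nu q))"
  have c: "0 < c" unfolding c_def using q0 nu_pos_iff[of q] by simp
  have nq: "nu (hs c q) = 1" unfolding c_def by (rule normalized[OF q0])
  have mem: "hs c p \<in> cball (hs c q) (1/4)" "Gm (hs c p) = hs c q" if "fst p \<noteq> 0" "Gm p = q" for p
  proof -
    show g: "Gm (hs c p) = hs c q" using Gm_hom[OF c that(1)] that(2) by simp
    have f: "fst (hs c p) \<noteq> 0" using that(1) c fst_hs[of c p] by simp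
    have "1/8 \<le> nu (hs c p)" "nu (hs c p) \<le> 8" using Gm_nu[OF f] unfolding g nq by auto
    then have "norm (Gm (hs c p) - hs c p) \<le> 1/4" by (rule Gm_near)
    then show "hs c p \<in> cball (hs c q) (1/4)" unfolding g by (simp add: dist_norm)
  qed
  note m1 = mem[OF assms(1), unfolded q_def, OF refl, folded q_def] and m2 = mem[OF assms(2), unfolded q_def, OF assms(3)[symmetric], folded q_def]
  have "hs c p1 - hs c p2 = - (Pj (\<phi> (hs c p1) - hs c p1) - Pj (\<phi> (hs c p2) - hs c p2))"
    using m1(2) m2(2) unfolding Gm_def by (simp add: algebra_simps)
  then have "norm (hs c p1 - hs c p2) \<le> 1/2 * norm (hs c p1 - hs c p2)"
    using contraction[OF nq m1(1) m2(1)] by (metis norm_minus_cancel)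
  then have "hs c p1 = hs c p2" by simp
  then have "hs (inverse c) (hs c p1) = hs (inverse c) (hs c p2)" by simp
  then show ?thesis using c by simp
qed

text \<open>A preimage of q is a fixed point of p -> q - Pj (\<phi> p - p), which Banach's theorem
  provides.\<close>

lemma Gm_surj_normalized:
  assumes "nu q = 1"
  shows "\<exists>p. p \<in> cball q (1/4) \<and> Gm p = q"
proof -
  have "\<exists>!p\<in>cball q (1/4). q - Pj (\<phi> p - p) = p"
  proof (rule Banach_fix)
    show "complete (cball q (1/4))" by (simp add: complete_eq_closed)
    show "(\<lambda>p. q - Pj (\<phi> p - p)) ` cball q (1/4) \<subseteq> cball q (1/4)"
    proof (rule image_subsetI)
      fix p assume "p \<in> cball q (1/4)"
      then have "norm (p - q) \<le> 1/4" by (simp add: dist_norm norm_minus_commute)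
      from near[OF nu_near[OF assms this]] have "norm (Pj (\<phi> p - p)) \<le> 1/4" using norm_Pj_le[of "\<phi> p - p"] by linarith
      then show "q - Pj (\<phi> p - p) \<in> cball q (1/4)" by (simp add: dist_norm)
    qed
    show "dist (q - Pj (\<phi> x - x)) (q - Pj (\<phi> y - y)) \<le> 1/2 * dist x y"
      if "x \<in> cball q (1/4)" "y \<in> cball q (1/4)" for x y
      using contraction[OF assms that] by (simp add: dist_norm norm_minus_commute)
  qed auto
  then obtain p where "p \<in> cball q (1/4)" "q - Pj (\<phi> p - p) = p" by blast
  then show ?thesis by (intro exI[of _ p]) (simp add: Gm_def eq_diff_eq[symmetric])
qed

lemma Gm_surj:
  assumes "fst q \<noteq> 0" shows "\<exists>p. fst p \<noteq> 0 \<and> Gm p = q"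
proof -
  define c where "c = inverse (sqrt (nu q))"
  have c: "0 < c" unfolding c_def using assms nu_pos_iff[of q] by simp
  have nq: "nu (hs c q) = 1" unfolding c_def by (rule normalized[OF assms])
  obtain p where p: "p \<in> cball (hs c q) (1/4)" "Gm p = hs c q" using Gm_surj_normalized[OF nq] by blast
  have "norm (p - hs c q) \<le> 1/4" using p(1) by (simp add: dist_norm norm_minus_commute)
  from nu_near(1)[OF nq this] have p0: "fst p \<noteq> 0" using nu_pos_iff[of p] by linarith
  have "Gm (hs (inverse c) p) = q" using Gm_hom[of "inverse c" p] c p0 p(2) by simp
  moreover have "fst (hs (inverse c) p) \<noteq> 0" using fst_hs[of "inverse c" p] c p0 by simp
  ultimately show ?thesis by blast
qed

definition Gi where "Gi y = (SOME p. fst p \<noteq> 0 \<and> Gm p = y)"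

lemma Gi: assumes "fst y \<noteq> 0" shows "fst (Gi y) \<noteq> 0" "Gm (Gi y) = y"
  using someI_ex[OF Gm_surj[OF assms]] unfolding Gi_def by auto

lemma Gi_eqI: "fst p \<noteq> 0 \<Longrightarrow> Gm p = y \<Longrightarrow> Gi y = p"
  using Gm_inj[of "Gi y" p] Gi[of y] Gm_D[of p] by auto

lemma Gi_hom: "0 < c \<Longrightarrow> fst y \<noteq> 0 \<Longrightarrow> Gi (hs c y) = hs c (Gi y)"
  by (rule Gi_eqI) (use Gi[of y] fst_hs[of c "Gi y"] Gm_hom[of c "Gi y"] in auto)

lemma Gi_per: "fst y \<noteq> 0 \<Longrightarrow> Gi (shift (of_int n) y) = shift (of_int n) (Gi y)"
  by (rule Gi_eqI) (use Gi[of y] Gm_per[of "Gi y" n] in auto)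

lemma Gi_tw: "fst y \<noteq> 0 \<Longrightarrow> Gi (twX k mm y) = twX k mm (Gi y)"
  by (rule Gi_eqI) (use Gi[of y] fst_twX[of k mm "Gi y"] Gm_tw[of "Gi y"] in auto)

lemma open_D: "open {p :: ((complex ^ 'n) \<times> real) \<times> real. fst p \<noteq> 0}"
  by (intro open_Collect_neq continuous_intros)

text \<open>The derivative of \<open>Gm\<close> differs from the identity by at most one half, so it
  is invertible and the inverse function theorem applies.\<close>

lemma Gi_differentiable_normalized:
  assumes "nu y = 1" shows "\<exists>G'. (Gi has_derivative G') (at y)"
proof -
  have y0: "fst y \<noteq> 0" using assms nu_pos_iff[of y] by simp
  let ?x = "Gi y"
  have x: "fst ?x \<noteq> 0" "Gm ?x = y" using Gi[OF y0] by auto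
  have n: "1/8 \<le> nu ?x" "nu ?x \<le> 8" using Gm_nu[OF x(1)] unfolding x(2) assms by auto
  let ?A = "\<lambda>v. v + Pj (\<phi>' ?x v - v)"
  have A: "(Gm has_derivative ?A) (at ?x)" by (rule Gm_der[OF x(1)])
  have lin: "linear ?A" using has_derivative_linear[OF A] .
  have "inj ?A"
    unfolding linear_injective_0[OF lin]
  proof (intro allI impI)
    fix v assume "?A v = 0"
    then have "norm v = norm (Pj (\<phi>' ?x v - v))" by (metis add_eq_0_iff norm_minus_cancel)
    also have "\<dots> \<le> 1/2 * norm v" using near'[OF n, of v] norm_Pj_le[of "\<phi>' ?x v - v"] by linarith
    finally show "v = 0" by simp
  qed
  then obtain B where B: "linear B" "\<And>v. ?A (B v) = v" using linear_injective_isomorphism[OF lin] by blast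
  have "(Gi has_derivative B) (at (Gm ?x))"
  proof (rule has_derivative_inverse_strong[OF open_D _ _ _ A])
    show "?x \<in> {p. fst p \<noteq> 0}" using x by simp
    show "continuous_on {p. fst p \<noteq> 0} Gm"
      by (intro continuous_at_imp_continuous_on ballI has_derivative_continuous[OF Gm_der]) simp
    show "Gi (Gm p) = p" if "p \<in> {p. fst p \<noteq> 0}" for p using that Gi_eqI[of p] by simp
    show "?A \<circ> B = id" using B(2) by (simp add: fun_eq_iff)
  qed
  then show ?thesis unfolding x(2) by blast
qed

lemma Gi_differentiable:
  assumes "fst y \<noteq> 0" shows "\<exists>G'. (Gi has_derivative G') (at y)"
proof -
  define c where "c = inverse (sqrt (nu y))"
  have c: "0 < c" unfolding c_def using assms nu_pos_iff[of y] by simp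
  have "nu (hs c y) = 1" unfolding c_def by (rule normalized[OF assms])
  then obtain G' where G': "(Gi has_derivative G') (at (hs c y))" using Gi_differentiable_normalized by blast
  have "((\<lambda>y. hs (inverse c) (Gi (hs c y))) has_derivative (\<lambda>v. hs (inverse c) (G' (hs c v)))) (at y)"
    by (intro bounded_linear.has_derivative[OF bounded_linear_hs]
        has_derivative_compose[OF bounded_linear.has_derivative[OF bounded_linear_hs has_derivative_ident] G'])
  then have "(Gi has_derivative (\<lambda>v. hs (inverse c) (G' (hs c v)))) (at y)"
    by (rule has_derivative_transform_within_open[OF _ open_D]) (use assms c in \<open>auto simp: Gi_hom\<close>)
  then show ?thesis by blast
qed

text \<open>The increments of z, sigma and w under \<phi> as functions of the mixed point y;
  \<open>bD\<close> is the old sigma minus the new one.\<close>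

definition aD where "aD y = snd (\<phi> (Gi y)) - snd y"
definition bD where "bD y = snd (fst (Gi y)) - snd (fst y)"
definition dD where "dD y = fst (fst (\<phi> (Gi y))) - fst (fst (Gi y))"
text \<open>Forced by Euler's identity: a function of weight 2 is half its differential on (w, 2 *
  sigma), and the desired differential gives 2 * sigma * a + cxp w d there. The primitive is thus
  explicit.\<close>

definition SD where "SD y = snd (fst y) * aD y + (1/2) * cxp (fst (fst y)) (dD y)"

lemma Gi_parts:
  assumes "fst y \<noteq> 0"
  shows "Gi y = ((fst (fst y) - (1/2) *\<^sub>R dD y, snd (fst y) + bD y), snd y)"
    "\<phi> (Gi y) = ((fst (fst y) + (1/2) *\<^sub>R dD y, snd (fst y)), snd y + aD y)"
proof -
  let ?w = "fst (fst (Gi y))" and ?W = "fst (fst (\<phi> (Gi y)))"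
  have "(((1/2) *\<^sub>R (?w + ?W), snd (fst (\<phi> (Gi y)))), snd (Gi y)) = y" using Gi(2)[OF assms] unfolding Gm_eq .
  then have e: "fst (fst y) = (1/2) *\<^sub>R (?w + ?W)" "snd (fst (\<phi> (Gi y))) = snd (fst y)" "snd (Gi y) = snd y"
    by (metis fst_conv snd_conv)+
  have "(1/2) *\<^sub>R (?w + ?W) - (1/2) *\<^sub>R (?W - ?w) = ?w" "(1/2) *\<^sub>R (?w + ?W) + (1/2) *\<^sub>R (?W - ?w) = ?W"
    by (simp_all add: algebra_simps flip: scaleR_add_left)
  then show "Gi y = ((fst (fst y) - (1/2) *\<^sub>R dD y, snd (fst y) + bD y), snd y)"
    "\<phi> (Gi y) = ((fst (fst y) + (1/2) *\<^sub>R dD y, snd (fst y)), snd y + aD y)"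
    unfolding prod_eq_iff by (simp_all add: dD_def bD_def aD_def e)
qed

lemma D_hom:
  assumes "0 < c" "fst y \<noteq> 0"
  shows "aD (hs c y) = aD y" "bD (hs c y) = c\<^sup>2 * bD y" "dD (hs c y) = c *\<^sub>R dD y" "SD (hs c y) = c\<^sup>2 * SD y"
proof -
  show 1: "aD (hs c y) = aD y" "bD (hs c y) = c\<^sup>2 * bD y" "dD (hs c y) = c *\<^sub>R dD y"
    using assms Gi(1)[OF assms(2)] by (simp_all add: aD_def bD_def dD_def Gi_hom \<phi>_hom) (simp_all add: hs_def algebra_simps)
  show "SD (hs c y) = c\<^sup>2 * SD y" unfolding SD_def 1
    by (simp add: hs_def cxp.scaleR_left cxp.scaleR_right power2_eq_square algebra_simps)
qed

lemma D_per:
  assumes "fst y \<noteq> 0"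
  shows "aD (shift (of_int n) y) = aD y" "bD (shift (of_int n) y) = bD y" "dD (shift (of_int n) y) = dD y" "SD (shift (of_int n) y) = SD y"
proof -
  show 1: "aD (shift (of_int n) y) = aD y" "bD (shift (of_int n) y) = bD y" "dD (shift (of_int n) y) = dD y"
    using assms Gi(1)[OF assms] by (simp_all add: aD_def bD_def dD_def Gi_per \<phi>_per) (simp_all add: shift_def)
  show "SD (shift (of_int n) y) = SD y" unfolding SD_def 1 by (simp add: shift_def)
qed

lemma D_tw:
  assumes "fst y \<noteq> 0"
  shows "aD (twX k mm y) = aD y" "bD (twX k mm y) = bD y" "dD (twX k mm y) = tw k mm (dD y)"
  using assms Gi(1)[OF assms] by (simp_all add: aD_def bD_def dD_def Gi_tw \<phi>_tw) (simp_all add: twX_def)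

lemma D_cont:
  "continuous_on {y. fst y \<noteq> 0} aD" "continuous_on {y. fst y \<noteq> 0} bD" "continuous_on {y. fst y \<noteq> 0} dD"
proof -
  have G: "continuous_on {y. fst y \<noteq> 0} Gi"
  proof (intro continuous_at_imp_continuous_on ballI)
    fix y :: "((complex ^ 'n) \<times> real) \<times> real" assume "y \<in> {y. fst y \<noteq> 0}"
    then obtain G' where "(Gi has_derivative G') (at y)" using Gi_differentiable[of y] by auto
    then show "isCont Gi y" by (rule has_derivative_continuous)
  qed
  have p: "continuous_on {y. fst y \<noteq> 0} \<phi>"
    by (intro continuous_at_imp_continuous_on ballI has_derivative_continuous[OF \<phi>_der]) simp
  have "continuous_on {y. fst y \<noteq> 0} (\<lambda>y. \<phi> (Gi y))"
    by (rule continuous_on_compose2[OF p G]) (use Gi(1) in auto)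
  then show "continuous_on {y. fst y \<noteq> 0} aD" "continuous_on {y. fst y \<noteq> 0} bD" "continuous_on {y. fst y \<noteq> 0} dD"
    unfolding aD_def[abs_def] bD_def[abs_def] dD_def[abs_def] by (intro continuous_intros G; assumption)+
qed

text \<open>Invariance of \<open>lam\<close> under \<phi>, rewritten in the mixed coordinates,
  cancels the derivatives of \<phi> and of \<open>Gi\<close> that the product rule produces.\<close>

lemma SD_der:
  assumes "fst y \<noteq> 0"
  shows "(SD has_derivative (\<lambda>v. aD y * snd (fst v) + bD y * snd v - cxp (dD y) (fst (fst v)))) (at y)"
proof -
  obtain G' where G': "(Gi has_derivative G') (at y)" using Gi_differentiable[OF assms] by blast
  note x0 = Gi(1)[OF assms]
  let ?p = "\<lambda>v. \<phi>' (Gi y) (G' v)"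
  have P: "((\<lambda>y. \<phi> (Gi y)) has_derivative ?p) (at y)" by (rule has_derivative_compose[OF G' \<phi>_der[OF x0]])
  have "((\<lambda>y. Gm (Gi y)) has_derivative (\<lambda>v. G' v + Pj (?p v - G' v))) (at y)"
    by (rule has_derivative_compose[OF G' Gm_der[OF x0]])
  moreover have "((\<lambda>y. Gm (Gi y)) has_derivative (\<lambda>v. v)) (at y)"
    by (rule has_derivative_transform_within_open[OF has_derivative_ident open_D]) (use assms Gi(2) in auto)
  ultimately have "(\<lambda>v. G' v + Pj (?p v - G' v)) = (\<lambda>v. v)" by (rule has_derivative_unique)
  then have v: "v = G' v + Pj (?p v - G' v)" for v by metis
  have vp: "fst (fst v) = (1/2) *\<^sub>R (fst (fst (G' v)) + fst (fst (?p v)))" "snd (fst v) = snd (fst (?p v))" "snd v = snd (G' v)" for v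
    by (subst v, simp add: Pj_def algebra_simps flip: scaleR_add_left)+
  have S: "(SD has_derivative (\<lambda>v. snd (fst y) * (snd (?p v) - snd v) + snd (fst v) * aD y
     + (1/2) * (cxp (fst (fst y)) (fst (fst (?p v)) - fst (fst (G' v))) + cxp (fst (fst v)) (dD y)))) (at y)"
    unfolding SD_def[abs_def] aD_def[abs_def] dD_def[abs_def]
    by (intro has_derivative_add has_derivative_mult has_derivative_diff has_derivative_mult_right cxp.FDERIV
       has_derivative_fst has_derivative_snd has_derivative_ident P G')
  have "snd (fst y) * (snd (?p v) - snd v) + snd (fst v) * aD y
     + (1/2) * (cxp (fst (fst y)) (fst (fst (?p v)) - fst (fst (G' v))) + cxp (fst (fst v)) (dD y))
     = aD y * snd (fst v) + bD y * snd v - cxp (dD y) (fst (fst v))" for v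
  proof -
    define w W w' W' where "w = fst (fst (Gi y))" and "W = fst (fst (\<phi> (Gi y)))" and "w' = fst (fst (G' v))" and "W' = fst (fst (?p v))"
    have d: "dD y = W - w" by (simp add: dD_def w_def W_def)
    have s: "snd (fst (\<phi> (Gi y))) = snd (fst y)" "snd (fst (Gi y)) = snd (fst y) + bD y" using Gi_parts[OF assms] by simp_all
    have m: "fst (fst y) = (1/2) *\<^sub>R (w + W)"
      using arg_cong[OF Gi(2)[OF assms], of "\<lambda>p. fst (fst p)"] by (simp add: Gm_eq w_def W_def)
    have m': "fst (fst v) = (1/2) *\<^sub>R (w' + W')" using vp(1)[of v] by (simp add: w'_def W'_def)
    \<comment> \<open>This is \<open>\<phi>_lam\<close> at the tangent vector
      \<open>G' v\<close>.\<close>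
    have l: "snd (fst y) * snd (?p v) + (1/2) * cxp W W' = (snd (fst y) + bD y) * snd v + (1/2) * cxp w w'"
      using \<phi>_lam[OF x0, of "G' v"] vp(3)[of v] s by (simp add: lam_def w_def W_def w'_def W'_def)
    have "cxp (w' + W') (W - w) = - cxp (W - w) (w' + W')" by (rule cxp_antisym)
    then show ?thesis
      using l unfolding d m m' w'_def[symmetric] W'_def[symmetric]
      by (simp add: cxp.add_left cxp.add_right cxp.diff_left cxp.diff_right cxp.scaleR_left cxp.scaleR_right algebra_simps)
  qed
  then show ?thesis by (intro has_derivative_eq_rhs[OF S] ext)
qed

definition yy :: "(complex ^ 'n) \<times> real \<Rightarrow> real \<Rightarrow> ((complex ^ 'n) \<times> real) \<times> real" where
  "yy e z = ((fst e, sg e), z)"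

lemma yy_D: "e \<noteq> 0 \<Longrightarrow> fst (yy e z) \<noteq> 0"
  by (auto simp: yy_def sg_def zero_prod_def prod_eq_iff)

text \<open>For \<open>bE\<close>, \<open>dE\<close> and \<open>SE\<close> the value 0 at the origin
  is the continuous extension; for \<open>aE\<close>, of weight 0, it only serves to keep the
  function bounded.\<close>

definition aE where "aE e z = (if e = 0 then 0 else aD (yy e z))"
definition bE where "bE e z = (if e = 0 then 0 else bD (yy e z))"
definition dE where "dE e z = (if e = 0 then 0 else dD (yy e z))"
definition SE where "SE e z = (if e = 0 then 0 else SD (yy e z))"

lemma sg_scale: "0 \<le> c \<Longrightarrow> sg (c *\<^sub>R e) = c\<^sup>2 * sg e" for e :: "(complex ^ 'n) \<times> real"
  by (simp add: sg_def power2_eq_square)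

lemma yy_hom: "0 < c \<Longrightarrow> yy (c *\<^sub>R e) z = hs c (yy e z)"
  by (simp add: yy_def hs_def sg_scale)

lemma E_hom:
  assumes "0 < c" "e \<noteq> 0"
  shows "aE (c *\<^sub>R e) z = aE e z" "bE (c *\<^sub>R e) z = c\<^sup>2 * bE e z" "dE (c *\<^sub>R e) z = c *\<^sub>R dE e z" "SE (c *\<^sub>R e) z = c\<^sup>2 * SE e z"
  using assms by (simp_all add: aE_def bE_def dE_def SE_def yy_hom D_hom yy_D)

lemma yy_shift: "yy e (z + n) = shift n (yy e z)" by (simp add: yy_def shift_def)

lemma E_per:
  "aE e (z + of_int n) = aE e z" "bE e (z + of_int n) = bE e z" "dE e (z + of_int n) = dE e z" "SE e (z + of_int n) = SE e z"
  by (simp_all add: aE_def bE_def dE_def SE_def yy_shift D_per yy_D)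

lemma E_tw:
  "aE (tw k mm w, y) z = aE (w, y) z" "bE (tw k mm w, y) z = bE (w, y) z" "dE (tw k mm w, y) z = tw k mm (dE (w, y) z)"
proof -
  have n: "norm (tw k mm w, y) = norm (w, y)" by (simp add: norm_Pair)
  then have z: "(tw k mm w, y) = 0 \<longleftrightarrow> (w, y) = 0" by (metis norm_eq_zero)
  have "yy (tw k mm w, y) z = twX k mm (yy (w, y) z)" by (simp add: yy_def twX_def sg_def n)
  then show "aE (tw k mm w, y) z = aE (w, y) z" "bE (tw k mm w, y) z = bE (w, y) z" "dE (tw k mm w, y) z = tw k mm (dE (w, y) z)"
    using D_tw[OF yy_D[of "(w, y)" z]] unfolding aE_def bE_def dE_def z by simp_all
qed

lemma yy_cont: "continuous_on A (\<lambda>p. yy (fst p) (snd p))"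
  unfolding yy_def by (intro continuous_intros continuous_on_compose2[OF continuous_on_sg[of UNIV]]) auto

lemma E_cont:
  "continuous_on {p. fst p \<noteq> 0} (\<lambda>p. aE (fst p) (snd p))"
  "continuous_on {p. fst p \<noteq> 0} (\<lambda>p. bE (fst p) (snd p))"
  "continuous_on {p. fst p \<noteq> 0} (\<lambda>p. dE (fst p) (snd p))"
proof -
  have im: "(\<lambda>p. yy (fst p) (snd p)) ` {p. fst p \<noteq> 0} \<subseteq> {y. fst y \<noteq> 0}" using yy_D by auto
  show "continuous_on {p. fst p \<noteq> 0} (\<lambda>p. aE (fst p) (snd p))"
    by (rule continuous_on_eq[OF continuous_on_compose2[OF D_cont(1) yy_cont im]]) (simp add: aE_def)
  show "continuous_on {p. fst p \<noteq> 0} (\<lambda>p. bE (fst p) (snd p))"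
    by (rule continuous_on_eq[OF continuous_on_compose2[OF D_cont(2) yy_cont im]]) (simp add: bE_def)
  show "continuous_on {p. fst p \<noteq> 0} (\<lambda>p. dE (fst p) (snd p))"
    by (rule continuous_on_eq[OF continuous_on_compose2[OF D_cont(3) yy_cont im]]) (simp add: dE_def)
qed

lemma aE_bounded: "\<exists>C. \<forall>e z. \<bar>aE e z\<bar> \<le> C"
proof -
  obtain C where C: "0 \<le> C" "\<And>e z. e \<noteq> 0 \<Longrightarrow> norm (aE e z) \<le> C * norm e ^ 0"
    using homogeneous_bounded[OF E_cont(1), where j = 0] E_hom(1) E_per(1) by auto
  have "\<bar>aE e z\<bar> \<le> C" for e z using C(1) C(2)[of e z] by (cases "e = 0") (auto simp: aE_def)
  then show ?thesis by blast
qed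

lemma bE_cont: "continuous_on UNIV (\<lambda>p. bE (fst p) (snd p))"
  by (rule homogeneous_continuous[OF E_cont(2), where j = 1]) (use E_hom(2) E_per(2) in \<open>auto simp: bE_def power2_eq_square\<close>)

lemma dE_cont: "continuous_on UNIV (\<lambda>p. dE (fst p) (snd p))"
  by (rule homogeneous_continuous[OF E_cont(3), where j = 0]) (use E_hom(3) E_per(3) in \<open>auto simp: dE_def\<close>)

lemma SE_hom: "0 \<le> c \<Longrightarrow> SE (c *\<^sub>R e) z = c\<^sup>2 * SE e z"
  using E_hom(4)[of c e z] by (cases "c = 0 \<or> e = 0") (auto simp: SE_def)

lemma SE_der_nz:
  assumes "e \<noteq> 0"
  shows "((\<lambda>p. SE (fst p) (snd p)) has_derivative
       (\<lambda>v. aE e z * (gsg e \<bullet> fst v) + bE e z * snd v - cxp (dE e z) (fst (fst v)))) (at (e, z))"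
proof -
  have y: "((\<lambda>p. yy (fst p) (snd p)) has_derivative (\<lambda>v. ((fst (fst v), gsg e \<bullet> fst v), snd v))) (at (e, z))"
  proof -
    have "((\<lambda>p. sg (fst p)) has_derivative (\<lambda>v. gsg e \<bullet> fst v)) (at (e, z))"
      by (rule has_derivative_eq_rhs[OF has_derivative_compose[OF has_derivative_fst[OF has_derivative_ident] sg_has_derivative]]) simp
    then show ?thesis unfolding yy_def by (intro has_derivative_Pair has_derivative_fst has_derivative_snd has_derivative_ident)
  qed
  have "((\<lambda>p. SD (yy (fst p) (snd p))) has_derivative
     (\<lambda>v. aE e z * (gsg e \<bullet> fst v) + bE e z * snd v - cxp (dE e z) (fst (fst v)))) (at (e, z))"
  proof -
    have "(SD has_derivative (\<lambda>v. aE e z * snd (fst v) + bE e z * snd v - cxp (dE e z) (fst (fst v)))) (at (yy (fst (e, z)) (snd (e, z))))"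
      using SD_der[OF yy_D[OF assms, of z]] assms by (simp add: aE_def bE_def dE_def)
    from has_derivative_compose[OF y this] show ?thesis by simp
  qed
  moreover have "open {p :: ((complex ^ 'n) \<times> real) \<times> real. fst p \<noteq> 0}" by (rule open_D)
  ultimately show ?thesis
    by (rule has_derivative_transform_within_open) (use assms in \<open>auto simp: SE_def\<close>)
qed

lemma SE_der:
  "((\<lambda>p. SE (fst p) (snd p)) has_derivative
       (\<lambda>v. aE e z * (gsg e \<bullet> fst v) + bE e z * snd v - cxp (dE e z) (fst (fst v)))) (at (e, z))"
proof (cases "e = 0")
  case True
  have c: "continuous_on {p. fst p \<noteq> 0} (\<lambda>p. SE (fst p) (snd p))"
  proof (intro continuous_at_imp_continuous_on ballI)
    fix p :: "((complex ^ 'n) \<times> real) \<times> real" assume "p \<in> {p. fst p \<noteq> 0}"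
    then show "isCont (\<lambda>p. SE (fst p) (snd p)) p"
      using has_derivative_continuous[OF SE_der_nz[of "fst p" "snd p"]] by simp
  qed
  obtain C where C: "0 \<le> C" "\<And>e z. e \<noteq> 0 \<Longrightarrow> norm (SE e z) \<le> C * norm e ^ 2"
    using homogeneous_bounded[OF c, where j = 2] E_hom(4) E_per(4) by auto
  have "\<bar>SE (fst ((0, z) + h)) (snd ((0, z) + h))\<bar> \<le> C * (norm h)\<^sup>2" for h
  proof (cases "fst h = 0")
    case False
    have "norm (SE (fst h) (z + snd h)) \<le> C * norm (fst h) ^ 2" by (rule C(2)[OF False])
    also have "\<dots> \<le> C * (norm h)\<^sup>2" using norm_fst_le[of "fst h" "snd h"] C(1) by (intro mult_left_mono power_mono) auto
    finally show ?thesis by simp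
  qed (use C(1) in \<open>simp add: SE_def\<close>)
  from quadratic_has_derivative_0[OF this C(1)] show ?thesis using True by (simp add: aE_def bE_def dE_def cxp.zero_left)
qed (rule SE_der_nz)

text \<open>The dictionary between critical equations and the map: in C^n the edge
  \<open>dE e z\<close> with midpoint \<open>fst e\<close> leads from a point to its image, and the
  image is the origin only if e is.\<close>

lemma generating:
  assumes "e \<noteq> 0"
  shows "\<phi> ((fst e - (1/2) *\<^sub>R dE e z, sg e + bE e z), z) = ((fst e + (1/2) *\<^sub>R dE e z, sg e), z + aE e z)"
    "(fst e - (1/2) *\<^sub>R dE e z, sg e + bE e z) \<noteq> 0" "(fst e + (1/2) *\<^sub>R dE e z, sg e) \<noteq> 0"
proof -
  note y = yy_D[OF assms, of z]
  have 1: "Gi (yy e z) = ((fst e - (1/2) *\<^sub>R dE e z, sg e + bE e z), z)"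
    using Gi_parts(1)[OF y] assms by (simp add: dE_def bE_def) (simp add: yy_def)
  have 2: "\<phi> (Gi (yy e z)) = ((fst e + (1/2) *\<^sub>R dE e z, sg e), z + aE e z)"
    using Gi_parts(2)[OF y] assms by (simp add: dE_def aE_def) (simp add: yy_def)
  show "\<phi> ((fst e - (1/2) *\<^sub>R dE e z, sg e + bE e z), z) = ((fst e + (1/2) *\<^sub>R dE e z, sg e), z + aE e z)"
    using 2 unfolding 1 .
  show "(fst e - (1/2) *\<^sub>R dE e z, sg e + bE e z) \<noteq> 0" using Gi(1)[OF y] unfolding 1 by simp
  show "(fst e + (1/2) *\<^sub>R dE e z, sg e) \<noteq> 0" using \<phi>_D[OF Gi(1)[OF y]] unfolding 2 by simp
qed

end

section \<open>Returning points of homogeneous isotopies\<close>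

lemma has_derivative_shift: "(shift n has_derivative (\<lambda>v. v)) (at p)"
proof -
  have "((\<lambda>p. (fst p, snd p + n)) has_derivative (\<lambda>v. (fst v, snd v + 0))) (at p)"
    by (intro has_derivative_Pair has_derivative_add has_derivative_fst has_derivative_snd has_derivative_ident has_derivative_const)
  then show ?thesis unfolding shift_def[abs_def] by simp
qed

lemma shift_shift [simp]: "shift a (shift b p) = shift (a + b) p"
  by (simp add: shift_def algebra_simps)

lemma shift_0 [simp]: "shift 0 p = p" by (simp add: shift_def)

lemma shift_of_int:
  assumes F: "\<And>p. fst p \<noteq> 0 \<Longrightarrow> F (shift 1 p) = shift 1 (F p)" and p: "fst p \<noteq> 0"
  shows "F (shift (of_int n) p) = shift (of_int n) (F p)"
proof -
  have nat: "F (shift (of_nat m) p) = shift (of_nat m) (F p)" if "fst p \<noteq> 0" for m p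
    using that
  proof (induction m)
    case (Suc m)
    have "F (shift (of_nat (Suc m)) p) = F (shift 1 (shift (of_nat m) p))" by (simp add: algebra_simps)
    also have "\<dots> = shift 1 (F (shift (of_nat m) p))" by (rule F) (use Suc.prems in simp)
    also have "\<dots> = shift (of_nat (Suc m)) (F p)" using Suc by (simp add: algebra_simps)
    finally show ?case .
  qed simp
  show ?thesis
  proof (cases n rule: int_cases2)
    case (nonneg m)
    then show ?thesis using nat[OF p, of m] by simp
  next
    case (nonpos m)
    have "F p = shift (of_nat m) (F (shift (of_int n) p))"
      using nat[of "shift (of_int n) p" m] p nonpos by simp
    then have "shift (of_int n) (F p) = shift (of_int n) (shift (of_nat m) (F (shift (of_int n) p)))" by simp
    then show ?thesis using nonpos by simp
  qed
qed

lemma compact_annulus: "compact {p :: ((complex ^ 'n::finite) \<times> real) \<times> real. A \<le> nu p \<and> nu p \<le> B \<and> 0 \<le> snd p \<and> snd p \<le> 1}"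
  (is "compact ?K")
proof -
  have c: "continuous_on UNIV (nu :: ((complex ^ 'n) \<times> real) \<times> real \<Rightarrow> real)"
    unfolding nu_def[abs_def] by (intro continuous_intros)
  have "closed ?K" by (intro closed_Collect_conj closed_Collect_le c continuous_intros)
  moreover have "bounded ?K"
    unfolding bounded_iff
  proof (intro exI ballI)
    fix p assume "p \<in> ?K"
    then have p: "(norm (fst (fst p)))\<^sup>2 + \<bar>snd (fst p)\<bar> \<le> B" "\<bar>snd p\<bar> \<le> 1" by (auto simp: nu_def)
    have "norm (fst (fst p)) \<le> 1 + (norm (fst (fst p)))\<^sup>2"
      using zero_le_power2[of "norm (fst (fst p)) - 1"] by (simp add: power2_diff) (smt (verit) norm_ge_zero)
    moreover have "norm p \<le> norm (fst (fst p)) + \<bar>snd (fst p)\<bar> + \<bar>snd p\<bar>"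
      using norm_Pair_le[of "fst p" "snd p"] norm_Pair_le[of "fst (fst p)" "snd (fst p)"] by simp
    ultimately show "norm p \<le> 2 + B" using p by linarith
  qed
  ultimately show ?thesis by (simp add: compact_eq_bounded_closed)
qed

text \<open>What the argument retains of the lifted isotopy. The inverses \<open>fi\<close> enter
  with pointwise derivatives only; uniform estimates are made for f, whose space derivative is
  continuous in time and space.\<close>

locale homog_isotopy =
  fixes k :: nat and mm :: "'n::finite \<Rightarrow> int"
    and f fi :: "real \<Rightarrow> ((complex ^ 'n) \<times> real) \<times> real \<Rightarrow> ((complex ^ 'n) \<times> real) \<times> real"
    and f' :: "real \<Rightarrow> ((complex ^ 'n) \<times> real) \<times> real \<Rightarrow> ((complex ^ 'n) \<times> real) \<times> real \<Rightarrow> ((complex ^ 'n) \<times> real) \<times> real"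
  assumes k_prime: "prime k" and mm: "\<And>j. \<not> int k dvd mm j"
    and f_D: "\<And>t p. t \<in> {0..1} \<Longrightarrow> fst p \<noteq> 0 \<Longrightarrow> fst (f t p) \<noteq> 0"
    and fi_D: "\<And>t p. t \<in> {0..1} \<Longrightarrow> fst p \<noteq> 0 \<Longrightarrow> fst (fi t p) \<noteq> 0"
    and fi_f: "\<And>t p. t \<in> {0..1} \<Longrightarrow> fst p \<noteq> 0 \<Longrightarrow> fi t (f t p) = p"
    and f_fi: "\<And>t p. t \<in> {0..1} \<Longrightarrow> fst p \<noteq> 0 \<Longrightarrow> f t (fi t p) = p"
    and f_der: "\<And>t p. t \<in> {0..1} \<Longrightarrow> fst p \<noteq> 0 \<Longrightarrow> (f t has_derivative f' t p) (at p)"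
    and fi_der: "\<And>t p. t \<in> {0..1} \<Longrightarrow> fst p \<noteq> 0 \<Longrightarrow> \<exists>g'. (fi t has_derivative g') (at p)"
    and f_cont: "continuous_on ({0..1} \<times> {p. fst p \<noteq> 0}) (\<lambda>q. f (fst q) (snd q))"
    and f'_cont: "\<And>v. continuous_on ({0..1} \<times> {p. fst p \<noteq> 0}) (\<lambda>q. f' (fst q) (snd q) v)"
    and f_lam: "\<And>t p v. t \<in> {0..1} \<Longrightarrow> fst p \<noteq> 0 \<Longrightarrow> lam (f t p) (f' t p v) = lam p v"
    and f_hom: "\<And>t c p. t \<in> {0..1} \<Longrightarrow> 0 < c \<Longrightarrow> fst p \<noteq> 0 \<Longrightarrow> f t (hs c p) = hs c (f t p)"
    and f_per1: "\<And>t p. t \<in> {0..1} \<Longrightarrow> fst p \<noteq> 0 \<Longrightarrow> f t (shift 1 p) = shift 1 (f t p)"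
    and f_tw: "\<And>t p. t \<in> {0..1} \<Longrightarrow> fst p \<noteq> 0 \<Longrightarrow> f t (twX k mm p) = twX k mm (f t p)"
    and f_0: "\<And>p. fst p \<noteq> 0 \<Longrightarrow> f 0 p = p"
begin

lemma f_per: "t \<in> {0..1} \<Longrightarrow> fst p \<noteq> 0 \<Longrightarrow> f t (shift (of_int n) p) = shift (of_int n) (f t p)"
  by (rule shift_of_int[of "f t"]) (auto intro: f_per1)

lemma fi_eqI: "t \<in> {0..1} \<Longrightarrow> fst q \<noteq> 0 \<Longrightarrow> f t q = p \<Longrightarrow> fi t p = q"
  using fi_f by blast

lemma fi_hom: "t \<in> {0..1} \<Longrightarrow> 0 < c \<Longrightarrow> fst p \<noteq> 0 \<Longrightarrow> fi t (hs c p) = hs c (fi t p)"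
  by (rule fi_eqI) (use fst_hs[of c "fi t p"] fi_D[of t p] f_fi[of t p] f_hom[of t c "fi t p"] in auto)

lemma fi_per: "t \<in> {0..1} \<Longrightarrow> fst p \<noteq> 0 \<Longrightarrow> fi t (shift (of_int n) p) = shift (of_int n) (fi t p)"
  by (rule fi_eqI) (use fi_D[of t p] f_fi[of t p] f_per[of t "fi t p" n] in auto)

lemma fi_tw: "t \<in> {0..1} \<Longrightarrow> fst p \<noteq> 0 \<Longrightarrow> fi t (twX k mm p) = twX k mm (fi t p)"
  by (rule fi_eqI) (use fst_twX[of k mm "fi t p"] fi_D[of t p] f_fi[of t p] f_tw[of t "fi t p"] in auto)

lemma open_fst_nonzero: "open {p :: ((complex ^ 'n) \<times> real) \<times> real. fst p \<noteq> 0}"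
  by (intro open_Collect_neq continuous_intros)

lemma f'_per:
  assumes t: "t \<in> {0..1}" and p: "fst p \<noteq> 0"
  shows "f' t (shift (of_int n) p) v = f' t p v"
proof -
  let ?s = "shift (of_int n) :: ((complex ^ 'n) \<times> real) \<times> real \<Rightarrow> _"
  have sp: "fst (?s p) \<noteq> 0" using p by simp
  have "((\<lambda>x. f t (?s x)) has_derivative (\<lambda>v. f' t (?s p) v)) (at p)"
    by (rule has_derivative_compose[OF has_derivative_shift f_der[OF t sp]])
  moreover have "((\<lambda>x. ?s (f t x)) has_derivative (\<lambda>v. f' t p v)) (at p)"
    by (rule has_derivative_compose[OF f_der[OF t p] has_derivative_shift])
  then have "((\<lambda>x. f t (?s x)) has_derivative (\<lambda>v. f' t p v)) (at p)"
    by (rule has_derivative_transform_within_open[OF _ open_fst_nonzero]) (use p f_per[OF t] in auto)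
  ultimately have "(\<lambda>v. f' t (?s p) v) = (\<lambda>v. f' t p v)" by (rule has_derivative_unique)
  then show ?thesis by (rule fun_cong)
qed

lemma f'_inverse:
  assumes t: "t \<in> {0..1}" and q: "fst q \<noteq> 0" and g': "(fi t has_derivative g') (at (f t q))"
  shows "g' (f' t q v) = v" "f' t q (g' v) = v"
proof -
  have "((\<lambda>x. fi t (f t x)) has_derivative (\<lambda>v. g' (f' t q v))) (at q)"
    by (rule has_derivative_compose[OF f_der[OF t q] g'])
  moreover have "((\<lambda>x. fi t (f t x)) has_derivative (\<lambda>v. v)) (at q)"
    by (rule has_derivative_transform_within_open[OF has_derivative_ident open_fst_nonzero]) (use q fi_f[OF t] in auto)
  ultimately have "(\<lambda>v. g' (f' t q v)) = (\<lambda>v. v)" by (rule has_derivative_unique)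
  then show "g' (f' t q v) = v" by (rule fun_cong)
  have p: "fst (f t q) \<noteq> 0" by (rule f_D[OF t q])
  have "(f t has_derivative f' t q) (at (fi t (f t q)))" using f_der[OF t q] fi_f[OF t q] by simp
  then have "((\<lambda>x. f t (fi t x)) has_derivative (\<lambda>v. f' t q (g' v))) (at (f t q))"
    by (rule has_derivative_compose[OF g'])
  moreover have "((\<lambda>x. f t (fi t x)) has_derivative (\<lambda>v. v)) (at (f t q))"
    by (rule has_derivative_transform_within_open[OF has_derivative_ident open_fst_nonzero]) (use p f_fi[OF t] in auto)
  ultimately have "(\<lambda>v. f' t q (g' v)) = (\<lambda>v. v)" by (rule has_derivative_unique)
  then show "f' t q (g' v) = v" by (rule fun_cong)
qed

text \<open>On the compact set with \<open>nu\<close> = 1 and z in [0, 1] the gauge of the image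
  lies between positive bounds; dilations and integer shifts carry these to all points.\<close>

lemma nu_distortion:
  "\<exists>c1 c2. 0 < c1 \<and> 0 < c2 \<and> (\<forall>t\<in>{0..1}. \<forall>q. fst q \<noteq> 0 \<longrightarrow> c1 * nu q \<le> nu (f t q) \<and> nu (f t q) \<le> c2 * nu q)"
proof -
  let ?K = "{0..1::real} \<times> {p :: ((complex ^ 'n) \<times> real) \<times> real. 1 \<le> nu p \<and> nu p \<le> 1 \<and> 0 \<le> snd p \<and> snd p \<le> 1}"
  have K: "compact ?K" by (intro compact_Times compact_annulus compact_Icc)
  have KD: "?K \<subseteq> {0..1} \<times> {p. fst p \<noteq> 0}" by (auto simp: nu_pos_iff[symmetric])
  have c: "continuous_on UNIV (nu :: ((complex ^ 'n) \<times> real) \<times> real \<Rightarrow> real)"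
    unfolding nu_def[abs_def] by (intro continuous_intros)
  have "continuous_on ?K (\<lambda>q. nu (f (fst q) (snd q)))"
    by (rule continuous_on_compose2[OF c continuous_on_subset[OF f_cont KD]]) auto
  then have cI: "compact ((\<lambda>q. nu (f (fst q) (snd q))) ` ?K)" using K by (rule compact_continuous_image)
  have pos: "0 < y" if y: "y \<in> (\<lambda>q. nu (f (fst q) (snd q))) ` ?K" for y
  proof -
    obtain q where q: "q \<in> ?K" "y = nu (f (fst q) (snd q))" using y by blast
    then have "fst q \<in> {0..1}" "fst (snd q) \<noteq> 0" using subsetD[OF KD q(1)] by (auto simp: mem_Times_iff)
    then show ?thesis using f_D[of "fst q" "snd q"] nu_pos_iff q(2) by blast
  qed
  have "0 \<notin> (\<lambda>q. nu (f (fst q) (snd q))) ` ?K"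
  proof
    assume h: "0 \<in> (\<lambda>q. nu (f (fst q) (snd q))) ` ?K"
    from pos[OF h] show False by simp
  qed
  then obtain c1 where c1: "c1 > 0" "\<And>y. y \<in> (\<lambda>q. nu (f (fst q) (snd q))) ` ?K \<Longrightarrow> c1 \<le> dist 0 y"
    using separate_point_closed[OF compact_imp_closed[OF cI]] by blast
  obtain c2 where c2: "\<And>y. y \<in> (\<lambda>q. nu (f (fst q) (snd q))) ` ?K \<Longrightarrow> norm y \<le> c2"
    using compact_imp_bounded[OF cI] unfolding bounded_iff by blast
  have "c1 * nu q \<le> nu (f t q) \<and> nu (f t q) \<le> max c2 1 * nu q" if t: "t \<in> {0..1}" and q: "fst q \<noteq> 0" for t q
  proof -
    define c where "c = inverse (sqrt (nu q))"
    have nq: "0 < nu q" using q nu_pos_iff by blast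
    have c: "0 < c" unfolding c_def using nq by simp
    define r where "r = shift (of_int (- \<lfloor>snd q\<rfloor>)) (hs c q)"
    have hq: "fst (hs c q) \<noteq> 0" using fst_hs[of c q] c q by simp
    have "nu r = 1" unfolding r_def nu_shift c_def by (rule normalized[OF q])
    moreover have "0 \<le> snd r" "snd r \<le> 1" unfolding r_def by (auto simp: shift_def hs_def) linarith+
    ultimately have rK: "(t, r) \<in> ?K" using t by simp
    have "nu (f t r) = c\<^sup>2 * nu (f t q)" unfolding r_def f_per[OF t hq] f_hom[OF t c q] by simp
    then have eq: "nu (f t r) = nu (f t q) / nu q" unfolding c_def using nq by (simp add: power_inverse divide_inverse mult.commute)
    have im: "nu (f t r) \<in> (\<lambda>q. nu (f (fst q) (snd q))) ` ?K" using rK by (rule rev_image_eqI) simp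
    have "c1 \<le> nu (f t r)" "nu (f t r) \<le> c2"
      using c1(2)[OF im] c2[OF im] pos[OF im] unfolding dist_real_def real_norm_def by linarith+
    then have "c1 \<le> nu (f t q) / nu q" "nu (f t q) / nu q \<le> c2" unfolding eq .
    then have "c1 * nu q \<le> nu (f t q)" "nu (f t q) \<le> c2 * nu q" using nq by (simp_all add: field_simps)
    moreover have "c2 * nu q \<le> max c2 1 * nu q" using nq by (intro mult_right_mono) auto
    ultimately show ?thesis by linarith
  qed
  then show ?thesis using c1(1) by (intro exI[of _ c1] exI[of _ "max c2 1"]) auto
qed

text \<open>With q = fi t p the claim compares f at two times in the same point q, so uniform
  continuity on a compact set suffices. \<open>nu_distortion\<close> and an integer shift bring q
  into that set, and a lower bound for the derivative on unit vectors converts an estimate in u into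
  one in its image v.\<close>

lemma near_uniform:
  assumes \<epsilon>: "0 < \<epsilon>"
  shows "\<exists>\<delta>>0. \<forall>t\<in>{0..1}. \<forall>t'\<in>{0..1}. \<bar>t' - t\<bar> < \<delta> \<longrightarrow> (\<forall>p. 1/8 \<le> nu p \<and> nu p \<le> 8 \<longrightarrow>
     norm (f t' (fi t p) - p) \<le> \<epsilon> \<and>
     (\<forall>g'. (fi t has_derivative g') (at p) \<longrightarrow> (\<forall>v. norm (f' t' (fi t p) (g' v) - v) \<le> \<epsilon> * norm v)))"
proof -
  obtain c1 c2 where c: "0 < c1" "0 < c2"
    "\<And>t q. t \<in> {0..1} \<Longrightarrow> fst q \<noteq> 0 \<Longrightarrow> c1 * nu q \<le> nu (f t q) \<and> nu (f t q) \<le> c2 * nu q"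
    using nu_distortion by blast
  define Q where "Q = {p :: ((complex ^ 'n) \<times> real) \<times> real. 1 / (8 * c2) \<le> nu p \<and> nu p \<le> 8 / c1 \<and> 0 \<le> snd p \<and> snd p \<le> 1}"
  have cQ: "compact Q" unfolding Q_def by (rule compact_annulus)
  have QD: "fst p \<noteq> 0" if "p \<in> Q" for p
  proof -
    have "0 < 1 / (8 * c2)" using c by simp
    moreover have "1 / (8 * c2) \<le> nu p" using that unfolding Q_def by blast
    ultimately have "0 < nu p" by linarith
    then show ?thesis using nu_pos_iff by blast
  qed
  let ?T = "{0..1::real}"
  have sub: "?T \<times> Q \<subseteq> ?T \<times> {p. fst p \<noteq> 0}" using QD by auto
  have cTQ: "compact (?T \<times> Q)" by (intro compact_Times cQ compact_Icc)
  define Z where "Z = (?T \<times> Q) \<times> sphere (0 :: ((complex ^ 'n) \<times> real) \<times> real) 1"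
  have cZ: "compact Z" unfolding Z_def by (intro compact_Times cTQ compact_sphere)
  define \<Psi> where "\<Psi> x = f' (fst (fst x)) (snd (fst x)) (snd x)" for x
  have lin: "linear (f' (fst q) (snd q))" if "q \<in> ?T \<times> {p. fst p \<noteq> 0}" for q
    using f_der[of "fst q" "snd q"] that has_derivative_linear by (auto simp: mem_Times_iff)
  have c\<Psi>: "continuous_on Z \<Psi>"
    unfolding \<Psi>_def
  proof (rule linear_family_continuous[where f' = "\<lambda>q. f' (fst q) (snd q)" and g = fst and u = snd and S = "?T \<times> {p. fst p \<noteq> 0}"])
    show "linear (f' (fst x) (snd x))" if "x \<in> ?T \<times> {p. fst p \<noteq> 0}" for x by (rule lin[OF that])
    show "continuous_on (?T \<times> {p. fst p \<noteq> 0}) (\<lambda>x. f' (fst x) (snd x) v)" for v by (rule f'_cont)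
    show "fst ` Z \<subseteq> ?T \<times> {p. fst p \<noteq> 0}" unfolding Z_def using sub by auto
    show "continuous_on Z fst" "continuous_on Z snd" by (intro continuous_on_fst continuous_on_snd continuous_on_id)+
  qed
  \<comment> \<open>The derivative has a left inverse, hence no zero on unit vectors; compactness
    turns this into the bound B.\<close>
  have "0 \<notin> \<Psi> ` Z"
  proof
    assume "0 \<in> \<Psi> ` Z"
    then obtain x where x: "x \<in> Z" "\<Psi> x = 0" by (metis imageE)
    then have t: "fst (fst x) \<in> ?T" and q: "fst (snd (fst x)) \<noteq> 0" and v: "norm (snd x) = 1"
      using QD unfolding Z_def by (auto simp: mem_Times_iff)
    obtain g' where g': "(fi (fst (fst x)) has_derivative g') (at (f (fst (fst x)) (snd (fst x))))"
      using fi_der[OF t f_D[OF t q]] by blast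
    have "g' (\<Psi> x) = snd x" unfolding \<Psi>_def by (rule f'_inverse(1)[OF t q g'])
    moreover have "g' 0 = 0" using has_derivative_linear[OF g'] by (rule linear_0)
    ultimately show False using x(2) v by simp
  qed
  then obtain B where B: "B > 0" "\<And>y. y \<in> \<Psi> ` Z \<Longrightarrow> B \<le> dist 0 y"
    using separate_point_closed[OF compact_imp_closed[OF compact_continuous_image[OF c\<Psi> cZ]]] by blast
  have "\<exists>d>0. \<forall>x\<in>Z. \<forall>x'\<in>Z. dist x' x < d \<longrightarrow> dist (\<Psi> x') (\<Psi> x) < \<epsilon> * B"
    using compact_uniformly_continuous[OF c\<Psi> cZ] mult_pos_pos[OF \<epsilon> B(1)] unfolding uniformly_continuous_on_def by (elim allE[of _ "\<epsilon> * B"] impE)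
  then obtain \<delta>1 where \<delta>1: "\<delta>1 > 0" "\<And>x x'. x \<in> Z \<Longrightarrow> x' \<in> Z \<Longrightarrow> dist x' x < \<delta>1 \<Longrightarrow> dist (\<Psi> x') (\<Psi> x) < \<epsilon> * B"
    by blast
  have "\<exists>d>0. \<forall>x\<in>?T \<times> Q. \<forall>x'\<in>?T \<times> Q. dist x' x < d \<longrightarrow> dist (f (fst x') (snd x')) (f (fst x) (snd x)) < \<epsilon>"
    using compact_uniformly_continuous[OF continuous_on_subset[OF f_cont sub] cTQ] \<epsilon>
    unfolding uniformly_continuous_on_def by (elim allE[of _ \<epsilon>] impE)
  then obtain \<delta>2 where \<delta>2: "\<delta>2 > 0" "\<And>x x'. x \<in> ?T \<times> Q \<Longrightarrow> x' \<in> ?T \<times> Q \<Longrightarrow> dist x' x < \<delta>2 \<Longrightarrow> dist (f (fst x') (snd x')) (f (fst x) (snd x)) < \<epsilon>"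
    by blast
  show ?thesis
  proof (intro exI[of _ "min \<delta>1 \<delta>2"] conjI ballI impI allI)
    show "0 < min \<delta>1 \<delta>2" using \<delta>1(1) \<delta>2(1) by simp
    fix t t' :: real and p :: "((complex ^ 'n) \<times> real) \<times> real"
    assume t: "t \<in> ?T" "t' \<in> ?T" and d: "\<bar>t' - t\<bar> < min \<delta>1 \<delta>2" and p: "1/8 \<le> nu p \<and> nu p \<le> 8"
    have p0: "fst p \<noteq> 0" using p nu_pos_iff[of p] by auto
    define q where "q = fi t p"
    have q0: "fst q \<noteq> 0" unfolding q_def by (rule fi_D[OF t(1) p0])
    have fq: "f t q = p" unfolding q_def by (rule f_fi[OF t(1) p0])
    define n :: int where "n = - \<lfloor>snd q\<rfloor>"
    define r where "r = shift (of_int n) q"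
    have r0: "fst r \<noteq> 0" using q0 by (simp add: r_def)
    have rQ: "r \<in> Q"
    proof -
      have "c1 * nu q \<le> 8" "1/8 \<le> c2 * nu q" using c(3)[OF t(1) q0] p unfolding fq by auto
      then have "1 / (8 * c2) \<le> nu r" "nu r \<le> 8 / c1" unfolding r_def nu_shift using c(1,2) by (simp_all add: field_simps)
      moreover have "0 \<le> snd r" "snd r \<le> 1" unfolding r_def n_def by (auto simp: shift_def) linarith+
      ultimately show ?thesis unfolding Q_def by simp
    qed
    have "dist (t', r) (t, r) < \<delta>2" using d by (simp add: dist_Pair_Pair dist_real_def)
    from \<delta>2(2)[OF _ _ this] have "dist (f t' r) (f t r) < \<epsilon>" using t rQ by simp
    moreover have "f t' r - f t r = f t' q - p"
      unfolding r_def f_per[OF t(2) q0] f_per[OF t(1) q0] fq by (simp add: shift_def prod_eq_iff)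
    ultimately show "norm (f t' (fi t p) - p) \<le> \<epsilon>" unfolding q_def[symmetric] by (simp add: dist_norm)
    fix g' v assume g': "(fi t has_derivative g') (at p)"
    define u where "u = g' v"
    have fu: "f' t r u = v" unfolding r_def f'_per[OF t(1) q0] u_def
      by (rule f'_inverse(2)[OF t(1) q0]) (use g' fq in simp)
    have goal: "norm (f' t' r u - f' t r u) \<le> \<epsilon> * norm (f' t r u)"
    proof (cases "u = 0")
      case True
      then show ?thesis using \<epsilon> linear_0[OF has_derivative_linear[OF f_der[OF t(1) r0]]] linear_0[OF has_derivative_linear[OF f_der[OF t(2) r0]]] by simp
    next
      case False
      have z: "((t, r), sgn u) \<in> Z" "((t', r), sgn u) \<in> Z" unfolding Z_def using t rQ False by (auto simp: norm_sgn)
      have sc: "f' s r u = norm u *\<^sub>R f' s r (sgn u)" if "s \<in> ?T" for s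
        using linear_cmul[OF has_derivative_linear[OF f_der[OF that r0]], of "norm u" "sgn u"] False by (simp add: sgn_div_norm)
      have "dist ((t', r), sgn u) ((t, r), sgn u) < \<delta>1" using d by (simp add: dist_Pair_Pair dist_real_def)
      from \<delta>1(2)[OF z this] have 1: "norm (f' t' r (sgn u) - f' t r (sgn u)) \<le> \<epsilon> * B" by (simp add: \<Psi>_def dist_norm)
      have "B \<le> norm (f' t r (sgn u))" using B(2)[OF imageI[OF z(1)]] by (simp add: \<Psi>_def)
      then have "\<epsilon> * B \<le> \<epsilon> * norm (f' t r (sgn u))" using \<epsilon> by (intro mult_left_mono) auto
      then have "norm (f' t' r (sgn u) - f' t r (sgn u)) \<le> \<epsilon> * norm (f' t r (sgn u))" using 1 by linarith
      then have "norm u * norm (f' t' r (sgn u) - f' t r (sgn u)) \<le> norm u * (\<epsilon> * norm (f' t r (sgn u)))" by (intro mult_left_mono) auto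
      then show ?thesis unfolding sc[OF t(1)] sc[OF t(2)] scaleR_diff_right[symmetric]
        by (simp only: norm_scaleR abs_norm_cancel mult.left_commute)
    qed
    have "f' t' r u = f' t' q u" unfolding r_def by (rule f'_per[OF t(2) q0])
    then have "norm (f' t' q u - v) \<le> \<epsilon> * norm v" using goal unfolding fu by simp
    then show "norm (f' t' (fi t p) (g' v) - v) \<le> \<epsilon> * norm v" unfolding u_def q_def .
  qed
qed

lemma near_identity_step:
  assumes t: "t \<in> {0..1}" "t' \<in> {0..1}"
    and n: "\<And>p g' v. 1/8 \<le> nu p \<Longrightarrow> nu p \<le> 8 \<Longrightarrow> norm (f t' (fi t p) - p) \<le> 1/4 \<and>
       ((fi t has_derivative g') (at p) \<longrightarrow> norm (f' t' (fi t p) (g' v) - v) \<le> 1/4 * norm v)"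
  shows "near_identity k mm (\<lambda>p. f t' (fi t p)) (\<lambda>p v. f' t' (fi t p) ((SOME g'. (fi t has_derivative g') (at p)) v))"
proof -
  define g' where "g' p = (SOME g'. (fi t has_derivative g') (at p))" for p
  have g': "(fi t has_derivative g' p) (at p)" if "fst p \<noteq> 0" for p
    using someI_ex[OF fi_der[OF t(1) that]] unfolding g'_def .
  have "near_identity k mm (\<lambda>p. f t' (fi t p)) (\<lambda>p v. f' t' (fi t p) (g' p v))"
  proof
    fix p :: "((complex ^ 'n) \<times> real) \<times> real" and v
    assume p: "fst p \<noteq> 0"
    note q = fi_D[OF t(1) p]
    show "fst (f t' (fi t p)) \<noteq> 0" by (rule f_D[OF t(2) q])
    show "((\<lambda>p. f t' (fi t p)) has_derivative (\<lambda>v. f' t' (fi t p) (g' p v))) (at p)"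
      by (rule has_derivative_compose[OF g'[OF p] f_der[OF t(2) q]])
    have "f' t (fi t p) (g' p v) = v" by (rule f'_inverse(2)[OF t(1) q]) (use g'[OF p] f_fi[OF t(1) p] in simp)
    then have "lam p v = lam (fi t p) (g' p v)" using f_lam[OF t(1) q, of "g' p v"] f_fi[OF t(1) p] by simp
    then show "lam (f t' (fi t p)) (f' t' (fi t p) (g' p v)) = lam p v" using f_lam[OF t(2) q] by simp
    show "f t' (fi t (hs c p)) = hs c (f t' (fi t p))" if "0 < c" for c
      using fi_hom[OF t(1) that p] f_hom[OF t(2) that q] by simp
    show "f t' (fi t (shift (of_int n) p)) = shift (of_int n) (f t' (fi t p))" for n
      using fi_per[OF t(1) p] f_per[OF t(2) q] by simp
    show "f t' (fi t (twX k mm p)) = twX k mm (f t' (fi t p))"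
      using fi_tw[OF t(1) p] f_tw[OF t(2) q] by simp
  next
    fix p :: "((complex ^ 'n) \<times> real) \<times> real" and v
    assume p: "1/8 \<le> nu p" "nu p \<le> 8"
    then have p0: "fst p \<noteq> 0" using nu_pos_iff[of p] by auto
    show "norm (f t' (fi t p) - p) \<le> 1/4" using n[OF p] by blast
    have "norm (f' t' (fi t p) (g' p v) - v) \<le> 1/4 * norm v" using n[OF p, of "g' p" v] g'[OF p0] by blast
    then show "norm (f' t' (fi t p) (g' p v) - v) \<le> 1/2 * norm v" using norm_ge_zero[of v] by linarith
  qed
  then show ?thesis unfolding g'_def .
qed

text \<open>The interval is cut into M parts shorter than \<open>\<delta>\<close>, so every step is
  near the identity and has a generating function. The critical orbit joins up modulo integer shifts
  of z; as all maps commute with these, it is an actual orbit of f that starts and ends with sigma =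
  0.\<close>

theorem returning_point: "\<exists>p. fst p \<noteq> 0 \<and> snd (fst p) = 0 \<and> snd (fst (f 1 p)) = 0"
proof -
  obtain \<delta> where \<delta>: "\<delta> > 0" "\<forall>t\<in>{0..1}. \<forall>t'\<in>{0..1}. \<bar>t' - t\<bar> < \<delta> \<longrightarrow> (\<forall>p. 1/8 \<le> nu p \<and> nu p \<le> 8 \<longrightarrow>
     norm (f t' (fi t p) - p) \<le> 1/4 \<and>
     (\<forall>g'. (fi t has_derivative g') (at p) \<longrightarrow> (\<forall>v. norm (f' t' (fi t p) (g' v) - v) \<le> 1/4 * norm v)))"
    using near_uniform[of "1/4"] by auto
  obtain M0 :: nat where M0: "1 / \<delta> < real M0" using reals_Archimedean2 by blast
  \<comment> \<open>M \<ge> 2 gives the fixed sphere positive dimension.\<close>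
  define M where "M = M0 + 2"
  have M2: "2 \<le> M" and M\<delta>: "1 / real M < \<delta>"
  proof -
    have "1 / \<delta> < real M" using M0 by (simp add: M_def)
    then show "1 / real M < \<delta>" using \<delta>(1) by (simp add: M_def field_simps)
  qed (simp add: M_def)
  \<comment> \<open>The index is capped at M - 1 so that the steps are defined, and near the
    identity, for every natural number.\<close>
  define tt where "tt i = real (min i (M - 1)) / real M" for i
  define ts where "ts i = real (Suc (min i (M - 1))) / real M" for i
  have tt: "tt i \<in> {0..1}" "ts i \<in> {0..1}" "\<bar>ts i - tt i\<bar> < \<delta>" for i
    using M2 M\<delta> unfolding tt_def ts_def by (auto simp: divide_le_eq_1 diff_divide_distrib[symmetric])
  define \<phi> where "\<phi> i p = f (ts i) (fi (tt i) p)" for i p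
  define \<phi>' where "\<phi>' i p v = f' (ts i) (fi (tt i) p) ((SOME g'. (fi (tt i) has_derivative g') (at p)) v)" for i p v
  have ni: "near_identity k mm (\<phi> i) (\<phi>' i)" for i
    unfolding \<phi>_def[abs_def] \<phi>'_def[abs_def]
    by (rule near_identity_step[OF tt(1,2)]) (use \<delta>(2) tt[of i] in blast)
  let ?S = "\<lambda>i. near_identity.SE (\<phi> i)" and ?a = "\<lambda>i. near_identity.aE (\<phi> i)"
    and ?b = "\<lambda>i. near_identity.bE (\<phi> i)" and ?d = "\<lambda>i. near_identity.dE (\<phi> i)"
  obtain Cf where Cf: "\<And>i e z. \<bar>?a i e z\<bar> \<le> Cf i"
    using near_identity.aE_bounded[OF ni] by metis
  define Ca where "Ca = (\<Sum>i<M. \<bar>Cf i\<bar>)"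
  \<comment> \<open>Later indices repeat the last map, so finitely many bounds give a uniform
    one.\<close>
  have \<phi>min: "\<phi> i = \<phi> (min i (M - 1))" for i by (simp add: \<phi>_def[abs_def] tt_def ts_def)
  have Ca: "\<bar>?a i e z\<bar> \<le> Ca" for i e z
  proof -
    have "\<bar>?a i e z\<bar> \<le> \<bar>Cf (min i (M - 1))\<bar>" using Cf[of "min i (M - 1)" e z] unfolding \<phi>min[of i] by simp
    also have "\<dots> \<le> Ca" unfolding Ca_def by (rule member_le_sum) (use M2 in auto)
    finally show ?thesis .
  qed
  have da: "discrete_action k mm M ?S ?a ?b ?d Ca"
    by (rule discrete_action.intro[OF k_prime mm M2 near_identity.SE_der[OF ni] near_identity.E_cont(1)[OF ni] Ca
        near_identity.bE_cont[OF ni] near_identity.dE_cont[OF ni] near_identity.SE_hom[OF ni]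
        near_identity.E_per(4)[OF ni] near_identity.E_per(1)[OF ni] near_identity.E_per(2)[OF ni] near_identity.E_per(3)[OF ni]
        near_identity.E_tw(1)[OF ni] near_identity.E_tw(2)[OF ni] near_identity.E_tw(3)[OF ni]])
  have "\<exists>e z. (\<forall>i<M. e i \<noteq> 0) \<and> sg (e 0) + ?b 0 (e 0) (z 0) = 0 \<and> sg (e (M - 1)) = 0 \<and>
     (\<forall>i. Suc i < M \<longrightarrow> fst (e i) + (1/2) *\<^sub>R ?d i (e i) (z i) = fst (e (Suc i)) - (1/2) *\<^sub>R ?d (Suc i) (e (Suc i)) (z (Suc i))
        \<and> sg (e i) = sg (e (Suc i)) + ?b (Suc i) (e (Suc i)) (z (Suc i))
        \<and> (\<exists>n::int. z (Suc i) = z i + ?a i (e i) (z i) + of_int n))"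
  proof (rule discrete_action.critical_orbit[OF da])
    show "(fst e - (1/2) *\<^sub>R ?d i e z, sg e + ?b i e z) \<noteq> 0 \<and> (fst e + (1/2) *\<^sub>R ?d i e z, sg e) \<noteq> 0" if "e \<noteq> 0" for i e z
      using near_identity.generating(2,3)[OF ni that] by blast
    show "?d i 0 z = 0" "?b i 0 z = 0" for i z
      by (simp_all add: near_identity.dE_def[OF ni] near_identity.bE_def[OF ni])
  qed
  then obtain e z where ne: "\<And>i. i < M \<Longrightarrow> e i \<noteq> 0" and s0: "sg (e 0) + ?b 0 (e 0) (z 0) = 0" and sM: "sg (e (M - 1)) = 0"
    and ch: "\<And>i. Suc i < M \<Longrightarrow> fst (e i) + (1/2) *\<^sub>R ?d i (e i) (z i) = fst (e (Suc i)) - (1/2) *\<^sub>R ?d (Suc i) (e (Suc i)) (z (Suc i))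
        \<and> sg (e i) = sg (e (Suc i)) + ?b (Suc i) (e (Suc i)) (z (Suc i))
        \<and> (\<exists>n::int. z (Suc i) = z i + ?a i (e i) (z i) + of_int n)" by blast
  define pm where "pm i = ((fst (e i) - (1/2) *\<^sub>R ?d i (e i) (z i), sg (e i) + ?b i (e i) (z i)), z i)" for i
  define pp where "pp i = ((fst (e i) + (1/2) *\<^sub>R ?d i (e i) (z i), sg (e i)), z i + ?a i (e i) (z i))" for i
  have g: "\<phi> i (pm i) = pp i" "fst (pm i) \<noteq> 0" if "i < M" for i
    using near_identity.generating(1,2)[OF ni ne[OF that], of i "z i"] unfolding pm_def pp_def by simp_all
  have link: "\<exists>n::int. pp i = shift (of_int n) (pm (Suc i))" if i: "Suc i < M" for i
  proof -
    obtain n :: int where n: "z (Suc i) = z i + ?a i (e i) (z i) + of_int n" using ch[OF i] by blast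
    have "pp i = shift (of_int (- n)) (pm (Suc i))"
      using ch[OF i] n by (simp add: pp_def pm_def shift_def)
    then show ?thesis by blast
  qed
  \<comment> \<open>The integer shift accumulated so far passes through the step unchanged.\<close>
  have step: "f (real (Suc i) / real M) (pm 0) = shift (of_int n) (pp i)" if i: "i < M" and h: "f (real i / real M) (pm 0) = shift (of_int n) (pm i)" for i and n :: int
  proof -
    have m: "min i (M - 1) = i" using i by simp
    have ti: "tt i = real i / real M" "ts i = real (Suc i) / real M" unfolding tt_def ts_def m by auto
    have p0: "fst (pm 0) \<noteq> 0" using g(2)[of 0] M2 by simp
    have "shift (of_int n) (pp i) = \<phi> i (shift (of_int n) (pm i))"
      using near_identity.\<phi>_per[OF ni g(2)[OF i], of i n] g(1)[OF i] by simp
    also have "\<dots> = f (ts i) (fi (tt i) (f (tt i) (pm 0)))" unfolding \<phi>_def h[symmetric] ti(1) ..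
    also have "\<dots> = f (ts i) (pm 0)" using fi_f[OF tt(1) p0] by simp
    finally show ?thesis unfolding ti by simp
  qed
  have orb: "\<exists>n::int. f (real i / real M) (pm 0) = shift (of_int n) (pm i)" if "i < M" for i
    using that
  proof (induction i)
    case 0
    have "f 0 (pm 0) = pm 0" using f_0 g(2)[of 0] 0 by blast
    then show ?case by (intro exI[of _ 0]) simp
  next
    case (Suc i)
    then obtain n :: int where n: "f (real i / real M) (pm 0) = shift (of_int n) (pm i)" by auto
    have "i < M" using Suc by simp
    from step[OF this n] obtain n' :: int where "f (real (Suc i) / real M) (pm 0) = shift (of_int n) (shift (of_int n') (pm (Suc i)))"
      using link[OF Suc.prems] by metis
    then show ?case by (intro exI[of _ "n + n'"]) simp
  qed
  obtain n :: int where n: "f (real (M - 1) / real M) (pm 0) = shift (of_int n) (pm (M - 1))" using orb[of "M - 1"] M2 by auto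
  have e1: "real (Suc (M - 1)) / real M = 1" using M2 by simp
  have f1: "f 1 (pm 0) = shift (of_int n) (pp (M - 1))"
    by (rule step[OF _ n, unfolded e1]) (use M2 in simp)
  have "snd (fst (f 1 (pm 0))) = 0" unfolding f1 fst_shift pp_def fst_conv snd_conv by (rule sM)
  moreover have "snd (fst (pm 0)) = 0" unfolding pm_def fst_conv snd_conv by (rule s0)
  moreover have "fst (pm 0) \<noteq> 0" by (rule g(2)) (use M2 in simp)
  ultimately show ?thesis by blast
qed

end

section \<open>The lifted contact isotopy\<close>

lemma alpha_eq: "alpha p v = snd v + (1/2) * cxp (fst p) (fst v)"
  unfolding alpha_def cxp_def by (simp add: sum_subtractf algebra_simps)

lemma alpha_linear: "linear (alpha p)"
  by (rule linearI) (auto simp: alpha_eq cxp.add_right cxp.scaleR_right algebra_simps)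

lemma alpha_dz [simp]: "alpha p (0, 1) = 1"
  by (simp add: alpha_eq cxp.zero_right)

text \<open>The conformal factor of g: since alpha is 1 on (0, 1), it can be read off from the image
  of this vector.\<close>

definition cfac :: "('n::finite pt \<Rightarrow> 'n pt) \<Rightarrow> 'n pt \<Rightarrow> real" where
  "cfac g p = alpha (g p) (frechet_derivative g (at p) (0, 1))"

lemma cfac_eq: "(g has_derivative g') (at p) \<Longrightarrow> cfac g p = alpha (g p) (g' (0, 1))"
  unfolding cfac_def by (simp flip: frechet_derivative_at)

text \<open>Split v into a multiple of (0, 1) and a vector in the kernel of alpha, whose image stays
  in the kernel.\<close>

lemma conformal:
  assumes "preserves_xi g" and g': "(g has_derivative g') (at p)"
  shows "alpha (g p) (g' v) = cfac g p * alpha p v"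
proof -
  obtain h where h: "(g has_derivative h) (at p)" "\<And>v. alpha p v = 0 \<Longrightarrow> alpha (g p) (h v) = 0"
    using assms(1) unfolding preserves_xi_def by blast
  have hg: "h = g'" using h(1) g' by (rule has_derivative_unique)
  let ?u = "v - alpha p v *\<^sub>R (0, 1)"
  have "alpha p ?u = 0" by (simp add: linear_diff[OF alpha_linear] linear_cmul[OF alpha_linear] del: scaleR_Pair)
  then have "0 = alpha (g p) (g' ?u)" using h(2) hg by simp
  also have "\<dots> = alpha (g p) (g' v) - alpha p v * cfac g p"
    using has_derivative_linear[OF g'] by (simp add: cfac_eq[OF g'] linear_diff linear_cmul alpha_linear del: scaleR_Pair)
  finally show ?thesis by simp
qed

text \<open>Shows in particular that the factor never vanishes, which will fix its sign along the
  isotopy.\<close>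

lemma cfac_inverse:
  assumes g: "preserves_xi g" "(g has_derivative g') (at p)" and gi: "\<And>q. gi (g q) = q" "\<And>q. g (gi q) = q"
    and gi': "(gi has_derivative gi') (at (g p))"
  shows "cfac g p * cfac gi (g p) = 1"
proof -
  have "(g has_derivative g') (at (gi (g p)))" using g(2) gi(1) by simp
  then have "((\<lambda>q. g (gi q)) has_derivative (\<lambda>v. g' (gi' v))) (at (g p))" by (rule has_derivative_compose[OF gi'])
  then have "((\<lambda>q. q) has_derivative (\<lambda>v. g' (gi' v))) (at (g p))" using gi(2) by simp
  then have "(\<lambda>v. g' (gi' v)) = (\<lambda>v. v)" using has_derivative_ident by (rule has_derivative_unique)
  then have "g' (gi' (0, 1)) = (0, 1)" by metis
  then have "1 = cfac g p * alpha p (gi' (0, 1))" using conformal[OF g, of "gi' (0, 1)"] by simp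
  also have "alpha p (gi' (0, 1)) = cfac gi (g p)" using cfac_eq[OF gi'] gi(1) by simp
  finally show ?thesis by simp
qed

text \<open>The phase 2 pi N z contributes r^2 * N * pi * |w|^2 dz to (1/2) w \<times> dw, and the
  sigma-component of \<open>LL\<close> is chosen so that exactly this term cancels.\<close>

lemma lam_LL:
  assumes D: "(LL N has_derivative D) (at x)"
  shows "lam (LL N x) (D v) = (snd x)\<^sup>2 * alpha (fst x) (fst v)"
proof -
  define W z r where "W = fst (fst x)" and "z = snd (fst x)" and "r = snd x"
  define c where "c = cis (2 * pi * N * z)"
  have "((\<lambda>x. fst (fst (LL N x))) has_derivative (\<lambda>v. fst (fst (D v)))) (at x)"
    by (intro has_derivative_fst D)
  moreover have "((\<lambda>x. snd x *\<^sub>R cml (cis (2 * pi * N * snd (fst x))) (fst (fst x))) has_derivative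
     (\<lambda>v. r *\<^sub>R (cml c (fst (fst v)) + cml ((2 * pi * N * snd (fst v)) *\<^sub>R (\<i> * c)) W) + snd v *\<^sub>R cml c W)) (at x)"
    unfolding r_def c_def W_def z_def
    by (intro has_derivative_scaleR has_derivative_snd has_derivative_fst has_derivative_ident cml.FDERIV
        has_derivative_cis has_derivative_mult_right)
  then have "((\<lambda>x. fst (fst (LL N x))) has_derivative
     (\<lambda>v. r *\<^sub>R (cml c (fst (fst v)) + cml ((2 * pi * N * snd (fst v)) *\<^sub>R (\<i> * c)) W) + snd v *\<^sub>R cml c W)) (at x)"
    unfolding LL_def by simp
  ultimately have "(\<lambda>v. fst (fst (D v))) =
     (\<lambda>v. r *\<^sub>R (cml c (fst (fst v)) + cml ((2 * pi * N * snd (fst v)) *\<^sub>R (\<i> * c)) W) + snd v *\<^sub>R cml c W)"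
    by (rule has_derivative_unique)
  then have 1: "fst (fst (D v)) = r *\<^sub>R (cml c (fst (fst v)) + cml ((2 * pi * N * snd (fst v)) *\<^sub>R (\<i> * c)) W) + snd v *\<^sub>R cml c W"
    by (rule fun_cong)
  have "((\<lambda>x. snd (LL N x)) has_derivative (\<lambda>v. snd (D v))) (at x)" by (intro has_derivative_snd D)
  moreover have "((\<lambda>x. snd (LL N x)) has_derivative (\<lambda>v. snd (fst v))) (at x)"
    unfolding LL_def snd_conv by (intro has_derivative_snd has_derivative_fst has_derivative_ident)
  ultimately have "(\<lambda>v. snd (D v)) = (\<lambda>v. snd (fst v))" by (rule has_derivative_unique)
  then have 2: "snd (D v) = snd (fst v)" by (rule fun_cong)
  have cc: "cmod c = 1" by (simp add: c_def)
  have e: "cml ((2 * pi * N * snd (fst v)) *\<^sub>R (\<i> * c)) W = (2 * pi * N * snd (fst v)) *\<^sub>R Jv (cml c W)"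
    unfolding cml.scaleR_left by (simp add: cml_def Jv_def vec_eq_iff)
  have i: "cml c W \<bullet> cml c W = W \<bullet> W" unfolding c_def by (rule inner_cml)
  have s: "cxp W W = 0" using cxp_antisym[of W W] by simp
  have LLx: "LL N x = ((r *\<^sub>R cml c W, r * r * (1 - N * pi * (W \<bullet> W))), z)"
    by (simp add: LL_def r_def c_def W_def z_def)
  have "cxp (r *\<^sub>R cml c W) (fst (fst (D v))) = r\<^sup>2 * (cxp W (fst (fst v)) + 2 * pi * N * snd (fst v) * (W \<bullet> W))"
    unfolding 1 e
    by (simp add: cxp.scaleR_left cxp.scaleR_right cxp.add_right cxp_cml cxp_Jv cc i s power2_eq_square algebra_simps)
  then have "lam (LL N x) (D v) = r * r * (1 - N * pi * (W \<bullet> W)) * snd (fst v)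
      + (1/2) * (r\<^sup>2 * (cxp W (fst (fst v)) + 2 * pi * N * snd (fst v) * (W \<bullet> W)))"
    unfolding lam_def LLx 2 by simp
  also have "\<dots> = r\<^sup>2 * (snd (fst v) + (1/2) * cxp W (fst (fst v)))"
    by (simp add: power2_eq_square algebra_simps)
  finally show ?thesis unfolding alpha_eq W_def r_def .
qed

lemma LL_differentiable: "\<exists>D. (LL N has_derivative D) (at x)"
  using C1_LL[OF C1_id, of N UNIV] unfolding Ck_on.simps by blast

text \<open>In the chart \<open>lam\<close> is r^2 alpha; the map multiplies alpha by its conformal
  factor and the change of r divides by it again.\<close>

lemma lift_lam_pos:
  fixes g :: "'n::finite pt \<Rightarrow> 'n pt"
  assumes g: "preserves_xi g" "\<And>q. \<exists>g'. (g has_derivative g') (at q)"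
    and c: "\<And>q. \<exists>c'. (cfac g has_derivative c') (at q)" "\<And>q. 0 < cfac g q"
    and p: "0 < hro N p" and D: "(lift N g (cfac g) has_derivative D) (at p)"
  shows "lam (lift N g (cfac g) p) (D v) = lam p v"
proof -
  let ?U = "{p :: ((complex ^ 'n) \<times> real) \<times> real. 0 < hro N p}"
  let ?A = "\<lambda>p :: ((complex ^ 'n) \<times> real) \<times> real. (A1 N p, sqrt (hro N p))"
  have "Ck_on (Suc 0) ?A ?U" by (intro C1_Pair C1_A1 C1_sqrt C1_hro C1_id) auto
  then obtain A' where A': "(?A has_derivative A') (at p)" using p unfolding Ck_on.simps by blast
  have A1': "(A1 N has_derivative (\<lambda>v. fst (A' v))) (at p)" using has_derivative_fst[OF A'] by simp
  define q where "q = A1 N p"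
  obtain g' where g': "(g has_derivative g') (at q)" using g(2) by blast
  obtain c' where c': "(cfac g has_derivative c') (at q)" using c(1) by blast
  have gA: "((\<lambda>p. g (A1 N p)) has_derivative (\<lambda>v. g' (fst (A' v)))) (at p)"
    by (rule has_derivative_compose[OF A1' g'[unfolded q_def]])
  have cA: "((\<lambda>p. cfac g (A1 N p)) has_derivative (\<lambda>v. c' (fst (A' v)))) (at p)"
    by (rule has_derivative_compose[OF A1' c'[unfolded q_def]])
  have "\<exists>S'. ((\<lambda>p. sqrt (cfac g (A1 N p))) has_derivative S') (at p)"
    using has_derivative_real_sqrt[OF c(2) cA] by blast
  then obtain S' where S': "((\<lambda>p. sqrt (cfac g (A1 N p))) has_derivative S') (at p)" by blast
  have r': "((\<lambda>p. sqrt (hro N p)) has_derivative (\<lambda>v. snd (A' v))) (at p)" using has_derivative_snd[OF A'] by simp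
  have sc: "sqrt (cfac g (A1 N p)) \<noteq> 0" using c(2)[of "A1 N p"] by simp
  from has_derivative_mult[OF r' has_derivative_compose[OF S' has_derivative_inverse'[OF sc]]]
  obtain R' where R': "((\<lambda>p. sqrt (hro N p) * inverse (sqrt (cfac g (A1 N p)))) has_derivative R') (at p)" by blast
  let ?B = "\<lambda>p. (g (A1 N p), sqrt (hro N p) * inverse (sqrt (cfac g (A1 N p))))"
  have B: "(?B has_derivative (\<lambda>v. (g' (fst (A' v)), R' v))) (at p)" by (rule has_derivative_Pair[OF gA R'])
  obtain L0 where L0: "(LL N has_derivative L0) (at (?A p))" using LL_differentiable by blast
  obtain L1 where L1: "(LL N has_derivative L1) (at (?B p))" using LL_differentiable by blast
  have "((\<lambda>p. LL N (?A p)) has_derivative (\<lambda>v. L0 (A' v))) (at p)" by (rule has_derivative_compose[OF A' L0])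
  moreover have "((\<lambda>p. LL N (?A p)) has_derivative (\<lambda>v. v)) (at p)"
    by (rule has_derivative_transform_within_open[OF has_derivative_ident open_hro[of N]]) (simp_all add: p LL_A1)
  ultimately have "(\<lambda>v. L0 (A' v)) = (\<lambda>v. v)" by (rule has_derivative_unique)
  then have 0: "L0 (A' v) = v" by (rule fun_cong)
  have "((\<lambda>p. LL N (?B p)) has_derivative (\<lambda>v. L1 (g' (fst (A' v)), R' v))) (at p)" by (rule has_derivative_compose[OF B L1])
  then have "(lift N g (cfac g) has_derivative (\<lambda>v. L1 (g' (fst (A' v)), R' v))) (at p)"
    by (rule has_derivative_transform_within_open[OF _ open_hro[of N]]) (use p in \<open>auto simp: lift_def\<close>)
  from has_derivative_unique[OF D this] have 1: "D v = L1 (g' (fst (A' v)), R' v)" by simp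
  have "lam (lift N g (cfac g) p) (D v) = (sqrt (hro N p) * inverse (sqrt (cfac g q)))\<^sup>2 * alpha (g q) (g' (fst (A' v)))"
    unfolding 1 using lam_LL[OF L1] p by (simp add: lift_def q_def)
  also have "\<dots> = hro N p * inverse (cfac g q) * (cfac g q * alpha q (fst (A' v)))"
    using p c(2)[of q] by (simp add: power_mult_distrib power_inverse conformal[OF g(1) g'])
  also have "\<dots> = hro N p * alpha q (fst (A' v))" using c(2)[of q] by simp
  also have "\<dots> = lam p v" using lam_LL[OF L0, of "A' v"] LL_A1[OF p] p unfolding 0 by (simp add: q_def)
  finally show ?thesis .
qed

lemma lift_inverse:
  assumes "\<And>q. gi (g q) = q" "\<And>q. 0 < c q" "\<And>q. c q * ci (g q) = 1"
  shows "lift N gi ci (lift N g c p) = p"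
proof (cases "0 < hro N p")
  case True
  let ?x = "(g (A1 N p), sqrt (hro N p) * inverse (sqrt (c (A1 N p))))"
  have x: "0 < snd ?x" using True assms(2) by simp
  have l: "lift N g c p = LL N ?x" using True by (simp add: lift_def)
  have h: "hro N (LL N ?x) = (snd ?x)\<^sup>2" by (rule hro_LL)
  have s: "sqrt (hro N (LL N ?x)) = snd ?x" unfolding h using x by (simp del: snd_conv)
  have "ci (g (A1 N p)) = inverse (c (A1 N p))" using assms(3)[of "A1 N p"] assms(2)[of "A1 N p"] by (simp add: field_simps)
  then have "inverse (sqrt (c (A1 N p))) * inverse (sqrt (ci (g (A1 N p)))) = 1"
    using assms(2)[of "A1 N p"] by (simp add: real_sqrt_inverse)
  then have eq: "snd ?x * inverse (sqrt (ci (g (A1 N p)))) = sqrt (hro N p)" by (simp add: mult.assoc)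
  have "0 < hro N (LL N ?x)" unfolding h using x by (simp del: snd_conv)
  then have "lift N gi ci (LL N ?x) = LL N (gi (g (A1 N p)), snd ?x * inverse (sqrt (ci (g (A1 N p)))))"
    unfolding lift_def A1_LL[OF x] s by simp
  also have "\<dots> = LL N (A1 N p, sqrt (hro N p))" unfolding eq assms(1) ..
  finally show ?thesis unfolding l LL_A1[OF True] .
qed (simp add: lift_def)

section \<open>Symmetries and regularity of the lift\<close>

lemma lift_nonzero:
  assumes "\<And>q. 0 < c q" "fst p \<noteq> 0" shows "fst (lift N g c p) \<noteq> 0"
proof (cases "0 < hro N p")
  case True
  have "0 < (sqrt (hro N p) * inverse (sqrt (c (A1 N p))))\<^sup>2" using True assms(1)[of "A1 N p"] by simp
  then have "0 < hro N (lift N g c p)" using True hro_LL[of N "(g (A1 N p), sqrt (hro N p) * inverse (sqrt (c (A1 N p))))"]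
    by (simp add: lift_def)
  then show ?thesis by (auto simp: hro_def)
qed (use assms in \<open>simp add: lift_def\<close>)

lemma lift_hom:
  fixes g :: "'n::finite pt \<Rightarrow> 'n pt"
  assumes "0 < s" shows "lift N g c (hs s p) = hs s (lift N g c p)"
proof -
  have h: "hro N (hs s p) = s\<^sup>2 * hro N p" by (simp add: hro_def hs_def power2_eq_square algebra_simps)
  have r: "sqrt (hro N (hs s p)) = s * sqrt (hro N p)" unfolding h using assms by (simp add: real_sqrt_mult)
  have a: "A1 N (hs s p) = A1 N p"
    unfolding A1_def r using assms by (simp add: hs_def cml.scaleR_right)
  have "LL N (x, s * y) = hs s (LL N (x, y))" for x :: "'n pt" and y
    by (simp add: LL_def hs_def power2_eq_square)
  then have "LL N (x, s * y * w) = hs s (LL N (x, y * w))" for x :: "'n pt" and y w by (simp add: mult.assoc)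
  then show ?thesis unfolding lift_def a r using assms h by (simp add: zero_less_mult_iff)
qed

text \<open>Integrality of N enters here: the phase of the chart has to be 1-periodic in z.\<close>

lemma cis_shift: "cis (2 * pi * real N * (x + 1)) = cis (2 * pi * real N * x)" "cis (2 * pi * real N * (x - 1)) = cis (2 * pi * real N * x)"
proof -
  have u: "cis (2 * pi * real N) = 1"
    using cis_multiple_2pi[of "real N"] by (simp add: mult.commute mult.left_commute)
  have "cis (2 * pi * real N * (x + 1)) = cis (2 * pi * real N * x) * cis (2 * pi * real N)"
    unfolding cis_mult by (simp add: algebra_simps)
  then show "cis (2 * pi * real N * (x + 1)) = cis (2 * pi * real N * x)" unfolding u by simp
  have "cis (2 * pi * real N * x) = cis (2 * pi * real N * (x - 1)) * cis (2 * pi * real N)"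
    unfolding cis_mult by (simp add: algebra_simps)
  then show "cis (2 * pi * real N * (x - 1)) = cis (2 * pi * real N * x)" unfolding u by simp
qed

lemma lift_per:
  fixes g :: "'n::finite pt \<Rightarrow> 'n pt"
  assumes "\<And>w z. g (w, z + 1) = (fst (g (w, z)), snd (g (w, z)) + 1)" "\<And>w z. c (w, z + 1) = c (w, z)"
  shows "lift (real N) g c (shift 1 p) = shift 1 (lift (real N) g c p)"
proof -
  have h: "hro N (shift 1 p) = hro N p" by (simp add: hro_def shift_def)
  have a: "A1 (real N) (shift 1 p) = (fst (A1 (real N) p), snd (A1 (real N) p) + 1)"
  proof -
    have "cis (2 * pi * real N * (- (snd p + 1))) = cis (2 * pi * real N * (- snd p))"
      using cis_shift(2)[of N "- snd p"] by simp
    then show ?thesis unfolding A1_def h by (simp add: shift_def)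
  qed
  have "LL (real N) ((fst q, snd q + 1), r) = shift 1 (LL (real N) (q, r))" for q :: "'n pt" and r
    using cis_shift(1)[of N "snd q"] by (simp add: LL_def shift_def)
  then show ?thesis unfolding lift_def h a assms by simp
qed

lemma lift_tw:
  fixes g :: "'n::finite pt \<Rightarrow> 'n pt"
  assumes "\<And>q. g (tau k m q) = tau k m (g q)" "\<And>q. c (tau k m q) = c q"
  shows "lift N g c (twX k m p) = twX k m (lift N g c p)"
proof -
  have t: "tau k m q = (tw k m (fst q), snd q)" for q by (simp add: tau_def tw_def)
  have h: "hro N (twX k m p) = hro N p" by (simp add: hro_def twX_def tw_inner)
  have a: "A1 N (twX k m p) = tau k m (A1 N p)" unfolding A1_def h t by (simp add: twX_def tw_cml)
  have "LL N (tau k m q, r) = twX k m (LL N (q, r))" for q :: "'n pt" and r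
    unfolding t by (simp add: LL_def twX_def tw_cml tw_inner)
  then show ?thesis unfolding lift_def h a assms by simp
qed

lemma lift_id: "lift N id (\<lambda>q. 1) p = p"
  using LL_A1[of N p] by (simp add: lift_def)

lemma cfac_per:
  fixes g :: "'n::finite pt \<Rightarrow> 'n pt"
  assumes "descends g" and g': "\<And>q. \<exists>g'. (g has_derivative g') (at q)"
  shows "cfac g (w, z + 1) = cfac g (w, z)"
proof -
  let ?s = "\<lambda>q :: 'n pt. q + (0, 1)"
  have gs: "g (?s q) = ?s (g q)" for q
    using assms(1)[unfolded descends_def, rule_format, of "fst q" "snd q"] by (simp add: plus_prod_def prod_eq_iff)
  obtain g1 where g1: "(g has_derivative g1) (at (w, z))" using g' by blast
  obtain g2 where g2: "(g has_derivative g2) (at (?s (w, z)))" using g' by blast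
  have s: "(?s has_derivative (\<lambda>v. v)) (at q)" for q by (auto intro!: derivative_eq_intros)
  have "((\<lambda>q. g (?s q)) has_derivative g2) (at (w, z))" using has_derivative_compose[OF s g2] by simp
  moreover have "((\<lambda>q. ?s (g q)) has_derivative g1) (at (w, z))" using has_derivative_compose[OF g1 s] by simp
  ultimately have "g2 = g1" unfolding gs by (rule has_derivative_unique)
  then show ?thesis using cfac_eq[OF g1] cfac_eq[OF g2] gs[of "(w, z)"] by (simp add: alpha_eq)
qed

lemma cfac_tau:
  fixes g :: "'n::finite pt \<Rightarrow> 'n pt"
  assumes "g \<circ> tau k m = tau k m \<circ> g" and g': "\<And>q. \<exists>g'. (g has_derivative g') (at q)"
  shows "cfac g (tau k m q) = cfac g q"
proof -
  have t: "tau k m = (\<lambda>q. (tw k m (fst q), snd q))" by (simp add: tau_def tw_def fun_eq_iff)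
  have tl: "linear (tau k m)" unfolding t by (rule linearI) auto
  have tb: "bounded_linear (tau k m)" using tl by (simp add: linear_conv_bounded_linear)
  have gs: "g (tau k m q) = tau k m (g q)" for q using fun_cong[OF assms(1)] by simp
  obtain g1 where g1: "(g has_derivative g1) (at q)" using g' by blast
  obtain g2 where g2: "(g has_derivative g2) (at (tau k m q))" using g' by blast
  have "((\<lambda>q. g (tau k m q)) has_derivative (\<lambda>v. g2 (tau k m v))) (at q)"
    by (rule has_derivative_compose[OF bounded_linear.has_derivative[OF tb has_derivative_ident] g2])
  moreover have "((\<lambda>q. tau k m (g q)) has_derivative (\<lambda>v. tau k m (g1 v))) (at q)"
    by (rule bounded_linear.has_derivative[OF tb g1])
  ultimately have "(\<lambda>v. g2 (tau k m v)) = (\<lambda>v. tau k m (g1 v))" unfolding gs by (rule has_derivative_unique)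
  then have "g2 (tau k m (0, 1)) = tau k m (g1 (0, 1))" by metis
  moreover have "tau k m (0, 1) = (0, 1)" by (simp add: t)
  ultimately have "g2 (0, 1) = tau k m (g1 (0, 1))" by simp
  then show ?thesis unfolding cfac_eq[OF g1] cfac_eq[OF g2] gs by (simp add: t alpha_eq tw_cxp)
qed

lemma cfac_outside:
  fixes g :: "'n::finite pt \<Rightarrow> 'n pt"
  assumes "supported_in C g" "C < norm w"
  shows "g (w, z) = (w, z)" "cfac g (w, z) = 1"
proof -
  show 1: "g (w, z) = (w, z)" using assms by (simp add: supported_in_def)
  have "(g has_derivative (\<lambda>v. v)) (at (w, z))"
  proof (rule has_derivative_transform_within_open[OF has_derivative_ident])
    show "open {q :: 'n pt. C < norm (fst q)}" by (intro open_Collect_less continuous_intros)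
    show "q = g q" if "q \<in> {q :: 'n pt. C < norm (fst q)}" for q
      using that assms(1) unfolding supported_in_def by (metis less_imp_le mem_Collect_eq prod.collapse)
  qed (use assms in simp)
  from cfac_eq[OF this] show "cfac g (w, z) = 1" by simp
qed

text \<open>The factor involves one derivative of the map, so two derivatives of the family make it
  C1, jointly in time and space.\<close>

lemma cfac_C1:
  assumes "smooth_on (\<lambda>q. g (fst q) (snd q)) UNIV"
  shows "Ck_on (Suc 0) (\<lambda>q :: real \<times> 'n::finite pt. cfac (g (fst q)) (snd q)) UNIV"
proof -
  have "Ck_on (Suc (Suc 0)) (\<lambda>q. g (fst q) (snd q)) UNIV" using assms unfolding smooth_on_def by blast
  then obtain F' where F': "\<And>q. ((\<lambda>q. g (fst q) (snd q)) has_derivative F' q) (at q)" "\<And>v. Ck_on (Suc 0) (\<lambda>q. F' q v) UNIV"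
    by (subst (asm) Ck_on.simps(2)) blast
  have F1: "Ck_on (Suc 0) (\<lambda>q. g (fst q) (snd q)) UNIV" using assms unfolding smooth_on_def by blast
  have gd: "(g t has_derivative (\<lambda>v. F' (t, p) (0, v))) (at p)" for t p
  proof -
    have "((\<lambda>p. (t, p)) has_derivative (\<lambda>v. (0, v))) (at p)" by (auto intro!: derivative_eq_intros)
    from has_derivative_compose[OF this F'(1)] show ?thesis by simp
  qed
  have "cfac (g (fst q)) (snd q) = snd (F' q (0, (0, 1))) + (1/2) * cxp (fst (g (fst q) (snd q))) (fst (F' q (0, (0, 1))))" for q
    using cfac_eq[OF gd[of "fst q" "snd q"]] by (simp add: alpha_eq)
  moreover have "Ck_on (Suc 0) (\<lambda>q. snd (F' q (0, (0, 1))) + (1/2) * cxp (fst (g (fst q) (snd q))) (fst (F' q (0, (0, 1))))) UNIV"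
    by (intro C1_add C1_snd C1_fst C1_mult C1_const C1_bilinear[OF cxp_bilinear] F'(2) F1)
  ultimately show ?thesis by simp
qed

lemma cfac_C1_single:
  assumes "smooth_on g UNIV"
  shows "Ck_on (Suc 0) (cfac g :: 'n::finite pt \<Rightarrow> real) UNIV"
proof -
  have "Ck_on (Suc (Suc 0)) g UNIV" using assms unfolding smooth_on_def by blast
  then obtain F' where F': "\<And>q. (g has_derivative F' q) (at q)" "\<And>v. Ck_on (Suc 0) (\<lambda>q. F' q v) UNIV"
    by (subst (asm) Ck_on.simps(2)) blast
  have F1: "Ck_on (Suc 0) g UNIV" using assms unfolding smooth_on_def by blast
  have "cfac g = (\<lambda>q. snd (F' q (0, 1)) + (1/2) * cxp (fst (g q)) (fst (F' q (0, 1))))"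
    using cfac_eq[OF F'(1)] by (simp add: alpha_eq fun_eq_iff)
  moreover have "Ck_on (Suc 0) (\<lambda>q. snd (F' q (0, 1)) + (1/2) * cxp (fst (g q)) (fst (F' q (0, 1)))) UNIV"
    by (intro C1_add C1_snd C1_fst C1_mult C1_const C1_bilinear[OF cxp_bilinear] F'(2) F1)
  ultimately show ?thesis by simp
qed

lemma smooth_imp_differentiable: "smooth_on g UNIV \<Longrightarrow> \<exists>g'. (g has_derivative g') (at q)"
  unfolding smooth_on_def using Ck_on.simps(2)[of 0 g UNIV] by blast

text \<open>In the chart sigma = 0 means N * pi * |w|^2 = 1, so a returning point of the lifted
  isotopy lies over this sphere and \<psi> sends it back over the same sphere.\<close>

theorem lifted_isotopy_returns:
  fixes m :: "'n::finite \<Rightarrow> int" and \<psi> :: "'n pt \<Rightarrow> 'n pt"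
  assumes k: "prime k" and m: "\<And>j. \<not> int k dvd m j" and \<psi>: "\<psi> \<in> Cont0Zk k m" and N: "0 < N"
  shows "\<exists>q. real N * pi * (fst q \<bullet> fst q) = 1 \<and> real N * pi * (fst (\<psi> q) \<bullet> fst (\<psi> q)) = 1"
proof -
  obtain \<Phi> :: "real \<Rightarrow> 'n pt \<Rightarrow> 'n pt" and C where sm: "smooth_on (\<lambda>(t, p). \<Phi> t p) UNIV" and \<Phi>0: "\<Phi> 0 = id" and \<Phi>1: "\<Phi> 1 = \<psi>"
    and ec: "\<And>t. t \<in> {0..1} \<Longrightarrow> equivariant_contacto k m (\<Phi> t)"
    and sC: "\<And>t. t \<in> {0..1} \<Longrightarrow> supported_in C (\<Phi> t)"
    using \<psi> unfolding Cont0Zk_def by blast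
  let ?T = "{0..1::real}"
  define C1 where "C1 = \<bar>C\<bar> + 1"
  have C1: "0 < C1" by (simp add: C1_def)
  have s1: "supported_in C1 (\<Phi> t)" if "t \<in> ?T" for t
    using sC[OF that] unfolding supported_in_def C1_def by auto
  have sm': "smooth_on (\<lambda>q. \<Phi> (fst q) (snd q)) UNIV" using sm by (simp add: case_prod_beta')
  have smt: "smooth_on (\<Phi> t) UNIV" and pxi: "preserves_xi (\<Phi> t)" and desc: "descends (\<Phi> t)"
    and comm: "\<Phi> t \<circ> tau k m = tau k m \<circ> \<Phi> t"
    and ex: "\<exists>g. (\<forall>p. g (\<Phi> t p) = p \<and> \<Phi> t (g p) = p) \<and> smooth_on g UNIV" if "t \<in> ?T" for t
    using ec[OF that] unfolding equivariant_contacto_def diffeo_def by blast+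
  define gi where "gi t = (SOME g. (\<forall>p. g (\<Phi> t p) = p \<and> \<Phi> t (g p) = p) \<and> smooth_on g UNIV)" for t
  have gi: "gi t (\<Phi> t p) = p" "\<Phi> t (gi t p) = p" "smooth_on (gi t) UNIV" if "t \<in> ?T" for t p
    using someI_ex[OF ex[OF that]] unfolding gi_def by blast+
  have d\<Phi>: "\<exists>g'. (\<Phi> t has_derivative g') (at q)" if "t \<in> ?T" for t q by (rule smooth_imp_differentiable[OF smt[OF that]])
  have dgi: "\<exists>g'. (gi t has_derivative g') (at q)" if "t \<in> ?T" for t q by (rule smooth_imp_differentiable[OF gi(3)[OF that]])
  have cc: "cfac (\<Phi> t) p * cfac (gi t) (\<Phi> t p) = 1" if t: "t \<in> ?T" for t p
  proof -
    obtain g' where g': "(\<Phi> t has_derivative g') (at p)" using d\<Phi>[OF t] by blast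
    obtain h' where h': "(gi t has_derivative h') (at (\<Phi> t p))" using dgi[OF t] by blast
    show ?thesis by (rule cfac_inverse[OF pxi[OF t] g' gi(1,2)[OF t] h'])
  qed
  have cC1: "Ck_on (Suc 0) (\<lambda>q. cfac (\<Phi> (fst q)) (snd q)) UNIV" by (rule cfac_C1[OF sm'])
  have c0: "cfac (\<Phi> 0) = (\<lambda>p. 1)"
    unfolding \<Phi>0 by (intro ext) (simp add: cfac_eq[OF has_derivative_id])
  \<comment> \<open>The factor is 1 at time 0 and never 0, so by the intermediate value theorem it
    stays positive.\<close>
  have cpos: "0 < cfac (\<Phi> t) p" if t: "t \<in> ?T" for t p
  proof (rule ccontr)
    assume "\<not> 0 < cfac (\<Phi> t) p"
    moreover have "continuous_on {0..t} (\<lambda>s. cfac (\<Phi> s) p)"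
      using continuous_on_compose2[OF C1_continuous_on[OF cC1], of "{0..t}" "\<lambda>s. (s, p)"]
      by (simp add: continuous_on_Pair)
    ultimately obtain s where "0 \<le> s" "s \<le> t" "cfac (\<Phi> s) p = 0"
      using IVT2'[of "\<lambda>s. cfac (\<Phi> s) p" t 0 0] t c0 by auto
    then show False using cc[of s p] t by simp
  qed
  have cipos: "0 < cfac (gi t) q" if t: "t \<in> ?T" for t q
  proof -
    have "cfac (\<Phi> t) (gi t q) * cfac (gi t) q = 1" using cc[OF t, of "gi t q"] gi(2)[OF t] by simp
    then show ?thesis using cpos[OF t, of "gi t q"] by (metis zero_less_mult_pos zero_less_one)
  qed
  have sgi: "supported_in C1 (gi t)" if t: "t \<in> ?T" for t
    unfolding supported_in_def
  proof (intro allI impI)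
    fix w :: "complex ^ 'n" and z assume "C1 \<le> norm w"
    then have "\<Phi> t (w, z) = (w, z)" using s1[OF t] by (simp add: supported_in_def)
    then show "gi t (w, z) = (w, z)" using gi(1)[OF t, of "(w, z)"] by simp
  qed
  define f where "f t = lift (real N) (\<Phi> t) (cfac (\<Phi> t))" for t
  define fi where "fi t = lift (real N) (gi t) (cfac (gi t))" for t
  have \<Phi>C1: "Ck_on (Suc 0) (\<lambda>q. \<Phi> (fst q) (snd q)) UNIV" using sm' unfolding smooth_on_def by blast
  have supp: "\<Phi> t (w, z) = (w, z) \<and> cfac (\<Phi> t) (w, z) = 1" if "t \<in> ?T" "C1 < norm w" for t w z
    using cfac_outside[OF s1[OF that(1)] that(2)] by blast
  obtain f' where f': "\<And>t p. t \<in> ?T \<Longrightarrow> fst p \<noteq> 0 \<Longrightarrow> (f t has_derivative f' t p) (at p)"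
    "\<And>v. continuous_on (?T \<times> {p. fst p \<noteq> 0}) (\<lambda>q. f' (fst q) (snd q) v)"
    using lift_C1(1)[where g = \<Phi> and c = "\<lambda>t. cfac (\<Phi> t)" and T = ?T and N = "real N", OF \<Phi>C1 cC1 cpos C1 supp]
    unfolding f_def by blast
  have fcont: "continuous_on (?T \<times> {p. fst p \<noteq> 0}) (\<lambda>q. f (fst q) (snd q))"
    unfolding f_def by (rule lift_C1(2)[where g = \<Phi> and c = "\<lambda>t. cfac (\<Phi> t)" and T = ?T and N = "real N", OF \<Phi>C1 cC1 cpos C1 supp])
  have fider: "\<exists>g'. (fi t has_derivative g') (at p)" if t: "t \<in> ?T" and p: "fst p \<noteq> 0" for t p
  proof -
    have g1: "Ck_on (Suc 0) (gi t) UNIV" using gi(3)[OF t] unfolding smooth_on_def by blast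
    have a: "Ck_on (Suc 0) (\<lambda>q :: real \<times> 'n pt. gi t (snd q)) UNIV" by (rule C1_compose[OF g1 C1_snd[OF C1_id]]) simp
    have b: "Ck_on (Suc 0) (\<lambda>q :: real \<times> 'n pt. cfac (gi t) (snd q)) UNIV"
      by (rule C1_compose[OF cfac_C1_single[OF gi(3)[OF t]] C1_snd[OF C1_id]]) simp
    have s: "gi t (w, z) = (w, z) \<and> cfac (gi t) (w, z) = 1" if "C1 < norm w" for w z
      using cfac_outside[OF sgi[OF t] that] by blast
    show ?thesis
      using lift_C1(1)[where g = "\<lambda>_. gi t" and c = "\<lambda>_. cfac (gi t)" and T = UNIV and N = "real N", OF a b cipos[OF t] C1 s] p
      unfolding fi_def by blast
  qed
  have flam: "lam (f t p) (f' t p v) = lam p v" if t: "t \<in> ?T" and p: "fst p \<noteq> 0" for t p v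
  proof (cases "0 < hro (real N) p")
    case True
    have "\<exists>c'. (cfac (\<Phi> t) has_derivative c') (at q)" for q
      using cfac_C1_single[OF smt[OF t]] unfolding Ck_on.simps by blast
    then show ?thesis using lift_lam_pos[OF pxi[OF t] d\<Phi>[OF t] _ cpos[OF t] True] f'(1)[OF t p] unfolding f_def by blast
  next
    case False
    \<comment> \<open>Off the chart region the lift is the identity on a neighbourhood of p.\<close>
    then have V: "p \<in> Vset C1 (real N)" using Vset_cover[OF p C1, of "real N"] by blast
    have id: "f t q = q" if "q \<in> Vset C1 (real N)" for q
      unfolding f_def by (rule lift_Vset[OF C1 supp[OF t] that])
    have "(f t has_derivative (\<lambda>v. v)) (at p)"
      by (rule has_derivative_transform_within_open[OF has_derivative_ident open_Vset V]) (simp add: id)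
    from has_derivative_unique[OF f'(1)[OF t p] this] show ?thesis by (simp add: id[OF V])
  qed
  have "homog_isotopy k m f fi f'"
  proof
    show "prime k" by (rule k)
    show "\<not> int k dvd m j" for j by (rule m)
    show "continuous_on (?T \<times> {p. fst p \<noteq> 0}) (\<lambda>q. f (fst q) (snd q))" by (rule fcont)
    show "continuous_on (?T \<times> {p. fst p \<noteq> 0}) (\<lambda>q. f' (fst q) (snd q) v)" for v by (rule f'(2))
    show "f 0 p = p" if "fst p \<noteq> 0" for p unfolding f_def c0 unfolding \<Phi>0 by (rule lift_id)
    fix t :: real and p :: "((complex ^ 'n) \<times> real) \<times> real" assume t: "t \<in> ?T" and p: "fst p \<noteq> 0"
    show "fst (f t p) \<noteq> 0" unfolding f_def by (rule lift_nonzero[OF cpos[OF t] p])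
    show "fst (fi t p) \<noteq> 0" unfolding fi_def by (rule lift_nonzero[OF cipos[OF t] p])
    show "fi t (f t p) = p" unfolding f_def fi_def by (rule lift_inverse) (rule gi(1)[OF t] cpos[OF t] cc[OF t])+
    show "f t (fi t p) = p" unfolding f_def fi_def
    proof (rule lift_inverse)
      show "\<Phi> t (gi t q) = q" "0 < cfac (gi t) q" for q by (rule gi(2)[OF t], rule cipos[OF t])
      show "cfac (gi t) q * cfac (\<Phi> t) (gi t q) = 1" for q
        using cc[OF t, of "gi t q"] gi(2)[OF t] by (simp add: mult.commute)
    qed
    show "(f t has_derivative f' t p) (at p)" by (rule f'(1)[OF t p])
    show "\<exists>g'. (fi t has_derivative g') (at p)" by (rule fider[OF t p])
    show "lam (f t p) (f' t p v) = lam p v" for v by (rule flam[OF t p])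
    show "f t (hs c p) = hs c (f t p)" if "0 < c" for c unfolding f_def by (rule lift_hom[OF that])
    show "f t (shift 1 p) = shift 1 (f t p)" unfolding f_def
      by (rule lift_per) (use desc[OF t] cfac_per[OF desc[OF t] d\<Phi>[OF t]] in \<open>auto simp: descends_def\<close>)
    show "f t (twX k m p) = twX k m (f t p)" unfolding f_def
      by (rule lift_tw) (use fun_cong[OF comm[OF t]] cfac_tau[OF comm[OF t] d\<Phi>[OF t]] in \<open>auto simp: o_def\<close>)
  qed
  then obtain p where p: "fst p \<noteq> 0" "snd (fst p) = 0" "snd (fst (f 1 p)) = 0"
    using homog_isotopy.returning_point by blast
  define q where "q = A1 (real N) p"
  define r where "r = sqrt (hro (real N) p) * inverse (sqrt (cfac \<psi> q))"
  \<comment> \<open>A nonzero point with sigma = 0 has w \<noteq> 0 and hence lies in the chart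
    region.\<close>
  have w: "fst (fst p) \<noteq> 0" using p(1,2) by (auto simp: prod_eq_iff)
  have h: "hro (real N) p = real N * pi * (fst (fst p) \<bullet> fst (fst p))" by (simp add: hro_def p(2))
  then have hp: "0 < hro (real N) p" using w N by simp
  have "real N * pi * (norm (fst q))\<^sup>2 * hro (real N) p = hro (real N) p"
    using norm_A1[OF hp] h unfolding q_def by (simp add: power2_norm_eq_inner mult.assoc)
  then have 1: "real N * pi * (fst q \<bullet> fst q) = 1" using hp by (simp add: power2_norm_eq_inner)
  have "0 < cfac \<psi> q" using cpos[of 1 q] unfolding \<Phi>1 by simp
  then have r: "r \<noteq> 0" unfolding r_def using hp by simp
  have "f 1 p = LL (real N) (\<psi> q, r)" unfolding f_def \<Phi>1 lift_def r_def q_def using hp by simp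
  then have "r * r * (1 - real N * pi * (fst (\<psi> q) \<bullet> fst (\<psi> q))) = 0" using p(3) by (simp add: LL_def)
  then have "real N * pi * (fst (\<psi> q) \<bullet> fst (\<psi> q)) = 1" using r by simp
  then show ?thesis using 1 by blast
qed

lemma sum_cmod_eq_inner: "(\<Sum>j\<in>UNIV. (cmod (w $ j))\<^sup>2) = w \<bullet> w"
  by (simp add: inner_vec_def power2_norm_eq_inner)

theorem theorem1p2:
  fixes k :: nat and m :: "'n::finite \<Rightarrow> int"
  assumes "prime k"
    and "\<forall>j. \<not> int k dvd m j"
  shows "\<forall>R>0. \<exists>\<epsilon>>0. \<forall>R'. 0 < R' \<and> R' < \<epsilon> \<longrightarrow>
           \<not> (\<exists>\<psi>\<in>Cont0Zk k m. \<psi> ` closure (Bhat R :: 'n pt set) \<subseteq> Bhat R')"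
proof (intro allI impI)
  fix R :: real assume R: "0 < R"
  \<comment> \<open>An integer N with 1/N < R puts the sphere pi |w|^2 = 1/N inside B(R); this 1/N
    is the epsilon, since the returning point is mapped back over the sphere and so cannot enter a
    smaller ball.\<close>
  obtain N0 :: nat where N0: "inverse (real (Suc N0)) < R" using reals_Archimedean[OF R] by auto
  define N where "N = Suc N0"
  have N: "0 < N" "1 / real N < R" using N0 by (simp_all add: N_def inverse_eq_divide)
  show "\<exists>\<epsilon>>0. \<forall>R'. 0 < R' \<and> R' < \<epsilon> \<longrightarrow> \<not> (\<exists>\<psi>\<in>Cont0Zk k m. \<psi> ` closure (Bhat R :: 'n pt set) \<subseteq> Bhat R')"
  proof (intro exI[of _ "1 / real N"] conjI allI impI notI)
    show "0 < 1 / real N" using N by simp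
    fix R' assume R': "0 < R' \<and> R' < 1 / real N"
    assume "\<exists>\<psi>\<in>Cont0Zk k m. \<psi> ` closure (Bhat R :: 'n pt set) \<subseteq> Bhat R'"
    then obtain \<psi> where \<psi>: "\<psi> \<in> Cont0Zk k m" "\<psi> ` closure (Bhat R :: 'n pt set) \<subseteq> Bhat R'" by blast
    have m: "\<And>j. \<not> int k dvd m j" using assms(2) by blast
    obtain q where q: "real N * pi * (fst q \<bullet> fst q) = 1" "real N * pi * (fst (\<psi> q) \<bullet> fst (\<psi> q)) = 1"
      using lifted_isotopy_returns[OF assms(1) m \<psi>(1) N(1)] by blast
    have "pi * (fst q \<bullet> fst q) = 1 / real N" using q(1) N(1) by (simp add: field_simps)
    then have "pi * (fst q \<bullet> fst q) < R" using N(2) by simp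
    then have "q \<in> Bhat R" by (cases q) (simp add: Bhat_def Bball_def sum_cmod_eq_inner)
    then have "\<psi> q \<in> Bhat R'" using \<psi>(2) closure_subset by blast
    then have "pi * (fst (\<psi> q) \<bullet> fst (\<psi> q)) < R'" by (cases "\<psi> q") (simp add: Bhat_def Bball_def sum_cmod_eq_inner)
    then have "pi * (fst (\<psi> q) \<bullet> fst (\<psi> q)) < 1 / real N" using R' by simp
    then show False using q(2) N by (simp add: field_simps)
  qed
qed

end
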